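(* Let $F$ be an oriented linked surface in $\mathbb{R}^4$ whose diagram $D_F$ is a $p$-diagram, with double decker set $\Gamma\subset F$, sets of circles $X\subset A_f$ and a fixed checkerboard colouring of $(\bigcup A_f)\cup(F\setminus\Gamma)$ as defined in the context, each circle of $A_f$ being given the orientation defined in the context. Then the class $$\left[\bigcup\left\{c\in A_f:\left(\pi^{-1}(\pi(c))\cap F\right)\setminus c\in X\right\}\right]\in H_1(F;\mathbb{Z})$$ (the sum of the classes of the oriented circles in the displayed set) is an invariant of $p$-diagrams with respect to the $p$-equivalence of the oriented linked surface $F$. That is, it is unchanged along any sequence of $p$-diagrams realizing a $p$-equivalence, where all first homology groups are identified with that of the common base surface and the checkerboard colouring is carried along the sequence, as described in the context.
   Context: **Linked surfaces.** A linked surface is the image in $\mathbb{R}^4$ of a (smooth) embedding $f:F\to\mathbb{R}^4$ of a closed, possibly disconnected, surface $F$ (the base surface); $f(F)$ is also denoted $F$, and it is oriented when $F$ is. **Diagrams.** Let $\pi:\mathbb{R}^4\to\mathbb{R}^3$, $\pi(x,y,z,t)=(x,y,z)$. Linked surfaces are assumed to be in general position with respect to $\pi$: the points of $F^*=\pi(F)$ near which $F^*$ is not an embedded sheet are locally modelled on (i) two transversely intersecting sheets (double point), (ii) three transversely intersecting sheets (triple point), or (iii) the Whitney umbrella (branch point). The diagram $D_F$ is $F^*$ together with the information, along self-crossings, of which sheet was higher (larger $t$-coordinate) before being projected. It is a $p$-diagram if it has no triple point, i.e. $\#(\pi^{-1}(x)\cap F)<3$ for all $x\in D_F$. **Double decker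 set, $A_f$.** The double decker set $\Gamma$ is the closure in $F$ of $\{p\in F:\#(\pi^{-1}(\pi(p))\cap F)>1\}$; $\Gamma^*=\pi(\Gamma)$. For a $p$-diagram, $\Gamma$ is a union of circles. $A_f$ is the set of those circles $c\subset\Gamma$ for which $\pi^{-1}(\pi(c))\cap F$ has nonempty intersection with two distinct components of $F$. For $c\in A_f$, the circle $(\pi^{-1}(\pi(c))\cap F)\setminus c$ is called its mate. **Orientation of circles of $A_f$.** Let sheets $G_1^*=\pi(G_1)$ and $G_2^*=\pi(G_2)$ meet in a double curve $c^*$, with preimages $c_1\subset G_1$, $c_2\subset G_2$, and let $\vec n_1,\vec n_2$ be the normal vectors to $G_1^*,G_2^*$ determined by the orientations of $F$ and $\mathbb{R}^3$ (with one fixed convention). The orientation of $c_1$ is given by the tangent vector $\vec v_1$ such that $(\vec n_1,\vec n_2,\pi(\vec v_1))$ matches the orientation of $\mathbb{R}^3$; that of $c_2$ is defined analogously, using $(\vec n_2,\vec n_1,\pi(\vec v_2))$. **Colouring and $X$.** A checkerboard colouring of $(\bigcup A_f)\cup(F\setminus\Gamma)$ assigns to each connected component (region) of this subset of $F$ a colour $0$ or $1$ so that regions adjacent along a common boundary edge have different colours; such colourings exist (colour each component of $F$ as a separate surface knot), and one is fixed. $X\subset A_f$ is the set of circles $d\in A_f$ that lie on a region of colour $1$ and lie higher (with respect to the $t$-axis, the projection direction) than their mate. **$p$-equivalence.** Two $p$-diagrams are $p$-equivalent if they are joined by a finite sequence of $p$-diagrams in which each transition is either an isotopy of the diagram in $\mathbb{R}^3$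 (ambient, carrying crossing information along) or one of the four Roseman moves that involve only $p$-diagrams. These four moves are the following. Each takes place inside a 3-ball $B$ and leaves everything outside $B$ unchanged; inside $B$, up to a diffeomorphism of the ball and damping the deformation near $\partial B$, it is the passage of a small parameter $s$ through $0$ (in either direction) in one of the following families. - Move I: a single sheet $(u,v)\mapsto(u,v^2,v^3+u^2v+sv)$. - Move II: a single sheet $(u,v)\mapsto(u,v^2,v^3-u^2v+sv)$. - Move III: two sheets $\{z=0\}$ and $\{z=x^2+y^2-s\}$. - Move IV: two sheets $\{z=0\}$ and $\{z=x^2-y^2-s\}$. In moves I and II the sheet is lifted to $\mathbb{R}^4$ with fourth coordinate $\varepsilon v$ for a fixed $\varepsilon\in\{1,-1\}$. In moves III and IV one of the two sheets is the upper one, and it is the same one before and after the move. **Identifications along a sequence.** All transitions are realized by deformations of the embedding of the one oriented base surface $F$, which identifies all the first homology groups with $H_1(F;\mathbb{Z})$. The checkerboard colouring is carried along: under isotopies of the diagram it is transported, and under a move in a ball $B$ it is kept unchanged at points of $F$ not mapped into $B$. *)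

theory Defs
  imports "HOL-Homology.Homology" "HOL-Analysis.Analysis"
begin

section \<open>Smooth maps between open subsets of Euclidean spaces\<close>

text \<open>Meaningful for open \<open>S\<close> only, because derivatives are taken at interior points.\<close>

primrec Ck_on :: "nat \<Rightarrow> 'a::euclidean_space set \<Rightarrow> ('a \<Rightarrow> 'b::euclidean_space) \<Rightarrow> bool" where
  "Ck_on 0 S f \<longleftrightarrow> continuous_on S f"
| "Ck_on (Suc k) S f \<longleftrightarrow>
     (\<forall>x\<in>S. f differentiable (at x)) \<and> (\<forall>v. Ck_on k S (\<lambda>x. frechet_derivative f (at x) v))"

definition smooth_on :: "'a::euclidean_space set \<Rightarrow> ('a \<Rightarrow> 'b::euclidean_space) \<Rightarrow> bool" where
  "smooth_on S f \<longleftrightarrow> (\<forall>k. Ck_on k S f)"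

definition diffeo :: "'a::euclidean_space set \<Rightarrow> 'b::euclidean_space set \<Rightarrow> ('a \<Rightarrow> 'b) \<Rightarrow> bool" where
  "diffeo S T g \<longleftrightarrow> open S \<and> open T \<and> bij_betw g S T \<and> smooth_on S g \<and> smooth_on T (inv_into S g)"


section \<open>Oriented closed surfaces and embeddings in 4-space\<close>

type_synonym 'a atlas = "('a set \<times> ('a \<Rightarrow> real^2)) set"

text \<open>The surface may be disconnected. The orientation is carried by the atlas, whose
  transition maps have positive Jacobian determinant. Second countability is automatic,
  since the space is compact and locally Euclidean.\<close>

definition oriented_closed_surface :: "'a topology \<Rightarrow> 'a atlas \<Rightarrow> bool" where
  "oriented_closed_surface M \<A> \<longleftrightarrow>
     compact_space M \<and> Hausdorff_space M \<and> (\<Union>(U,\<phi>)\<in>\<A>. U) = topspace M \<and>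
     (\<forall>(U,\<phi>)\<in>\<A>. openin M U \<and> open (\<phi> ` U) \<and>
        homeomorphic_map (subtopology M U) (top_of_set (\<phi> ` U)) \<phi>) \<and>
     (\<forall>(U,\<phi>)\<in>\<A>. \<forall>(V,\<psi>)\<in>\<A>. smooth_on (\<phi> ` (U \<inter> V)) (\<psi> \<circ> inv_into U \<phi>) \<and>
        (\<forall>x \<in> \<phi> ` (U \<inter> V). 0 < det (matrix (frechet_derivative (\<psi> \<circ> inv_into U \<phi>) (at x)))))"

text \<open>An injective immersion; it is a topological embedding because the surface is compact.\<close>

definition surface_embedding :: "'a topology \<Rightarrow> 'a atlas \<Rightarrow> ('a \<Rightarrow> real^4) \<Rightarrow> bool" where
  "surface_embedding M \<A> f \<longleftrightarrow> inj_on f (topspace M) \<and>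
     (\<forall>(U,\<phi>)\<in>\<A>. smooth_on (\<phi> ` U) (f \<circ> inv_into U \<phi>) \<and>
        (\<forall>x \<in> \<phi> ` U. inj (frechet_derivative (f \<circ> inv_into U \<phi>) (at x))))"

definition deformation :: "'a topology \<Rightarrow> 'a atlas \<Rightarrow> real set \<Rightarrow> (real \<Rightarrow> 'a \<Rightarrow> real^4) \<Rightarrow> bool" where
  "deformation M \<A> I F \<longleftrightarrow> open I \<and> (\<forall>t\<in>I. surface_embedding M \<A> (F t)) \<and>
     (\<forall>(U,\<phi>)\<in>\<A>. smooth_on (I \<times> \<phi> ` U) (\<lambda>(t,x). F t (inv_into U \<phi> x)))"

text \<open>Smooth local parametrization of the surface; it need not preserve the orientation.\<close>

definition local_param :: "'a topology \<Rightarrow> 'a atlas \<Rightarrow> (real^2) set \<Rightarrow> (real^2 \<Rightarrow> 'a) \<Rightarrow> bool" where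
  "local_param M \<A> D \<alpha> \<longleftrightarrow> open D \<and> inj_on \<alpha> D \<and> openin M (\<alpha> ` D) \<and>
     (\<forall>(U,\<phi>)\<in>\<A>. diffeo {x\<in>D. \<alpha> x \<in> U} (\<phi> ` (\<alpha> ` D \<inter> U)) (\<phi> \<circ> \<alpha>))"


section \<open>Projection, general position, diagrams\<close>

text \<open>A point \<open>f p\<close> of the linked surface is represented by the point \<open>p\<close> of the base
  surface. Accordingly all subsets of the linked surface (double decker set, circles,
  regions) are treated as subsets of the base surface.\<close>

definition proj :: "real^4 \<Rightarrow> real^3" where
  "proj x = vector [x$1, x$2, x$3]"

definition height :: "real^4 \<Rightarrow> real" where
  "height x = x$4"

definition fibre :: "'a topology \<Rightarrow> ('a \<Rightarrow> real^4) \<Rightarrow> real^3 \<Rightarrow> 'a set" where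
  "fibre M f y = {p \<in> topspace M. proj (f p) = y}"

definition sheet_deriv ::
  "('a \<Rightarrow> real^4) \<Rightarrow> 'a set \<Rightarrow> ('a \<Rightarrow> real^2) \<Rightarrow> 'a \<Rightarrow> real^2 \<Rightarrow> real^3" where
  "sheet_deriv f U \<phi> p = frechet_derivative (proj \<circ> f \<circ> inv_into U \<phi>) (at (\<phi> p))"

definition immersed_at :: "'a atlas \<Rightarrow> ('a \<Rightarrow> real^4) \<Rightarrow> 'a \<Rightarrow> bool" where
  "immersed_at \<A> f p \<longleftrightarrow> (\<forall>(U,\<phi>)\<in>\<A>. p \<in> U \<longrightarrow> inj (sheet_deriv f U \<phi> p))"

text \<open>All charts at \<open>p\<close> contribute the same plane to this union.\<close>

definition tangent_plane :: "'a atlas \<Rightarrow> ('a \<Rightarrow> real^4) \<Rightarrow> 'a \<Rightarrow> (real^3) set" where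
  "tangent_plane \<A> f p = (\<Union>(U,\<phi>)\<in>{(U,\<phi>)\<in>\<A>. p \<in> U}. range (sheet_deriv f U \<phi> p))"

text \<open>The normal is determined up to a positive factor, which depends on the chart.\<close>

definition oriented_normal :: "'a atlas \<Rightarrow> ('a \<Rightarrow> real^4) \<Rightarrow> 'a \<Rightarrow> real^3 \<Rightarrow> bool" where
  "oriented_normal \<A> f p n \<longleftrightarrow> (\<exists>(U,\<phi>)\<in>\<A>. p \<in> U \<and>
     n = cross3 (sheet_deriv f U \<phi> p (axis 1 1)) (sheet_deriv f U \<phi> p (axis 2 1)))"

definition whitney_sheet :: "real^2 \<Rightarrow> real^3" where
  "whitney_sheet x = vector [x$1, (x$2)^2, x$1 * x$2]"

definition whitney_umbrella_at :: "'a topology \<Rightarrow> 'a atlas \<Rightarrow> ('a \<Rightarrow> real^4) \<Rightarrow> 'a \<Rightarrow> bool" where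
  "whitney_umbrella_at M \<A> f p \<longleftrightarrow> (\<exists>D \<alpha> W \<Psi>.
     local_param M \<A> D \<alpha> \<and> 0 \<in> D \<and> \<alpha> 0 = p \<and> diffeo W (\<Psi> ` W) \<Psi> \<and>
     (\<forall>x\<in>D. whitney_sheet x \<in> W \<and> proj (f (\<alpha> x)) = \<Psi> (whitney_sheet x)))"

text \<open>The four cases: embedded sheet, double point, triple point, branch point.\<close>

definition general_position :: "'a topology \<Rightarrow> 'a atlas \<Rightarrow> ('a \<Rightarrow> real^4) \<Rightarrow> bool" where
  "general_position M \<A> f \<longleftrightarrow> (\<forall>y \<in> proj ` f ` topspace M.
     (\<exists>p. fibre M f y = {p} \<and> immersed_at \<A> f p) \<or>
     (\<exists>p q. p \<noteq> q \<and> fibre M f y = {p,q} \<and> immersed_at \<A> f p \<and> immersed_at \<A> f q \<and>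
        span (tangent_plane \<A> f p \<union> tangent_plane \<A> f q) = UNIV) \<or>
     (\<exists>p q r. distinct [p,q,r] \<and> fibre M f y = {p,q,r} \<and>
        immersed_at \<A> f p \<and> immersed_at \<A> f q \<and> immersed_at \<A> f r \<and>
        tangent_plane \<A> f p \<inter> tangent_plane \<A> f q \<inter> tangent_plane \<A> f r = {0}) \<or>
     (\<exists>p. fibre M f y = {p} \<and> whitney_umbrella_at M \<A> f p))"

definition p_diagram :: "'a topology \<Rightarrow> 'a atlas \<Rightarrow> ('a \<Rightarrow> real^4) \<Rightarrow> bool" where
  "p_diagram M \<A> f \<longleftrightarrow> surface_embedding M \<A> f \<and> general_position M \<A> f \<and>
     (\<forall>y. finite (fibre M f y) \<and> card (fibre M f y) < 3)"


section \<open>Double decker set and the circles in \<open>A_f\<close>\<close>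

definition double_decker :: "'a topology \<Rightarrow> ('a \<Rightarrow> real^4) \<Rightarrow> 'a set" where
  "double_decker M f =
     M closure_of {p \<in> topspace M. \<exists>q \<in> topspace M. q \<noteq> p \<and> proj (f q) = proj (f p)}"

definition decker_circles :: "'a topology \<Rightarrow> ('a \<Rightarrow> real^4) \<Rightarrow> 'a set set" where
  "decker_circles M f = connected_components_of (subtopology M (double_decker M f))"

definition over_set :: "'a topology \<Rightarrow> ('a \<Rightarrow> real^4) \<Rightarrow> 'a set \<Rightarrow> 'a set" where
  "over_set M f c = {q \<in> topspace M. proj (f q) \<in> proj ` f ` c}"

definition A_circles :: "'a topology \<Rightarrow> ('a \<Rightarrow> real^4) \<Rightarrow> 'a set set" where
  "A_circles M f = {c \<in> decker_circles M f.
     \<exists>K \<in> connected_components_of M. \<exists>L \<in> connected_components_of M. K \<noteq> L \<and>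
       over_set M f c \<inter> K \<noteq> {} \<and> over_set M f c \<inter> L \<noteq> {}}"

definition mate :: "'a topology \<Rightarrow> ('a \<Rightarrow> real^4) \<Rightarrow> 'a set \<Rightarrow> 'a set" where
  "mate M f c = over_set M f c - c"

text \<open>A parametrization of the circle \<open>c\<close>, once around, in the direction of its orientation.
  Here \<open>w\<close> is the projected tangent vector at the point \<open>\<gamma> t\<close>, and \<open>q\<close> is the point of
  the other sheet over the same double point. Replacing both normals by their negatives
  does not change the condition, so it does not depend on the convention for normals.\<close>

definition oriented_circle_param ::
  "'a topology \<Rightarrow> 'a atlas \<Rightarrow> ('a \<Rightarrow> real^4) \<Rightarrow> 'a set \<Rightarrow> (real \<Rightarrow> 'a) \<Rightarrow> bool" where
  "oriented_circle_param M \<A> f c \<gamma> \<longleftrightarrow>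
     continuous_map (top_of_set {0..1}) M \<gamma> \<and> \<gamma> 0 = \<gamma> 1 \<and> inj_on \<gamma> {0..<1} \<and> \<gamma> ` {0..1} = c \<and>
     (\<forall>t\<in>{0..1}. \<exists>w. ((\<lambda>t. proj (f (\<gamma> t))) has_vector_derivative w) (at t within {0..1}) \<and>
        (\<forall>q\<in>topspace M. \<forall>n1 n2. q \<noteq> \<gamma> t \<and> proj (f q) = proj (f (\<gamma> t)) \<and>
           oriented_normal \<A> f (\<gamma> t) n1 \<and> oriented_normal \<A> f q n2 \<longrightarrow>
           0 < det (vector [n1, n2, w] :: real^3^3)))"

definition loop_class :: "'a topology \<Rightarrow> (real \<Rightarrow> 'a) \<Rightarrow> 'a chain set" where
  "loop_class M \<gamma> =
     homologous_rel_set 1 M {} (frag_of (restrict (\<lambda>x. \<gamma> (x 1)) (standard_simplex 1)))"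

definition circle_class :: "'a topology \<Rightarrow> 'a atlas \<Rightarrow> ('a \<Rightarrow> real^4) \<Rightarrow> 'a set \<Rightarrow> 'a chain set" where
  "circle_class M \<A> f c = (THE h. \<exists>\<gamma>. oriented_circle_param M \<A> f c \<gamma> \<and> h = loop_class M \<gamma>)"


section \<open>Checkerboard colourings and the homology class\<close>

definition coloured_set :: "'a topology \<Rightarrow> ('a \<Rightarrow> real^4) \<Rightarrow> 'a set" where
  "coloured_set M f = \<Union>(A_circles M f) \<union> (topspace M - double_decker M f)"

definition regions :: "'a topology \<Rightarrow> ('a \<Rightarrow> real^4) \<Rightarrow> 'a set set" where
  "regions M f = connected_components_of (subtopology M (coloured_set M f))"

text \<open>The boundary edges of the regions are the circles of the double decker set
  that are not in \<open>A_f\<close>.\<close>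

definition adjacent_regions :: "'a topology \<Rightarrow> ('a \<Rightarrow> real^4) \<Rightarrow> 'a set \<Rightarrow> 'a set \<Rightarrow> bool" where
  "adjacent_regions M f R R' \<longleftrightarrow> R \<noteq> R' \<and>
     (\<exists>e \<in> decker_circles M f - A_circles M f. e \<subseteq> M closure_of R \<and> e \<subseteq> M closure_of R')"

definition checkerboard :: "'a topology \<Rightarrow> ('a \<Rightarrow> real^4) \<Rightarrow> ('a set \<Rightarrow> nat) \<Rightarrow> bool" where
  "checkerboard M f col \<longleftrightarrow> (\<forall>R \<in> regions M f. col R \<in> {0,1}) \<and>
     (\<forall>R \<in> regions M f. \<forall>R' \<in> regions M f. adjacent_regions M f R R' \<longrightarrow> col R \<noteq> col R')"

definition X_circles :: "'a topology \<Rightarrow> ('a \<Rightarrow> real^4) \<Rightarrow> ('a set \<Rightarrow> nat) \<Rightarrow> 'a set set" where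
  "X_circles M f col = {d \<in> A_circles M f. (\<exists>R \<in> regions M f. d \<subseteq> R \<and> col R = 1) \<and>
     (\<forall>p\<in>d. \<forall>q \<in> mate M f d. proj (f q) = proj (f p) \<longrightarrow> height (f q) < height (f p))}"

text \<open>The group operation of \<open>homology_group 1 M\<close> is written multiplicatively in the library;
  the sum of the circle classes is therefore a \<open>finprod\<close>.\<close>

definition crossing_class ::
  "'a topology \<Rightarrow> 'a atlas \<Rightarrow> ('a \<Rightarrow> real^4) \<Rightarrow> ('a set \<Rightarrow> nat) \<Rightarrow> 'a chain set" where
  "crossing_class M \<A> f col = finprod (homology_group 1 M) (circle_class M \<A> f)
     {c \<in> A_circles M f. mate M f c \<in> X_circles M f col}"


section \<open>Isotopies of the diagram\<close>

definition ambient_isotopy :: "(real \<Rightarrow> real^3 \<Rightarrow> real^3) \<Rightarrow> bool" where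
  "ambient_isotopy H \<longleftrightarrow> smooth_on UNIV (\<lambda>(t,x). H t x) \<and> (\<forall>x. H 0 x = x) \<and>
     (\<forall>t. diffeo UNIV UNIV (H t))"

definition surface_isotopy :: "'a topology \<Rightarrow> (real \<Rightarrow> 'a \<Rightarrow> 'a) \<Rightarrow> bool" where
  "surface_isotopy M \<theta> \<longleftrightarrow>
     continuous_map (prod_topology euclideanreal M) M (\<lambda>(t,p). \<theta> t p) \<and>
     (\<forall>p\<in>topspace M. \<theta> 0 p = p) \<and> (\<forall>t. homeomorphic_map M M (\<theta> t))"

text \<open>The embeddings \<open>F t\<close> deform \<open>f\<close> into \<open>f'\<close> in such a way that the diagram is moved by
  the ambient isotopy \<open>H\<close> of 3-space. The isotopy \<open>\<theta>\<close> tracks the points: the point of the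
  diagram represented by \<open>p\<close> at time 0 is represented by \<open>\<theta> t p\<close> at time \<open>t\<close>. Families over
  [0,1] are extended to all times, which is no restriction after reparametrizing time.\<close>

definition diagram_isotopy ::
  "'a topology \<Rightarrow> 'a atlas \<Rightarrow> ('a \<Rightarrow> real^4) \<Rightarrow> ('a \<Rightarrow> real^4) \<Rightarrow> (real \<Rightarrow> 'a \<Rightarrow> 'a) \<Rightarrow> bool" where
  "diagram_isotopy M \<A> f f' \<theta> \<longleftrightarrow> surface_isotopy M \<theta> \<and>
     (\<exists>F H. deformation M \<A> UNIV F \<and> ambient_isotopy H \<and>
        (\<forall>p\<in>topspace M. F 0 p = f p \<and> F 1 p = f' p) \<and>
        (\<forall>t. \<forall>p\<in>topspace M. proj (F t (\<theta> t p)) = H t (proj (f p))) \<and>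
        (\<forall>t. \<forall>p\<in>topspace M. \<forall>q\<in>topspace M. proj (f p) = proj (f q) \<longrightarrow>
           (height (F t (\<theta> t p)) < height (F t (\<theta> t q)) \<longleftrightarrow> height (f p) < height (f q))))"


section \<open>Roseman moves between p-diagrams\<close>

definition sheet_I :: "real \<Rightarrow> real^2 \<Rightarrow> real^3" where
  "sheet_I s x = vector [x$1, (x$2)^2, (x$2)^3 + (x$1)^2 * x$2 + s * x$2]"

definition sheet_II :: "real \<Rightarrow> real^2 \<Rightarrow> real^3" where
  "sheet_II s x = vector [x$1, (x$2)^2, (x$2)^3 - (x$1)^2 * x$2 + s * x$2]"

definition sheet_III :: "real \<Rightarrow> real^2 \<Rightarrow> real^3" where
  "sheet_III s x = vector [x$1, x$2, (x$1)^2 + (x$2)^2 - s]"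

definition sheet_IV :: "real \<Rightarrow> real^2 \<Rightarrow> real^3" where
  "sheet_IV s x = vector [x$1, x$2, (x$1)^2 - (x$2)^2 - s]"

definition sheet_flat :: "real^2 \<Rightarrow> real^3" where
  "sheet_flat x = vector [x$1, x$2, 0]"

text \<open>The deformation \<open>g s\<close> of a model sheet is damped by using the parameter \<open>s * \<rho> x\<close>
  instead of \<open>s\<close>: full strength near the origin, no deformation near and outside of the
  boundary of the model ball of radius \<open>r\<close>.\<close>

definition damping :: "(real \<Rightarrow> real^2 \<Rightarrow> real^3) \<Rightarrow> real \<Rightarrow> (real^2 \<Rightarrow> real) \<Rightarrow> bool" where
  "damping g r \<rho> \<longleftrightarrow> smooth_on UNIV \<rho> \<and> range \<rho> \<subseteq> {0..1} \<and>
     (\<exists>\<delta>>0. (\<forall>x. norm x < \<delta> \<longrightarrow> \<rho> x = 1) \<and> (\<forall>x. \<rho> x \<noteq> 0 \<longrightarrow> norm (g 0 x) < r - \<delta>))"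

text \<open>In the next two definitions \<open>\<Psi>\<close> is the coordinate change between the model ball
  \<open>cball 0 r\<close> and the ball \<open>B\<close> (extended to a neighbourhood \<open>W\<close>), and the parametrizations
  \<open>\<alpha>\<close>, \<open>\<beta>\<close> identify the sheets with the pieces of the surface that are mapped into \<open>B\<close>.\<close>

definition one_sheet_family ::
  "'a topology \<Rightarrow> 'a atlas \<Rightarrow> (real \<Rightarrow> real^2 \<Rightarrow> real^3) \<Rightarrow> (real^3) set \<Rightarrow> real set \<Rightarrow>
   (real \<Rightarrow> 'a \<Rightarrow> real^4) \<Rightarrow> bool" where
  "one_sheet_family M \<A> g B I F \<longleftrightarrow> (\<exists>r W \<Psi> D \<alpha> \<rho> \<epsilon>.
     0 < r \<and> diffeo W (\<Psi> ` W) \<Psi> \<and> cball 0 r \<subseteq> W \<and> B = \<Psi> ` cball 0 r \<and>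
     local_param M \<A> D \<alpha> \<and> {x. g 0 x \<in> cball 0 r} \<subseteq> D \<and> damping g r \<rho> \<and> \<epsilon> \<in> {1,-1} \<and>
     (\<forall>s\<in>I. (\<forall>x\<in>D. g (s * \<rho> x) x \<in> W \<and> proj (F s (\<alpha> x)) = \<Psi> (g (s * \<rho> x) x) \<and>
                     height (F s (\<alpha> x)) = \<epsilon> * x$2) \<and>
             {p \<in> topspace M. proj (F s p) \<in> B} = \<alpha> ` {x. g 0 x \<in> cball 0 r}))"

definition two_sheet_family ::
  "'a topology \<Rightarrow> 'a atlas \<Rightarrow> (real \<Rightarrow> real^2 \<Rightarrow> real^3) \<Rightarrow> (real^3) set \<Rightarrow> real set \<Rightarrow>
   (real \<Rightarrow> 'a \<Rightarrow> real^4) \<Rightarrow> bool" where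
  "two_sheet_family M \<A> g B I F \<longleftrightarrow> (\<exists>r W \<Psi> D \<alpha> E \<beta> \<rho> \<epsilon>.
     0 < r \<and> diffeo W (\<Psi> ` W) \<Psi> \<and> cball 0 r \<subseteq> W \<and> B = \<Psi> ` cball 0 r \<and>
     local_param M \<A> D \<alpha> \<and> {x. sheet_flat x \<in> cball 0 r} \<subseteq> D \<and>
     local_param M \<A> E \<beta> \<and> {x. g 0 x \<in> cball 0 r} \<subseteq> E \<and> \<alpha> ` D \<inter> \<beta> ` E = {} \<and>
     damping g r \<rho> \<and> \<epsilon> \<in> {1,-1} \<and>
     (\<forall>s\<in>I. (\<forall>x\<in>D. sheet_flat x \<in> W \<and> proj (F s (\<alpha> x)) = \<Psi> (sheet_flat x)) \<and>
             (\<forall>x\<in>E. g (s * \<rho> x) x \<in> W \<and> proj (F s (\<beta> x)) = \<Psi> (g (s * \<rho> x) x)) \<and>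
             (\<forall>x\<in>D. \<forall>y\<in>E. proj (F s (\<alpha> x)) = proj (F s (\<beta> y)) \<longrightarrow>
                \<epsilon> * height (F s (\<alpha> x)) < \<epsilon> * height (F s (\<beta> y))) \<and>
             {p \<in> topspace M. proj (F s p) \<in> B} =
               \<alpha> ` {x. sheet_flat x \<in> cball 0 r} \<union> \<beta> ` {x. g 0 x \<in> cball 0 r}))"

text \<open>The parameter runs through an interval around 0 that is so small that the diagram is
  a p-diagram at all other parameter values; the move leads from one side of 0 to the other.\<close>

definition roseman_p_move ::
  "'a topology \<Rightarrow> 'a atlas \<Rightarrow> (real^3) set \<Rightarrow> ('a \<Rightarrow> real^4) \<Rightarrow> ('a \<Rightarrow> real^4) \<Rightarrow> bool" where
  "roseman_p_move M \<A> B f f' \<longleftrightarrow> (\<exists>F a s s'.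
     deformation M \<A> {-a<..<a} F \<and> s \<in> {-a<..<a} \<and> s' \<in> {-a<..<a} \<and> s * s' < 0 \<and>
     (\<forall>p\<in>topspace M. F s p = f p \<and> F s' p = f' p) \<and>
     (\<forall>t\<in>{-a<..<a} - {0}. p_diagram M \<A> (F t)) \<and>
     (\<forall>t\<in>{-a<..<a}. \<forall>p\<in>topspace M. proj (F 0 p) \<notin> B \<longrightarrow> F t p = F 0 p) \<and>
     (one_sheet_family M \<A> sheet_I B {-a<..<a} F \<or> one_sheet_family M \<A> sheet_II B {-a<..<a} F \<or>
      two_sheet_family M \<A> sheet_III B {-a<..<a} F \<or> two_sheet_family M \<A> sheet_IV B {-a<..<a} F))"


section \<open>p-equivalence of coloured p-diagrams\<close>

definition p_transition ::
  "'a topology \<Rightarrow> 'a atlas \<Rightarrow> ('a \<Rightarrow> real^4) \<times> ('a set \<Rightarrow> nat) \<Rightarrow>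
   ('a \<Rightarrow> real^4) \<times> ('a set \<Rightarrow> nat) \<Rightarrow> bool" where
  "p_transition M \<A> = (\<lambda>(f,col) (f',col').
     p_diagram M \<A> f \<and> p_diagram M \<A> f' \<and> checkerboard M f col \<and> checkerboard M f' col' \<and>
     ((\<exists>\<theta>. diagram_isotopy M \<A> f f' \<theta> \<and> (\<forall>R \<in> regions M f. col' (\<theta> 1 ` R) = col R)) \<or>
      (\<exists>B. roseman_p_move M \<A> B f f' \<and>
         (\<forall>R \<in> regions M f. \<forall>R' \<in> regions M f'.
            (\<exists>p \<in> R \<inter> R'. proj (f p) \<notin> B) \<longrightarrow> col' R' = col R))))"

definition p_equivalence_sequence ::
  "'a topology \<Rightarrow> 'a atlas \<Rightarrow> ('a \<Rightarrow> real^4) \<times> ('a set \<Rightarrow> nat) \<Rightarrow>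
   ('a \<Rightarrow> real^4) \<times> ('a set \<Rightarrow> nat) \<Rightarrow> bool" where
  "p_equivalence_sequence M \<A> = rtranclp (p_transition M \<A>)"

end

theory Submission
  imports Defs "HOL-Complex_Analysis.Winding_Numbers"
begin

text \<open>
  The class in question is the sum of the circles of \<open>A_f\<close> that lie below their mates while the mate
  runs in a region of colour 1. A p-equivalence is composed of two kinds of steps, and the class is
  invariant for a different reason under each of them.

  \<^item> \<^emph>\<open>Roseman moves\<close> (\<open>roseman_p_move_invariant\<close>). Outside of the ball nothing changes, neither the
  curves nor their orientations, heights and colours. In moves I and II the ball contains a piece of
  one component only, and circles of \<open>A_f\<close> run where two components meet, so they do not enter the
  ball. In moves III and IV the curves in the ball that count run on the lower of the two sheets.
  Whatever happens to them, and whether or not they count at all in view of their colours, the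
  difference of the sums before and after the move is a cycle in the piece of the lower sheet in the
  ball. This piece is a disc, so the difference is a boundary. The general form of this argument is
  \<open>circle_flow_locality\<close>.

  \<^item> \<^emph>\<open>Isotopies\<close> (\<open>diagram_isotopy_invariant\<close>). The final map of the isotopy of the surface
  takes the circles that count to the circles that count. It is homotopic to the identity, hence does
  not change homology classes. It remains to see that it respects the orientations of the circles.
  These are defined by the normals of the two sheets and the tangent vector of the double curve, which
  are transported by the derivative of a diffeomorphism of space that is isotopic to the identity;
  this requires that the map of the surface preserves the orientation of the surface. It is a
  homeomorphism at all times, but known to be differentiable at the mixed double points only at the end
  of the isotopy, so this is proved with winding numbers (\<open>isotopy_preserves_orientation\<close>).

  The circles of \<open>A_f\<close> are accessible through the points on them: a double point is on such a circle
  iff its two preimages are in different components. At such a point both sheets are immersed and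
  transverse, and the orientation rule defines a unit tangent vector of the double curve. This
  direction field integrates to a flow on the compact set of mixed double points, and the circles of
  \<open>A_f\<close> with their orientations are the orbits of this flow (\<open>circle_flow_mixed\<close>, \<open>A_circles_eq\<close>).
  Every oriented parametrization of a circle is homologous to the flow orbit (\<open>loop_class_oriented\<close>),
  and therefore the class of a circle is well defined and can be computed with chains of flow segments
  (\<open>crossing_class_eq\<close>), which are cut at the boundary of a disc without difficulty.
\<close>

section \<open>Chains of paths\<close>

text \<open>Nothing is assumed about the order of \<open>a\<close> and \<open>b\<close>. For a path defined on the whole line, such
  as a flow line, these chains are additive for end points in any order.\<close>

definition path_chain :: "(real \<Rightarrow> 'a) \<Rightarrow> real \<Rightarrow> real \<Rightarrow> 'a chain" where
  "path_chain g a b = frag_of (restrict (\<lambda>x. g (a + (b - a) * x 1)) (standard_simplex 1))"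

lemma loop_class_path_chain: "loop_class M \<gamma> = homologous_rel_set 1 M {} (path_chain \<gamma> 0 1)"
  by (simp add: loop_class_def path_chain_def)

lemma standard_simplex_1_bounds: "x \<in> standard_simplex 1 \<Longrightarrow> 0 \<le> x 1 \<and> x 1 \<le> 1"
  by (simp add: standard_simplex_def)

lemma continuous_map_simplex_coordinate:
  "continuous_map (subtopology (powertop_real UNIV) (standard_simplex 1)) euclideanreal (\<lambda>x. x 1)"
  by (intro continuous_map_from_subtopology continuous_map_product_projection) auto

lemma singular_chain_path_chain:
  assumes g: "continuous_map (top_of_set {a..b}) M g" and ab: "a \<le> b"
  shows "singular_chain 1 M (path_chain g a b)"
proof -
  let ?S = "subtopology (powertop_real UNIV) (standard_simplex 1)"
  have 1: "continuous_map ?S euclideanreal (\<lambda>x. a + (b - a) * x 1)"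
    by (intro continuous_map_add continuous_map_real_mult continuous_map_simplex_coordinate) auto
  have "a + (b - a) * x 1 \<in> {a..b}" if "x \<in> standard_simplex 1" for x
  proof -
    have x: "0 \<le> x 1" "x 1 \<le> 1" using standard_simplex_1_bounds[OF that] by blast+
    have "0 \<le> (b-a) * x 1" "(b-a) * x 1 \<le> (b-a) * 1"
      using ab x by (intro mult_nonneg_nonneg mult_left_mono; linarith)+
    then show ?thesis by simp
  qed
  then have "continuous_map ?S (top_of_set {a..b}) (\<lambda>x. a + (b - a) * x 1)"
    unfolding continuous_map_in_subtopology topspace_standard_simplex using 1 by blast
  from continuous_map_compose[OF this g]
  have "continuous_map ?S M (\<lambda>x. g (a + (b - a) * x 1))" unfolding o_def .
  then show ?thesis
    unfolding path_chain_def singular_chain_of singular_simplex_def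
    by (simp add: continuous_map_eq)
qed

lemma singular_chain_path_chain_line:
  assumes "continuous_map euclideanreal M g"
  shows "singular_chain 1 M (path_chain g a b)"
proof -
  let ?S = "subtopology (powertop_real UNIV) (standard_simplex 1)"
  have "continuous_map ?S euclideanreal (\<lambda>x. a + (b - a) * x 1)"
    by (intro continuous_map_add continuous_map_real_mult continuous_map_simplex_coordinate) auto
  from continuous_map_compose[OF this assms]
  have "continuous_map ?S M (\<lambda>x. g (a + (b - a) * x 1))" unfolding o_def .
  then show ?thesis
    unfolding path_chain_def singular_chain_of singular_simplex_def
    by (simp add: continuous_map_eq)
qed

lemma chain_map_path_chain: "chain_map 1 h (path_chain g a b) = path_chain (h \<circ> g) a b"
  unfolding path_chain_def chain_map_of simplex_map_def
  by (rule arg_cong[where f=frag_of], rule ext) (simp add: restrict_def)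

lemma chain_boundary_path_chain:
  "chain_boundary 1 (path_chain g a b) =
     frag_of (restrict (\<lambda>_. g b) (standard_simplex 0)) - frag_of (restrict (\<lambda>_. g a) (standard_simplex 0))"
proof -
  have 0: "singular_face 1 0 (restrict (\<lambda>x. g (a + (b - a) * x 1)) (standard_simplex 1))
      = restrict (\<lambda>_. g b) (standard_simplex 0)"
    using simplical_face_in_standard_simplex[of 1 0]
    by (auto simp: singular_face_def fun_eq_iff standard_simplex_0 simplical_face_def)
  have 1: "singular_face 1 1 (restrict (\<lambda>x. g (a + (b - a) * x 1)) (standard_simplex 1))
      = restrict (\<lambda>_. g a) (standard_simplex 0)"
    using simplical_face_in_standard_simplex[of 1 1]
    by (auto simp: singular_face_def fun_eq_iff standard_simplex_0 simplical_face_def)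
  show ?thesis
    using 0 1 by (simp add: path_chain_def chain_boundary_of)
qed

lemma contractible_cycle_is_boundary:
  assumes Y: "contractible_space Y" and c: "singular_relcycle 1 Y {} c"
  shows "singular_relboundary 1 Y {} c"
proof -
  have "trivial_group (homology_group 1 Y)"
    using trivial_reduced_homology_group_contractible_space[OF Y, of 1]
    by (simp add: un_reduced_homology_group)
  then have 1: "carrier (homology_group 1 Y) = {\<one>\<^bsub>homology_group 1 Y\<^esub>}"
    by (simp only: trivial_group_def)
  have "homologous_rel_set 1 Y {} c \<in> carrier (homology_group 1 Y)"
    using c carrier_relative_homology_group[of 1 Y "{}", unfolded of_nat_1] by blast
  then have "homologous_rel_set 1 Y {} c = \<one>\<^bsub>homology_group 1 Y\<^esub>"
    unfolding 1 by (rule singletonD)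
  also have "\<dots> = singular_relboundary_set 1 Y {}"
    by (rule one_relative_homology_group[of 1 Y "{}", unfolded of_nat_1])
  finally have "homologous_rel_set 1 Y {} c = singular_relboundary_set 1 Y {}" .
  then show ?thesis
    using homologous_rel_set_eq_relboundary by blast
qed

text \<open>The line is contractible, so chains carried by one continuous line may be
  compared by their boundaries alone. Concatenation and reparametrization of paths are
  instances of this.\<close>

lemma homologous_line_chains:
  assumes g: "continuous_map euclideanreal M g"
    and c: "singular_chain 1 euclideanreal c" "singular_chain 1 euclideanreal d"
    and "chain_boundary 1 c = chain_boundary 1 d"
  shows "homologous_rel 1 M S (chain_map 1 g c) (chain_map 1 g d)"
proof -
  have "singular_relcycle 1 euclideanreal {} (c - d)"
    using assms by (simp add: singular_cycle singular_chain_diff chain_boundary_diff)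
  then have "singular_relboundary 1 euclideanreal {} (c - d)"
    by (intro contractible_cycle_is_boundary) (auto simp: contractible_space_euclideanreal)
  from singular_relboundary_chain_map[OF this g, of S]
  show ?thesis by (simp add: homologous_rel_def chain_map_diff)
qed

lemma path_chain_concat:
  assumes g: "continuous_map euclideanreal M g"
  shows "homologous_rel 1 M S (path_chain g a c) (path_chain g a b + path_chain g b c)"
proof -
  have id: "continuous_map euclideanreal euclideanreal (id :: real \<Rightarrow> real)" by simp
  have "chain_boundary 1 (path_chain id a c) = chain_boundary 1 (path_chain id a b + path_chain id b c)"
    by (simp only: chain_boundary_add chain_boundary_path_chain) simp
  then have "homologous_rel 1 M S (chain_map 1 g (path_chain id a c))
      (chain_map 1 g (path_chain id a b + path_chain id b c))"
    by (rule homologous_line_chains[OF g singular_chain_path_chain_line[OF id]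
          singular_chain_add[OF singular_chain_path_chain_line[OF id] singular_chain_path_chain_line[OF id]]])
  then show ?thesis by (simp only: chain_map_add chain_map_path_chain comp_id)
qed

lemma path_chain_reparametrize:
  assumes g: "continuous_map euclideanreal M g" and u: "continuous_on {0..1} u" "u 0 = a" "u 1 = b"
  shows "homologous_rel 1 M S (path_chain (g \<circ> u) 0 1) (path_chain g a b)"
proof -
  have id: "continuous_map euclideanreal euclideanreal (id :: real \<Rightarrow> real)" by simp
  have u': "continuous_map (top_of_set {0..1}) euclideanreal u" using u by simp
  have "chain_boundary 1 (path_chain u 0 1) = chain_boundary 1 (path_chain id a b)"
    by (simp only: chain_boundary_path_chain) (simp add: u)
  then have "homologous_rel 1 M S (chain_map 1 g (path_chain u 0 1)) (chain_map 1 g (path_chain id a b))"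
    by (rule homologous_line_chains[OF g singular_chain_path_chain[OF u' zero_le_one] singular_chain_path_chain_line[OF id]])
  then show ?thesis by (simp only: chain_map_path_chain comp_id)
qed

text \<open>The inner minimum is the next subdivision point after \<open>s\<close>, or \<open>b\<close> when there is none.\<close>

lemma path_chain_subdivide:
  assumes g: "continuous_map euclideanreal M g"
  shows "\<lbrakk>finite F; F \<subseteq> {a<..<b}\<rbrakk> \<Longrightarrow> homologous_rel 1 M S (path_chain g a b)
     (\<Sum>s\<in>insert a F. path_chain g s (Min (insert b {t\<in>insert a F. s < t})))"
proof (induction F arbitrary: b rule: finite_linorder_max_induct)
  case empty
  have "{t\<in>insert a {}. a < t} = {}" by auto
  then have "Min (insert b {t\<in>insert a {}. a < t}) = b" by (simp only: Min_singleton)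
  then show ?case by simp
next
  case (insert m F)
  let ?c = "\<lambda>b F s. path_chain g s (Min (insert b {t\<in>insert a F. s < t}))"
  from insert have m: "a < m" "m < b" and F: "F \<subseteq> {a<..<m}" "m \<notin> insert a F" "finite (insert a F)" by auto
  have 1: "?c b (insert m F) s = ?c m F s" if "s \<in> insert a F" for s
  proof -
    have s: "s < m" using that F m by auto
    have "{t\<in>insert a (insert m F). s < t} = insert m {t\<in>insert a F. s < t}"
      using s F by auto
    moreover have "Min (insert b (insert m {t\<in>insert a F. s < t})) = Min (insert m {t\<in>insert a F. s < t})"
      using m F by (subst Min_insert) (auto simp: min_def dest!: order_trans)
    ultimately show ?thesis by simp
  qed
  have 2: "?c b (insert m F) m = path_chain g m b"
  proof -
    have "{t\<in>insert a (insert m F). m < t} = {}" using F m by auto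
    then show ?thesis by (simp only: Min_singleton)
  qed
  have "(\<Sum>s\<in>insert m (insert a F). ?c b (insert m F) s)
      = ?c b (insert m F) m + (\<Sum>s\<in>insert a F. ?c b (insert m F) s)"
    by (rule sum.insert) (use F in auto)
  also have "\<dots> = path_chain g m b + (\<Sum>s\<in>insert a F. ?c m F s)"
    by (simp only: 2 sum.cong[OF refl 1])
  finally have 3: "(\<Sum>s\<in>insert a (insert m F). ?c b (insert m F) s)
      = (\<Sum>s\<in>insert a F. ?c m F s) + path_chain g m b"
    by (simp only: insert_commute[of a m F] add.commute)
  have "homologous_rel 1 M S (path_chain g a m + path_chain g m b)
      ((\<Sum>s\<in>insert a F. ?c m F s) + path_chain g m b)"
    by (rule homologous_rel_add[OF insert.IH[OF F(1)] homologous_rel_refl])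
  then show ?case
    unfolding 3 using path_chain_concat[OF g, of S a b m] by (rule homologous_rel_trans)
qed

lemma homologous_rel_set_add:
  assumes "singular_relcycle 1 M {} a" "singular_relcycle 1 M {} b"
  shows "homologous_rel_set 1 M {} a \<otimes>\<^bsub>homology_group 1 M\<^esub> homologous_rel_set 1 M {} b
    = homologous_rel_set 1 M {} (a + b)"
proof -
  have "(\<Union>r\<in>homologous_rel_set 1 M {} a. \<Union>s\<in>homologous_rel_set 1 M {} b. {r + s})
      = homologous_rel_set 1 M {} (a + b)" (is "?L = ?R")
  proof
    show "?L \<subseteq> ?R" by (auto intro: homologous_rel_add simp del: One_nat_def)
    show "?R \<subseteq> ?L"
    proof
      fix c assume "c \<in> ?R"
      then have "homologous_rel 1 M {} (a + b - a) (c - a)"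
        by (intro homologous_rel_diff) auto
      then have "c - a \<in> homologous_rel_set 1 M {} b" by simp
      then show "c \<in> ?L"
        by (intro UN_I[of a] UN_I[of "c - a"]) (auto simp: homologous_rel_refl)
    qed
  qed
  then show ?thesis
    using mult_relative_homology_group[of 1 M "{}"] by simp
qed

lemma finprod_homology_classes:
  assumes "finite I" "\<And>i. i \<in> I \<Longrightarrow> singular_relcycle 1 M {} (z i)"
    "\<And>i. i \<in> I \<Longrightarrow> h i = homologous_rel_set 1 M {} (z i)"
  shows "finprod (homology_group 1 M) h I = homologous_rel_set 1 M {} (\<Sum>i\<in>I. z i)
     \<and> finprod (homology_group 1 M) h I \<in> carrier (homology_group 1 M)"
  using assms
proof (induction I)
  interpret H: comm_group "homology_group 1 M" by (rule abelian_homology_group)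
  case empty
  have "(one (homology_group 1 M)) = singular_relboundary_set 1 M {}"
    using one_relative_homology_group[of 1 M] by simp
  then have "one (homology_group 1 M) = homologous_rel_set 1 M {} 0"
    using homologous_rel_set_eq_relboundary[of 1 M "{}" 0] by simp
  then show ?case using H.one_closed by (simp del: One_nat_def)
next
  interpret H: comm_group "homology_group 1 M" by (rule abelian_homology_group)
  case (insert i I)
  have c: "h j \<in> carrier (homology_group 1 M)" if "j \<in> insert i I" for j
    using insert.prems that carrier_relative_homology_group[of 1 M "{}"] by auto
  have "finprod (homology_group 1 M) h (insert i I)
      = h i \<otimes>\<^bsub>homology_group 1 M\<^esub> finprod (homology_group 1 M) h I"
    using insert.hyps c by (intro H.finprod_insert) auto
  also have "\<dots> = homologous_rel_set 1 M {} (z i) \<otimes>\<^bsub>homology_group 1 M\<^esub> homologous_rel_set 1 M {} (\<Sum>i\<in>I. z i)"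
    using insert by simp
  also have "\<dots> = homologous_rel_set 1 M {} (z i + (\<Sum>i\<in>I. z i))"
    using insert.prems by (intro homologous_rel_set_add singular_relcycle_sum) auto
  finally have "finprod (homology_group 1 M) h (insert i I) = homologous_rel_set 1 M {} (\<Sum>i\<in>insert i I. z i)"
    using insert.hyps by simp
  moreover have "finprod (homology_group 1 M) h (insert i I) \<in> carrier (homology_group 1 M)"
    using c by (intro H.finprod_closed) auto
  ultimately show ?case by blast
qed

text \<open>The difference of the two cycles is homologous to a chain in \<open>\<Delta>\<close>, which is then itself a
  cycle, and a contractible space has no first homology.\<close>

lemma homologous_rel_contractible:
  assumes z: "singular_relcycle 1 M {} z" "singular_relcycle 1 M {} z'"
    and h: "homologous_rel 1 M \<Delta> z z'"
    and \<Delta>: "contractible_space (subtopology M \<Delta>)"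
  shows "homologous_rel 1 M {} z z'"
proof -
  obtain d e where d: "singular_chain 2 M d" and e: "singular_chain 1 (subtopology M \<Delta>) e"
    and eq: "z - z' = chain_boundary 2 d + e"
    using h by (auto simp: homologous_rel_def singular_relboundary numeral_2_eq_2)
  have "chain_boundary 1 (chain_boundary 2 d) = 0"
    using chain_boundary_boundary[of 2 M d] d by simp
  then have "chain_boundary 1 e = 0"
    using arg_cong[OF eq, of "chain_boundary 1"] z
    by (simp add: chain_boundary_diff chain_boundary_add singular_cycle)
  then have "singular_relboundary 1 (subtopology M \<Delta>) {} e"
    using e by (intro contractible_cycle_is_boundary \<Delta>) (simp add: singular_cycle)
  then have "singular_relboundary 1 M {} (chain_map 1 id e)"
    by (rule singular_relboundary_chain_map) (auto simp: continuous_map_from_subtopology)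
  then have "singular_relboundary 1 M {} e"
    using e chain_map_id_gen[of 1 "subtopology M \<Delta>" e id] by simp
  moreover have "singular_relboundary 1 M {} (chain_boundary 2 d)"
    using d by (auto simp: singular_boundary numeral_2_eq_2)
  ultimately show ?thesis
    unfolding homologous_rel_def eq by (rule singular_relboundary_add[rotated])
qed

section \<open>Circles as orbits of flows\<close>

text \<open>A compact one-dimensional set that is moved along itself by a flow is a finite union of
  circles, each with a direction. Working with the flow replaces the classification of compact
  one-manifolds: the circles are the orbits, parametrized by time. The last two conditions say that
  an orbit is open in \<open>Z\<close> and is not a rest point.\<close>

locale circle_flow =
  fixes M :: "'a topology" and Z :: "'a set" and \<phi> :: "'a \<Rightarrow> real \<Rightarrow> 'a"
  assumes Hausdorff: "Hausdorff_space M"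
    and compact: "compactin M Z"
    and cont: "\<And>p. p \<in> Z \<Longrightarrow> continuous_map euclideanreal M (\<phi> p)"
    and inZ: "\<And>p t. p \<in> Z \<Longrightarrow> \<phi> p t \<in> Z"
    and zero: "\<And>p. p \<in> Z \<Longrightarrow> \<phi> p 0 = p"
    and add: "\<And>p s t. p \<in> Z \<Longrightarrow> \<phi> (\<phi> p s) t = \<phi> p (s + t)"
    and open_orbit: "\<And>p e. \<lbrakk>p \<in> Z; 0 < e\<rbrakk> \<Longrightarrow> \<exists>U. openin M U \<and> p \<in> U \<and> Z \<inter> U \<subseteq> \<phi> p ` {-e<..<e}"
    and locally_inj: "\<And>p. p \<in> Z \<Longrightarrow> \<exists>e>0. inj_on (\<phi> p) {-e<..<e}"
begin

definition orbit :: "'a \<Rightarrow> 'a set" where "orbit p = range (\<phi> p)"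

definition orbits :: "'a set set" where "orbits = orbit ` Z"

lemma Z_subset: "Z \<subseteq> topspace M" using compact by (rule compactin_subset_topspace)

lemma self_orbit: "p \<in> Z \<Longrightarrow> p \<in> orbit p"
  unfolding orbit_def by (metis zero rangeI)

lemma orbit_subset: "p \<in> Z \<Longrightarrow> orbit p \<subseteq> Z"
  unfolding orbit_def using inZ by auto

lemma orbit_flow: "p \<in> Z \<Longrightarrow> orbit (\<phi> p t) = orbit p"
proof -
  assume p: "p \<in> Z"
  have "\<phi> p s \<in> orbit (\<phi> p t)" for s
    unfolding orbit_def using add[OF p, of t "s - t"] by (metis add_diff_cancel_left' add.commute rangeI diff_add_cancel)
  moreover have "\<phi> (\<phi> p t) s \<in> orbit p" for s
    unfolding orbit_def add[OF p] by simp
  ultimately show ?thesis unfolding orbit_def by blast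
qed

lemma orbit_eq: "\<lbrakk>p \<in> Z; q \<in> orbit p\<rbrakk> \<Longrightarrow> orbit q = orbit p"
  using orbit_flow unfolding orbit_def by blast

lemma openin_flow_image:
  assumes p: "p \<in> Z" and "open O'"
  shows "openin (subtopology M Z) (\<phi> p ` O')"
proof (subst openin_subopen, clarify)
  fix s assume "s \<in> O'"
  then obtain e where e: "e > 0" "ball s e \<subseteq> O'" using \<open>open O'\<close> open_contains_ball by blast
  obtain U where U: "openin M U" "\<phi> p s \<in> U" "Z \<inter> U \<subseteq> \<phi> (\<phi> p s) ` {-e<..<e}"
    using open_orbit[OF inZ[OF p] e(1)] by blast
  have "\<phi> (\<phi> p s) t \<in> \<phi> p ` O'" if "t \<in> {-e<..<e}" for t
    unfolding add[OF p] using e(2) that by (intro imageI) (auto simp: subset_iff dist_real_def)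
  then have "Z \<inter> U \<subseteq> \<phi> p ` O'" using U(3) by blast
  then show "\<exists>T. openin (subtopology M Z) T \<and> \<phi> p s \<in> T \<and> T \<subseteq> \<phi> p ` O'"
    using U(1,2) inZ[OF p] by (intro exI[of _ "Z \<inter> U"]) (auto simp: openin_subtopology_Int2)
qed

lemma openin_orbit: "p \<in> Z \<Longrightarrow> openin (subtopology M Z) (orbit p)"
  unfolding orbit_def by (rule openin_flow_image) auto

lemma closedin_orbit:
  assumes p: "p \<in> Z" shows "closedin (subtopology M Z) (orbit p)"
proof -
  have "Z - orbit p = \<Union> (orbit ` (Z - orbit p))"
    using self_orbit orbit_eq[OF p] orbit_subset orbit_eq by blast
  moreover have "openin (subtopology M Z) (\<Union> (orbit ` (Z - orbit p)))"
    by (intro openin_Union) (auto intro: openin_orbit)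
  ultimately have "openin (subtopology M Z) (topspace (subtopology M Z) - orbit p)"
    using Z_subset by (simp add: inf_absorb2)
  then show ?thesis
    using orbit_subset[OF p] Z_subset by (simp add: closedin_def inf_absorb2)
qed

lemma connectedin_orbit: "p \<in> Z \<Longrightarrow> connectedin (subtopology M Z) (orbit p)"
  unfolding orbit_def
  by (rule connectedin_continuous_map_image[of euclideanreal])
     (auto simp: continuous_map_in_subtopology cont inZ connectedin_iff_connected)

text \<open>Orbits are connected, and both an orbit and its complement, which is a union of orbits,
  are open.\<close>

lemma orbits_eq_components: "orbits = connected_components_of (subtopology M Z)"
proof -
  have 1: "orbit p \<in> connected_components_of (subtopology M Z)" if p: "p \<in> Z" for p
  proof -
    let ?C = "connected_component_of_set (subtopology M Z) p"
    have pt: "p \<in> topspace (subtopology M Z)" using p Z_subset by auto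
    have "orbit p \<subseteq> ?C"
      by (intro connected_component_of_maximal connectedin_orbit self_orbit p)
    moreover have "?C \<subseteq> orbit p"
      using connectedin_clopen_cases[OF connectedin_connected_component_of[of "subtopology M Z" p] closedin_orbit[OF p] openin_orbit[OF p]]
        self_orbit[OF p] pt connected_component_of_refl[of "subtopology M Z" p] by (auto simp: disjnt_iff)
    ultimately have "orbit p = ?C" by blast
    then show ?thesis using pt by (auto simp: connected_components_of_def)
  qed
  moreover have "c \<in> orbits" if c: "c \<in> connected_components_of (subtopology M Z)" for c
  proof -
    obtain p where "p \<in> c" using nonempty_connected_components_of[OF c] by blast
    then have p: "p \<in> Z" using connected_components_of_subset[OF c] by auto
    have "c = orbit p" using connected_components_of_overlap[OF c 1[OF p]] \<open>p \<in> c\<close> self_orbit[OF p] by blast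
    then show ?thesis using p by (auto simp: orbits_def)
  qed
  ultimately show ?thesis by (auto simp: orbits_def)
qed

lemma finite_orbits: "finite orbits"
proof -
  have "compact_space (subtopology M Z)" using compact by (simp add: compact_space_subtopology)
  moreover have "\<forall>U\<in>orbits. openin (subtopology M Z) U" by (auto simp: orbits_def openin_orbit)
  moreover have "topspace (subtopology M Z) \<subseteq> \<Union>orbits" using self_orbit by (auto simp: orbits_def)
  ultimately obtain F where F: "finite F" "F \<subseteq> orbits" "topspace (subtopology M Z) \<subseteq> \<Union>F"
    unfolding compact_space_alt by meson
  have "orbits \<subseteq> F"
  proof
    fix c assume "c \<in> orbits"
    then obtain p where p: "p \<in> Z" "c = orbit p" by (auto simp: orbits_def)
    then obtain d where d: "d \<in> F" "p \<in> d" using F(3) Z_subset by auto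
    then obtain q where q: "q \<in> Z" "d = orbit q" using F(2) by (auto simp: orbits_def)
    then show "c \<in> F" using orbit_eq[of q p] p d by auto
  qed
  then show ?thesis using F(1) finite_subset by blast
qed

lemma compactin_orbit: "p \<in> Z \<Longrightarrow> compactin M (orbit p)"
  using closedin_compact_space[OF _ closedin_orbit, of p] compact
  by (simp add: compact_space_subtopology compactin_subtopology)

text \<open>An injective orbit would be a compact line exhausted by its open bounded pieces.\<close>

lemma periodic:
  assumes p: "p \<in> Z" shows "\<exists>T>0. \<phi> p T = p"
proof -
  let ?V = "\<lambda>n::nat. \<phi> p ` {-real n<..<real n}"
  have c: "compact_space (subtopology M (orbit p))"
    using compactin_orbit[OF p] by (simp add: compact_space_subtopology)
  have tops: "topspace (subtopology M (orbit p)) = orbit p"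
    using orbit_subset[OF p] Z_subset by auto
  have op: "openin (subtopology M (orbit p)) (?V n)" for n
  proof -
    have "openin (subtopology (subtopology M Z) (orbit p)) (?V n)"
      using openin_subtopology_Int2[OF openin_flow_image[OF p, of "{-real n<..<real n}"], of "orbit p"]
      by (simp add: Int_absorb1 orbit_def image_mono)
    then show ?thesis by (simp add: subtopology_subtopology inf_absorb2 orbit_subset[OF p])
  qed
  have cov: "orbit p \<subseteq> \<Union>(range ?V)"
  proof
    fix q assume "q \<in> orbit p"
    then obtain s where s: "q = \<phi> p s" by (auto simp: orbit_def)
    obtain n::nat where "\<bar>s\<bar> < real n" using reals_Archimedean2 by blast
    then show "q \<in> \<Union>(range ?V)" using s by (auto simp: image_iff intro!: exI[of _ n] bexI[of _ s])
  qed
  have "compactin (subtopology M (orbit p)) (orbit p)" using c unfolding compact_space_def tops .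
  then obtain F where F: "finite F" "F \<subseteq> range ?V" "orbit p \<subseteq> \<Union>F"
    using compactinD[of "subtopology M (orbit p)" "orbit p" "range ?V"] op cov by blast
  obtain N where N: "finite N" "F = ?V ` N" using finite_subset_image[OF F(1,2)] by auto
  obtain m where m: "\<forall>n\<in>N. n \<le> m" using N(1) finite_nat_set_iff_bounded_le by blast
  have "\<phi> p (real m) \<in> orbit p" by (simp add: orbit_def)
  then obtain n s where n: "n \<in> N" "\<bar>s\<bar> < real n" "\<phi> p (real m) = \<phi> p s"
    using F(3) N(2) by (force simp: abs_less_iff)
  then have "s < real m" using m by (metis abs_ge_self le_less_trans less_le_trans of_nat_le_iff)
  moreover have "\<phi> p (real m - s) = p"
    using arg_cong[OF n(3), of "\<lambda>q. \<phi> q (-s)"] by (simp add: add[OF p] zero[OF p])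
  ultimately show ?thesis by (intro exI[of _ "real m - s"]) auto
qed

definition least_period :: "'a \<Rightarrow> real" where
  "least_period p = Inf {T. 0 < T \<and> \<phi> p T = p}"

lemma flow_eq_iff: "p \<in> Z \<Longrightarrow> \<phi> p s = \<phi> p t \<longleftrightarrow> \<phi> p (t - s) = p"
proof
  assume p: "p \<in> Z"
  show "\<phi> p (t - s) = p" if "\<phi> p s = \<phi> p t"
    using arg_cong[OF that, of "\<lambda>q. \<phi> q (-s)"] by (simp add: add[OF p] zero[OF p])
  show "\<phi> p s = \<phi> p t" if "\<phi> p (t - s) = p"
    using arg_cong[OF that, of "\<lambda>q. \<phi> q s"] by (simp add: add[OF p] zero[OF p])
qed

lemma least_period:
  assumes p: "p \<in> Z"
  shows "0 < least_period p" "\<phi> p (least_period p) = p"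
    "\<And>t. \<lbrakk>0 < t; t < least_period p\<rbrakk> \<Longrightarrow> \<phi> p t \<noteq> p"
proof -
  let ?S = "{T. 0 < T \<and> \<phi> p T = p}"
  obtain e where e: "e > 0" "inj_on (\<phi> p) {-e<..<e}" using locally_inj[OF p] by blast
  have ge: "e \<le> T" if "T \<in> ?S" for T
  proof (rule ccontr)
    assume "\<not> e \<le> T"
    then have "T = 0" using that e zero[OF p] by (intro inj_onD[OF e(2)]) auto
    then show False using that by simp
  qed
  have ne: "?S \<noteq> {}" using periodic[OF p] by blast
  have "closed {T. \<phi> p T = p}"
  proof -
    have "closedin M {p}" 
      using p Z_subset by (intro closedin_Hausdorff_singleton[OF Hausdorff]) auto
    from closedin_continuous_map_preimage[OF cont[OF p] this] show ?thesis by simp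
  qed
  then have "closed ({e..} \<inter> {T. \<phi> p T = p})" by (intro closed_Int) auto
  moreover have "?S = {e..} \<inter> {T. \<phi> p T = p}" using ge e(1) by force
  ultimately have "Inf ?S \<in> ?S"
    using ne by (intro closed_contains_Inf) (auto intro!: bdd_belowI[of _ e] simp: ge)
  then show "0 < least_period p" "\<phi> p (least_period p) = p" by (auto simp: least_period_def)
  show "\<phi> p t \<noteq> p" if "0 < t" "t < least_period p" for t
  proof
    assume "\<phi> p t = p"
    then have "Inf ?S \<le> t" using that by (intro cInf_lower) (auto intro!: bdd_belowI[of _ e] simp: ge)
    then show False using that by (simp add: least_period_def)
  qed
qed

lemma flow_add_period: "p \<in> Z \<Longrightarrow> \<phi> p (t + least_period p) = \<phi> p t"
  using flow_eq_iff[of p "least_period p" 0] flow_eq_iff[of p "t + least_period p" t]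
  by (simp add: zero least_period(2))

lemma inj_on_period: "p \<in> Z \<Longrightarrow> inj_on (\<phi> p) {0..<least_period p}"
proof (rule inj_onI, rule ccontr)
  fix s t assume *: "p \<in> Z" "s \<in> {0..<least_period p}" "t \<in> {0..<least_period p}" "\<phi> p s = \<phi> p t" "s \<noteq> t"
  show False
  proof (cases "s < t")
    case True
    then show False using least_period(3)[of p "t - s"] * flow_eq_iff[of p s t] by auto
  next
    case False
    then show False using least_period(3)[of p "s - t"] * flow_eq_iff[of p t s] by auto
  qed
qed

lemma orbit_image_period:
  assumes p: "p \<in> Z" shows "orbit p = \<phi> p ` {0..<least_period p}"
proof
  let ?T = "least_period p"
  have T: "0 < ?T" using least_period[OF p] by simp
  have per: "\<phi> p (t + real n * ?T) = \<phi> p t" for t n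
  proof (induction n)
    case (Suc n)
    then show ?case using flow_add_period[OF p, of "t + real n * ?T"] by (simp add: algebra_simps)
  qed simp
  have per': "\<phi> p (t + of_int k * ?T) = \<phi> p t" for t k
  proof (cases "k \<ge> 0")
    case True then show ?thesis using per[of t "nat k"] by simp
  next
    case False then show ?thesis using per[of "t + of_int k * ?T" "nat (-k)"] by simp
  qed
  show "orbit p \<subseteq> \<phi> p ` {0..<?T}"
  proof
    fix q assume "q \<in> orbit p"
    then obtain t where t: "q = \<phi> p t" by (auto simp: orbit_def)
    let ?u = "t - of_int \<lfloor>t / ?T\<rfloor> * ?T"
    have "of_int \<lfloor>t / ?T\<rfloor> \<le> t / ?T" "t / ?T < of_int \<lfloor>t / ?T\<rfloor> + 1" by linarith+
    then have "of_int \<lfloor>t / ?T\<rfloor> * ?T \<le> t" "t < (of_int \<lfloor>t / ?T\<rfloor> + 1) * ?T"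
      using T by (simp_all only: pos_le_divide_eq pos_divide_less_eq)
    then have "?u \<in> {0..<?T}" by (simp add: distrib_right)
    moreover have "\<phi> p ?u = q" using per'[of ?u "\<lfloor>t / ?T\<rfloor>"] t by simp
    ultimately show "q \<in> \<phi> p ` {0..<?T}" by blast
  qed
qed (auto simp: orbit_def)

definition loop_chain :: "'a \<Rightarrow> 'a chain" where
  "loop_chain p = path_chain (\<phi> p) 0 (least_period p)"

definition return_time :: "'a set \<Rightarrow> 'a \<Rightarrow> real" where
  "return_time P p = Min {t. 0 < t \<and> t \<le> least_period p \<and> \<phi> p t \<in> P}"

lemma finite_hitting_times:
  assumes p: "p \<in> Z" and "finite P" shows "finite {t. 0 < t \<and> t \<le> least_period p \<and> \<phi> p t \<in> P}"
proof -
  have "inj_on (\<phi> p) {0<..least_period p}"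
  proof (rule inj_onI)
    fix s t assume *: "s \<in> {0<..least_period p}" "t \<in> {0<..least_period p}" "\<phi> p s = \<phi> p t"
    have **: "\<phi> p u \<noteq> p" if "0 < u" "u < least_period p" for u using least_period(3)[OF p that] .
    show "s = t" using **[of "t - s"] **[of "s - t"] * flow_eq_iff[OF p, of s t] flow_eq_iff[OF p, of t s]
      by (cases s t rule: linorder_cases) auto
  qed
  then have "inj_on (\<phi> p) {t. 0 < t \<and> t \<le> least_period p \<and> \<phi> p t \<in> P}"
    by (rule inj_on_subset) auto
  then show ?thesis by (rule inj_on_finite[OF _ _ \<open>finite P\<close>]) auto
qed

lemma return_time:
  assumes p: "p \<in> Z" "p \<in> P" and P: "finite P"
  shows "0 < return_time P p" "return_time P p \<le> least_period p" "\<phi> p (return_time P p) \<in> P"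
    "\<And>t. \<lbrakk>0 < t; t < return_time P p\<rbrakk> \<Longrightarrow> \<phi> p t \<notin> P"
proof -
  let ?S = "{t. 0 < t \<and> t \<le> least_period p \<and> \<phi> p t \<in> P}"
  have ne: "least_period p \<in> ?S" using least_period[OF p(1)] p by auto
  have fin: "finite ?S" by (rule finite_hitting_times[OF p(1) P])
  have in': "return_time P p \<in> ?S" unfolding return_time_def using Min_in[OF fin] ne by blast
  then show 1: "0 < return_time P p" "return_time P p \<le> least_period p" "\<phi> p (return_time P p) \<in> P" by auto
  show "\<phi> p t \<notin> P" if "0 < t" "t < return_time P p" for t
  proof
    assume "\<phi> p t \<in> P"
    then have "t \<in> ?S" using that 1 by auto
    then have "return_time P p \<le> t" unfolding return_time_def using Min_le[OF fin] by blast
    then show False using that by simp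
  qed
qed

lemma return_time_unique:
  assumes p: "p \<in> Z" "p \<in> P" and P: "finite P"
    and r: "0 < r" "\<phi> p r \<in> P" "\<And>t. \<lbrakk>0 < t; t < r\<rbrakk> \<Longrightarrow> \<phi> p t \<notin> P"
  shows "return_time P p = r"
  using return_time[OF p P] r by (metis linorder_less_linear)

definition segment_chain :: "'a set \<Rightarrow> 'a \<Rightarrow> 'a chain" where
  "segment_chain P p = path_chain (\<phi> p) 0 (return_time P p)"

lemma path_chain_shift: "p \<in> Z \<Longrightarrow> path_chain (\<phi> p) s u = path_chain (\<phi> (\<phi> p s)) 0 (u - s)"
  unfolding path_chain_def by (simp add: add)

text \<open>The time interval of one period is subdivided at the times at which the orbit visits
  \<open>P\<close>; the piece that starts in \<open>q\<close> is the flow line from \<open>q\<close> up to its next visit.\<close>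

lemma loop_chain_segments:
  assumes p: "p \<in> Z" "p \<in> P" and P: "finite P"
  shows "homologous_rel 1 M S (loop_chain p) (\<Sum>q\<in>P \<inter> orbit p. segment_chain P q)"
proof -
  let ?T = "least_period p"
  define F where "F = {t. 0 < t \<and> t < ?T \<and> \<phi> p t \<in> P}"
  have T: "0 < ?T" "\<phi> p ?T = p" using least_period[OF p(1)] by auto
  have fin: "finite F" by (rule finite_subset[OF _ finite_hitting_times[OF p(1) P]]) (auto simp: F_def)
  have F: "F \<subseteq> {0<..<?T}" by (auto simp: F_def)
  have bij: "bij_betw (\<phi> p) (insert 0 F) (P \<inter> orbit p)"
    unfolding bij_betw_def
  proof
    show "inj_on (\<phi> p) (insert 0 F)"
      by (rule inj_on_subset[OF inj_on_period[OF p(1)]]) (use F T in auto)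
    show "\<phi> p ` insert 0 F = P \<inter> orbit p"
    proof -
      have "{0..<?T} = insert 0 {0<..<?T}" using T by auto
      then show ?thesis
        unfolding orbit_image_period[OF p(1)] using p zero[OF p(1)] by (auto simp: F_def)
    qed
  qed
  have seg: "path_chain (\<phi> p) s (Min (insert ?T {t\<in>insert 0 F. s < t})) = segment_chain P (\<phi> p s)"
    if s: "s \<in> insert 0 F" for s
  proof -
    let ?u = "Min (insert ?T {t\<in>insert 0 F. s < t})"
    have fin': "finite (insert ?T {t\<in>insert 0 F. s < t})" using fin by auto
    have u: "?u \<in> insert ?T {t\<in>insert 0 F. s < t}" using Min_in[OF fin'] by blast
    have uT: "?u \<le> ?T" using fin' by (intro Min_le) auto
    have s0: "0 \<le> s" "s < ?T" "\<phi> p s \<in> P" using s F T p zero[OF p(1)] by (auto simp: F_def)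
    have us: "s < ?u" using u s0 by auto
    have "return_time P (\<phi> p s) = ?u - s"
    proof (rule return_time_unique[OF inZ[OF p(1)] s0(3) P])
      show "0 < ?u - s" using us by simp
      have "\<phi> p ?u \<in> P" using u p T zero[OF p(1)] by (auto simp: F_def)
      then show "\<phi> (\<phi> p s) (?u - s) \<in> P" by (simp add: add[OF p(1)])
      show "\<phi> (\<phi> p s) t \<notin> P" if "0 < t" "t < ?u - s" for t
      proof
        assume "\<phi> (\<phi> p s) t \<in> P"
        then have "s + t \<in> {t\<in>insert 0 F. s < t}"
          using that uT s0 by (auto simp: F_def add[OF p(1)])
        then have "?u \<le> s + t" using fin' by (intro Min_le) auto
        then show False using that by simp
      qed
    qed
    then show ?thesis unfolding segment_chain_def by (simp only: path_chain_shift[OF p(1), of s ?u])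
  qed
  have "homologous_rel 1 M S (path_chain (\<phi> p) 0 ?T)
     (\<Sum>s\<in>insert 0 F. path_chain (\<phi> p) s (Min (insert ?T {t\<in>insert 0 F. s < t})))"
    by (rule path_chain_subdivide[OF cont[OF p(1)] fin F])
  also have "(\<Sum>s\<in>insert 0 F. path_chain (\<phi> p) s (Min (insert ?T {t\<in>insert 0 F. s < t})))
     = (\<Sum>s\<in>insert 0 F. segment_chain P (\<phi> p s))"
    by (rule sum.cong[OF refl seg])
  also have "\<dots> = (\<Sum>q\<in>P \<inter> orbit p. segment_chain P q)"
    by (rule sum.reindex_bij_betw[OF bij])
  finally show ?thesis by (simp only: loop_chain_def)
qed

lemma loop_chain_base:
  assumes p: "p \<in> Z" and q: "q \<in> orbit p"
  shows "homologous_rel 1 M S (loop_chain p) (loop_chain q)"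
proof -
  have q': "q \<in> Z" using orbit_subset[OF p] q by auto
  have "homologous_rel 1 M S (loop_chain q) (\<Sum>x\<in>{p,q} \<inter> orbit q. segment_chain {p,q} x)"
    by (rule loop_chain_segments[OF q']) auto
  moreover have "homologous_rel 1 M S (loop_chain p) (\<Sum>x\<in>{p,q} \<inter> orbit p. segment_chain {p,q} x)"
    by (rule loop_chain_segments[OF p]) auto
  ultimately show ?thesis
    unfolding orbit_eq[OF p q] by (metis homologous_rel_sym homologous_rel_trans)
qed

lemma loop_chain_cycle: assumes p: "p \<in> Z" shows "singular_relcycle 1 M {} (loop_chain p)"
  unfolding singular_cycle loop_chain_def
  using singular_chain_path_chain_line[OF cont[OF p]]
  by (simp only: chain_boundary_path_chain least_period[OF p] zero[OF p]) auto

end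

section \<open>Circle systems that agree outside of a disc\<close>

text \<open>The times at which the two flow lines coincide form a closed set by continuity, and a
  relatively open one by local agreement together with the group law of the flows. The closure
  covers the end points of the arc, which may lie in \<open>\<Delta>\<close>.\<close>

lemma flows_agree_along:
  assumes F: "circle_flow M Z \<phi>" and F': "circle_flow M Z' \<phi>'"
    and out: "Z - \<Delta> = Z' - \<Delta>"
    and loc: "\<And>x. x \<in> Z - \<Delta> \<Longrightarrow> \<exists>e>0. \<forall>t. \<bar>t\<bar> < e \<longrightarrow> \<phi>' x t = \<phi> x t"
    and x: "x \<in> Z - \<Delta>" and ab: "a < 0" "0 < b"
    and arc: "\<And>t. \<lbrakk>a < t; t < b\<rbrakk> \<Longrightarrow> \<phi> x t \<notin> \<Delta>"
    and t: "t \<in> {a..b}"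
  shows "\<phi>' x t = \<phi> x t"
proof -
  interpret F: circle_flow M Z \<phi> by (rule F)
  interpret F': circle_flow M Z' \<phi>' by (rule F')
  have xZ: "x \<in> Z" "x \<in> Z'" using x out by auto
  let ?E = "{t. \<phi>' x t = \<phi> x t}"
  have cl: "closed ?E"
    using closedin_continuous_maps_eq[OF F.Hausdorff F'.cont[OF xZ(2)] F.cont[OF xZ(1)]] by simp
  have "{a<..<b} \<subseteq> ?E"
  proof (rule ccontr)
    assume "\<not> {a<..<b} \<subseteq> ?E"
    have "openin (top_of_set {a<..<b}) ({a<..<b} \<inter> ?E)"
      unfolding openin_contains_ball
    proof (intro conjI ballI)
      fix s assume s: "s \<in> {a<..<b} \<inter> ?E"
      have "\<phi> x s \<in> Z - \<Delta>" using s arc F.inZ[OF xZ(1)] by auto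
      from loc[OF this] obtain e where e: "e > 0" "\<And>t. \<bar>t\<bar> < e \<Longrightarrow> \<phi>' (\<phi> x s) t = \<phi> (\<phi> x s) t" by blast
      have "ball s e \<inter> {a<..<b} \<subseteq> {a<..<b} \<inter> ?E"
      proof
        fix u assume u: "u \<in> ball s e \<inter> {a<..<b}"
        have "\<phi>' x u = \<phi>' (\<phi>' x s) (u - s)" by (simp add: F'.add xZ)
        also have "\<dots> = \<phi> (\<phi> x s) (u - s)"
          using s e(2)[of "u - s"] u by (auto simp: dist_real_def)
        also have "\<dots> = \<phi> x u" by (simp add: F.add xZ)
        finally show "u \<in> {a<..<b} \<inter> ?E" using u by auto
      qed
      then show "\<exists>e>0. ball s e \<inter> {a<..<b} \<subseteq> {a<..<b} \<inter> ?E" using e by blast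
    qed auto
    moreover have "closedin (top_of_set {a<..<b}) ({a<..<b} \<inter> ?E)"
      using cl by (simp add: closedin_closed_Int)
    moreover have "connected {a<..<b}" by simp
    ultimately have "{a<..<b} \<inter> ?E = {} \<or> {a<..<b} \<inter> ?E = {a<..<b}"
      unfolding connected_clopen by blast
    moreover have "0 \<in> {a<..<b} \<inter> ?E" using ab xZ by (simp add: F.zero F'.zero)
    ultimately show False using \<open>\<not> {a<..<b} \<subseteq> ?E\<close> by blast
  qed
  then have "closure {a<..<b} \<subseteq> ?E" using cl by (rule closure_minimal)
  then show ?thesis using t ab by auto
qed

context circle_flow begin

lemma path_chain_inside:
  assumes p: "p \<in> Z" and "0 \<le> r" and "\<And>t. \<lbrakk>0 \<le> t; t \<le> r\<rbrakk> \<Longrightarrow> \<phi> p t \<in> \<Delta>"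
  shows "homologous_rel 1 M \<Delta> (path_chain (\<phi> p) 0 r) 0"
proof -
  have "continuous_map (top_of_set {0..r}) (subtopology M \<Delta>) (\<phi> p)"
    using assms by (auto simp: continuous_map_in_subtopology continuous_map_from_subtopology[OF cont[OF p]])
  then have "singular_chain 1 (subtopology M \<Delta>) (path_chain (\<phi> p) 0 r)"
    using \<open>0 \<le> r\<close> by (rule singular_chain_path_chain)
  then show ?thesis unfolding homologous_rel_def
    by (intro singular_chain_imp_relboundary) simp
qed

lemma connectedin_arc:
  assumes "p \<in> Z" "connected I" shows "connectedin M (\<phi> p ` I)"
  by (rule connectedin_continuous_map_image[OF cont[OF assms(1)]]) (simp add: connectedin_iff_connected assms)

text \<open>An arc that avoids the collar between \<open>\<Delta>i\<close> and \<open>\<Delta>\<close> is separated by the open set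
  \<open>\<Delta>i\<close> and the complement of \<open>\<Delta>\<close>.\<close>

lemma arc_in_or_out:
  assumes \<Delta>: "closedin M \<Delta>" "openin M \<Delta>i" "\<Delta>i \<subseteq> \<Delta>"
    and p: "p \<in> Z" "connected I" and av: "\<And>t. t \<in> I \<Longrightarrow> \<phi> p t \<notin> \<Delta> - \<Delta>i"
  shows "\<phi> p ` I \<subseteq> \<Delta>i \<or> \<phi> p ` I \<inter> \<Delta> = {}"
proof (rule ccontr)
  assume n: "\<not> ?thesis"
  have "openin M (topspace M - \<Delta>)" using \<Delta>(1) by blast
  moreover have "\<phi> p ` I \<subseteq> \<Delta>i \<union> (topspace M - \<Delta>)"
    using av Z_subset inZ[OF p(1)] by auto
  ultimately show False
    using connectedin_arc[OF p] n \<Delta> av Z_subset unfolding connectedin by blast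
qed

text \<open>Only the flow segments outside of \<open>\<Delta>\<close> contribute to the class modulo \<open>\<Delta>\<close>.\<close>

definition outer_points :: "'a set \<Rightarrow> 'a set \<Rightarrow> 'a set" where
  "outer_points \<Delta> P = {q \<in> P \<inter> Z. \<forall>t. 0 < t \<and> t < return_time P q \<longrightarrow> \<phi> q t \<notin> \<Delta>}"

text \<open>Every flow segment between consecutive points of \<open>P\<close> lies in \<open>\<Delta>\<close> or avoids it, because the
  flow lines cross the collar between \<open>\<Delta>i\<close> and \<open>\<Delta>\<close> only in points of \<open>P\<close>. The segments in \<open>\<Delta>\<close>
  vanish modulo \<open>\<Delta>\<close>.\<close>

lemma loops_outer_segments:
  assumes \<Delta>: "closedin M \<Delta>" "openin M \<Delta>i" "\<Delta>i \<subseteq> \<Delta>" and P: "finite P" "Z \<inter> (\<Delta> - \<Delta>i) \<subseteq> P"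
    and meet: "\<And>c. \<lbrakk>c \<in> orbits; c \<inter> \<Delta> = {}\<rbrakk> \<Longrightarrow> c \<inter> P \<noteq> {}"
    and base: "\<And>c. c \<in> orbits \<Longrightarrow> b c \<in> c"
  shows "homologous_rel 1 M \<Delta> (\<Sum>c\<in>orbits. loop_chain (b c)) (\<Sum>q\<in>outer_points \<Delta> P. segment_chain P q)"
proof -
  have orb: "c \<subseteq> Z" "\<And>q. q \<in> c \<Longrightarrow> orbit q = c" if "c \<in> orbits" for c
  proof -
    obtain p where p: "p \<in> Z" "c = orbit p" using \<open>c \<in> orbits\<close> by (auto simp: orbits_def)
    show "c \<subseteq> Z" using orbit_subset[OF p(1)] p(2) by simp
    show "orbit q = c" if "q \<in> c" for q using orbit_eq[OF p(1)] p(2) that by simp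
  qed
  have 1: "homologous_rel 1 M \<Delta> (loop_chain (b c)) (\<Sum>q\<in>P \<inter> c. segment_chain P q)" if c: "c \<in> orbits" for c
  proof (cases "c \<inter> P = {}")
    case False
    then obtain p where p: "p \<in> c" "p \<in> P" by blast
    have bc: "b c \<in> Z" "p \<in> Z" "orbit (b c) = c" "orbit p = c" using orb[OF c] base[OF c] p by auto
    have "homologous_rel 1 M \<Delta> (loop_chain (b c)) (loop_chain p)"
      using loop_chain_base[OF bc(1)] bc(3) p by blast
    moreover have "homologous_rel 1 M \<Delta> (loop_chain p) (\<Sum>q\<in>P \<inter> c. segment_chain P q)"
      using loop_chain_segments[OF bc(2) p(2) P(1)] bc(4) by blast
    ultimately show ?thesis by (metis homologous_rel_trans)
  next
    case True
    have bc: "b c \<in> Z" "orbit (b c) = c" using orb[OF c] base[OF c] by auto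
    have rng: "\<phi> (b c) ` UNIV = c" using bc by (simp add: orbit_def)
    have av: "\<phi> (b c) t \<notin> \<Delta> - \<Delta>i" for t using True rng P(2) inZ[OF bc(1)] by blast
    have "\<phi> (b c) ` UNIV \<subseteq> \<Delta>i \<or> \<phi> (b c) ` UNIV \<inter> \<Delta> = {}"
      by (rule arc_in_or_out[OF \<Delta> bc(1)]) (use av in auto)
    then have "c \<subseteq> \<Delta>" using rng meet[OF c] True \<Delta>(3) by auto
    then have "\<phi> (b c) t \<in> \<Delta>" for t using rng by blast
    then have "homologous_rel 1 M \<Delta> (loop_chain (b c)) 0"
      unfolding loop_chain_def using least_period(1)[OF bc(1)] by (intro path_chain_inside[OF bc(1)]) auto
    then show ?thesis using True by (simp add: Int_commute)
  qed
  have "homologous_rel 1 M \<Delta> (\<Sum>c\<in>orbits. loop_chain (b c)) (\<Sum>c\<in>orbits. \<Sum>q\<in>P \<inter> c. segment_chain P q)"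
    by (rule homologous_rel_sum) (use finite_orbits 1 in auto)
  also have "(\<Sum>c\<in>orbits. \<Sum>q\<in>P \<inter> c. segment_chain P q) = (\<Sum>q\<in>(\<Union>c\<in>orbits. P \<inter> c). segment_chain P q)"
  proof (rule sum.UNION_disjoint[symmetric])
    show "\<forall>c\<in>orbits. \<forall>d\<in>orbits. c \<noteq> d \<longrightarrow> P \<inter> c \<inter> (P \<inter> d) = {}"
    proof (intro ballI impI)
      fix c d assume cd: "c \<in> orbits" "d \<in> orbits" "c \<noteq> d"
      have "q \<notin> d" if "q \<in> c" for q using orb(2)[OF cd(1) that] orb(2)[OF cd(2), of q] cd(3) by auto
      then show "P \<inter> c \<inter> (P \<inter> d) = {}" by blast
    qed
  qed (use finite_orbits P in auto)
  also have "(\<Union>c\<in>orbits. P \<inter> c) = P \<inter> Z"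
  proof -
    have "\<Union>orbits = Z"
    proof
      show "\<Union>orbits \<subseteq> Z" using orb(1) by blast
      show "Z \<subseteq> \<Union>orbits"
      proof
        fix q assume "q \<in> Z"
        then show "q \<in> \<Union>orbits" using self_orbit[of q] by (auto simp: orbits_def)
      qed
    qed
    then show ?thesis by blast
  qed
  finally have 2: "homologous_rel 1 M \<Delta> (\<Sum>c\<in>orbits. loop_chain (b c)) (\<Sum>q\<in>P \<inter> Z. segment_chain P q)" .
  have 3: "homologous_rel 1 M \<Delta> (segment_chain P q) (if q \<in> outer_points \<Delta> P then segment_chain P q else 0)"
    if q: "q \<in> P \<inter> Z" for q
  proof (cases "q \<in> outer_points \<Delta> P")
    case False
    have qq: "q \<in> Z" "q \<in> P" using q by auto
    let ?r = "return_time P q"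
    have r: "0 < ?r" "\<phi> q ?r \<in> P" using return_time[OF qq P(1)] by auto
    have av: "\<phi> q t \<notin> \<Delta> - \<Delta>i" if "t \<in> {0<..<?r}" for t
      using return_time(4)[OF qq P(1), of t] that P(2) inZ[OF qq(1)] by auto
    have "\<phi> q ` {0<..<?r} \<subseteq> \<Delta>i \<or> \<phi> q ` {0<..<?r} \<inter> \<Delta> = {}"
      by (rule arc_in_or_out[OF \<Delta> qq(1)]) (use av in auto)
    moreover obtain t where "t \<in> {0<..<?r}" "\<phi> q t \<in> \<Delta>"
      using False q by (auto simp: outer_points_def)
    ultimately have "\<phi> q ` {0<..<?r} \<subseteq> \<Delta>" using \<Delta>(3) by blast
    then have "{0<..<?r} \<subseteq> {t. \<phi> q t \<in> \<Delta>}" by auto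
    moreover have "closed {t. \<phi> q t \<in> \<Delta>}"
      using closedin_continuous_map_preimage[OF cont[OF qq(1)] \<Delta>(1)] by simp
    ultimately have "closure {0<..<?r} \<subseteq> {t. \<phi> q t \<in> \<Delta>}" by (rule closure_minimal)
    then have "\<phi> q t \<in> \<Delta>" if "0 \<le> t" "t \<le> ?r" for t using that r by auto
    then have "homologous_rel 1 M \<Delta> (segment_chain P q) 0"
      unfolding segment_chain_def using r(1) by (intro path_chain_inside qq) auto
    then show ?thesis using False by simp
  qed auto
  have "homologous_rel 1 M \<Delta> (\<Sum>q\<in>P \<inter> Z. segment_chain P q)
     (\<Sum>q\<in>P \<inter> Z. if q \<in> outer_points \<Delta> P then segment_chain P q else 0)"
    by (rule homologous_rel_sum) (use P 3 in auto)
  also have "(\<Sum>q\<in>P \<inter> Z. if q \<in> outer_points \<Delta> P then segment_chain P q else 0)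
     = (\<Sum>q\<in>outer_points \<Delta> P. segment_chain P q)"
    using P by (subst sum.inter_filter[symmetric]) (auto simp: outer_points_def intro!: sum.cong)
  finally show ?thesis using 2 by (metis homologous_rel_trans)
qed

end

lemma outer_segments_transfer:
  assumes F: "circle_flow M Z \<phi>" and F': "circle_flow M Z' \<phi>'"
    and out: "Z - \<Delta> = Z' - \<Delta>"
    and loc: "\<And>x. x \<in> Z - \<Delta> \<Longrightarrow> \<exists>e>0. \<forall>t. \<bar>t\<bar> < e \<longrightarrow> \<phi>' x t = \<phi> x t"
    and P: "finite P" and q: "q \<in> circle_flow.outer_points Z \<phi> \<Delta> P"
  shows "q \<in> circle_flow.outer_points Z' \<phi>' \<Delta> P \<and>
    circle_flow.segment_chain \<phi>' P q = circle_flow.segment_chain \<phi> P q"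
proof -
  interpret F: circle_flow M Z \<phi> by (rule F)
  interpret F': circle_flow M Z' \<phi>' by (rule F')
  let ?r = "F.return_time P q"
  have qq: "q \<in> Z" "q \<in> P" and o: "\<And>t. \<lbrakk>0 < t; t < ?r\<rbrakk> \<Longrightarrow> \<phi> q t \<notin> \<Delta>"
    using q by (auto simp: F.outer_points_def)
  note r = F.return_time[OF qq P]
  define x where "x = \<phi> q (?r/2)"
  have x: "x \<in> Z - \<Delta>" "x \<in> Z" "x \<in> Z'" using o[of "?r/2"] r(1) F.inZ[OF qq(1)] out by (auto simp: x_def)
  have sh: "\<phi> x t = \<phi> q (?r/2 + t)" for t by (simp add: x_def F.add qq)
  have ag: "\<phi>' x t = \<phi> x t" if "t \<in> {-(?r/2)..?r/2}" for t
  proof (rule flows_agree_along[OF F F' out loc x(1) _ _ _ that])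
    show "\<phi> x t \<notin> \<Delta>" if "- (?r/2) < t" "t < ?r/2" for t
      unfolding sh by (rule o) (use that in \<open>simp_all add: field_simps\<close>)
  qed (use r in auto)
  have "\<phi>' x (-(?r/2)) = q" using ag[of "-(?r/2)"] r(1) by (simp add: sh F.zero qq)
  then have q': "q \<in> Z'" "\<phi>' q t = \<phi>' x (t - ?r/2)" for t
    using F'.inZ[OF x(3), of "-(?r/2)"] F'.add[OF x(3), of "-(?r/2)" t] by auto
  have eq: "\<phi>' q t = \<phi> q t" if "t \<in> {0..?r}" for t
    using ag[of "t - ?r/2"] that by (simp add: q' sh)
  have r': "F'.return_time P q = ?r"
    by (rule F'.return_time_unique[OF q'(1) qq(2) P]) (use r eq in auto)
  have "path_chain (\<phi>' q) 0 ?r = path_chain (\<phi> q) 0 ?r"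
  proof -
    have "?r * x 1 \<in> {0..?r}" if "x \<in> standard_simplex 1" for x
      using standard_simplex_1_bounds[OF that] r(1) by (auto intro: mult_left_le)
    then show ?thesis unfolding path_chain_def
      by (intro arg_cong[where f=frag_of] restrict_ext) (simp add: eq)
  qed
  then show ?thesis
    using q' qq o eq r' by (auto simp: F.segment_chain_def F'.segment_chain_def F'.outer_points_def)
qed

text \<open>Outside of \<open>\<Delta>\<close> both circle systems consist of the same oriented arcs, so their
  difference is a cycle in \<open>\<Delta>\<close>, which bounds when \<open>\<Delta>\<close> is contractible.\<close>

theorem circle_flow_locality:
  assumes F: "circle_flow M Z \<phi>" and F': "circle_flow M Z' \<phi>'"
    and out: "Z - \<Delta> = Z' - \<Delta>"
    and loc: "\<And>x. x \<in> Z - \<Delta> \<Longrightarrow> \<exists>e>0. \<forall>t. \<bar>t\<bar> < e \<longrightarrow> \<phi>' x t = \<phi> x t"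
    and \<Delta>: "closedin M \<Delta>" "openin M \<Delta>i" "\<Delta>i \<subseteq> \<Delta>" "contractible_space (subtopology M \<Delta>)"
    and P: "finite P" "(Z \<union> Z') \<inter> (\<Delta> - \<Delta>i) \<subseteq> P"
    and base: "\<And>c. c \<in> circle_flow.orbits Z \<phi> \<Longrightarrow> b c \<in> c" "\<And>c. c \<in> circle_flow.orbits Z' \<phi>' \<Longrightarrow> b c \<in> c"
  shows "homologous_rel 1 M {} (\<Sum>c\<in>circle_flow.orbits Z \<phi>. circle_flow.loop_chain \<phi> (b c))
     (\<Sum>c\<in>circle_flow.orbits Z' \<phi>'. circle_flow.loop_chain \<phi>' (b c))"
proof -
  interpret F: circle_flow M Z \<phi> by (rule F)
  interpret F': circle_flow M Z' \<phi>' by (rule F')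
  have sub: "c \<subseteq> Z" if "c \<in> F.orbits" for c using that F.orbit_subset by (auto simp: F.orbits_def)
  have sub': "c \<subseteq> Z'" if "c \<in> F'.orbits" for c using that F'.orbit_subset by (auto simp: F'.orbits_def)
  \<comment> \<open>The base points are added to the cutting points, so that circles that avoid \<open>\<Delta>\<close> are cut as well.\<close>
  define Q where "Q = P \<union> b ` F.orbits \<union> b ` F'.orbits"
  have Q: "finite Q" "Z \<inter> (\<Delta> - \<Delta>i) \<subseteq> Q" "Z' \<inter> (\<Delta> - \<Delta>i) \<subseteq> Q"
    using P F.finite_orbits F'.finite_orbits by (auto simp: Q_def)
  have loc': "\<exists>e>0. \<forall>t. \<bar>t\<bar> < e \<longrightarrow> \<phi> x t = \<phi>' x t" if "x \<in> Z' - \<Delta>" for x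
  proof -
    have "x \<in> Z - \<Delta>" using that out by simp
    from loc[OF this] show ?thesis by metis
  qed
  note tr = outer_segments_transfer[OF F F' out loc Q(1)]
  note tr' = outer_segments_transfer[OF F' F out[symmetric] loc' Q(1)]
  have "F.outer_points \<Delta> Q = F'.outer_points \<Delta> Q" using tr tr' by blast
  then have eq: "(\<Sum>q\<in>F.outer_points \<Delta> Q. F.segment_chain Q q) = (\<Sum>q\<in>F'.outer_points \<Delta> Q. F'.segment_chain Q q)"
    by (intro sum.cong) (use tr in auto)
  have meet: "c \<inter> Q \<noteq> {}" if "c \<in> F.orbits" "c \<inter> \<Delta> = {}" for c
    using base(1)[OF that(1)] that(1) unfolding Q_def by blast
  have meet': "c \<inter> Q \<noteq> {}" if "c \<in> F'.orbits" "c \<inter> \<Delta> = {}" for c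
    using base(2)[OF that(1)] that(1) unfolding Q_def by blast
  have 1: "homologous_rel 1 M \<Delta> (\<Sum>c\<in>F.orbits. F.loop_chain (b c)) (\<Sum>q\<in>F.outer_points \<Delta> Q. F.segment_chain Q q)"
    by (rule F.loops_outer_segments[OF \<Delta>(1-3) Q(1,2) meet base(1)])
  have 2: "homologous_rel 1 M \<Delta> (\<Sum>c\<in>F'.orbits. F'.loop_chain (b c)) (\<Sum>q\<in>F.outer_points \<Delta> Q. F.segment_chain Q q)"
    unfolding eq by (rule F'.loops_outer_segments[OF \<Delta>(1-3) Q(1,3) meet' base(2)])
  have 3: "homologous_rel 1 M \<Delta> (\<Sum>c\<in>F.orbits. F.loop_chain (b c)) (\<Sum>c\<in>F'.orbits. F'.loop_chain (b c))"
    using 1 2 by (metis homologous_rel_sym homologous_rel_trans)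
  have "singular_relcycle 1 M {} (\<Sum>c\<in>F.orbits. F.loop_chain (b c))"
    by (intro singular_relcycle_sum F.loop_chain_cycle) (use sub base(1) in blast)
  moreover have "singular_relcycle 1 M {} (\<Sum>c\<in>F'.orbits. F'.loop_chain (b c))"
    by (intro singular_relcycle_sum F'.loop_chain_cycle) (use sub' base(2) in blast)
  ultimately show ?thesis
    by (rule homologous_rel_contractible[OF _ _ 3 \<Delta>(4)])
qed

section \<open>Normals of planes and the inverse function theorem\<close>

lemma cross3_nonzero_if_inj:
  fixes D :: "real^2 \<Rightarrow> real^3"
  assumes D: "linear D" "inj D"
  shows "cross3 (D (axis 1 1)) (D (axis 2 1)) \<noteq> 0"
proof
  assume "cross3 (D (axis 1 1)) (D (axis 2 1)) = 0"
  then have "collinear {0, D (axis 1 1), D (axis 2 1)}" by (simp add: cross_eq_0)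
  moreover have nz: "D (axis i 1) \<noteq> 0" for i
    using linear_injective_0[OF D(1)] D(2) axis_eq_0_iff[of i "1::real"] by auto
  ultimately obtain c where "D (axis 2 1) = c *\<^sub>R D (axis 1 1)" by (auto simp: collinear_lemma)
  then have "D (axis 2 1) = D (c *\<^sub>R axis 1 1)" using D(1) by (simp add: linear_cmul)
  then have "axis 2 1 = c *\<^sub>R (axis 1 1 :: real^2)" using D(2) by (simp add: inj_eq)
  then have "(axis 2 1 :: real^2) $ 2 = (c *\<^sub>R (axis 1 1 :: real^2)) $ 2" by simp
  then show False by (simp add: axis_def)
qed

lemma linear_real2_expand:
  fixes D :: "real^2 \<Rightarrow> 'b::real_vector"
  assumes "linear D"
  shows "D v = v$1 *\<^sub>R D (axis 1 1) + v$2 *\<^sub>R D (axis 2 1)"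
proof -
  have "v = v$1 *\<^sub>R axis 1 1 + v$2 *\<^sub>R axis 2 1"
    by (simp add: vec_eq_iff forall_2 axis_def)
  then have "D v = D (v$1 *\<^sub>R axis 1 1 + v$2 *\<^sub>R axis 2 1)" by simp
  then show ?thesis using assms by (simp add: linear_add linear_cmul)
qed

lemma dot_normal_zero:
  fixes D :: "real^2 \<Rightarrow> real^3"
  assumes "linear D" shows "D v \<bullet> cross3 (D (axis 1 1)) (D (axis 2 1)) = 0"
  by (subst linear_real2_expand[OF assms, of v]) (simp add: inner_add_left dot_cross_self)

lemma orthogonal_to_both_normals:
  fixes w :: "real^3"
  assumes "w \<bullet> n1 = 0" "w \<bullet> n2 = 0" "cross3 n1 n2 \<noteq> 0"
  shows "\<exists>c. w = c *\<^sub>R cross3 n1 n2"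
proof -
  have "cross3 w (cross3 n1 n2) = 0"
    using assms by (simp add: Lagrange)
  then have "cross3 (cross3 n1 n2) w = 0" using cross_skew[of "cross3 n1 n2" w] by simp
  then have "collinear {0, cross3 n1 n2, w}" by (simp add: cross_eq_0)
  then show ?thesis using assms(3) by (auto simp: collinear_lemma intro: exI[of _ 0])
qed

lemma cross3_normals_nonzero:
  fixes D1 D2 :: "real^2 \<Rightarrow> real^3"
  assumes D: "linear D1" "inj D1" "linear D2" "inj D2" and sp: "span (range D1 \<union> range D2) = UNIV"
  shows "cross3 (cross3 (D1 (axis 1 1)) (D1 (axis 2 1))) (cross3 (D2 (axis 1 1)) (D2 (axis 2 1))) \<noteq> 0"
proof
  let ?n1 = "cross3 (D1 (axis 1 1)) (D1 (axis 2 1))" and ?n2 = "cross3 (D2 (axis 1 1)) (D2 (axis 2 1))"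
  have nz: "?n1 \<noteq> 0" "?n2 \<noteq> 0" using cross3_nonzero_if_inj D by auto
  assume "cross3 ?n1 ?n2 = 0"
  then have "cross3 ?n2 ?n1 = 0" using cross_skew[of ?n2 ?n1] by simp
  then have "collinear {0, ?n2, ?n1}" by (simp add: cross_eq_0)
  then obtain c where c: "?n1 = c *\<^sub>R ?n2" using nz by (auto simp: collinear_lemma)
  have "range D1 \<union> range D2 \<subseteq> {x. ?n1 \<bullet> x = 0}"
    using dot_normal_zero[OF D(1)] dot_normal_zero[OF D(3)] c by (auto simp: inner_commute)
  then have "span (range D1 \<union> range D2) \<subseteq> {x. ?n1 \<bullet> x = 0}"
    by (rule span_minimal) (rule subspace_hyperplane)
  then have "?n1 \<bullet> ?n1 = 0" using sp by blast
  then show False using nz by simp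
qed

text \<open>The inverse function theorem is needed for maps from \<open>R^2 \<times> R\<close> and \<open>R^2 \<times> R^2\<close>, so domain
  and range are different types of equal dimension. Partial derivatives in fixed directions are what
  smoothness provides, so continuity of the derivative is stated for them.\<close>

lemma inverse_function_C1:
  fixes f :: "'a::euclidean_space \<Rightarrow> 'b::euclidean_space" and f' :: "'a \<Rightarrow> 'a \<Rightarrow> 'b"
  assumes dim: "DIM('a) = DIM('b)" and S: "open S" "x0 \<in> S"
    and der: "\<And>x. x \<in> S \<Longrightarrow> (f has_derivative f' x) (at x)"
    and cont: "\<And>v. continuous_on S (\<lambda>x. f' x v)" and inj: "inj (f' x0)"
  obtains U V g where "open U" "U \<subseteq> S" "x0 \<in> U" "open V" "f x0 \<in> V" "homeomorphism U V f g"
    "\<And>y. y \<in> V \<Longrightarrow> \<exists>L. (g has_derivative L) (at y) \<and> (\<forall>v. f' (g y) (L v) = v)"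
proof -
  obtain J :: "'b \<Rightarrow> 'a" and K :: "'a \<Rightarrow> 'b"
    where JK: "linear J" "linear K" "\<And>x. K (J x) = x" "\<And>y. J (K y) = y"
    using isomorphisms_UNIV_UNIV[OF dim[symmetric]] by metis
  have blJ: "bounded_linear J" and blK: "bounded_linear K" using JK linear_conv_bounded_linear by auto
  have contJ: "continuous_on X J" for X
    using blJ linear_continuous_on by auto
  define F where "F x = Blinfun (\<lambda>v. J (f' x v))" for x
  have blf: "bounded_linear (f' x)" if "x \<in> S" for x using der[OF that] has_derivative_bounded_linear by blast
  have F: "blinfun_apply (F x) = (\<lambda>v. J (f' x v))" if "x \<in> S" for x
    unfolding F_def by (rule bounded_linear_Blinfun_apply) (rule bounded_linear_compose[OF blJ blf[OF that]])
  have derJ: "((J \<circ> f) has_derivative blinfun_apply (F x)) (at x)" if "x \<in> S" for x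
    unfolding F[OF that] o_def
    by (rule bounded_linear.has_derivative[OF blJ der[OF that]])
  have contF: "continuous_on S F"
  proof (rule continuous_on_blinfun_componentwise)
    fix i :: 'a
    have "continuous_on S (\<lambda>x. J (f' x i))"
      using continuous_on_compose2[OF contJ[of UNIV] cont[of i]] by simp
    then show "continuous_on S (\<lambda>x. blinfun_apply (F x) i)"
      by (subst continuous_on_cong[OF refl]) (auto simp: F)
  qed
  have lin: "linear (\<lambda>v. J (f' x0 v))"
    using bounded_linear_compose[OF blJ blf[OF S(2)]] bounded_linear.linear by blast
  have "inj (\<lambda>v. J (f' x0 v))"
  proof (rule injI)
    fix a b assume "J (f' x0 a) = J (f' x0 b)"
    then have "K (J (f' x0 a)) = K (J (f' x0 b))" by simp
    then show "a = b" using inj by (simp add: JK(3) inj_eq)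
  qed
  then obtain L where L: "linear L" "\<And>v. L (J (f' x0 v)) = v"
    using linear_injective_left_inverse[OF lin] by (auto simp: fun_eq_iff)
  define Li where "Li = Blinfun L"
  have Li: "blinfun_apply Li = L" unfolding Li_def
    by (rule bounded_linear_Blinfun_apply) (use L(1) linear_conv_bounded_linear in blast)
  have "Li o\<^sub>L F x0 = id_blinfun"
    by (rule blinfun_eqI) (simp add: Li F[OF S(2)] L)
  from inverse_function_theorem[OF S(1) derJ contF S(2) this]
  obtain U V g g' where UV: "open U" "U \<subseteq> S" "x0 \<in> U" "open V" "(J \<circ> f) x0 \<in> V"
    "homeomorphism U V (J \<circ> f) g" "\<And>y. y \<in> V \<Longrightarrow> (g has_derivative g' y) (at y)"
    "\<And>y. y \<in> V \<Longrightarrow> g' y = inv_into UNIV (blinfun_apply (F (g y)))" "\<And>y. y \<in> V \<Longrightarrow> bij (blinfun_apply (F (g y)))"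
    by blast
  show thesis
  proof (rule that[of U "J -` V" "g \<circ> J"])
    show "open (J -` V)" using UV(4) contJ[of UNIV] by (simp add: open_vimage)
    have gf: "g (J (f x)) = x" if "x \<in> U" for x
      using homeomorphism_apply1[OF UV(6) that] by simp
    have fg: "J (f (g y)) = y" "g y \<in> U" if "y \<in> V" for y
      using homeomorphism_apply2[OF UV(6) that] homeomorphism_image2[OF UV(6)] that by auto
    show "homeomorphism U (J -` V) f (g \<circ> J)"
    proof (rule homeomorphismI)
      show "continuous_on U f"
        using der UV(2) has_derivative_continuous continuous_at_imp_continuous_on by (metis subsetD)
      show "continuous_on (J -` V) (g \<circ> J)"
        by (intro continuous_on_compose contJ) (rule continuous_on_subset[OF homeomorphism_cont2[OF UV(6)]], auto)
      show "f ` U \<subseteq> J -` V" using homeomorphism_image1[OF UV(6)] by auto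
      show "(g \<circ> J) ` (J -` V) \<subseteq> U" using fg by auto
      show "(g \<circ> J) (f x) = x" if "x \<in> U" for x using gf[OF that] by simp
      show "f ((g \<circ> J) y) = y" if "y \<in> J -` V" for y
        using fg(1)[of "J y"] that JK(3) by (metis comp_apply vimageD)
    qed
    fix y assume y: "y \<in> J -` V"
    let ?L = "\<lambda>v. g' (J y) (J v)"
    have "(g \<circ> J has_derivative ?L) (at y)"
      unfolding o_def using y
      by (intro has_derivative_compose[OF bounded_linear_imp_has_derivative[OF blJ], of g "g' (J y)"] UV(7)) simp
    moreover have "f' (g (J y)) (g' (J y) (J v)) = v" for v
    proof -
      have gS: "g (J y) \<in> S" using fg y UV(2) by auto
      have "blinfun_apply (F (g (J y))) (g' (J y) (J v)) = J v"
        using UV(8)[of "J y"] UV(9)[of "J y"] y by (simp add: surj_f_inv_f bij_is_surj)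
      then have "J (f' (g (J y)) (g' (J y) (J v))) = J v" by (simp add: F[OF gS])
      then show ?thesis using JK(3) by metis
    qed
    ultimately show "\<exists>L. (g \<circ> J has_derivative L) (at y) \<and> (\<forall>v. f' ((g \<circ> J) y) (L v) = v)" by auto
  qed (use UV in auto)
qed

section \<open>The intersection curve of two transverse sheets\<close>

definition sheet_normal :: "(real^2 \<Rightarrow> real^3) \<Rightarrow> real^3" where
  "sheet_normal D = cross3 (D (axis 1 1)) (D (axis 2 1))"

lemma continuous_on_cross3:
  assumes "continuous_on S f" "continuous_on S g" shows "continuous_on S (\<lambda>x. cross3 (f x) (g x))"
proof -
  have "cross3 = (\<lambda>a b. cross3 a b)" by simp
  have "continuous_on S (\<lambda>x. cross3 (f x) (g x) $ i)" for i
    using exhaust_3[of i] by (elim disjE) (auto simp: cross_components intro!: continuous_intros assms)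
  then show ?thesis by (intro continuous_on_vec_lambda[of S "\<lambda>i x. cross3 (f x) (g x) $ i", simplified])
qed

text \<open>The inverse function theorem is applied to \<open>(x,y) \<mapsto> (G1 x - G2 y, l \<bullet> G1 x)\<close>. Its zero set in
  the first component is the double curve, and the linear form \<open>l\<close> in the direction of the curve
  at the base point is a coordinate on it. In this coordinate the velocity is the multiple of
  the crossing vector \<open>N\<close> whose product with \<open>l\<close> is 1.\<close>

lemma transversal_intersection_curve:
  fixes G1 G2 :: "real^2 \<Rightarrow> real^3" and D1 D2 :: "real^2 \<Rightarrow> real^2 \<Rightarrow> real^3"
  assumes S: "open S1" "open S2" "a \<in> S1" "b \<in> S2"
    and der: "\<And>x. x \<in> S1 \<Longrightarrow> (G1 has_derivative D1 x) (at x)" "\<And>x. x \<in> S2 \<Longrightarrow> (G2 has_derivative D2 x) (at x)"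
    and cont: "\<And>v. continuous_on S1 (\<lambda>x. D1 x v)" "\<And>v. continuous_on S2 (\<lambda>x. D2 x v)"
    and inj: "inj (D1 a)" "inj (D2 b)" and eq: "G1 a = G2 b"
    and N: "N = (\<lambda>z. cross3 (sheet_normal (D1 (fst z))) (sheet_normal (D2 (snd z))))" and nz: "N (a,b) \<noteq> 0"
    and l: "l = N (a,b)"
  obtains e k W where "0 < (e::real)" "k 0 = (a,b)" "open W" "(a,b) \<in> W" "W \<subseteq> S1 \<times> S2"
    "\<And>t. \<bar>t\<bar> < e \<Longrightarrow> fst (k t) \<in> S1 \<and> snd (k t) \<in> S2 \<and> G1 (fst (k t)) = G2 (snd (k t)) \<and> isCont k t
       \<and> 0 < l \<bullet> N (k t) \<and> ((\<lambda>t. G1 (fst (k t))) has_vector_derivative (1 / (l \<bullet> N (k t))) *\<^sub>R N (k t)) (at t)"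
    "\<And>x y. \<lbrakk>(x,y) \<in> W; G1 x = G2 y\<rbrakk> \<Longrightarrow> \<bar>l \<bullet> (G1 x - G1 a)\<bar> < e \<and> (x,y) = k (l \<bullet> (G1 x - G1 a))"
proof -
  let ?S = "S1 \<times> S2"
  define P where "P z = (G1 (fst z) - G2 (snd z), l \<bullet> G1 (fst z))" for z
  define P' where "P' z v = (D1 (fst z) (fst v) - D2 (snd z) (snd v), l \<bullet> D1 (fst z) (fst v))" for z v :: "(real^2) \<times> (real^2)"
  have lin1: "linear (D1 x)" if "x \<in> S1" for x using der(1)[OF that] has_derivative_linear by blast
  have lin2: "linear (D2 x)" if "x \<in> S2" for x using der(2)[OF that] has_derivative_linear by blast
  have So: "open ?S" using S open_Times by blast
  have inS: "(a,b) \<in> ?S" using S by simp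
  have dP: "(P has_derivative P' z) (at z)" if "z \<in> ?S" for z
  proof -
    have 1: "((\<lambda>z. G1 (fst z)) has_derivative (\<lambda>v. D1 (fst z) (fst v))) (at z)"
      using that by (intro has_derivative_compose[of fst, OF _ der(1)] derivative_eq_intros) auto
    have 2: "((\<lambda>z. G2 (snd z)) has_derivative (\<lambda>v. D2 (snd z) (snd v))) (at z)"
      using that by (intro has_derivative_compose[of snd, OF _ der(2)] derivative_eq_intros) auto
    show ?thesis unfolding P_def P'_def
      by (intro has_derivative_Pair has_derivative_diff 1 2 has_derivative_inner_right)
  qed
  have c1: "continuous_on ?S (\<lambda>z. D1 (fst z) v)" for v
    by (rule continuous_on_compose2[OF cont(1)]) (auto intro: continuous_intros)
  have c2: "continuous_on ?S (\<lambda>z. D2 (snd z) v)" for v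
    by (rule continuous_on_compose2[OF cont(2)]) (auto intro: continuous_intros)
  have cP': "continuous_on ?S (\<lambda>z. P' z v)" for v
    unfolding P'_def by (intro continuous_intros c1 c2)
  have cN: "continuous_on ?S N" unfolding N sheet_normal_def
    by (intro continuous_on_cross3 c1 c2)
  have tang: "\<exists>c. w = c *\<^sub>R N (x,y)" if "w = D1 x h" "w = D2 y q" "x \<in> S1" "y \<in> S2" "N (x,y) \<noteq> 0" for w h q x y
    using that orthogonal_to_both_normals[of w "sheet_normal (D1 x)" "sheet_normal (D2 y)"]
      dot_normal_zero[OF lin1, of x h] dot_normal_zero[OF lin2, of y q] by (auto simp: N sheet_normal_def)
  have injP: "inj (P' (a,b))"
  proof -
    have lin: "linear (P' (a,b))" using dP[OF inS] has_derivative_linear by blast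
    have "v = 0" if "P' (a,b) v = 0" for v
    proof -
      have w: "D1 a (fst v) = D2 b (snd v)" "l \<bullet> D1 a (fst v) = 0"
        using that by (auto simp: P'_def zero_prod_def)
      obtain c where c: "D1 a (fst v) = c *\<^sub>R N (a,b)" using tang[OF refl w(1) S(3,4) nz] by blast
      have "c = 0" using w(2) nz unfolding c l by simp
      then have "D1 a (fst v) = 0" "D2 b (snd v) = 0" using c w by auto
      then have "fst v = 0" "snd v = 0"
        using inj lin1[OF S(3)] lin2[OF S(4)] linear_injective_0 by blast+
      then show ?thesis by (simp add: prod_eq_iff)
    qed
    then show ?thesis using linear_injective_0[OF lin] by blast
  qed
  obtain U V g where UV: "open U" "U \<subseteq> ?S" "(a,b) \<in> U" "open V" "P (a,b) \<in> V" "homeomorphism U V P g"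
    and dg: "\<And>y. y \<in> V \<Longrightarrow> \<exists>L. (g has_derivative L) (at y) \<and> (\<forall>v. P' (g y) (L v) = v)"
    by (rule inverse_function_C1[of ?S "(a,b)" P P', OF _ So inS dP cP' injP]) auto
  define c0 where "c0 = l \<bullet> G1 a"
  have P0: "P (a,b) = (0, c0)" by (simp add: P_def eq c0_def)
  define k where "k t = g (0, c0 + t)" for t
  have Pk: "P (k t) = (0, c0 + t)" "k t \<in> U" if "(0, c0 + t) \<in> V" for t
    using homeomorphism_apply2[OF UV(6) that] homeomorphism_image2[OF UV(6)] that by (auto simp: k_def)
  have k0: "k 0 = (a,b)" using homeomorphism_apply1[OF UV(6,3)] P0 by (simp add: k_def)
  have contg: "continuous_on V g" using homeomorphism_cont2[OF UV(6)] .
  let ?I = "{t. (0, c0 + t) \<in> V}"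
  have openI: "open ?I"
  proof -
    have "?I = (\<lambda>t. (0, c0 + t)) -` V" by auto
    moreover have "open \<dots>" by (rule open_vimage[OF UV(4)]) (intro continuous_intros)
    ultimately show ?thesis by simp
  qed
  have contk: "continuous_on ?I k" unfolding k_def
    by (rule continuous_on_compose2[OF contg]) (auto intro!: continuous_intros)
  have "continuous_on ?I (\<lambda>t. l \<bullet> N (k t))"
    by (intro continuous_intros continuous_on_compose2[OF cN contk]) (use Pk(2) UV(2) in blast)
  from continuous_on_open_vimage[OF openI, THEN iffD1, OF this, rule_format, of "{0<..}"]
  have "open ((\<lambda>t. l \<bullet> N (k t)) -` {0<..} \<inter> ?I)" by simp
  moreover have "0 \<in> (\<lambda>t. l \<bullet> N (k t)) -` {0<..} \<inter> ?I"
    using UV(5) P0 nz by (simp add: k0 l)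
  ultimately obtain e where e: "0 < e" "ball 0 e \<subseteq> (\<lambda>t. l \<bullet> N (k t)) -` {0<..} \<inter> ?I"
    using open_contains_ball by meson
  have eI: "(0, c0 + t) \<in> V" "0 < l \<bullet> N (k t)" if "\<bar>t\<bar> < e" for t
    using e(2) that by (auto simp: subset_iff)
  define W where "W = U \<inter> (\<lambda>z. l \<bullet> G1 (fst z) - c0) -` {-e<..<e}"
  show thesis
  proof (rule that[of e k W])
    show "open W"
    proof -
      have "continuous_on U P" using homeomorphism_cont1[OF UV(6)] .
      then have "continuous_on U (\<lambda>z. snd (P z) - c0)" by (intro continuous_intros)
      then have "continuous_on U (\<lambda>z. l \<bullet> G1 (fst z) - c0)" by (simp add: P_def)
      from continuous_on_open_vimage[OF UV(1), THEN iffD1, OF this, rule_format, of "{-e<..<e}"]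
      show ?thesis by (simp add: W_def Int_commute)
    qed
    show "(a,b) \<in> W" using UV e by (simp add: W_def c0_def)
    show "W \<subseteq> S1 \<times> S2" using UV by (auto simp: W_def)
    show "\<bar>l \<bullet> (G1 x - G1 a)\<bar> < e \<and> (x,y) = k (l \<bullet> (G1 x - G1 a))" if "(x,y) \<in> W" "G1 x = G2 y" for x y
    proof -
      have "P (x,y) = (0, c0 + l \<bullet> (G1 x - G1 a))" using that by (simp add: P_def c0_def inner_diff_right)
      then have "(x,y) = k (l \<bullet> (G1 x - G1 a))"
        using homeomorphism_apply1[OF UV(6), of "(x,y)"] that by (simp add: k_def W_def)
      moreover have "\<bar>l \<bullet> (G1 x - G1 a)\<bar> < e"
        using that(1) by (auto simp: W_def c0_def inner_diff_right abs_less_iff)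
      ultimately show ?thesis by blast
    qed
    fix t :: real assume t: "\<bar>t\<bar> < e"
    note V = eI[OF t]
    have kS: "fst (k t) \<in> S1" "snd (k t) \<in> S2" "k t \<in> ?S" using Pk(2)[OF V(1)] UV(2) by auto
    have kG: "G1 (fst (k t)) = G2 (snd (k t))" using Pk(1)[OF V(1)] by (simp add: P_def)
    have kc: "isCont k t" using contk openI V(1) by (simp add: continuous_on_eq_continuous_at)
    obtain L where L: "(g has_derivative L) (at (0, c0 + t))" "\<And>v. P' (k t) (L v) = v"
      using dg[OF V(1)] by (auto simp: k_def)
    define h where "h = L (0,1)"
    have "P' (k t) h = (0,1)" by (simp add: h_def L)
    then have w: "D1 (fst (k t)) (fst h) = D2 (snd (k t)) (snd h)" "l \<bullet> D1 (fst (k t)) (fst h) = 1"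
      by (auto simp: P'_def)
    obtain c where c: "D1 (fst (k t)) (fst h) = c *\<^sub>R N (k t)"
      using tang[OF refl w(1) kS(1,2)] V(2) by fastforce
    have "c = 1 / (l \<bullet> N (k t))" using w(2) V(2) by (simp add: c field_simps)
    then have c': "D1 (fst (k t)) (fst h) = (1 / (l \<bullet> N (k t))) *\<^sub>R N (k t)" using c by simp
    have lin: "linear L" using L(1) has_derivative_linear by blast
    have "(k has_derivative (\<lambda>s. L (0, s))) (at t)"
      unfolding k_def
      by (rule has_derivative_compose[where f="\<lambda>t. (0, c0 + t)" and f'="\<lambda>s. (0, s)" and g=g and g'=L, OF _ L(1)])
        (auto intro!: derivative_eq_intros)
    moreover have "L (0, s) = s *\<^sub>R h" for s
      using linear_cmul[OF lin, of s "(0,1)"] by (simp add: h_def)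
    ultimately have "(k has_derivative (\<lambda>s. s *\<^sub>R h)) (at t)" by simp
    then have "((\<lambda>t. fst (k t)) has_derivative (\<lambda>s. s *\<^sub>R fst h)) (at t)"
      by (auto intro!: derivative_eq_intros)
    from has_derivative_compose[OF this der(1)[OF kS(1)]]
    have "((\<lambda>t. G1 (fst (k t))) has_derivative (\<lambda>s. D1 (fst (k t)) (s *\<^sub>R fst h))) (at t)" .
    then have "((\<lambda>t. G1 (fst (k t))) has_vector_derivative (1 / (l \<bullet> N (k t))) *\<^sub>R N (k t)) (at t)"
      unfolding has_vector_derivative_def linear_cmul[OF lin1[OF kS(1)]] c' .
    then show "fst (k t) \<in> S1 \<and> snd (k t) \<in> S2 \<and> G1 (fst (k t)) = G2 (snd (k t)) \<and> isCont k t
       \<and> 0 < l \<bullet> N (k t) \<and> ((\<lambda>t. G1 (fst (k t))) has_vector_derivative (1 / (l \<bullet> N (k t))) *\<^sub>R N (k t)) (at t)"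
      using kS kG kc V by simp
  qed (use e k0 in auto)
qed

text \<open>The parameter \<open>u\<close> is the inverse of an antiderivative of \<open>v\<close>.\<close>

lemma reparametrize_by_speed:
  fixes v :: "real \<Rightarrow> real"
  assumes e: "0 < e" and v: "continuous_on {-e<..<e} v" "\<And>t. \<bar>t\<bar> < e \<Longrightarrow> 0 < v t"
  obtains d u where "0 < (d::real)" "u 0 = 0" "\<And>s. \<bar>s\<bar> < d \<Longrightarrow> \<bar>u s\<bar> < e"
    "\<And>s. \<bar>s\<bar> < d \<Longrightarrow> (u has_real_derivative 1 / v (u s)) (at s)"
    "open (u ` {-d<..<d})"
proof -
  let ?h = "e/2"
  have h: "0 < ?h" "?h < e" using e by auto
  have cv: "continuous_on {-?h..?h} v" by (rule continuous_on_subset[OF v(1)]) (use h in auto)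
  define L where "L t = integral {-?h..t} v - integral {-?h..0} v" for t
  let ?S = "{-?h<..<?h}"
  have dL: "(L has_derivative (\<lambda>x. v t * x)) (at t)" if "t \<in> ?S" for t
  proof -
    have "((\<lambda>u. integral {-?h..u} v) has_real_derivative v t) (at t within {-?h..?h})"
      using that cv by (intro integral_has_real_derivative) auto
    then have "((\<lambda>u. integral {-?h..u} v) has_real_derivative v t) (at t)"
      using that by (simp add: at_within_Icc_at)
    then have "(L has_real_derivative v t) (at t)" unfolding L_def by (auto intro!: derivative_eq_intros)
    then show ?thesis by (simp add: has_field_derivative_def)
  qed
  have ih: "inj (\<lambda>x. v 0 * x)" using v(2)[of 0] e by (auto intro: injI)
  have cv': "continuous_on ?S (\<lambda>t. v t * x)" for x
    by (intro continuous_intros continuous_on_subset[OF cv]) auto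
  have S: "open ?S" "0 \<in> ?S" using h by auto
  obtain U V g where UV: "open U" "U \<subseteq> ?S" "0 \<in> U" "open V" "L 0 \<in> V" "homeomorphism U V L g"
    and dg: "\<And>y. y \<in> V \<Longrightarrow> \<exists>K. (g has_derivative K) (at y) \<and> (\<forall>x. v (g y) * K x = x)"
    by (rule inverse_function_C1[of ?S 0 L "\<lambda>t x. v t * x", OF refl S dL cv' ih]) auto
  have L0: "L 0 = 0" by (simp add: L_def)
  obtain d where d: "0 < d" "ball 0 d \<subseteq> V" using UV(4,5) L0 open_contains_ball by metis
  have dV: "s \<in> V" if "\<bar>s\<bar> < d" for s using d(2) that by (auto simp: subset_iff)
  show thesis
  proof (rule that[of d g])
    show "g 0 = 0" using homeomorphism_apply1[OF UV(6,3)] L0 by simp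
    show "\<bar>g s\<bar> < e" if "\<bar>s\<bar> < d" for s
      using homeomorphism_image2[OF UV(6)] dV[OF that] UV(2) h by fastforce
    show "(g has_real_derivative 1 / v (g s)) (at s)" if s: "\<bar>s\<bar> < d" for s
    proof -
      obtain K where K: "(g has_derivative K) (at s)" "\<And>x. v (g s) * K x = x" using dg[OF dV[OF s]] by blast
      have "K = (\<lambda>x. (1 / v (g s)) * x)"
      proof
        fix x
        have "v (g s) \<noteq> 0" using K(2)[of 1] by auto
        then show "K x = (1 / v (g s)) * x" using K(2)[of x] by (simp add: field_simps)
      qed
      then show ?thesis using K(1) unfolding has_field_derivative_def by metis
    qed
    have "g ` {-d<..<d} = U \<inter> L -` {-d<..<d}"
    proof
      show "g ` {-d<..<d} \<subseteq> U \<inter> L -` {-d<..<d}"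
      proof
        fix x assume "x \<in> g ` {-d<..<d}"
        then obtain s where s: "x = g s" "\<bar>s\<bar> < d" by (auto simp: abs_less_iff)
        have "L x = s" "x \<in> U"
          using homeomorphism_image2[OF UV(6)] homeomorphism_apply2[OF UV(6) dV[OF s(2)]] dV[OF s(2)] s(1) by auto
        then show "x \<in> U \<inter> L -` {-d<..<d}" using s(2) by (auto simp: abs_less_iff)
      qed
      show "U \<inter> L -` {-d<..<d} \<subseteq> g ` {-d<..<d}"
      proof
        fix x assume x: "x \<in> U \<inter> L -` {-d<..<d}"
        then have "x = g (L x)" using homeomorphism_apply1[OF UV(6)] by simp
        then show "x \<in> g ` {-d<..<d}" using x by blast
      qed
    qed
    moreover have "open (L -` {-d<..<d} \<inter> U)"
      using continuous_on_open_vimage[OF UV(1), THEN iffD1, OF homeomorphism_cont1[OF UV(6)], rule_format, of "{-d<..<d}"] by simp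
    ultimately show "open (g ` {-d<..<d})" by (simp add: Int_commute)
  qed (use d in auto)
qed

lemma unit_speed_intersection_curve:
  fixes G1 G2 :: "real^2 \<Rightarrow> real^3" and D1 D2 :: "real^2 \<Rightarrow> real^2 \<Rightarrow> real^3"
  assumes S: "open S1" "open S2" "a \<in> S1" "b \<in> S2"
    and der: "\<And>x. x \<in> S1 \<Longrightarrow> (G1 has_derivative D1 x) (at x)" "\<And>x. x \<in> S2 \<Longrightarrow> (G2 has_derivative D2 x) (at x)"
    and cont: "\<And>v. continuous_on S1 (\<lambda>x. D1 x v)" "\<And>v. continuous_on S2 (\<lambda>x. D2 x v)"
    and inj: "inj (D1 a)" "inj (D2 b)" and eq: "G1 a = G2 b"
    and N: "N = (\<lambda>z. cross3 (sheet_normal (D1 (fst z))) (sheet_normal (D2 (snd z))))" and nz: "N (a,b) \<noteq> 0"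
  obtains d k W where "0 < (d::real)" "k 0 = (a,b)" "open W" "(a,b) \<in> W" "W \<subseteq> S1 \<times> S2"
    "\<And>t. \<bar>t\<bar> < d \<Longrightarrow> fst (k t) \<in> S1 \<and> snd (k t) \<in> S2 \<and> G1 (fst (k t)) = G2 (snd (k t)) \<and> isCont k t
       \<and> 0 < N (a,b) \<bullet> N (k t) \<and> ((\<lambda>t. G1 (fst (k t))) has_vector_derivative N (k t) /\<^sub>R norm (N (k t))) (at t)"
    "\<And>x y. \<lbrakk>(x,y) \<in> W; G1 x = G2 y\<rbrakk> \<Longrightarrow> \<exists>t. \<bar>t\<bar> < d \<and> (x,y) = k t"
proof -
  let ?l = "N (a,b)"
  obtain e k W where e: "0 < (e::real)" "k 0 = (a,b)" "open W" "(a,b) \<in> W" "W \<subseteq> S1 \<times> S2"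
    and k: "\<And>t. \<bar>t\<bar> < e \<Longrightarrow> fst (k t) \<in> S1 \<and> snd (k t) \<in> S2 \<and> G1 (fst (k t)) = G2 (snd (k t)) \<and> isCont k t
       \<and> 0 < ?l \<bullet> N (k t) \<and> ((\<lambda>t. G1 (fst (k t))) has_vector_derivative (1 / (?l \<bullet> N (k t))) *\<^sub>R N (k t)) (at t)"
    and W: "\<And>x y. \<lbrakk>(x,y) \<in> W; G1 x = G2 y\<rbrakk> \<Longrightarrow> \<bar>?l \<bullet> (G1 x - G1 a)\<bar> < e \<and> (x,y) = k (?l \<bullet> (G1 x - G1 a))"
    by (rule transversal_intersection_curve[OF S der cont inj eq N nz refl]) blast+
  let ?v = "\<lambda>t. norm (N (k t)) / (?l \<bullet> N (k t))"
  have cN: "continuous_on (S1 \<times> S2) N"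
  proof -
    have c1: "continuous_on (S1 \<times> S2) (\<lambda>z. D1 (fst z) v)" for v
      by (rule continuous_on_compose2[OF cont(1)]) (auto intro: continuous_intros)
    have c2: "continuous_on (S1 \<times> S2) (\<lambda>z. D2 (snd z) v)" for v
      by (rule continuous_on_compose2[OF cont(2)]) (auto intro: continuous_intros)
    show ?thesis unfolding N sheet_normal_def by (intro continuous_on_cross3 c1 c2)
  qed
  have ck: "continuous_on {-e<..<e} k"
    using k by (intro continuous_at_imp_continuous_on) auto
  have cNk: "continuous_on {-e<..<e} (\<lambda>t. N (k t))"
  proof (rule continuous_on_compose2[OF cN ck])
    show "k ` {-e<..<e} \<subseteq> S1 \<times> S2"
    proof clarify
      fix x y t assume "(x, y) = k t" "t \<in> {-e<..<e}"
      then show "x \<in> S1 \<and> y \<in> S2" using k[of t] by (metis abs_less_iff fst_conv greaterThanLessThan_iff minus_less_iff snd_conv)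
    qed
  qed
  have pos: "0 < ?l \<bullet> N (k t)" "N (k t) \<noteq> 0" if "\<bar>t\<bar> < e" for t using k[OF that] by auto
  have cv: "continuous_on {-e<..<e} ?v"
  proof (intro continuous_intros cNk ballI)
    fix t assume "t \<in> {-e<..<e}" then have "\<bar>t\<bar> < e" by auto
    then show "?l \<bullet> N (k t) \<noteq> 0" using pos(1)[of t] by simp
  qed
  have pv: "0 < ?v t" if "\<bar>t\<bar> < e" for t using pos[OF that] by simp
  obtain d u where d: "0 < (d::real)" "u 0 = 0" "\<And>s. \<bar>s\<bar> < d \<Longrightarrow> \<bar>u s\<bar> < e"
    "\<And>s. \<bar>s\<bar> < d \<Longrightarrow> (u has_real_derivative 1 / ?v (u s)) (at s)" "open (u ` {-d<..<d})"
    by (rule reparametrize_by_speed[OF e(1) cv pv]) blast+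
  define W' where "W' = W \<inter> (\<lambda>z. ?l \<bullet> (G1 (fst z) - G1 a)) -` (u ` {-d<..<d})"
  show thesis
  proof (rule that[of d "\<lambda>s. k (u s)" W'])
    have "continuous_on S1 G1" using der(1) has_derivative_continuous by (intro continuous_at_imp_continuous_on) blast
    then have "continuous_on W (\<lambda>z. G1 (fst z))"
      by (rule continuous_on_compose2) (use e(5) in \<open>auto intro: continuous_intros\<close>)
    then have "continuous_on W (\<lambda>z. ?l \<bullet> (G1 (fst z) - G1 a))" by (intro continuous_intros)
    from continuous_on_open_vimage[OF e(3), THEN iffD1, OF this, rule_format, OF d(5)]
    show "open W'" by (simp add: W'_def Int_commute)
    show "(a,b) \<in> W'" using e(4) d(1,2) by (force simp: W'_def)
    show "W' \<subseteq> S1 \<times> S2" using e(5) by (auto simp: W'_def)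
    show "\<exists>t. \<bar>t\<bar> < d \<and> (x,y) = k (u t)" if xy: "(x,y) \<in> W'" "G1 x = G2 y" for x y
    proof -
      obtain t where t: "t \<in> {-d<..<d}" "?l \<bullet> (G1 x - G1 a) = u t" using xy(1) by (auto simp: W'_def)
      have "(x,y) = k (u t)" using W[of x y] xy t(2) by (simp add: W'_def)
      then show ?thesis using t(1) by (intro exI[of _ t]) auto
    qed
    fix s :: real assume s: "\<bar>s\<bar> < d"
    note us = d(3)[OF s]
    have c: "isCont (\<lambda>s. k (u s)) s"
      using isCont_o2[of s u k] DERIV_isCont[OF d(4)[OF s]] k[OF us] by blast
    have ud: "(u has_vector_derivative 1 / ?v (u s)) (at s)"
      using d(4)[OF s] by (simp only: has_real_derivative_iff_has_vector_derivative)
    have kd: "((\<lambda>t. G1 (fst (k t))) has_vector_derivative (1 / (?l \<bullet> N (k (u s)))) *\<^sub>R N (k (u s))) (at (u s))"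
      using k[OF us] by blast
    have "((\<lambda>s. G1 (fst (k (u s)))) has_vector_derivative (1 / ?v (u s)) *\<^sub>R ((1 / (?l \<bullet> N (k (u s)))) *\<^sub>R N (k (u s)))) (at s)"
      using vector_diff_chain_at[OF ud kd] unfolding o_def .
    moreover have "(1 / ?v (u s)) *\<^sub>R ((1 / (?l \<bullet> N (k (u s)))) *\<^sub>R N (k (u s))) = N (k (u s)) /\<^sub>R norm (N (k (u s)))"
      using pos[OF us] by (simp add: inverse_eq_divide)
    ultimately have "((\<lambda>s. G1 (fst (k (u s)))) has_vector_derivative N (k (u s)) /\<^sub>R norm (N (k (u s)))) (at s)"
      by (simp only:)
    then show "fst (k (u s)) \<in> S1 \<and> snd (k (u s)) \<in> S2 \<and> G1 (fst (k (u s))) = G2 (snd (k (u s))) \<and> isCont (\<lambda>s. k (u s)) s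
       \<and> 0 < ?l \<bullet> N (k (u s)) \<and> ((\<lambda>t. G1 (fst (k (u t)))) has_vector_derivative N (k (u s)) /\<^sub>R norm (N (k (u s)))) (at s)"
      using k[OF us] c by blast
  qed (use d e in auto)
qed

section \<open>Charts and sheets of a surface in 4-space\<close>

lemma smooth_on_has_derivative:
  assumes "smooth_on S h" "x \<in> S" shows "(h has_derivative frechet_derivative h (at x)) (at x)"
proof -
  have "Ck_on (Suc 0) S h" using assms by (simp only: smooth_on_def)
  then show ?thesis using assms(2) by (simp add: frechet_derivative_works)
qed

lemma smooth_on_continuous_derivative:
  assumes "smooth_on S h" shows "continuous_on S (\<lambda>x. frechet_derivative h (at x) v)"
proof -
  have "Ck_on (Suc 0) S h" using assms by (simp only: smooth_on_def)
  then show ?thesis by simp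
qed

lemma smooth_on_continuous: assumes "smooth_on S h" shows "continuous_on S h"
proof -
  have "Ck_on 0 S h" using assms by (simp only: smooth_on_def)
  then show ?thesis by simp
qed

lemma bounded_linear_proj: "bounded_linear proj"
proof -
  have "linear proj"
    by (rule linearI) (simp_all add: proj_def vec_eq_iff forall_3)
  then show ?thesis by (simp add: linear_conv_bounded_linear)
qed

lemma sheet_normal_compose:
  fixes D :: "real^2 \<Rightarrow> real^3" and L :: "real^2 \<Rightarrow> real^2"
  assumes "linear D" "linear L"
  shows "sheet_normal (D \<circ> L) = det (matrix L) *\<^sub>R sheet_normal D"
proof -
  let ?a = "axis 1 1 :: real^2" and ?b = "axis 2 1 :: real^2"
  have "D (L ?a) = L ?a$1 *\<^sub>R D ?a + L ?a$2 *\<^sub>R D ?b" "D (L ?b) = L ?b$1 *\<^sub>R D ?a + L ?b$2 *\<^sub>R D ?b"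
    using linear_real2_expand[OF assms(1)] by blast+
  moreover have "det (matrix L) = L ?a$1 * L ?b$2 - L ?b$1 * L ?a$2"
    by (simp add: det_2 matrix_def)
  moreover have "cross3 (D ?b) (D ?a) = - cross3 (D ?a) (D ?b)" by (rule cross_skew)
  ultimately show ?thesis
    by (simp add: sheet_normal_def cross_add_left cross_add_right cross_mult_left cross_mult_right scaleR_diff_left
        mult.commute)
qed

locale oriented_surface =
  fixes M :: "'a topology" and \<A> :: "'a atlas"
  assumes surface: "oriented_closed_surface M \<A>"
begin

lemma compact_space: "compact_space M" and Hausdorff: "Hausdorff_space M"
  using surface by (simp_all add: oriented_closed_surface_def)

lemma chart_at: assumes "p \<in> topspace M" obtains U \<phi> where "(U,\<phi>) \<in> \<A>" "p \<in> U"
proof -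
  have "p \<in> (\<Union>(U,\<phi>)\<in>\<A>. U)" using surface assms by (simp add: oriented_closed_surface_def)
  then show thesis using that by auto
qed

lemma chart:
  assumes c: "(U,\<phi>) \<in> \<A>"
  shows "openin M U" "U \<subseteq> topspace M" "open (\<phi> ` U)" "inj_on \<phi> U"
    "homeomorphic_map (subtopology M U) (top_of_set (\<phi> ` U)) \<phi>"
    "continuous_map (top_of_set (\<phi> ` U)) M (inv_into U \<phi>)"
    "continuous_map (subtopology M U) euclidean \<phi>"
proof -
  have *: "\<forall>(U,\<phi>)\<in>\<A>. openin M U \<and> open (\<phi> ` U) \<and> homeomorphic_map (subtopology M U) (top_of_set (\<phi> ` U)) \<phi>"
    using surface unfolding oriented_closed_surface_def by blast
  then show 1: "openin M U" "open (\<phi> ` U)" "homeomorphic_map (subtopology M U) (top_of_set (\<phi> ` U)) \<phi>"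
    using c by auto
  then show s: "U \<subseteq> topspace M" using openin_subset by blast
  then have t: "topspace (subtopology M U) = U" by auto
  show i: "inj_on \<phi> U" using homeomorphic_imp_injective_map[OF 1(3)] t by simp
  obtain g where g: "homeomorphic_maps (subtopology M U) (top_of_set (\<phi> ` U)) \<phi> g"
    using 1(3) homeomorphic_map_maps by blast
  have "continuous_map (top_of_set (\<phi> ` U)) (subtopology M U) g"
    using g by (simp add: homeomorphic_maps_def)
  then have "continuous_map (top_of_set (\<phi> ` U)) (subtopology M U) (inv_into U \<phi>)"
    by (rule continuous_map_eq) (use g t i in \<open>auto simp: homeomorphic_maps_def inv_into_f_f\<close>)
  then show "continuous_map (top_of_set (\<phi> ` U)) M (inv_into U \<phi>)"
    by (simp add: continuous_map_in_subtopology)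
  show "continuous_map (subtopology M U) euclidean \<phi>"
    using homeomorphic_imp_continuous_map[OF 1(3)] by (simp add: continuous_map_in_subtopology)
qed

lemma open_chart_image:
  assumes c: "(U,\<phi>) \<in> \<A>" and O: "openin M O'" shows "open (\<phi> ` (U \<inter> O'))"
proof -
  have "openin (subtopology M U) (U \<inter> O')" using O by (simp add: openin_subtopology_Int2)
  then have "openin (top_of_set (\<phi> ` U)) (\<phi> ` (U \<inter> O'))"
    using homeomorphic_imp_open_map[OF chart(5)[OF c]] by (simp add: open_map_def)
  then show ?thesis using chart(3)[OF c] openin_open_eq by blast
qed

lemma openin_chart_preimage:
  assumes c: "(U,\<phi>) \<in> \<A>" and O: "open O'" shows "openin M {p\<in>U. \<phi> p \<in> O'}"
proof -
  have "openin (subtopology M U) {p \<in> topspace (subtopology M U). \<phi> p \<in> O'}"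
    using openin_continuous_map_preimage[OF chart(7)[OF c], of O'] O by simp
  moreover have "topspace (subtopology M U) = U" using chart(2)[OF c] by auto
  ultimately show ?thesis using openin_trans_full[OF _ chart(1)[OF c]] by metis
qed

lemma transition:
  assumes c: "(U,\<phi>) \<in> \<A>" "(V,\<psi>) \<in> \<A>" and p: "p \<in> U" "p \<in> V"
  defines "L \<equiv> frechet_derivative (\<psi> \<circ> inv_into U \<phi>) (at (\<phi> p))"
  shows "((\<psi> \<circ> inv_into U \<phi>) has_derivative L) (at (\<phi> p))" "0 < det (matrix L)" "linear L"
    "smooth_on (\<phi> ` (U \<inter> V)) (\<psi> \<circ> inv_into U \<phi>)"
proof -
  have *: "\<forall>(U,\<phi>)\<in>\<A>. \<forall>(V,\<psi>)\<in>\<A>. smooth_on (\<phi> ` (U \<inter> V)) (\<psi> \<circ> inv_into U \<phi>) \<and>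
        (\<forall>x \<in> \<phi> ` (U \<inter> V). 0 < det (matrix (frechet_derivative (\<psi> \<circ> inv_into U \<phi>) (at x))))"
    using surface unfolding oriented_closed_surface_def by blast
  have x: "\<phi> p \<in> \<phi> ` (U \<inter> V)" using p by auto
  show s: "smooth_on (\<phi> ` (U \<inter> V)) (\<psi> \<circ> inv_into U \<phi>)" using * c by blast
  show d: "((\<psi> \<circ> inv_into U \<phi>) has_derivative L) (at (\<phi> p))"
    unfolding L_def by (rule smooth_on_has_derivative[OF s x])
  show "0 < det (matrix L)" unfolding L_def using * c x by blast
  show "linear L" using d has_derivative_linear by blast
qed

lemma locally_connected: "locally_connected_space M"
  unfolding locally_connected_space
proof (intro allI impI)
  fix W p assume W: "openin M W \<and> p \<in> W"
  then have pM: "p \<in> topspace M" using openin_subset by blast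
  obtain U \<phi> where c: "(U,\<phi>) \<in> \<A>" "p \<in> U" using chart_at[OF pM] .
  have "open (\<phi> ` (U \<inter> W))" using open_chart_image[OF c(1)] W by blast
  moreover have "\<phi> p \<in> \<phi> ` (U \<inter> W)" using c W by auto
  ultimately obtain e where e: "e > 0" "ball (\<phi> p) e \<subseteq> \<phi> ` (U \<inter> W)" using open_contains_ball by meson
  let ?V = "{q\<in>U. \<phi> q \<in> ball (\<phi> p) e}"
  have eq: "?V = inv_into U \<phi> ` ball (\<phi> p) e"
  proof
    show "?V \<subseteq> inv_into U \<phi> ` ball (\<phi> p) e"
      using chart(4)[OF c(1)] by (force simp: image_iff inv_into_f_f)
    show "inv_into U \<phi> ` ball (\<phi> p) e \<subseteq> ?V"
      using e(2) by (auto simp: inv_into_into f_inv_into_f subset_iff)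
  qed
  have "connectedin M ?V" unfolding eq
  proof (rule connectedin_continuous_map_image[OF chart(6)[OF c(1)]])
    show "connectedin (top_of_set (\<phi> ` U)) (ball (\<phi> p) e)"
      using e(2) by (auto simp: connectedin_subtopology connectedin_iff_connected)
  qed
  moreover have "?V \<subseteq> W" using e(2) chart(4)[OF c(1)] by (auto simp: subset_iff inj_on_def image_iff) 
  ultimately show "\<exists>U. openin M U \<and> connectedin M U \<and> p \<in> U \<and> U \<subseteq> W"
    using openin_chart_preimage[OF c(1), of "ball (\<phi> p) e"] c(2) e(1)
    by (intro exI[of _ ?V]) auto
qed

lemma openin_component: "openin M (connected_component_of_set M p)"
  by (rule openin_connected_component_of_locally_connected_space[OF locally_connected])

lemma closedin_component: "closedin M (connected_component_of_set M p)"
  by (rule closedin_connected_component_of)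

lemma finite_components: "finite (connected_components_of M)"
proof -
  have "openin M C" if "C \<in> connected_components_of M" for C
    using openin_connected_components_of_locally_connected_space[OF locally_connected that] .
  moreover have "topspace M \<subseteq> \<Union>(connected_components_of M)" by (simp add: Union_connected_components_of)
  ultimately obtain F where F: "finite F" "F \<subseteq> connected_components_of M" "topspace M \<subseteq> \<Union>F"
    using compact_space unfolding compact_space_alt by meson
  have "connected_components_of M \<subseteq> F"
  proof
    fix C assume C: "C \<in> connected_components_of M"
    obtain x where x: "x \<in> C" using nonempty_connected_components_of[OF C] by blast
    then obtain D where D: "D \<in> F" "x \<in> D" using F(3) connected_components_of_subset[OF C] by blast
    then have "C = D" using connected_components_of_overlap[OF C, of D] F(2) x by blast
    then show "C \<in> F" using D by simp
  qed
  then show ?thesis using F(1) finite_subset by blast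
qed

end

locale embedded_surface = oriented_surface M \<A> for M :: "'a topology" and \<A> +
  fixes f :: "'a \<Rightarrow> real^4"
  assumes embedding: "surface_embedding M \<A> f"
begin

abbreviation shadow :: "'a \<Rightarrow> real^3" where "shadow p \<equiv> proj (f p)"

definition sheet :: "'a set \<Rightarrow> ('a \<Rightarrow> real^2) \<Rightarrow> real^2 \<Rightarrow> real^3" where
  "sheet U \<phi> = proj \<circ> f \<circ> inv_into U \<phi>"

definition sheet' :: "'a set \<Rightarrow> ('a \<Rightarrow> real^2) \<Rightarrow> real^2 \<Rightarrow> real^2 \<Rightarrow> real^3" where
  "sheet' U \<phi> x = frechet_derivative (sheet U \<phi>) (at x)"

lemma inj_f: "inj_on f (topspace M)" using embedding by (simp add: surface_embedding_def)

lemma sheet_chart: "\<lbrakk>(U,\<phi>) \<in> \<A>; p \<in> U\<rbrakk> \<Longrightarrow> sheet U \<phi> (\<phi> p) = shadow p"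
  using chart(4) by (simp add: sheet_def inv_into_f_f)

lemma sheet_deriv_eq: "sheet_deriv f U \<phi> p = sheet' U \<phi> (\<phi> p)"
  by (simp add: sheet_deriv_def sheet'_def sheet_def)

lemma smooth_chart: assumes "(U,\<phi>) \<in> \<A>" shows "smooth_on (\<phi> ` U) (f \<circ> inv_into U \<phi>)"
  using embedding assms by (auto simp: surface_embedding_def)

lemma sheet:
  assumes c: "(U,\<phi>) \<in> \<A>"
  shows "x \<in> \<phi> ` U \<Longrightarrow> (sheet U \<phi> has_derivative sheet' U \<phi> x) (at x)"
    and "continuous_on (\<phi> ` U) (\<lambda>x. sheet' U \<phi> x v)"
    and "continuous_on (\<phi> ` U) (sheet U \<phi>)"
    and "x \<in> \<phi> ` U \<Longrightarrow> linear (sheet' U \<phi> x)"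
proof -
  let ?h = "f \<circ> inv_into U \<phi>"
  have s: "sheet U \<phi> = (\<lambda>x. proj (?h x))" by (auto simp: sheet_def)
  have d: "(sheet U \<phi> has_derivative (\<lambda>v. proj (frechet_derivative ?h (at x) v))) (at x)" if "x \<in> \<phi> ` U" for x
    unfolding s by (rule bounded_linear.has_derivative[OF bounded_linear_proj smooth_on_has_derivative[OF smooth_chart[OF c] that]])
  then have e: "sheet' U \<phi> x = (\<lambda>v. proj (frechet_derivative ?h (at x) v))" if "x \<in> \<phi> ` U" for x
    unfolding sheet'_def using frechet_derivative_at[OF d[OF that]] by simp
  show 1: "(sheet U \<phi> has_derivative sheet' U \<phi> x) (at x)" if "x \<in> \<phi> ` U" for x
    using d[OF that] e[OF that] by simp
  show "linear (sheet' U \<phi> x)" if "x \<in> \<phi> ` U" using 1[OF that] has_derivative_linear by blast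
  have "continuous_on (\<phi> ` U) (\<lambda>x. proj (frechet_derivative ?h (at x) v))"
    using continuous_on_compose2[OF linear_continuous_on[OF bounded_linear_proj, of UNIV] smooth_on_continuous_derivative[OF smooth_chart[OF c]]] by simp
  then show "continuous_on (\<phi> ` U) (\<lambda>x. sheet' U \<phi> x v)"
    by (subst continuous_on_cong[OF refl]) (auto simp: e)
  show "continuous_on (\<phi> ` U) (sheet U \<phi>)"
    using 1 has_derivative_continuous by (intro continuous_at_imp_continuous_on) blast
qed

lemma continuous_f: "continuous_map M euclidean f"
proof (rule continuous_map_openin_preimage_eq[THEN iffD2], safe)
  fix O' :: "(real^4) set" assume O: "openin euclidean O'"
  show "openin M (topspace M \<inter> f -` O')"
  proof (subst openin_subopen, clarify)
    fix p assume p: "p \<in> topspace M" "f p \<in> O'"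
    obtain U \<phi> where c: "(U,\<phi>) \<in> \<A>" "p \<in> U" using chart_at[OF p(1)] .
    have ct: "continuous_on (\<phi> ` U) (f \<circ> inv_into U \<phi>)" using smooth_on_continuous[OF smooth_chart[OF c(1)]] .
    have "open ((f \<circ> inv_into U \<phi>) -` O' \<inter> \<phi> ` U)"
      using continuous_on_open_vimage[OF chart(3)[OF c(1)], THEN iffD1, OF ct] O by simp
    note W = openin_chart_preimage[OF c(1) this]
    have "f (inv_into U \<phi> (\<phi> q)) = f q" if "q \<in> U" for q
      using inv_into_f_f[OF chart(4)[OF c(1)] that] by (rule arg_cong)
    then have "{q \<in> U. \<phi> q \<in> (f \<circ> inv_into U \<phi>) -` O' \<inter> \<phi> ` U} = {q\<in>U. f q \<in> O'}"
      by (intro Collect_cong conj_cong refl) simp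
    then have "openin M {q\<in>U. f q \<in> O'}" using W by (simp only:)
    moreover have "p \<in> {q\<in>U. f q \<in> O'}" using c p by simp
    moreover have "{q\<in>U. f q \<in> O'} \<subseteq> topspace M \<inter> f -` O'" using chart(2)[OF c(1)] by blast
    ultimately show "\<exists>T. openin M T \<and> p \<in> T \<and> T \<subseteq> topspace M \<inter> f -` O'" by blast
  qed
qed auto

lemma continuous_shadow: "continuous_map M euclidean shadow"
  using continuous_map_compose[OF continuous_f, of euclidean proj] linear_continuous_on[OF bounded_linear_proj, of UNIV]
  by (simp add: o_def)

lemma sheet'_transition:
  assumes c: "(U,\<phi>) \<in> \<A>" "(V,\<psi>) \<in> \<A>" and p: "p \<in> U" "p \<in> V"
  shows "\<exists>L. linear L \<and> 0 < det (matrix L) \<and> sheet' U \<phi> (\<phi> p) = sheet' V \<psi> (\<psi> p) \<circ> L"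
proof -
  let ?t = "\<psi> \<circ> inv_into U \<phi>"
  let ?L = "frechet_derivative ?t (at (\<phi> p))"
  note t = transition[OF c p]
  have tp: "?t (\<phi> p) = \<psi> p" using p chart(4)[OF c(1)] by (simp add: inv_into_f_f)
  have "(sheet V \<psi> has_derivative sheet' V \<psi> (\<psi> p)) (at (?t (\<phi> p)))"
    unfolding tp using sheet(1)[OF c(2)] p by blast
  from diff_chain_at[OF t(1) this]
  have "((sheet V \<psi> \<circ> ?t) has_derivative (sheet' V \<psi> (\<psi> p) \<circ> ?L)) (at (\<phi> p))" .
  moreover have "sheet U \<phi> x = (sheet V \<psi> \<circ> ?t) x" if x: "x \<in> \<phi> ` (U \<inter> V)" for x
    using x chart(4)[OF c(1)] chart(4)[OF c(2)] by (auto simp: sheet_def inv_into_f_f)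
  moreover have "open (\<phi> ` (U \<inter> V))" by (rule open_chart_image[OF c(1) chart(1)[OF c(2)]])
  moreover have "\<phi> p \<in> \<phi> ` (U \<inter> V)" using p by auto
  ultimately have "(sheet U \<phi> has_derivative (sheet' V \<psi> (\<psi> p) \<circ> ?L)) (at (\<phi> p))"
    by (metis (no_types, lifting) has_derivative_transform_within_open)
  then have "sheet' V \<psi> (\<psi> p) \<circ> ?L = sheet' U \<phi> (\<phi> p)"
    unfolding sheet'_def[of U] by (rule frechet_derivative_at)
  then show ?thesis using t by metis
qed

lemma oriented_normal_iff: "oriented_normal \<A> f p n \<longleftrightarrow> (\<exists>(U,\<phi>)\<in>\<A>. p \<in> U \<and> n = sheet_normal (sheet' U \<phi> (\<phi> p)))"
  by (simp add: oriented_normal_def sheet_normal_def sheet_deriv_eq)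

lemma oriented_normal_unique:
  assumes "oriented_normal \<A> f p n" "oriented_normal \<A> f p n'"
  shows "\<exists>c>0. n = c *\<^sub>R n'"
proof -
  obtain U \<phi> V \<psi> where *: "(U,\<phi>) \<in> \<A>" "p \<in> U" "n = sheet_normal (sheet' U \<phi> (\<phi> p))"
    "(V,\<psi>) \<in> \<A>" "p \<in> V" "n' = sheet_normal (sheet' V \<psi> (\<psi> p))"
    using assms by (auto simp: oriented_normal_iff)
  obtain L where L: "linear L" "0 < det (matrix L)" "sheet' U \<phi> (\<phi> p) = sheet' V \<psi> (\<psi> p) \<circ> L"
    using sheet'_transition[OF *(1,4,2,5)] by blast
  have "n = det (matrix L) *\<^sub>R n'"
    unfolding *(3,6) L(3) by (rule sheet_normal_compose) (use sheet(4)[OF *(4)] * L in auto)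
  then show ?thesis using L by blast
qed

lemma tangent_plane_chart:
  assumes c: "(U,\<phi>) \<in> \<A>" "p \<in> U"
  shows "tangent_plane \<A> f p = range (sheet' U \<phi> (\<phi> p))"
proof
  show "range (sheet' U \<phi> (\<phi> p)) \<subseteq> tangent_plane \<A> f p"
    unfolding tangent_plane_def using c by (auto simp: sheet_deriv_eq)
  show "tangent_plane \<A> f p \<subseteq> range (sheet' U \<phi> (\<phi> p))"
  proof
    fix v assume "v \<in> tangent_plane \<A> f p"
    then obtain V \<psi> where V: "(V,\<psi>) \<in> \<A>" "p \<in> V" "v \<in> range (sheet' V \<psi> (\<psi> p))"
      by (auto simp: tangent_plane_def sheet_deriv_eq)
    then show "v \<in> range (sheet' U \<phi> (\<phi> p))"
      using sheet'_transition[OF V(1) c(1) V(2) c(2)] by auto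
  qed
qed

end

section \<open>Mixed double points of a diagram\<close>

lemma limitin_at_continuous_map:
  fixes g :: "real \<Rightarrow> 'a"
  assumes g: "continuous_map (top_of_set T) M g" and T: "open T" "t \<in> T"
  shows "limitin M g (g t) (at t)"
  unfolding limitin_def
proof (intro conjI allI impI)
  show "g t \<in> topspace M" using continuous_map_image_subset_topspace[OF g] T by auto
  fix U assume U: "openin M U \<and> g t \<in> U"
  then have "openin (top_of_set T) {x \<in> topspace (top_of_set T). g x \<in> U}"
    using openin_continuous_map_preimage[OF g] by blast
  then have "open {x\<in>T. g x \<in> U}" using T(1) by (simp add: openin_open_eq)
  then show "\<forall>\<^sub>F x in at t. g x \<in> U"
    unfolding eventually_at_topological using U T by (intro exI[of _ "{x\<in>T. g x \<in> U}"]) auto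
qed

lemma continuous_map_limitin_at:
  fixes g :: "real \<Rightarrow> 'a"
  assumes g: "\<And>t. t \<in> T \<Longrightarrow> limitin M g (g t) (at t)" and T: "open T"
  shows "continuous_map (top_of_set T) M g"
proof (rule continuous_map_openin_preimage_eq[THEN iffD2], intro conjI allI impI)
  show "g \<in> topspace (top_of_set T) \<rightarrow> topspace M" using g by (auto simp: limitin_def)
  fix U assume U: "openin M U"
  have "open {x\<in>T. g x \<in> U}"
  proof (subst open_subopen, clarify)
    fix t assume t: "t \<in> T" "g t \<in> U"
    have "\<forall>\<^sub>F x in at t. g x \<in> U" using g[OF t(1)] U t by (simp add: limitin_def)
    then obtain S where S: "open S" "t \<in> S" "\<And>x. \<lbrakk>x \<in> S; x \<noteq> t\<rbrakk> \<Longrightarrow> g x \<in> U"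
      unfolding eventually_at_topological by blast
    then show "\<exists>O'. open O' \<and> t \<in> O' \<and> O' \<subseteq> {x\<in>T. g x \<in> U}" using t T by (intro exI[of _ "S \<inter> T"]) auto
  qed
  moreover have "topspace (top_of_set T) \<inter> g -` U = {x\<in>T. g x \<in> U}" by auto
  ultimately show "openin (top_of_set T) (topspace (top_of_set T) \<inter> g -` U)"
    using T by (simp add: openin_open_eq)
qed

text \<open>Extend \<open>G\<close> to \<open>(x,s) \<mapsto> G x + s n\<close> with a normal vector \<open>n\<close>, invert this map and forget the last
  coordinate. The retraction recovers the position on the sheet differentiably from its shadow.\<close>

lemma immersion_local_retraction:
  fixes G :: "real^2 \<Rightarrow> real^3" and D :: "real^2 \<Rightarrow> real^2 \<Rightarrow> real^3"
  assumes S: "open S" "a \<in> S" and der: "\<And>x. x \<in> S \<Longrightarrow> (G has_derivative D x) (at x)"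
    and cont: "\<And>v. continuous_on S (\<lambda>x. D x v)" and inj: "inj (D a)"
  obtains U V r where "open U" "a \<in> U" "U \<subseteq> S" "open V" "G ` U \<subseteq> V" "\<And>x. x \<in> U \<Longrightarrow> r (G x) = x"
    "\<And>y. y \<in> V \<Longrightarrow> r differentiable (at y)"
proof -
  let ?n = "sheet_normal (D a)"
  define P where "P z = G (fst z) + snd z *\<^sub>R ?n" for z :: "(real^2) \<times> real"
  define P' where "P' z v = D (fst z) (fst v) + snd v *\<^sub>R ?n" for z v :: "(real^2) \<times> real"
  have lin: "linear (D a)" using der[OF S(2)] has_derivative_linear by blast
  have nz: "?n \<noteq> 0" unfolding sheet_normal_def by (rule cross3_nonzero_if_inj[OF lin inj])
  have So: "open (S \<times> (UNIV::real set))" "(a, 0) \<in> S \<times> (UNIV::real set)" using S by (auto intro: open_Times)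
  have dP: "(P has_derivative P' z) (at z)" if "z \<in> S \<times> UNIV" for z
  proof -
    have 1: "((\<lambda>z. G (fst z)) has_derivative (\<lambda>v. D (fst z) (fst v))) (at z)"
      using that by (intro has_derivative_compose[of fst, OF _ der] derivative_eq_intros) auto
    show ?thesis unfolding P_def P'_def by (intro has_derivative_add 1) (auto intro!: derivative_eq_intros)
  qed
  have c1: "continuous_on (S \<times> UNIV) (\<lambda>z. D (fst z) v)" for v
    by (rule continuous_on_compose2[OF cont]) (auto intro: continuous_intros)
  have cP': "continuous_on (S \<times> UNIV) (\<lambda>z. P' z v)" for v
    unfolding P'_def by (intro continuous_intros c1)
  have injP: "inj (P' (a,0))"
  proof -
    have l: "linear (P' (a,0))" using dP[OF So(2)] has_derivative_linear by blast
    have "v = 0" if "P' (a,0) v = 0" for v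
    proof -
      have e: "D a (fst v) + snd v *\<^sub>R ?n = 0" using that by (simp add: P'_def)
      have "0 = (D a (fst v) + snd v *\<^sub>R ?n) \<bullet> ?n" using e by simp
      also have "\<dots> = snd v * (?n \<bullet> ?n)"
        using dot_normal_zero[OF lin, of "fst v"] by (simp add: inner_add_left sheet_normal_def)
      finally have "snd v = 0" using nz by simp
      moreover then have "fst v = 0" using e lin inj linear_injective_0 by fastforce
      ultimately show ?thesis by (simp add: prod_eq_iff)
    qed
    then show ?thesis using linear_injective_0[OF l] by blast
  qed
  obtain U V g where UV: "open U" "U \<subseteq> S \<times> UNIV" "(a,0) \<in> U" "open V" "homeomorphism U V P g"
    and dg: "\<And>y. y \<in> V \<Longrightarrow> \<exists>L. (g has_derivative L) (at y) \<and> (\<forall>v. P' (g y) (L v) = v)"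
    by (rule inverse_function_C1[of "S \<times> UNIV" "(a,0)" P P', OF _ So dP cP' injP]) auto
  have P0: "P (x, 0) = G x" for x by (simp add: P_def)
  show thesis
  proof (rule that[of "(\<lambda>x. (x, 0)) -` U" V "fst \<circ> g"])
    show "open ((\<lambda>x. (x, 0)) -` U)" by (rule open_vimage[OF UV(1)]) (intro continuous_intros)
    show "(\<lambda>x. (x, 0)) -` U \<subseteq> S" using UV(2) by auto
    show "G ` ((\<lambda>x. (x, 0)) -` U) \<subseteq> V"
      using homeomorphism_image1[OF UV(5)] P0 by (metis (no_types, lifting) image_subset_iff imageI vimageD)
    show "(fst \<circ> g) (G x) = x" if "x \<in> (\<lambda>x. (x, 0)) -` U" for x
      using homeomorphism_apply1[OF UV(5), of "(x,0)"] that P0 by simp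
    show "(fst \<circ> g) differentiable (at y)" if "y \<in> V" for y
    proof -
      obtain L where "(g has_derivative L) (at y)" using dg[OF \<open>y \<in> V\<close>] by blast
      from has_derivative_fst[OF this] show ?thesis by (auto simp: o_def differentiable_def)
    qed
  qed (use UV in auto)
qed

text \<open>The points of the circles in \<open>A_f\<close>, described pointwise: double points whose two preimages
  lie on different components of the surface.\<close>

definition mixed_points :: "'a topology \<Rightarrow> ('a \<Rightarrow> real^4) \<Rightarrow> 'a set" where
  "mixed_points M f = {p \<in> topspace M. \<exists>q\<in>topspace M. proj (f q) = proj (f p) \<and> \<not> connected_component_of M p q}"

definition partner :: "'a topology \<Rightarrow> ('a \<Rightarrow> real^4) \<Rightarrow> 'a \<Rightarrow> 'a" where
  "partner M f p = (SOME q. q \<in> topspace M \<and> q \<noteq> p \<and> proj (f q) = proj (f p))"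

text \<open>The unit vector in the direction in which the circle of \<open>A_f\<close> through \<open>p\<close> is oriented.\<close>

definition crossing_direction :: "'a topology \<Rightarrow> 'a atlas \<Rightarrow> ('a \<Rightarrow> real^4) \<Rightarrow> 'a \<Rightarrow> real^3" where
  "crossing_direction M \<A> f p = (THE v. \<exists>n1 n2. oriented_normal \<A> f p n1 \<and>
     oriented_normal \<A> f (partner M f p) n2 \<and> v = cross3 n1 n2 /\<^sub>R norm (cross3 n1 n2))"

locale diagram = embedded_surface M \<A> f
  for M :: "'a topology" and \<A> and f :: "'a \<Rightarrow> real^4" +
  assumes p_diagram: "p_diagram M \<A> f"
begin

abbreviation mixed :: "'a set" where "mixed \<equiv> mixed_points M f"
abbreviation mt :: "'a \<Rightarrow> 'a" where "mt \<equiv> partner M f"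

lemma fibre_small: "finite (fibre M f y)" "card (fibre M f y) < 3"
  using p_diagram by (auto simp: p_diagram_def)

lemma partner:
  assumes p: "p \<in> mixed"
  shows "p \<in> topspace M" "mt p \<in> topspace M" "mt p \<noteq> p" "shadow (mt p) = shadow p"
    "\<not> connected_component_of M p (mt p)" "fibre M f (shadow p) = {p, mt p}"
    "\<And>r. \<lbrakk>r \<in> topspace M; shadow r = shadow p\<rbrakk> \<Longrightarrow> r = p \<or> r = mt p"
proof -
  obtain q where q: "p \<in> topspace M" "q \<in> topspace M" "shadow q = shadow p" "\<not> connected_component_of M p q"
    using p by (auto simp: mixed_points_def)
  then have qp: "q \<noteq> p" using connected_component_of_refl by metis
  have m: "mt p \<in> topspace M \<and> mt p \<noteq> p \<and> shadow (mt p) = shadow p"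
    unfolding partner_def by (rule someI[of _ q]) (use q qp in auto)
  have sub: "{p, mt p, r} \<subseteq> fibre M f (shadow p)" if "r \<in> topspace M" "shadow r = shadow p" for r
    using that m q by (auto simp: fibre_def)
  have two: "r = p \<or> r = mt p" if "r \<in> topspace M" "shadow r = shadow p" for r
  proof (rule ccontr)
    assume "\<not> ?thesis"
    then have "card {p, mt p, r} = 3" using m by (auto simp: card_insert_if)
    then show False using card_mono[OF fibre_small(1) sub[OF that]] fibre_small(2)[of "shadow p"] by linarith
  qed
  show "p \<in> topspace M" "mt p \<in> topspace M" "mt p \<noteq> p" "shadow (mt p) = shadow p" using q m by auto
  have "q = mt p" using two[OF q(2,3)] qp by simp
  then show "\<not> connected_component_of M p (mt p)" using q by simp
  show "fibre M f (shadow p) = {p, mt p}" using two m q by (auto simp: fibre_def)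
  show "r = p \<or> r = mt p" if "r \<in> topspace M" "shadow r = shadow p" for r using two[OF that] .
qed

lemma partnerI:
  assumes "p \<in> topspace M" "q \<in> topspace M" "shadow q = shadow p" "\<not> connected_component_of M p q"
  shows "p \<in> mixed" "mt p = q"
proof -
  show p: "p \<in> mixed" using assms by (auto simp: mixed_points_def)
  have "q \<noteq> p" using assms connected_component_of_refl by metis
  then show "mt p = q" using partner(7)[OF p assms(2,3)] by simp
qed

lemma partner_partner:
  assumes p: "p \<in> mixed" shows "mt p \<in> mixed" "mt (mt p) = p"
  using partnerI[of "mt p" p] partner[OF p] connected_component_of_sym[of M] by metis+

lemma immersed:
  assumes p: "p \<in> mixed"
  shows "immersed_at \<A> f p" "span (tangent_plane \<A> f p \<union> tangent_plane \<A> f (mt p)) = UNIV"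
proof -
  note m = partner[OF p]
  have "shadow p \<in> proj ` f ` topspace M" using m(1) by blast
  then have "(\<exists>a. fibre M f (shadow p) = {a} \<and> immersed_at \<A> f a) \<or>
     (\<exists>a b. a \<noteq> b \<and> fibre M f (shadow p) = {a,b} \<and> immersed_at \<A> f a \<and> immersed_at \<A> f b \<and>
        span (tangent_plane \<A> f a \<union> tangent_plane \<A> f b) = UNIV) \<or>
     (\<exists>a b c. distinct [a,b,c] \<and> fibre M f (shadow p) = {a,b,c} \<and>
        immersed_at \<A> f a \<and> immersed_at \<A> f b \<and> immersed_at \<A> f c \<and>
        tangent_plane \<A> f a \<inter> tangent_plane \<A> f b \<inter> tangent_plane \<A> f c = {0}) \<or>
     (\<exists>a. fibre M f (shadow p) = {a} \<and> whitney_umbrella_at M \<A> f a)"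
    using p_diagram unfolding p_diagram_def general_position_def by (elim conjE bspec)
  then consider a where "fibre M f (shadow p) = {a}"
    | a b where "a \<noteq> b" "fibre M f (shadow p) = {a,b}" "immersed_at \<A> f a" "immersed_at \<A> f b"
        "span (tangent_plane \<A> f a \<union> tangent_plane \<A> f b) = UNIV"
    | a b c where "distinct [a,b,c]" "fibre M f (shadow p) = {a,b,c}"
    by blast
  then have "immersed_at \<A> f p \<and> span (tangent_plane \<A> f p \<union> tangent_plane \<A> f (mt p)) = UNIV"
  proof cases
    case 1
    then show ?thesis using m by auto
  next
    case 2
    then have "{a,b} = {p, mt p}" using m(6) by simp
    then have "(a = p \<and> b = mt p) \<or> (a = mt p \<and> b = p)" by (auto simp: doubleton_eq_iff)
    then show ?thesis using 2 by (auto simp: Un_commute)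
  next
    case 3
    then show ?thesis using fibre_small(2)[of "shadow p"] by (simp add: card_insert_if)
  qed
  then show "immersed_at \<A> f p" "span (tangent_plane \<A> f p \<union> tangent_plane \<A> f (mt p)) = UNIV" by auto
qed

lemma immersed_chart:
  assumes p: "p \<in> mixed" and c: "(U,\<phi>) \<in> \<A>" "p \<in> U"
  shows "inj (sheet' U \<phi> (\<phi> p))"
  using immersed(1)[OF p] c by (auto simp: immersed_at_def sheet_deriv_eq)

lemma normals_transversal_chart:
  assumes p: "p \<in> mixed" and c: "(U,\<phi>) \<in> \<A>" "p \<in> U" "(V,\<psi>) \<in> \<A>" "mt p \<in> V"
  shows "cross3 (sheet_normal (sheet' U \<phi> (\<phi> p))) (sheet_normal (sheet' V \<psi> (\<psi> (mt p)))) \<noteq> 0"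
  unfolding sheet_normal_def
proof (rule cross3_normals_nonzero)
  show "span (range (sheet' U \<phi> (\<phi> p)) \<union> range (sheet' V \<psi> (\<psi> (mt p)))) = UNIV"
    using immersed(2)[OF p] tangent_plane_chart[OF c(1,2)] tangent_plane_chart[OF c(3,4)] by simp
qed (use immersed_chart[OF p c(1,2)] immersed_chart[OF partner_partner(1)[OF p] c(3,4)] sheet(4)[OF c(1)] sheet(4)[OF c(3)] c in auto)

lemma oriented_normal_exists:
  assumes "p \<in> topspace M" obtains n where "oriented_normal \<A> f p n"
proof -
  obtain U \<phi> where "(U,\<phi>) \<in> \<A>" "p \<in> U" using chart_at[OF assms] .
  then show thesis using that by (auto simp: oriented_normal_iff)
qed

lemma crossing_direction:
  assumes p: "p \<in> mixed" and n: "oriented_normal \<A> f p n1" "oriented_normal \<A> f (mt p) n2"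
  shows "cross3 n1 n2 \<noteq> 0" "crossing_direction M \<A> f p = cross3 n1 n2 /\<^sub>R norm (cross3 n1 n2)"
proof -
  show nz: "cross3 n1 n2 \<noteq> 0"
    using n normals_transversal_chart[OF p] by (auto simp: oriented_normal_iff)
  have "cross3 n1' n2' /\<^sub>R norm (cross3 n1' n2') = cross3 n1 n2 /\<^sub>R norm (cross3 n1 n2)"
    if n': "oriented_normal \<A> f p n1'" "oriented_normal \<A> f (mt p) n2'" for n1' n2'
  proof -
    obtain a b where "a > 0" "n1' = a *\<^sub>R n1" "b > 0" "n2' = b *\<^sub>R n2"
      using oriented_normal_unique[OF n'(1) n(1)] oriented_normal_unique[OF n'(2) n(2)] by blast
    then show ?thesis by (simp add: cross_mult_left cross_mult_right field_simps)
  qed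
  then show "crossing_direction M \<A> f p = cross3 n1 n2 /\<^sub>R norm (cross3 n1 n2)"
    unfolding crossing_direction_def using n by (intro the_equality) blast+
qed

abbreviation dir :: "'a \<Rightarrow> real^3" where "dir \<equiv> crossing_direction M \<A> f"

lemma dir_nonzero: assumes p: "p \<in> mixed" shows "dir p \<noteq> 0"
proof -
  obtain n1 n2 where "oriented_normal \<A> f p n1" "oriented_normal \<A> f (mt p) n2"
    using oriented_normal_exists partner[OF p] by metis
  from crossing_direction[OF p this] show ?thesis by simp
qed

text \<open>For every pair of components, the points of the first that lie over the shadow of the second
  form a closed set, and there are finitely many components.\<close>

lemma closed_mixed: "closedin M mixed"
proof -
  have "mixed = (\<Union>(K,L)\<in>{(K,L). K \<in> connected_components_of M \<and> L \<in> connected_components_of M \<and> K \<noteq> L}.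
      K \<inter> {p \<in> topspace M. shadow p \<in> shadow ` L})" (is "_ = (\<Union>(K,L)\<in>?I. ?S K L)")
  proof
    show "mixed \<subseteq> (\<Union>(K,L)\<in>?I. ?S K L)"
    proof
      fix p assume "p \<in> mixed"
      then obtain q where q: "p \<in> topspace M" "q \<in> topspace M" "shadow q = shadow p" "\<not> connected_component_of M p q"
        by (auto simp: mixed_points_def)
      let ?K = "connected_component_of_set M p" and ?L = "connected_component_of_set M q"
      have "?K \<in> connected_components_of M" "?L \<in> connected_components_of M"
        using q by (auto simp: connected_components_of_def)
      moreover have "p \<in> ?K" "q \<in> ?L" using q by (auto simp: connected_component_of_refl)
      moreover have "?K \<noteq> ?L" using q(4) calculation(4) by auto
      moreover have "shadow p \<in> shadow ` ?L"
        using imageI[OF \<open>q \<in> ?L\<close>, of shadow] q(3) by simp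
      ultimately show "p \<in> (\<Union>(K,L)\<in>?I. ?S K L)" using q(1)
        by (intro UN_I[of "(?K,?L)"]) simp_all
    qed
    show "(\<Union>(K,L)\<in>?I. ?S K L) \<subseteq> mixed"
    proof clarify
      fix p K L q assume *: "K \<in> connected_components_of M" "L \<in> connected_components_of M" "K \<noteq> L" "p \<in> K" "p \<in> topspace M" "shadow p = shadow q" "q \<in> L"
      have "\<not> connected_component_of M p q"
      proof
        assume "connected_component_of M p q"
        then obtain C where C: "connectedin M C" "p \<in> C" "q \<in> C" by (auto simp: connected_component_of_def)
        have "C \<subseteq> K" "C \<subseteq> L"
          using connected_components_of_maximal[OF *(1) C(1)] connected_components_of_maximal[OF *(2) C(1)] * C by (auto simp: disjnt_iff)
        then show False using connected_components_of_overlap[OF *(1,2)] C(2) *(3) by blast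
      qed
      then show "p \<in> mixed" using * connected_components_of_subset[OF *(2)] by (auto simp: mixed_points_def)
    qed
  qed
  moreover have "closedin M (\<Union>(K,L)\<in>?I. ?S K L)"
  proof (intro closedin_Union)
    have "finite (connected_components_of M \<times> connected_components_of M)" using finite_components by simp
    then have "finite ?I" by (rule rev_finite_subset) auto
    then show "finite ((\<lambda>(K,L). ?S K L) ` ?I)" by simp
    fix T assume "T \<in> (\<lambda>(K,L). ?S K L) ` ?I"
    then obtain K L where T: "T = ?S K L" "K \<in> connected_components_of M" "L \<in> connected_components_of M" by auto
    have "compactin M L" using closedin_compact_space[OF compact_space closedin_connected_components_of[OF T(3)]] .
    then have "closed (shadow ` L)"
      using image_compactin[OF _ continuous_shadow] by (simp add: compact_imp_closed)
    then have "closedin M {p \<in> topspace M. shadow p \<in> shadow ` L}"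
      using closedin_continuous_map_preimage[OF continuous_shadow] by simp
    then show "closedin M T" unfolding T(1) using closedin_connected_components_of[OF T(2)] by (rule closedin_Int[rotated])
  qed
  ultimately show ?thesis by simp
qed

lemma compact_mixed: "compactin M mixed"
  by (rule closedin_compact_space[OF compact_space closed_mixed])

text \<open>A fibre has two points, one in each of two components, so by compactness nearby
  points of one sheet have their partners near the partner.\<close>

lemma partner_near:
  assumes p: "p \<in> mixed" and V: "openin M V" "mt p \<in> V"
  obtains O' where "openin M O'" "p \<in> O'" "O' \<subseteq> connected_component_of_set M p" "\<And>x. x \<in> O' \<inter> mixed \<Longrightarrow> mt x \<in> V"
proof -
  let ?C = "connected_component_of_set M p"
  let ?K = "topspace M - (?C \<union> V)"
  have pC: "p \<in> ?C" using partner(1)[OF p] by (simp add: connected_component_of_refl)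
  have "openin M (?C \<union> V)" using openin_component V by blast
  then have "closedin M ?K" by blast
  then have "compactin M ?K" using closedin_compact_space[OF compact_space] by blast
  then have cl: "closed (shadow ` ?K)" using image_compactin[OF _ continuous_shadow] by (simp add: compact_imp_closed)
  have np: "shadow p \<notin> shadow ` ?K"
    using partner(7)[OF p] pC V(2) by (auto simp: image_iff) metis
  let ?O = "?C \<inter> {x \<in> topspace M. shadow x \<in> - shadow ` ?K}"
  show thesis
  proof (rule that[of ?O])
    have "openin M {x \<in> topspace M. shadow x \<in> - shadow ` ?K}"
      by (rule openin_continuous_map_preimage[OF continuous_shadow]) (use cl in auto)
    then show "openin M ?O" using openin_component by blast
    show "p \<in> ?O" using pC np partner(1)[OF p] by simp
    show "mt x \<in> V" if "x \<in> ?O \<inter> mixed" for x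
    proof -
      have x: "x \<in> mixed" "x \<in> ?C" "shadow x \<notin> shadow ` ?K" using that by auto
      have "mt x \<notin> ?K" using x(3) partner(4)[OF x(1)] by (metis imageI)
      moreover have "mt x \<notin> ?C"
        using partner(5)[OF x(1)] x(2) by (metis connected_component_of_sym connected_component_of_trans mem_Collect_eq)
      ultimately show ?thesis using partner(2)[OF x(1)] by blast
    qed
  qed auto
qed

text \<open>The curve is the intersection of the sheets at \<open>p\<close> and at its partner; by \<open>partner_near\<close> all
  mixed points near \<open>p\<close> arise from these two sheets.\<close>

lemma local_crossing_curve:
  assumes p: "p \<in> mixed"
  obtains d \<sigma> O' where "0 < (d::real)" "openin M O'" "p \<in> O'" "\<sigma> 0 = p"
    "\<And>t. \<bar>t\<bar> < d \<Longrightarrow> \<sigma> t \<in> mixed \<and> limitin M \<sigma> (\<sigma> t) (at t) \<and>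
       ((\<lambda>t. shadow (\<sigma> t)) has_vector_derivative dir (\<sigma> t)) (at t) \<and> 0 < dir p \<bullet> dir (\<sigma> t)"
    "mixed \<inter> O' \<subseteq> \<sigma> ` {-d<..<d}"
proof -
  let ?q = "mt p"
  note m = partner[OF p]
  obtain U \<phi> where U: "(U,\<phi>) \<in> \<A>" "p \<in> U" using chart_at[OF m(1)] .
  obtain V \<psi> where V: "(V,\<psi>) \<in> \<A>" "?q \<in> V" using chart_at[OF m(2)] .
  let ?C = "connected_component_of_set M p" and ?E = "connected_component_of_set M ?q"
  have pC: "p \<in> ?C" and qE: "?q \<in> ?E" using m by (auto simp: connected_component_of_refl)
  let ?S1 = "\<phi> ` (U \<inter> ?C)" and ?S2 = "\<psi> ` (V \<inter> ?E)"
  have So: "open ?S1" "open ?S2" "\<phi> p \<in> ?S1" "\<psi> ?q \<in> ?S2"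
    using open_chart_image[OF U(1) openin_component] open_chart_image[OF V(1) openin_component] U V pC qE by auto
  define N where "N = (\<lambda>z. cross3 (sheet_normal (sheet' U \<phi> (fst z))) (sheet_normal (sheet' V \<psi> (snd z))))"
  have nz: "N (\<phi> p, \<psi> ?q) \<noteq> 0" using normals_transversal_chart[OF p U V] by (simp add: N_def)
  have eq: "sheet U \<phi> (\<phi> p) = sheet V \<psi> (\<psi> ?q)" using sheet_chart[OF U] sheet_chart[OF V] m(4) by simp
  have d1: "(sheet U \<phi> has_derivative sheet' U \<phi> x) (at x)" if "x \<in> ?S1" for x
    by (rule sheet(1)[OF U(1)]) (use that in auto)
  have d2: "(sheet V \<psi> has_derivative sheet' V \<psi> x) (at x)" if "x \<in> ?S2" for x
    by (rule sheet(1)[OF V(1)]) (use that in auto)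
  have c1: "continuous_on ?S1 (\<lambda>x. sheet' U \<phi> x v)" for v
    by (rule continuous_on_subset[OF sheet(2)[OF U(1)]]) auto
  have c2: "continuous_on ?S2 (\<lambda>x. sheet' V \<psi> x v)" for v
    by (rule continuous_on_subset[OF sheet(2)[OF V(1)]]) auto
  obtain d k W where d: "0 < (d::real)" "k 0 = (\<phi> p, \<psi> ?q)" "open W" "(\<phi> p, \<psi> ?q) \<in> W" "W \<subseteq> ?S1 \<times> ?S2"
    and k: "\<And>t. \<bar>t\<bar> < d \<Longrightarrow> fst (k t) \<in> ?S1 \<and> snd (k t) \<in> ?S2 \<and> sheet U \<phi> (fst (k t)) = sheet V \<psi> (snd (k t)) \<and> isCont k t
       \<and> 0 < N (\<phi> p, \<psi> ?q) \<bullet> N (k t) \<and> ((\<lambda>t. sheet U \<phi> (fst (k t))) has_vector_derivative N (k t) /\<^sub>R norm (N (k t))) (at t)"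
    and W: "\<And>x y. \<lbrakk>(x,y) \<in> W; sheet U \<phi> x = sheet V \<psi> y\<rbrakk> \<Longrightarrow> \<exists>t. \<bar>t\<bar> < d \<and> (x,y) = k t"
    by (rule unit_speed_intersection_curve[OF So d1 d2 c1 c2 immersed_chart[OF p U] immersed_chart[OF partner_partner(1)[OF p] V] eq N_def nz])
      (assumption+, rule that, assumption+)
  define \<sigma> where "\<sigma> t = inv_into U \<phi> (fst (k t))" for t
  define \<tau> where "\<tau> t = inv_into V \<psi> (snd (k t))" for t
  have st: "\<sigma> t \<in> U \<inter> ?C" "\<phi> (\<sigma> t) = fst (k t)" "\<tau> t \<in> V \<inter> ?E" "\<psi> (\<tau> t) = snd (k t)" if t: "\<bar>t\<bar> < d" for t
  proof -
    obtain x y where x: "x \<in> U \<inter> ?C" "fst (k t) = \<phi> x" and y: "y \<in> V \<inter> ?E" "snd (k t) = \<psi> y" using k[OF t] by auto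
    have "\<sigma> t = x" "\<tau> t = y" using x y chart(4)[OF U(1)] chart(4)[OF V(1)] by (auto simp: \<sigma>_def \<tau>_def inv_into_f_f)
    then show "\<sigma> t \<in> U \<inter> ?C" "\<phi> (\<sigma> t) = fst (k t)" "\<tau> t \<in> V \<inter> ?E" "\<psi> (\<tau> t) = snd (k t)" using x y by auto
  qed
  have mix: "\<sigma> t \<in> mixed" "mt (\<sigma> t) = \<tau> t" if t: "\<bar>t\<bar> < d" for t
  proof -
    have "shadow (\<tau> t) = shadow (\<sigma> t)"
      using sheet_chart[OF U(1), of "\<sigma> t"] sheet_chart[OF V(1), of "\<tau> t"] st[OF t] k[OF t] by auto
    moreover have "\<not> connected_component_of M (\<sigma> t) (\<tau> t)"
      using st(1,3)[OF t] m(5) by (metis IntD2 connected_component_of_sym connected_component_of_trans mem_Collect_eq)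
    moreover have "\<sigma> t \<in> topspace M" "\<tau> t \<in> topspace M" using st(1,3)[OF t] chart(2)[OF U(1)] chart(2)[OF V(1)] by auto
    ultimately show "\<sigma> t \<in> mixed" "mt (\<sigma> t) = \<tau> t" using partnerI[of "\<sigma> t" "\<tau> t"] by blast+
  qed
  have dir: "dir (\<sigma> t) = N (k t) /\<^sub>R norm (N (k t))" "N (k t) \<noteq> 0" if t: "\<bar>t\<bar> < d" for t
  proof -
    have "oriented_normal \<A> f (\<sigma> t) (sheet_normal (sheet' U \<phi> (fst (k t))))"
      "oriented_normal \<A> f (mt (\<sigma> t)) (sheet_normal (sheet' V \<psi> (snd (k t))))"
      unfolding oriented_normal_iff mix(2)[OF t] st(2,4)[OF t, symmetric]
      using st(1,3)[OF t] U(1) V(1) by blast+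
    from crossing_direction[OF mix(1)[OF t] this]
    show "dir (\<sigma> t) = N (k t) /\<^sub>R norm (N (k t))" "N (k t) \<noteq> 0" by (simp_all add: N_def)
  qed
  have s0: "\<sigma> 0 = p" using d(2) chart(4)[OF U(1)] U(2) by (simp add: \<sigma>_def inv_into_f_f)
  have dirp: "dir p = N (\<phi> p, \<psi> ?q) /\<^sub>R norm (N (\<phi> p, \<psi> ?q))" using dir(1)[of 0] d s0 by simp
  have ctk: "continuous_on {-d<..<d} k" using k by (intro continuous_at_imp_continuous_on) (auto simp: abs_less_iff)
  have "continuous_map (top_of_set {-d<..<d}) (top_of_set (\<phi> ` U)) (\<lambda>t. fst (k t))"
  proof (simp add: continuous_map_in_subtopology, intro conjI)
    show "continuous_on {-d<..<d} (\<lambda>t. fst (k t))" using ctk by (intro continuous_intros)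
    show "(\<lambda>t. fst (k t)) \<in> {-d<..<d} \<rightarrow> \<phi> ` U" using k by (fastforce simp: abs_less_iff)
  qed
  from continuous_map_compose[OF this chart(6)[OF U(1)]]
  have cts: "continuous_map (top_of_set {-d<..<d}) M \<sigma>" by (simp add: o_def \<sigma>_def[abs_def])
  have lim: "limitin M \<sigma> (\<sigma> t) (at t)" if t: "\<bar>t\<bar> < d" for t
    by (rule limitin_at_continuous_map[OF cts]) (use t in auto)
  have "\<exists>A B. open A \<and> open B \<and> \<phi> p \<in> A \<and> \<psi> ?q \<in> B \<and> A \<times> B \<subseteq> W"
    using d(3,4) open_prod_elim[of W "(\<phi> p, \<psi> ?q)"] by (metis mem_Sigma_iff)
  then obtain A B where AB: "open A" "open B" "\<phi> p \<in> A" "\<psi> ?q \<in> B" "A \<times> B \<subseteq> W" by blast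
  have VB: "openin M {x\<in>V. \<psi> x \<in> B}" "?q \<in> {x\<in>V. \<psi> x \<in> B}" using openin_chart_preimage[OF V(1) AB(2)] V AB by auto
  obtain O1 where O1: "openin M O1" "p \<in> O1" "O1 \<subseteq> ?C" "\<And>x. x \<in> O1 \<inter> mixed \<Longrightarrow> mt x \<in> {x\<in>V. \<psi> x \<in> B}"
    by (rule partner_near[OF p VB]) (rule that, assumption+)
  let ?O = "O1 \<inter> {x\<in>U. \<phi> x \<in> A}"
  show thesis
  proof (rule that[of d ?O \<sigma>])
    show "openin M ?O" using O1(1) openin_chart_preimage[OF U(1) AB(1)] by blast
    show "p \<in> ?O" using O1 U AB by simp
    show "\<sigma> t \<in> mixed \<and> limitin M \<sigma> (\<sigma> t) (at t) \<and>
       ((\<lambda>t. shadow (\<sigma> t)) has_vector_derivative dir (\<sigma> t)) (at t) \<and> 0 < dir p \<bullet> dir (\<sigma> t)" if t: "\<bar>t\<bar> < d" for t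
    proof (intro conjI mix lim t)
      have "((\<lambda>t. sheet U \<phi> (fst (k t))) has_vector_derivative dir (\<sigma> t)) (at t)" using k[OF t] dir[OF t] by simp
      then show "((\<lambda>t. shadow (\<sigma> t)) has_vector_derivative dir (\<sigma> t)) (at t)"
        by (simp add: sheet_def \<sigma>_def o_def)
      show "0 < dir p \<bullet> dir (\<sigma> t)" using k[OF t] dir[OF t] nz by (simp add: dirp)
    qed
    show "mixed \<inter> ?O \<subseteq> \<sigma> ` {-d<..<d}"
    proof
      fix x assume x: "x \<in> mixed \<inter> ?O"
      have mx: "mt x \<in> V" "\<psi> (mt x) \<in> B" using O1(4)[of x] x by auto
      have "(\<phi> x, \<psi> (mt x)) \<in> W" using AB(5) mx x by auto
      moreover have "sheet U \<phi> (\<phi> x) = sheet V \<psi> (\<psi> (mt x))"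
        using sheet_chart[OF U(1), of x] sheet_chart[OF V(1) mx(1)] partner(4)[of x] x by simp
      ultimately obtain t where t: "\<bar>t\<bar> < d" "(\<phi> x, \<psi> (mt x)) = k t" using W by blast
      have "\<sigma> t = x" using t(2)[symmetric] x chart(4)[OF U(1)] by (simp add: \<sigma>_def inv_into_f_f)
      then show "x \<in> \<sigma> ` {-d<..<d}" using t(1) by (intro image_eqI[of _ _ t]) auto
    qed
  qed (use d s0 in auto)
qed

end

section \<open>Integral curves of the crossing direction\<close>

text \<open>The curve has the crossing direction as its velocity at time \<open>t\<close>, measured in 3-space. Continuity
  on the surface is required separately, because the shadow alone does not determine the sheet.\<close>

definition integral_at :: "'a topology \<Rightarrow> 'a atlas \<Rightarrow> ('a \<Rightarrow> real^4) \<Rightarrow> (real \<Rightarrow> 'a) \<Rightarrow> real \<Rightarrow> bool" where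
  "integral_at M \<A> f g t \<longleftrightarrow> g t \<in> mixed_points M f \<and> limitin M g (g t) (at t) \<and>
     ((\<lambda>s. proj (f (g s))) has_vector_derivative crossing_direction M \<A> f (g t)) (at t)"

definition crossing_flow :: "'a topology \<Rightarrow> 'a atlas \<Rightarrow> ('a \<Rightarrow> real^4) \<Rightarrow> 'a \<Rightarrow> real \<Rightarrow> 'a" where
  "crossing_flow M \<A> f p = (SOME g. g 0 = p \<and> (\<forall>t. integral_at M \<A> f g t))"

lemma integral_at_cong:
  assumes h: "integral_at M \<A> f h t" and N: "open N" "t \<in> N" "\<And>s. s \<in> N \<Longrightarrow> g s = h s"
  shows "integral_at M \<A> f g t"
proof -
  have gt: "g t = h t" using N by auto
  have ev: "\<forall>\<^sub>F s in at t. g s = h s"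
    unfolding eventually_at_topological using N by blast
  have "limitin M g (g t) (at t)"
    unfolding limitin_def
  proof (intro conjI allI impI)
    show "g t \<in> topspace M" using h gt by (auto simp: integral_at_def limitin_def)
    fix U assume "openin M U \<and> g t \<in> U"
    then have "\<forall>\<^sub>F s in at t. h s \<in> U" using h gt by (auto simp: integral_at_def limitin_def)
    then show "\<forall>\<^sub>F s in at t. g s \<in> U" using ev by eventually_elim simp
  qed
  moreover have "((\<lambda>s. proj (f (g s))) has_vector_derivative crossing_direction M \<A> f (g t)) (at t)"
    using h gt N by (auto simp: integral_at_def intro!: has_vector_derivative_transform_within_open[of "\<lambda>s. proj (f (h s))" _ t N])
  ultimately show ?thesis using h gt by (simp add: integral_at_def)
qed

lemma integral_at_shift:
  assumes h: "integral_at M \<A> f h (t + c)" shows "integral_at M \<A> f (\<lambda>s. h (s + c)) t"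
proof -
  have "filterlim (\<lambda>s. s + c) (at (t + c)) (at t)"
    by (rule filterlim_at[THEN iffD2]) (auto intro!: tendsto_eq_intros eventually_at_topological[THEN iffD2] exI[of _ UNIV])
  then have "limitin M (\<lambda>s. h (s + c)) (h (t + c)) (at t)"
    using h unfolding integral_at_def limitin_def filterlim_iff by auto
  moreover have "((\<lambda>s. proj (f (h (s + c)))) has_vector_derivative 1 *\<^sub>R crossing_direction M \<A> f (h (t + c))) (at t)"
  proof -
    have "((\<lambda>s. s + c) has_vector_derivative 1) (at t)" by (auto intro!: derivative_eq_intros)
    from vector_diff_chain_at[OF this, of "\<lambda>s. proj (f (h s))" "crossing_direction M \<A> f (h (t + c))"] h
    show ?thesis by (simp add: integral_at_def o_def)
  qed
  ultimately show ?thesis using h by (simp add: integral_at_def)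
qed

context diagram begin

abbreviation ic :: "(real \<Rightarrow> 'a) \<Rightarrow> real \<Rightarrow> bool" where "ic \<equiv> integral_at M \<A> f"

text \<open>The inverse of the local curve is recorded as a function of the position in space, so
  that it can be differentiated along any other curve in the same double arc.\<close>

lemma local_time:
  assumes p: "p \<in> mixed"
  obtains d \<sigma> O' T l where "0 < (d::real)" "openin M O'" "p \<in> O'" "\<sigma> 0 = p" "\<And>t. \<bar>t\<bar> < d \<Longrightarrow> ic \<sigma> t"
    "mixed \<inter> O' \<subseteq> \<sigma> ` {-d<..<d}" "\<And>t. \<bar>t\<bar> < d \<Longrightarrow> T (shadow (\<sigma> t)) = t"
    "\<And>t. \<bar>t\<bar> < d \<Longrightarrow> 0 < l \<bullet> dir (\<sigma> t)"
    "\<And>t. \<bar>t\<bar> < d \<Longrightarrow> (T has_derivative (\<lambda>v. (l \<bullet> v) / (l \<bullet> dir (\<sigma> t)))) (at (shadow (\<sigma> t)))"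
proof -
  obtain d \<sigma> O' where d: "0 < (d::real)" "openin M O'" "p \<in> O'" "\<sigma> 0 = p"
    and \<sigma>: "\<And>t. \<bar>t\<bar> < d \<Longrightarrow> \<sigma> t \<in> mixed \<and> limitin M \<sigma> (\<sigma> t) (at t) \<and>
       ((\<lambda>t. shadow (\<sigma> t)) has_vector_derivative dir (\<sigma> t)) (at t) \<and> 0 < dir p \<bullet> dir (\<sigma> t)"
    and O': "mixed \<inter> O' \<subseteq> \<sigma> ` {-d<..<d}"
    by (rule local_crossing_curve[OF p]) (rule that, assumption+)
  let ?l = "dir p"
  define L where "L t = ?l \<bullet> shadow (\<sigma> t)" for t
  let ?I = "{-d<..<d}"
  have dL: "(L has_real_derivative ?l \<bullet> dir (\<sigma> t)) (at t)" if "\<bar>t\<bar> < d" for t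
  proof -
    have "((\<lambda>t. shadow (\<sigma> t)) has_derivative (\<lambda>x. x *\<^sub>R dir (\<sigma> t))) (at t)"
      using \<sigma>[OF that] by (simp add: has_vector_derivative_def)
    from has_derivative_inner_right[OF this, of ?l]
    show ?thesis unfolding has_field_derivative_def L_def
      by (rule has_derivative_eq_rhs) (auto simp: mult.commute)
  qed
  have pos: "0 < ?l \<bullet> dir (\<sigma> t)" if "\<bar>t\<bar> < d" for t using \<sigma>[OF that] by blast
  have mono: "L s < L t" if "s < t" "\<bar>s\<bar> < d" "\<bar>t\<bar> < d" for s t
  proof (rule DERIV_pos_imp_increasing[OF that(1)])
    fix x assume "s \<le> x" "x \<le> t"
    then have "\<bar>x\<bar> < d" using that by auto
    then show "\<exists>y. (L has_real_derivative y) (at x) \<and> 0 < y" using dL pos by blast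
  qed
  have injL: "inj_on L ?I"
  proof (rule inj_onI, rule ccontr)
    fix s t assume *: "s \<in> ?I" "t \<in> ?I" "L s = L t" "s \<noteq> t"
    then have "\<bar>s\<bar> < d" "\<bar>t\<bar> < d" by auto
    then show False using mono[of s t] mono[of t s] * by (cases "s < t") auto
  qed
  define m where "m = inv_into ?I L"
  have mL: "m (L t) = t" if "\<bar>t\<bar> < d" for t
    unfolding m_def using that by (intro inv_into_f_f injL) auto
  have dm: "(m has_real_derivative inverse (?l \<bullet> dir (\<sigma> t))) (at (L t))" if t: "\<bar>t\<bar> < d" for t
  proof -
    obtain a b where ab: "a < t" "t < b" "\<bar>a\<bar> < d" "\<bar>b\<bar> < d"
      using t by (intro that[of "(t - d)/2" "(t + d)/2"]) (auto simp: abs_less_iff)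
    have in': "\<bar>z\<bar> < d" if "a \<le> z" "z \<le> b" for z using that ab by auto
    have cL: "isCont L z" if "a \<le> z" "z \<le> b" for z using dL[OF in'[OF that]] DERIV_isCont by blast
    have cm: "isCont m (L t)"
      by (rule isCont_inverse_function2[OF ab(1,2)]) (use mL in' cL in auto)
    have Lm: "L (m y) = y" if "L a < y" "y < L b" for y
    proof -
      have "\<exists>z\<ge>a. z \<le> b \<and> L z = y" using that ab cL by (intro IVT) auto
      then obtain z where z: "a \<le> z" "z \<le> b" "L z = y" by (elim exE conjE)
      then show ?thesis using mL[OF in'[OF z(1,2)]] by simp
    qed
    show ?thesis
    proof (rule DERIV_inverse_function[where f=L and g=m and x="L t" and a="L a" and b="L b"])
      show "(L has_real_derivative ?l \<bullet> dir (\<sigma> t)) (at (m (L t)))" using dL[OF t] mL[OF t] by simp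
      show "?l \<bullet> dir (\<sigma> t) \<noteq> 0" using pos[OF t] by simp
      show "L a < L t" "L t < L b" using mono ab t by auto
    qed (use Lm cm in auto)
  qed
  define T where "T y = m (?l \<bullet> y)" for y
  show thesis
  proof (rule that[of d O' \<sigma> T ?l])
    show "ic \<sigma> t" if "\<bar>t\<bar> < d" for t using \<sigma>[OF that] by (simp add: integral_at_def)
    show "T (shadow (\<sigma> t)) = t" if "\<bar>t\<bar> < d" for t using mL[OF that] by (simp add: T_def L_def)
    show "(T has_derivative (\<lambda>v. (?l \<bullet> v) / (?l \<bullet> dir (\<sigma> t)))) (at (shadow (\<sigma> t)))" if "\<bar>t\<bar> < d" for t
    proof -
      have "(m has_derivative (\<lambda>x. inverse (?l \<bullet> dir (\<sigma> t)) * x)) (at (?l \<bullet> shadow (\<sigma> t)))"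
        using dm[OF that] unfolding has_field_derivative_def L_def .
      from has_derivative_compose[OF bounded_linear_imp_has_derivative[OF bounded_linear_inner_right] this]
      show ?thesis unfolding T_def by (simp add: divide_inverse mult.commute)
    qed
  qed (use d O' pos in auto)
qed

text \<open>Near the point, the curve is the local double arc run through at varying speed: the time
  function \<open>T\<close> of the arc turns it into a real function, which is differentiated by the chain
  rule.\<close>

lemma curve_in_mixed:
  assumes lim: "limitin M g (g t) (at t within S)" and gt: "g t \<in> mixed"
    and ev: "\<forall>\<^sub>F s in at t within S. g s \<in> mixed"
    and der: "((\<lambda>s. shadow (g s)) has_vector_derivative w) (at t within S)"
    and nb: "at t within S \<noteq> bot" "t \<in> S"
  shows "\<exists>c. w = c *\<^sub>R dir (g t)"
proof -
  obtain d \<sigma> O' T l where d: "0 < (d::real)" "openin M O'" "g t \<in> O'" "\<sigma> 0 = g t"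
    and ic: "\<And>t. \<bar>t\<bar> < d \<Longrightarrow> ic \<sigma> t" and O': "mixed \<inter> O' \<subseteq> \<sigma> ` {-d<..<d}" and T: "\<And>t. \<bar>t\<bar> < d \<Longrightarrow> T (shadow (\<sigma> t)) = t"
    and l: "\<And>t. \<bar>t\<bar> < d \<Longrightarrow> 0 < l \<bullet> dir (\<sigma> t)"
    and dT: "\<And>t. \<bar>t\<bar> < d \<Longrightarrow> (T has_derivative (\<lambda>v. (l \<bullet> v) / (l \<bullet> dir (\<sigma> t)))) (at (shadow (\<sigma> t)))"
    by (rule local_time[OF gt]) (rule that, assumption+)
  let ?u = "\<lambda>s. T (shadow (g s))"
  let ?c = "(l \<bullet> w) / (l \<bullet> dir (g t))"
  have "\<forall>\<^sub>F s in at t within S. g s \<in> O'" using lim d by (simp add: limitin_def)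
  then have gs: "\<forall>\<^sub>F s in at t within S. shadow (g s) = shadow (\<sigma> (?u s))"
    using ev
  proof eventually_elim
    case (elim s)
    then obtain \<tau> where "\<tau> \<in> {-d<..<d}" "g s = \<sigma> \<tau>" using O' by blast
    then show ?case using T[of \<tau>] by auto
  qed
  have u0: "?u t = 0" using T[of 0] d by simp
  have dg: "((\<lambda>s. shadow (g s)) has_derivative (\<lambda>x. x *\<^sub>R w)) (at t within S)"
    using der by (simp add: has_vector_derivative_def)
  have "(T has_derivative (\<lambda>v. (l \<bullet> v) / (l \<bullet> dir (g t)))) (at (shadow (g t)))" using dT[of 0] d by simp
  from has_derivative_compose[OF dg this]
  have du: "(?u has_vector_derivative ?c) (at t within S)"
    by (simp add: has_vector_derivative_def)
  have "((\<lambda>t. shadow (\<sigma> t)) has_vector_derivative dir (\<sigma> 0)) (at 0)" using ic[of 0] d by (simp add: integral_at_def)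
  then have "((\<lambda>t. shadow (\<sigma> t)) has_vector_derivative dir (g t)) (at (?u t) within ?u ` S)"
    using u0 d by (auto intro: has_vector_derivative_at_within)
  from vector_diff_chain_within[OF du this]
  have A1: "((\<lambda>s. shadow (\<sigma> (?u s))) has_vector_derivative ?c *\<^sub>R dir (g t)) (at t within S)" by (simp add: o_def)
  have A2: "shadow (\<sigma> (?u t)) = shadow (g t)" using u0 d by simp
  have A3: "\<forall>\<^sub>F s in at t within S. shadow (\<sigma> (?u s)) = shadow (g s)"
    using gs by eventually_elim simp
  have "((\<lambda>s. shadow (g s)) has_vector_derivative ?c *\<^sub>R dir (g t)) (at t within S)"
    unfolding has_vector_derivative_def
    by (rule has_derivative_transform_eventually[OF A1[unfolded has_vector_derivative_def] A3 A2 nb(2)])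
  then have "w = ?c *\<^sub>R dir (g t)" by (rule vector_derivative_unique_within[OF nb(1) der])
  then show ?thesis by (rule exI)
qed

text \<open>In terms of the time function of the local double arc, both curves have speed 1 and start at
  the same time.\<close>

lemma integral_curves_agree_near:
  assumes e: "0 < e" and g: "\<And>s. \<bar>s - t\<bar> < e \<Longrightarrow> ic g s" and h: "\<And>s. \<bar>s - t\<bar> < e \<Longrightarrow> ic h s" and eq: "g t = h t"
  shows "\<exists>e'>0. \<forall>s. \<bar>s - t\<bar> < e' \<longrightarrow> g s = h s"
proof -
  have gt: "g t \<in> mixed" using g[of t] e by (simp add: integral_at_def)
  obtain d \<sigma> O' T l where d: "0 < (d::real)" "openin M O'" "g t \<in> O'" "\<sigma> 0 = g t"
    and ic: "\<And>t. \<bar>t\<bar> < d \<Longrightarrow> ic \<sigma> t" and O': "mixed \<inter> O' \<subseteq> \<sigma> ` {-d<..<d}" and T: "\<And>t. \<bar>t\<bar> < d \<Longrightarrow> T (shadow (\<sigma> t)) = t"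
    and l: "\<And>t. \<bar>t\<bar> < d \<Longrightarrow> 0 < l \<bullet> dir (\<sigma> t)"
    and dT: "\<And>t. \<bar>t\<bar> < d \<Longrightarrow> (T has_derivative (\<lambda>v. (l \<bullet> v) / (l \<bullet> dir (\<sigma> t)))) (at (shadow (\<sigma> t)))"
    by (rule local_time[OF gt]) (rule that, assumption+)
  have *: "\<exists>e'>0. \<forall>s. \<bar>s - t\<bar> < e' \<longrightarrow> k s = \<sigma> (s - t)"
    if k: "\<And>s. \<bar>s - t\<bar> < e \<Longrightarrow> ic k s" and kt: "k t = g t" for k
  proof -
    have "\<forall>\<^sub>F s in at t. k s \<in> O'" using k[of t] e d kt by (auto simp: integral_at_def limitin_def)
    then obtain r where r: "r > 0" "\<And>s. \<lbrakk>s \<noteq> t; \<bar>s - t\<bar> < r\<rbrakk> \<Longrightarrow> k s \<in> O'"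
      unfolding eventually_at dist_real_def by auto
    let ?r = "min r e"
    let ?u = "\<lambda>s. T (shadow (k s))"
    have ks: "k s = \<sigma> (?u s) \<and> \<bar>?u s\<bar> < d" if "\<bar>s - t\<bar> < ?r" for s
    proof -
      have "k s \<in> O'" using r(2)[of s] that kt d by (cases "s = t") auto
      moreover have "k s \<in> mixed" using k[of s] that by (simp add: integral_at_def)
      ultimately obtain \<tau> where "\<tau> \<in> {-d<..<d}" "k s = \<sigma> \<tau>" using O' by blast
      then show ?thesis using T[of \<tau>] by auto
    qed
    have du: "(?u has_real_derivative 1) (at s)" if s: "\<bar>s - t\<bar> < ?r" for s
    proof -
      have "((\<lambda>s. shadow (k s)) has_derivative (\<lambda>x. x *\<^sub>R dir (k s))) (at s)"
        using k[of s] s by (simp add: integral_at_def has_vector_derivative_def)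
      moreover have "(T has_derivative (\<lambda>v. (l \<bullet> v) / (l \<bullet> dir (k s)))) (at (shadow (k s)))"
        using dT[of "?u s"] ks[OF s] by auto
      ultimately have "(?u has_derivative (\<lambda>x. (l \<bullet> (x *\<^sub>R dir (k s))) / (l \<bullet> dir (k s)))) (at s)"
        by (rule has_derivative_compose)
      moreover have "0 < l \<bullet> dir (k s)" using l[of "?u s"] ks[OF s] by auto
      ultimately have "(?u has_derivative (\<lambda>x. x)) (at s)" by simp
      then show ?thesis unfolding has_field_derivative_def
        by (rule has_derivative_eq_rhs) auto
    qed
    have us: "?u s = s - t" if s: "\<bar>s - t\<bar> < ?r" for s
    proof -
      have "((\<lambda>s. ?u s - s) has_real_derivative 0) (at x within ball t ?r)" if "x \<in> ball t ?r" for x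
      proof -
        have "\<bar>x - t\<bar> < ?r" using that by (simp add: dist_real_def abs_minus_commute)
        from DERIV_diff[OF du[OF this] DERIV_ident]
        show ?thesis using has_field_derivative_at_within by fastforce
      qed
      then obtain c where c: "\<And>x. x \<in> ball t ?r \<Longrightarrow> ?u x - x = c"
        using has_field_derivative_zero_constant[of "ball t ?r" "\<lambda>s. ?u s - s"] by auto
      have "?u t = 0" using T[of 0] d kt by simp
      moreover have "s \<in> ball t ?r" "t \<in> ball t ?r" using s r e by (auto simp: dist_real_def abs_minus_commute)
      ultimately show ?thesis using c[of s] c[of t] by simp
    qed
    show ?thesis
    proof (intro exI[of _ ?r] conjI allI impI)
      show "k s = \<sigma> (s - t)" if "\<bar>s - t\<bar> < ?r" for s using ks[OF that] us[OF that] by simp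
    qed (use r e in auto)
  qed
  obtain e1 where e1: "e1 > 0" "\<And>s. \<bar>s - t\<bar> < e1 \<Longrightarrow> g s = \<sigma> (s - t)" using *[OF g refl] by blast
  obtain e2 where e2: "e2 > 0" "\<And>s. \<bar>s - t\<bar> < e2 \<Longrightarrow> h s = \<sigma> (s - t)" using *[OF h eq[symmetric]] by blast
  show ?thesis by (rule exI[of _ "min e1 e2"]) (use e1 e2 in auto)
qed

lemma integral_curves_unique:
  assumes g: "\<And>s. \<lbrakk>a < s; s < b\<rbrakk> \<Longrightarrow> ic g s" and h: "\<And>s. \<lbrakk>a < s; s < b\<rbrakk> \<Longrightarrow> ic h s"
    and t: "a < t" "t < b" "g t = h t" and s: "a < s" "s < b"
  shows "g s = h s"
proof -
  let ?J = "{a<..<b}"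
  let ?E = "{s\<in>?J. g s = h s}"
  have c: "continuous_map (top_of_set ?J) M g" "continuous_map (top_of_set ?J) M h"
    by (rule continuous_map_limitin_at; use g h in \<open>auto simp: integral_at_def\<close>)+
  have "closedin (top_of_set ?J) ?E"
    using closedin_continuous_maps_eq[OF Hausdorff c] by simp
  moreover have "open ?E"
  proof (subst open_subopen, clarify)
    fix x assume x: "x \<in> ?J" "g x = h x"
    obtain e where e: "e > 0" "ball x e \<subseteq> ?J"
      using open_contains_ball[THEN iffD1, OF open_greaterThanLessThan[of a b]] x(1) by blast
    have "a < s \<and> s < b" if "\<bar>s - x\<bar> < e" for s
      using e(2) that by (auto simp: subset_iff dist_real_def abs_minus_commute)
    then obtain e' where e': "e' > 0" "\<And>s. \<bar>s - x\<bar> < e' \<Longrightarrow> g s = h s"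
      using integral_curves_agree_near[OF e(1), of x g h] g h x(2) by blast
    have "ball x (min e e') \<subseteq> ?E"
    proof
      fix s assume "s \<in> ball x (min e e')"
      then have "s \<in> ball x e" "\<bar>s - x\<bar> < e'" by (auto simp: dist_real_def abs_minus_commute)
      then show "s \<in> ?E" using e(2) e'(2)[of s] by blast
    qed
    moreover have "x \<in> ball x (min e e')" using e(1) e'(1) by simp
    ultimately show "\<exists>T. open T \<and> x \<in> T \<and> T \<subseteq> ?E" using open_ball by blast
  qed
  then have "openin (top_of_set ?J) ?E" by (intro open_subset) auto
  moreover have "connected ?J" by simp
  ultimately have "?E = {} \<or> ?E = ?J" unfolding connected_clopen by blast
  moreover have "t \<in> ?E" using t by simp
  ultimately have "?E = ?J" by blast
  moreover have "s \<in> ?J" using s by simp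
  ultimately show ?thesis by blast
qed

end

section \<open>The crossing flow\<close>

context diagram begin

text \<open>The time interval is twice as long as the arc that covers the neighbourhood, so that the same curve,
  shifted in time, serves all points of that arc.\<close>

lemma local_curve_small:
  assumes p: "p \<in> mixed" and eps: "0 < eps"
  obtains e \<sigma> O' where "0 < (e::real)" "e \<le> eps" "openin M O'" "p \<in> O'" "\<sigma> 0 = p"
    "\<And>t. \<bar>t\<bar> < 2 * e \<Longrightarrow> ic \<sigma> t" "inj_on \<sigma> {-(2*e)<..<2*e}" "mixed \<inter> O' \<subseteq> \<sigma> ` {-e<..<e}"
proof -
  obtain d \<sigma> O' T l where d: "0 < (d::real)" "openin M O'" "p \<in> O'" "\<sigma> 0 = p"
    and ic: "\<And>t. \<bar>t\<bar> < d \<Longrightarrow> ic \<sigma> t" and O': "mixed \<inter> O' \<subseteq> \<sigma> ` {-d<..<d}" and T: "\<And>t. \<bar>t\<bar> < d \<Longrightarrow> T (shadow (\<sigma> t)) = t"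
    and l: "\<And>t. \<bar>t\<bar> < d \<Longrightarrow> 0 < l \<bullet> dir (\<sigma> t)"
    and dT: "\<And>t. \<bar>t\<bar> < d \<Longrightarrow> (T has_derivative (\<lambda>v. (l \<bullet> v) / (l \<bullet> dir (\<sigma> t)))) (at (shadow (\<sigma> t)))"
    by (rule local_time[OF p]) (rule that, assumption+)
  define e where "e = min eps (d/2)"
  have e: "0 < e" "e \<le> eps" "2 * e \<le> d" using eps d by (auto simp: e_def)
  have "isCont T (shadow p)" using dT[of 0] d has_derivative_continuous by force
  moreover have "T (shadow p) = 0" using T[of 0] d by simp
  ultimately obtain \<delta> where \<delta>: "\<delta> > 0" "\<And>y. dist y (shadow p) < \<delta> \<Longrightarrow> \<bar>T y\<bar> < e"
    unfolding continuous_at_eps_delta using e(1) by (auto simp: dist_norm)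
  let ?O = "O' \<inter> {x \<in> topspace M. shadow x \<in> ball (shadow p) \<delta>}"
  show thesis
  proof (rule that[of e ?O \<sigma>])
    have "openin M {x \<in> topspace M. shadow x \<in> ball (shadow p) \<delta>}"
      by (rule openin_continuous_map_preimage[OF continuous_shadow]) simp
    then show "openin M ?O" using d(2) by blast
    show "p \<in> ?O" using d(3) \<delta>(1) partner(1)[OF p] by simp
    show "ic \<sigma> t" if "\<bar>t\<bar> < 2 * e" for t using ic that e(3) by simp
    show "inj_on \<sigma> {-(2*e)<..<2*e}"
    proof (rule inj_onI)
      fix s t assume st: "s \<in> {-(2*e)<..<2*e}" "t \<in> {-(2*e)<..<2*e}" "\<sigma> s = \<sigma> t"
      then have "\<bar>s\<bar> < d" "\<bar>t\<bar> < d" using e(3) by auto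
      then have "T (shadow (\<sigma> s)) = s" "T (shadow (\<sigma> t)) = t" using T by blast+
      then show "s = t" unfolding st(3) by metis
    qed
    show "mixed \<inter> ?O \<subseteq> \<sigma> ` {-e<..<e}"
    proof
      fix x assume x: "x \<in> mixed \<inter> ?O"
      then obtain t where t: "t \<in> {-d<..<d}" "x = \<sigma> t" using O' by blast
      have "\<bar>T (shadow x)\<bar> < e" using x by (intro \<delta>) (simp add: dist_commute)
      moreover have "T (shadow x) = t" using T[of t] t by auto
      ultimately show "x \<in> \<sigma> ` {-e<..<e}" using t(2) by (intro image_eqI[of _ _ t]) auto
    qed
  qed (use d e in auto)
qed

text \<open>Integral curves exist locally for a time that can be chosen uniformly in a neighbourhood, and
  finitely many neighbourhoods cover the compact set of mixed points.\<close>

lemma uniform_time: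
  obtains \<eta> where "0 < (\<eta>::real)" "\<And>p. p \<in> mixed \<Longrightarrow> \<exists>g. g 0 = p \<and> (\<forall>t. \<bar>t\<bar> < 2 * \<eta> \<longrightarrow> ic g t)"
proof -
  define good where "good O' e \<longleftrightarrow> 0 < (e::real) \<and> (\<forall>x\<in>mixed \<inter> O'. \<exists>g. g 0 = x \<and> (\<forall>t. \<bar>t\<bar> < 2 * e \<longrightarrow> ic g t))" for O' e
  have "\<exists>O'. openin M O' \<and> p \<in> O' \<and> (\<exists>e. good O' e)" if p: "p \<in> mixed" for p
  proof -
    obtain e \<sigma> O' where e: "0 < (e::real)" "e \<le> 1" "openin M O'" "p \<in> O'" "\<sigma> 0 = p"
      "\<And>t. \<bar>t\<bar> < 2 * e \<Longrightarrow> ic \<sigma> t" "inj_on \<sigma> {-(2*e)<..<2*e}" "mixed \<inter> O' \<subseteq> \<sigma> ` {-e<..<e}"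
      by (rule local_curve_small[OF p zero_less_one]) (rule that, assumption+)
    have "good O' (e/2)" unfolding good_def
    proof (intro conjI ballI)
      fix x assume "x \<in> mixed \<inter> O'"
      then obtain s where s: "s \<in> {-e<..<e}" "x = \<sigma> s" using e(8) by blast
      have "ic (\<lambda>t. \<sigma> (t + s)) t" if "\<bar>t\<bar> < 2 * (e/2)" for t
        by (rule integral_at_shift, rule e(6)) (use that s in auto)
      then show "\<exists>g. g 0 = x \<and> (\<forall>t. \<bar>t\<bar> < 2 * (e/2) \<longrightarrow> ic g t)"
        using s by (intro exI[of _ "\<lambda>t. \<sigma> (t + s)"]) auto
    qed (use e in auto)
    then show ?thesis using e(3,4) by blast
  qed
  then have cov: "mixed \<subseteq> \<Union>{O'. openin M O' \<and> (\<exists>e. good O' e)}" by blast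
  obtain F where F: "finite F" "F \<subseteq> {O'. openin M O' \<and> (\<exists>e. good O' e)}" "mixed \<subseteq> \<Union>F"
    using compactinD[OF compact_mixed _ cov] by auto
  have "\<forall>O'\<in>F. \<exists>e. good O' e" using F(2) by blast
  then obtain e where e: "\<And>O'. O' \<in> F \<Longrightarrow> good O' (e O')" by metis
  define \<eta> where "\<eta> = Min (insert 1 (e ` F))"
  have fin: "finite (insert 1 (e ` F))" using F by simp
  show thesis
  proof (rule that[of \<eta>])
    have "\<forall>x\<in>insert 1 (e ` F). 0 < x" using e by (auto simp: good_def)
    then show "0 < \<eta>" unfolding \<eta>_def using fin by simp
    fix p assume p: "p \<in> mixed"
    then obtain O' where O': "O' \<in> F" "p \<in> O'" using F(3) by blast
    have le: "\<eta> \<le> e O'" unfolding \<eta>_def using fin O' by simp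
    obtain g where "g 0 = p" "\<forall>t. \<bar>t\<bar> < 2 * e O' \<longrightarrow> ic g t"
      using e[OF O'(1)] p O'(2) unfolding good_def by blast
    then show "\<exists>g. g 0 = p \<and> (\<forall>t. \<bar>t\<bar> < 2 * \<eta> \<longrightarrow> ic g t)" using le by (intro exI[of _ g]) auto
  qed
qed

lemma extend_integral_curve:
  assumes \<eta>: "0 < \<eta>" "\<And>p. p \<in> mixed \<Longrightarrow> \<exists>g. g 0 = p \<and> (\<forall>t. \<bar>t\<bar> < 2 * \<eta> \<longrightarrow> ic g t)"
    and a: "2 * \<eta> \<le> a" and g: "\<And>t. \<bar>t\<bar> < a \<Longrightarrow> ic g t"
  shows "\<exists>G. G 0 = g 0 \<and> (\<forall>t. \<bar>t\<bar> < a + \<eta> \<longrightarrow> ic G t)"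
proof -
  let ?r = "a - \<eta>"
  have r: "0 < ?r" "?r < a" using a \<eta>(1) by auto
  have "g ?r \<in> mixed" "g (-?r) \<in> mixed" using g[of ?r] g[of "-?r"] r by (auto simp: integral_at_def)
  then obtain h k where h: "h 0 = g ?r" "\<And>t. \<bar>t\<bar> < 2 * \<eta> \<Longrightarrow> ic h t" and k: "k 0 = g (-?r)" "\<And>t. \<bar>t\<bar> < 2 * \<eta> \<Longrightarrow> ic k t"
    using \<eta>(2) by metis
  define h' where "h' s = h (s + - ?r)" for s
  define k' where "k' s = k (s + ?r)" for s
  have ich: "ic h' s" if "a - 3 * \<eta> < s" "s < a + \<eta>" for s
    unfolding h'_def by (rule integral_at_shift, rule h(2)) (use that in \<open>auto simp: abs_less_iff\<close>)
  have ick: "ic k' s" if "- a - \<eta> < s" "s < - a + 3 * \<eta>" for s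
    unfolding k'_def by (rule integral_at_shift, rule k(2)) (use that in \<open>auto simp: abs_less_iff\<close>)
  have gh: "g s = h' s" if "a - 2 * \<eta> < s" "s < a" for s
    by (rule integral_curves_unique[of "a - 2 * \<eta>" a g h' ?r s])
      (use that a \<eta>(1) in \<open>auto intro!: g ich simp: abs_less_iff h'_def h(1)\<close>)
  have gk: "g s = k' s" if "- a < s" "s < - a + 2 * \<eta>" for s
    by (rule integral_curves_unique[of "- a" "- a + 2 * \<eta>" g k' "- ?r" s])
      (use that a \<eta>(1) in \<open>auto intro!: g ick simp: abs_less_iff k'_def k(1)\<close>)
  define G where "G s = (if s \<le> - ?r then k' s else if s < ?r then g s else h' s)" for s
  have Gh: "G s = h' s" if "a - 2 * \<eta> < s" "s < a + \<eta>" for s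
    using that gh[of s] a \<eta>(1) by (auto simp: G_def)
  have Gk: "G s = k' s" if "- a - \<eta> < s" "s < - a + 2 * \<eta>" for s
    using that gk[of s] a \<eta>(1) by (auto simp: G_def)
  have "ic G t" if t: "\<bar>t\<bar> < a + \<eta>" for t
  proof -
    consider "a - 2 * \<eta> < t" | "t < - a + 2 * \<eta>" | "- ?r < t" "t < ?r" using \<eta>(1) a by linarith
    then show ?thesis
    proof cases
      case 1
      show ?thesis by (rule integral_at_cong[OF ich, of t "{a - 2 * \<eta><..<a + \<eta>}"]) (use 1 t \<eta>(1) Gh in auto)
    next
      case 2
      show ?thesis by (rule integral_at_cong[OF ick, of t "{- a - \<eta><..<- a + 2 * \<eta>}"]) (use 2 t \<eta>(1) Gk in auto)
    next
      case 3
      show ?thesis by (rule integral_at_cong[OF g, of t "{- ?r<..<?r}"]) (use 3 \<eta>(1) in \<open>auto simp: G_def\<close>)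
    qed
  qed
  moreover have "G 0 = g 0" using r by (simp add: G_def)
  ultimately show ?thesis by blast
qed

lemma global_integral_curve:
  assumes p: "p \<in> mixed" shows "\<exists>g. g 0 = p \<and> (\<forall>t. ic g t)"
proof -
  obtain \<eta> where \<eta>: "0 < (\<eta>::real)" "\<And>p. p \<in> mixed \<Longrightarrow> \<exists>g. g 0 = p \<and> (\<forall>t. \<bar>t\<bar> < 2 * \<eta> \<longrightarrow> ic g t)"
    by (rule uniform_time) (rule that, assumption+)
  have "\<exists>g. g 0 = p \<and> (\<forall>t. \<bar>t\<bar> < (real n + 2) * \<eta> \<longrightarrow> ic g t)" for n
  proof (induction n)
    case 0
    then show ?case using \<eta>(2)[OF p] by simp
  next
    case (Suc n)
    then obtain g where g: "g 0 = p" "\<And>t. \<bar>t\<bar> < (real n + 2) * \<eta> \<Longrightarrow> ic g t" by blast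
    have "2 * \<eta> \<le> (real n + 2) * \<eta>" using \<eta>(1) by (simp add: distrib_right)
    from extend_integral_curve[OF \<eta> this g(2)]
    obtain G where "G 0 = g 0" "\<forall>t. \<bar>t\<bar> < (real n + 2) * \<eta> + \<eta> \<longrightarrow> ic G t" by blast
    moreover have "(real (Suc n) + 2) * \<eta> = (real n + 2) * \<eta> + \<eta>" by (simp add: algebra_simps)
    ultimately show ?case using g(1) by (intro exI[of _ G]) simp
  qed
  then obtain G where G: "\<And>n::nat. G n 0 = p" "\<And>n t. \<bar>t\<bar> < (real n + 2) * \<eta> \<Longrightarrow> ic (G n) t" by metis
  have agree: "G m t = G n t" if "\<bar>t\<bar> < (real m + 2) * \<eta>" "\<bar>t\<bar> < (real n + 2) * \<eta>" for m n t
  proof -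
    let ?b = "min ((real m + 2) * \<eta>) ((real n + 2) * \<eta>)"
    have "0 < ?b" using \<eta>(1) by (simp add: add_pos_pos add_nonneg_pos)
    show ?thesis
      by (rule integral_curves_unique[of "- ?b" ?b "G m" "G n" 0 t]) (use that G \<open>0 < ?b\<close> in \<open>auto simp: abs_less_iff\<close>)
  qed
  define N where "N t = nat \<lceil>\<bar>t\<bar> / \<eta>\<rceil>" for t :: real
  have N: "\<bar>t\<bar> \<le> real (N t) * \<eta>" for t
  proof -
    have "\<bar>t\<bar> / \<eta> \<le> real (N t)" unfolding N_def by linarith
    then show ?thesis using \<eta>(1) by (simp add: pos_divide_le_eq)
  qed
  have N': "\<bar>t\<bar> < (real (N t) + 2) * \<eta>" for t
    using N[of t] \<eta>(1) by (simp add: distrib_right)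
  define g where "g t = G (N t) t" for t
  have "ic g t" for t
  proof (rule integral_at_cong[OF G(2)[OF N'[of t]], of "{s. \<bar>s\<bar> < (real (N t) + 2) * \<eta>}"])
    show "open {s. \<bar>s\<bar> < (real (N t) + 2) * \<eta>}" by (intro open_Collect_less continuous_intros)
    show "g s = G (N t) s" if "s \<in> {s. \<bar>s\<bar> < (real (N t) + 2) * \<eta>}" for s
      unfolding g_def by (rule agree[OF N']) (use that in auto)
  qed (use N' in auto)
  moreover have "g 0 = p" by (simp add: g_def G)
  ultimately show ?thesis by blast
qed

abbreviation flow :: "'a \<Rightarrow> real \<Rightarrow> 'a" where "flow \<equiv> crossing_flow M \<A> f"

lemma flow:
  assumes "p \<in> mixed" shows "flow p 0 = p" "\<And>t. ic (flow p) t"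
  using someI_ex[OF global_integral_curve[OF assms]] unfolding crossing_flow_def by blast+

lemma flow_unique:
  assumes p: "p \<in> mixed" and "a < 0" "0 < b" "g 0 = p" "\<And>s. \<lbrakk>a < s; s < b\<rbrakk> \<Longrightarrow> ic g s" and "a < t" "t < b"
  shows "g t = flow p t"
  by (rule integral_curves_unique[of a b g "flow p" 0 t]) (use assms flow[OF p] in auto)

text \<open>The field of crossing directions on the mixed double points integrates to a flow for all
  times, by compactness; its orbits are the circles of \<open>A_f\<close> with their orientations.\<close>

theorem circle_flow_mixed: "circle_flow M mixed flow"
proof
  show "Hausdorff_space M" by (rule Hausdorff)
  show "compactin M mixed" by (rule compact_mixed)
  fix p assume p: "p \<in> mixed"
  show "continuous_map euclideanreal M (flow p)"
    using continuous_map_limitin_at[of UNIV M "flow p"] flow(2)[OF p] by (simp add: integral_at_def)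
  show in': "flow p t \<in> mixed" for t using flow(2)[OF p, of t] by (simp add: integral_at_def)
  show "flow p 0 = p" by (rule flow(1)[OF p])
  show "flow (flow p s) t = flow p (s + t)" for s t
  proof -
    have "flow p (t + s) = flow (flow p s) t"
      by (rule flow_unique[OF in', of "- \<bar>t\<bar> - 1" "\<bar>t\<bar> + 1" "\<lambda>t. flow p (t + s)"])
        (auto intro: integral_at_shift flow(2)[OF p])
    then show ?thesis by (simp add: add.commute)
  qed
  show "\<exists>U. openin M U \<and> p \<in> U \<and> mixed \<inter> U \<subseteq> flow p ` {-e<..<e}" if "0 < e" for e
  proof -
    obtain d \<sigma> O' where d: "0 < (d::real)" "d \<le> e" "openin M O'" "p \<in> O'" "\<sigma> 0 = p"
      "\<And>t. \<bar>t\<bar> < 2 * d \<Longrightarrow> ic \<sigma> t" "inj_on \<sigma> {-(2*d)<..<2*d}" "mixed \<inter> O' \<subseteq> \<sigma> ` {-d<..<d}"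
      by (rule local_curve_small[OF p \<open>0 < e\<close>]) (rule that, assumption+)
    have "\<sigma> t = flow p t" if "t \<in> {-d<..<d}" for t
      by (rule flow_unique[OF p, of "-d" d]) (use d that in auto)
    moreover have "{-d<..<d} \<subseteq> {-e<..<e}" using d(2) by auto
    ultimately have "\<sigma> ` {-d<..<d} \<subseteq> flow p ` {-e<..<e}" by (metis (no_types, lifting) image_cong image_mono)
    with d(8) have "mixed \<inter> O' \<subseteq> flow p ` {-e<..<e}" by (rule subset_trans)
    with d(3,4) show ?thesis by (intro exI[of _ O'] conjI)
  qed
  show "\<exists>e>0. inj_on (flow p) {-e<..<e}"
  proof -
    obtain d \<sigma> O' where d: "0 < (d::real)" "d \<le> 1" "openin M O'" "p \<in> O'" "\<sigma> 0 = p"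
      "\<And>t. \<bar>t\<bar> < 2 * d \<Longrightarrow> ic \<sigma> t" "inj_on \<sigma> {-(2*d)<..<2*d}" "mixed \<inter> O' \<subseteq> \<sigma> ` {-d<..<d}"
      by (rule local_curve_small[OF p zero_less_one]) (rule that, assumption+)
    have "\<sigma> t = flow p t" if "t \<in> {-d<..<d}" for t
      by (rule flow_unique[OF p, of "-d" d]) (use d that in auto)
    moreover have "inj_on \<sigma> {-d<..<d}" by (rule inj_on_subset[OF d(7)]) (use d in auto)
    ultimately have "inj_on (flow p) {-d<..<d}" using inj_on_cong[of "{-d<..<d}" \<sigma> "flow p"] by blast
    then show ?thesis using d(1) by blast
  qed
qed

end

section \<open>The circles of \<open>A_f\<close> as orbits\<close>

context circle_flow begin

lemma subflow:
  assumes Y: "Y \<subseteq> Z" and inv: "\<And>p. p \<in> Y \<Longrightarrow> orbit p \<subseteq> Y"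
  shows "circle_flow M Y \<phi>"
proof
  have "Z - Y = \<Union>(orbit ` (Z - Y))"
  proof
    show "Z - Y \<subseteq> \<Union>(orbit ` (Z - Y))" using self_orbit by blast
    show "\<Union>(orbit ` (Z - Y)) \<subseteq> Z - Y"
    proof clarify
      fix p q assume pq: "p \<in> Z" "p \<notin> Y" "q \<in> orbit p"
      have "p \<in> orbit q" using orbit_eq[OF pq(1,3)] self_orbit[OF pq(1)] by simp
      then have "q \<notin> Y" using inv pq(2) by blast
      then show "q \<in> Z - Y" using orbit_subset[OF pq(1)] pq(3) by blast
    qed
  qed
  moreover have "openin (subtopology M Z) (\<Union>(orbit ` (Z - Y)))"
    by (intro openin_Union) (auto intro: openin_orbit)
  ultimately have "openin (subtopology M Z) (topspace (subtopology M Z) - Y)"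
    using Z_subset by (simp add: inf_absorb2)
  then have "closedin (subtopology M Z) Y"
    using Y Z_subset by (simp add: closedin_def inf_absorb2)
  then show "compactin M Y"
    using closedin_compact_space[of "subtopology M Z" Y] compact
    by (simp add: compact_space_subtopology compactin_subtopology)
  show "Hausdorff_space M" by (rule Hausdorff)
  fix p assume pY: "p \<in> Y"
  then have p: "p \<in> Z" using Y by blast
  show "continuous_map euclideanreal M (\<phi> p)" "\<phi> p 0 = p" by (rule cont[OF p], rule zero[OF p])
  show "\<phi> p t \<in> Y" for t using inv[OF pY] by (auto simp: orbit_def)
  show "\<phi> (\<phi> p s) t = \<phi> p (s + t)" for s t by (rule add[OF p])
  show "\<exists>e>0. inj_on (\<phi> p) {-e<..<e}" by (rule locally_inj[OF p])
  show "\<exists>U. openin M U \<and> p \<in> U \<and> Y \<inter> U \<subseteq> \<phi> p ` {-e<..<e}" if "0 < e" for e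
    using open_orbit[OF p that] Y by (meson Int_mono order_refl order_trans)
qed

end

context diagram begin

sublocale mf: circle_flow M mixed flow by (rule circle_flow_mixed)

abbreviation deckers :: "'a set" where "deckers \<equiv> double_decker M f"

lemma mixed_subset: "mixed \<subseteq> topspace M" by (auto simp: mixed_points_def)

lemma mixed_in_decker: "mixed \<subseteq> deckers"
proof -
  have "mixed \<subseteq> {p \<in> topspace M. \<exists>q \<in> topspace M. q \<noteq> p \<and> shadow q = shadow p}"
    using partner by blast
  then show ?thesis unfolding double_decker_def
    by (rule subset_trans) (rule closure_of_subset, auto)
qed

text \<open>Near a mixed double point its own sheet is injectively projected, so nearby double
  points are mixed, too.\<close>

lemma mixed_open_in_double_points:
  assumes p: "p \<in> mixed"
  obtains O' where "openin M O'" "p \<in> O'" "\<And>x y. \<lbrakk>x \<in> O'; y \<in> topspace M; y \<noteq> x; shadow y = shadow x\<rbrakk> \<Longrightarrow> x \<in> mixed"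
proof -
  note m = partner[OF p]
  obtain U \<phi> where U: "(U,\<phi>) \<in> \<A>" "p \<in> U" using chart_at[OF m(1)] .
  have pU: "\<phi> p \<in> \<phi> ` U" using U by blast
  obtain X V r where X: "open X" "\<phi> p \<in> X" "X \<subseteq> \<phi> ` U" "open V" "sheet U \<phi> ` X \<subseteq> V"
    "\<And>x. x \<in> X \<Longrightarrow> r (sheet U \<phi> x) = x" "\<And>y. y \<in> V \<Longrightarrow> r differentiable (at y)"
    by (rule immersion_local_retraction[OF chart(3)[OF U(1)] pU sheet(1)[OF U(1)] sheet(2)[OF U(1)] immersed_chart[OF p U]])
      (assumption+, rule that, assumption+)
  define N where "N = {x\<in>U. \<phi> x \<in> X}"
  have N: "openin M N" "p \<in> N" using openin_chart_preimage[OF U(1) X(1)] U X(2) by (auto simp: N_def)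
  have injN: "x = y" if "x \<in> N" "y \<in> N" "shadow x = shadow y" for x y
  proof -
    have "\<phi> x = r (shadow x)" "\<phi> y = r (shadow y)"
      using that X(6)[of "\<phi> x"] X(6)[of "\<phi> y"] sheet_chart[OF U(1)] by (auto simp: N_def)
    then have "\<phi> x = \<phi> y" using that(3) by simp
    then show ?thesis using chart(4)[OF U(1)] that by (auto simp: N_def dest: inj_onD)
  qed
  let ?C = "connected_component_of_set M p"
  have pC: "p \<in> ?C" using m by (simp add: connected_component_of_refl)
  have "closedin M (?C - N)" using closedin_component N(1) by (rule closedin_diff)
  then have "compactin M (?C - N)" using closedin_compact_space[OF compact_space] by blast
  then have cl: "closed (shadow ` (?C - N))" using image_compactin[OF _ continuous_shadow] by (simp add: compact_imp_closed)
  have np: "shadow p \<notin> shadow ` (?C - N)"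
  proof
    assume "shadow p \<in> shadow ` (?C - N)"
    then obtain x where x: "x \<in> ?C" "x \<notin> N" "shadow x = shadow p" by auto
    then have "x \<in> topspace M" by (metis connected_component_of_refl connected_component_of_sym connected_component_of_trans mem_Collect_eq)
    then have "x = p \<or> x = mt p" using m(7) x(3) by blast
    then show False using x m(5) N(2) by auto
  qed
  let ?O = "?C \<inter> N \<inter> {x \<in> topspace M. shadow x \<in> - shadow ` (?C - N)}"
  show thesis
  proof (rule that[of ?O])
    have "openin M {x \<in> topspace M. shadow x \<in> - shadow ` (?C - N)}"
      by (rule openin_continuous_map_preimage[OF continuous_shadow]) (use cl in auto)
    then show "openin M ?O" using openin_component N(1) by blast
    show "p \<in> ?O" using pC np m(1) N(2) by simp
    fix x y assume xy: "x \<in> ?O" "y \<in> topspace M" "y \<noteq> x" "shadow y = shadow x"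
    have x: "x \<in> ?C" "x \<in> N" "x \<in> topspace M" "shadow x \<notin> shadow ` (?C - N)" using xy(1) by auto
    have "y \<notin> N" using injN[of x y] x(2) xy(3,4) by auto
    then have "y \<notin> ?C" using x(4) xy(4) by (metis DiffI imageI)
    then have "\<not> connected_component_of M x y" using x(1) by (metis connected_component_of_trans mem_Collect_eq)
    then show "x \<in> mixed" using x(3) xy by (auto simp: mixed_points_def)
  qed
qed

text \<open>A decker circle through a mixed point consists of mixed points. In particular it contains no
  branch point, so the analysis of immersed double points covers it.\<close>

lemma mixed_clopen: "openin (subtopology M deckers) mixed" "closedin (subtopology M deckers) mixed"
proof -
  show "closedin (subtopology M deckers) mixed"
    using closed_mixed mixed_in_decker by (simp add: closedin_subset_topspace)
  show "openin (subtopology M deckers) mixed"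
  proof (subst openin_subopen, clarify)
    fix p assume p: "p \<in> mixed"
    let ?D = "{p \<in> topspace M. \<exists>q \<in> topspace M. q \<noteq> p \<and> shadow q = shadow p}"
    obtain O' where O': "openin M O'" "p \<in> O'" "\<And>x y. \<lbrakk>x \<in> O'; y \<in> topspace M; y \<noteq> x; shadow y = shadow x\<rbrakk> \<Longrightarrow> x \<in> mixed"
      by (rule mixed_open_in_double_points[OF p]) (rule that, assumption+)
    have "O' \<inter> ?D \<subseteq> mixed" using O'(3) by blast
    have "O' \<inter> M closure_of ?D \<subseteq> M closure_of (O' \<inter> ?D)"
      by (rule openin_Int_closure_of_subset[OF O'(1)])
    also have "\<dots> \<subseteq> mixed" using closure_of_minimal[OF \<open>O' \<inter> ?D \<subseteq> mixed\<close> closed_mixed] .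
    finally have "O' \<inter> deckers \<subseteq> mixed" by (simp add: double_decker_def)
    moreover have "openin (subtopology M deckers) (deckers \<inter> O')" using O'(1) by (rule openin_subtopology_Int2)
    ultimately show "\<exists>T. openin (subtopology M deckers) T \<and> p \<in> T \<and> T \<subseteq> mixed"
      using p mixed_in_decker O'(2) by (intro exI[of _ "deckers \<inter> O'"]) auto
  qed
qed

lemma component_in_mixed:
  assumes c: "connectedin (subtopology M deckers) c" "c \<inter> mixed \<noteq> {}" shows "c \<subseteq> mixed"
  using connectedin_clopen_cases[OF c(1) mixed_clopen(2,1)] c(2) by (auto simp: disjnt_iff)

lemma subtopology_mixed: "subtopology (subtopology M deckers) mixed = subtopology M mixed"
  by (simp add: subtopology_subtopology inf_absorb2 mixed_in_decker)

text \<open>A decker circle over two components meets the mixed points, hence consists of them, since the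
  mixed points are open and closed in the double decker set.\<close>

theorem A_circles_eq: "A_circles M f = mf.orbits"
  unfolding mf.orbits_eq_components
proof
  show "A_circles M f \<subseteq> connected_components_of (subtopology M mixed)"
  proof
    fix c assume "c \<in> A_circles M f"
    then obtain K L where c: "c \<in> connected_components_of (subtopology M deckers)"
      and KL: "K \<in> connected_components_of M" "L \<in> connected_components_of M" "K \<noteq> L"
        "over_set M f c \<inter> K \<noteq> {}" "over_set M f c \<inter> L \<noteq> {}"
      by (auto simp: A_circles_def decker_circles_def)
    have con: "connectedin (subtopology M deckers) c" using c by (rule connectedin_connected_components_of)
    then have cM: "connectedin M c" by (simp add: connectedin_subtopology)
    have *: "c \<subseteq> mixed" if L: "L \<in> connected_components_of M" "over_set M f c \<inter> L \<noteq> {}" "\<not> c \<subseteq> L" for L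
    proof -
      obtain q p where q: "q \<in> L" "q \<in> topspace M" "p \<in> c" "shadow q = shadow p" using L(2) by (auto simp: over_set_def)
      have dis: "disjnt L c" using connected_components_of_maximal[OF L(1) cM] L(3) by blast
      have "\<not> connected_component_of M p q"
      proof
        assume "connected_component_of M p q"
        then obtain E where E: "connectedin M E" "p \<in> E" "q \<in> E" by (auto simp: connected_component_of_def)
        have "E \<subseteq> L" using connected_components_of_maximal[OF L(1) E(1)] E(3) q(1) by (auto simp: disjnt_iff)
        then show False using dis E(2) q(3) by (auto simp: disjnt_iff)
      qed
      moreover have "p \<in> topspace M" using q(3) cM connectedin_subset_topspace by blast
      ultimately have "p \<in> mixed" using q by (auto simp: mixed_points_def)
      then show ?thesis using component_in_mixed[OF con] q(3) by blast
    qed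
    have "\<not> (c \<subseteq> K \<and> c \<subseteq> L)"
      using connected_components_of_overlap[OF KL(1,2)] KL(3) nonempty_connected_components_of[OF c] by blast
    then have "c \<subseteq> mixed" using *[OF KL(1,4)] *[OF KL(2,5)] by blast
    from connected_components_of_subtopology[OF c this]
    show "c \<in> connected_components_of (subtopology M mixed)" by (simp add: subtopology_mixed)
  qed
  show "connected_components_of (subtopology M mixed) \<subseteq> A_circles M f"
  proof
    fix c assume c: "c \<in> connected_components_of (subtopology M mixed)"
    have con: "connectedin (subtopology M mixed) c" using c by (rule connectedin_connected_components_of)
    have csub: "c \<subseteq> mixed" using connected_components_of_subset[OF c] by auto
    have conM: "connectedin M c" using con by (simp add: connectedin_subtopology)
    then have conD: "connectedin (subtopology M deckers) c" using csub mixed_in_decker by (auto simp: connectedin_subtopology)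
    obtain p where p: "p \<in> c" using nonempty_connected_components_of[OF c] by blast
    have pm: "p \<in> mixed" using p csub by blast
    have "p \<in> deckers" "p \<in> topspace M" using pm mixed_in_decker mixed_subset by auto
    then have ne: "subtopology M deckers \<noteq> trivial_topology" by (auto simp: null_topspace_iff_trivial[symmetric])
    obtain E where E: "E \<in> connected_components_of (subtopology M deckers)" "c \<subseteq> E"
      using exists_connected_component_of_superset[OF conD ne] by blast
    have conE: "connectedin (subtopology M deckers) E" using E(1) by (rule connectedin_connected_components_of)
    have "E \<subseteq> mixed" using component_in_mixed[OF conE] p E(2) pm by blast
    then have "connectedin (subtopology M mixed) E" using conE by (auto simp: connectedin_subtopology)
    then have "E \<subseteq> c" using connected_components_of_maximal[OF c] p E(2) by (auto simp: disjnt_iff)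
    then have dc: "c \<in> decker_circles M f" using E by (simp add: decker_circles_def subset_antisym)
    let ?K = "connected_component_of_set M p" and ?L = "connected_component_of_set M (mt p)"
    note m = partner[OF pm]
    have KL: "?K \<in> connected_components_of M" "?L \<in> connected_components_of M"
      using m by (auto simp: connected_components_of_def)
    have "p \<in> over_set M f c \<inter> ?K" "mt p \<in> over_set M f c \<inter> ?L"
      using m p by (auto simp: over_set_def connected_component_of_refl)
    then have ne: "over_set M f c \<inter> ?K \<noteq> {}" "over_set M f c \<inter> ?L \<noteq> {}" by (metis empty_iff)+
    have "mt p \<in> ?L" "mt p \<notin> ?K" using m(2,5) by (simp_all add: connected_component_of_refl)
    then have "?K \<noteq> ?L" by metis
    then show "c \<in> A_circles M f"
      unfolding A_circles_def by (intro CollectI conjI dc bexI[OF _ KL(1)] bexI[OF _ KL(2)] ne)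
  qed
qed

lemma connected_mixed_component:
  assumes c: "connectedin M c" "c \<subseteq> mixed" "p \<in> c" "x \<in> c" shows "\<not> connected_component_of M p (mt x)"
proof
  assume "connected_component_of M p (mt x)"
  moreover have "connected_component_of M x p" using c by (auto simp: connected_component_of_def)
  ultimately have "connected_component_of M x (mt x)" by (rule connected_component_of_trans[rotated])
  then show False using partner(5)[of x] c by blast
qed

text \<open>The points over a mixed circle are the points of the circle and their partners, and the
  partners of points of a connected set lie on a component other than that of the set.\<close>

lemma mate_eq:
  assumes c: "c \<in> A_circles M f" shows "mate M f c = mt ` c" "c \<subseteq> mixed" "connectedin M c"
proof -
  obtain p where p: "p \<in> mixed" "c = mf.orbit p" using c by (auto simp: A_circles_eq mf.orbits_def)
  show sub: "c \<subseteq> mixed" using mf.orbit_subset[OF p(1)] p(2) by simp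
  show con: "connectedin M c" using mf.connectedin_orbit[OF p(1)] p(2) by (simp add: connectedin_subtopology)
  have "mt x \<notin> c" if "x \<in> c" for x
    using connected_mixed_component[OF con sub _ that, of "mt x"] partner(2)[of x] sub that
    by (auto simp: connected_component_of_refl)
  note notin = this
  show "mate M f c = mt ` c"
  proof
    show "mate M f c \<subseteq> mt ` c"
    proof
      fix q assume "q \<in> mate M f c"
      then obtain x where x: "q \<in> topspace M" "q \<notin> c" "x \<in> c" "shadow q = shadow x"
        by (auto simp: mate_def over_set_def)
      have "x \<in> mixed" using x(3) sub by blast
      from partner(7)[OF this x(1,4)] show "q \<in> mt ` c" using x(2,3) by blast
    qed
    show "mt ` c \<subseteq> mate M f c"
    proof clarify
      fix x assume x: "x \<in> c"
      then have xm: "x \<in> mixed" using sub by blast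
      have "shadow (mt x) \<in> proj ` f ` c" unfolding partner(4)[OF xm] using x by blast
      then show "mt x \<in> mate M f c"
        using notin[OF x] partner(2)[OF xm] by (simp add: mate_def over_set_def)
    qed
  qed
qed

lemma homeomorphic_partner: "homeomorphic_map (subtopology M mixed) (subtopology M mixed) mt"
proof -
  have t: "topspace (subtopology M mixed) = mixed" using mixed_subset by auto
  have c: "continuous_map (subtopology M mixed) (subtopology M mixed) mt"
  proof (rule continuous_map_openin_preimage_eq[THEN iffD2], unfold t, intro conjI allI impI)
    show "mt \<in> mixed \<rightarrow> mixed" using partner_partner by blast
    fix U assume "openin (subtopology M mixed) U"
    then obtain V where V: "openin M V" "U = V \<inter> mixed" by (auto simp: openin_subtopology)
    show "openin (subtopology M mixed) (mixed \<inter> mt -` U)"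
    proof (subst openin_subopen, clarify)
      fix p assume p: "p \<in> mixed" "mt p \<in> U"
      obtain O' where O': "openin M O'" "p \<in> O'" "O' \<subseteq> connected_component_of_set M p" "\<And>x. x \<in> O' \<inter> mixed \<Longrightarrow> mt x \<in> V"
        by (rule partner_near[OF p(1) V(1)]) (use p V in blast, rule that, assumption+)
      have "mixed \<inter> O' \<subseteq> mixed \<inter> mt -` U" using O'(4) V(2) partner_partner by blast
      then show "\<exists>T. openin (subtopology M mixed) T \<and> p \<in> T \<and> T \<subseteq> mixed \<inter> mt -` U"
        using O'(1,2) p(1) by (intro exI[of _ "mixed \<inter> O'"]) (simp add: openin_subtopology_Int2)
    qed
  qed
  have "homeomorphic_maps (subtopology M mixed) (subtopology M mixed) mt mt"
    unfolding homeomorphic_maps_def t using c partner_partner by simp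
  then show ?thesis using homeomorphic_maps_map by blast
qed

lemma mate_A_circle:
  assumes c: "c \<in> A_circles M f" shows "mate M f c \<in> A_circles M f" "mate M f (mate M f c) = c"
proof -
  have "image mt ` connected_components_of (subtopology M mixed) = connected_components_of (subtopology M mixed)"
    using homeomorphic_map_connected_components_of[OF homeomorphic_partner] by simp
  then show 1: "mate M f c \<in> A_circles M f"
    using c mate_eq(1)[OF c] by (auto simp: A_circles_eq mf.orbits_eq_components)
  have "mt ` mt ` c = c" using partner_partner mate_eq(2)[OF c] by (force simp: image_iff)
  then show "mate M f (mate M f c) = c" using mate_eq(1)[OF 1] mate_eq(1)[OF c] by simp
qed

text \<open>The union of the circles whose classes are summed, described by a condition on single points so
  that it can be compared locally for two diagrams.\<close>

definition selected :: "('a set \<Rightarrow> nat) \<Rightarrow> 'a set" where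
  "selected col = {p \<in> mixed. height (f p) < height (f (mt p)) \<and> (\<exists>R\<in>regions M f. mt p \<in> R \<and> col R = 1)}"

lemma height_differs: "p \<in> mixed \<Longrightarrow> height (f p) \<noteq> height (f (mt p))"
proof
  assume p: "p \<in> mixed" and h: "height (f p) = height (f (mt p))"
  have s: "shadow p = shadow (mt p)" using partner(4)[OF p] by simp
  have "f p $ i = f (mt p) $ i" for i
  proof -
    have "proj (f p) $ 1 = proj (f (mt p)) $ 1" "proj (f p) $ 2 = proj (f (mt p)) $ 2" "proj (f p) $ 3 = proj (f (mt p)) $ 3"
      using s by simp_all
    then show ?thesis using h exhaust_4[of i] by (auto simp: proj_def height_def)
  qed
  then have "f p = f (mt p)" by (simp add: vec_eq_iff)
  then show False using inj_f partner[OF p] by (auto dest: inj_onD)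
qed

text \<open>The relative height and the colour of the mate's region are constant along a circle.\<close>

lemma selected_circle_cases:
  assumes c: "c \<in> A_circles M f"
  shows "mate M f c \<in> X_circles M f col \<longleftrightarrow> c \<subseteq> selected col" "c \<inter> selected col \<noteq> {} \<Longrightarrow> c \<subseteq> selected col"
proof -
  note m = mate_eq[OF c] and mm = mate_A_circle[OF c]
  have ne: "c \<noteq> {}" using c nonempty_connected_components_of by (auto simp: A_circles_eq mf.orbits_eq_components)
  have cov: "mate M f c \<subseteq> coloured_set M f" unfolding coloured_set_def using mm(1) by blast
  have "connectedin (subtopology M (coloured_set M f)) (mate M f c)"
    using mate_eq(3)[OF mm(1)] cov by (simp add: connectedin_subtopology)
  then have reg: "mate M f c \<subseteq> R" if "R \<in> regions M f" "x \<in> c" "mt x \<in> R" for R x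
    using connected_components_of_maximal[of R "subtopology M (coloured_set M f)" "mate M f c"] that m(1)
    by (auto simp: regions_def disjnt_iff)
  have cont: "continuous_map (subtopology M mixed) euclideanreal (\<lambda>p. height (f (mt p)) - height (f p))"
  proof -
    have h: "continuous_map M euclideanreal (\<lambda>p. height (f p))"
      using continuous_map_compose[OF continuous_f, of euclideanreal height]
      by (simp add: o_def height_def[abs_def] continuous_on_component)
    have "continuous_map (subtopology M mixed) M mt"
      using homeomorphic_imp_continuous_map[OF homeomorphic_partner] by (simp add: continuous_map_in_subtopology)
    from continuous_map_compose[OF this h]
    have "continuous_map (subtopology M mixed) euclideanreal (\<lambda>p. height (f (mt p)))" by (simp add: o_def)
    then show ?thesis by (intro continuous_map_diff continuous_map_from_subtopology[OF h])
  qed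
  have con: "connected ((\<lambda>p. height (f (mt p)) - height (f p)) ` c)"
    using connectedin_continuous_map_image[OF cont, of c] m(2,3) by (simp add: connectedin_subtopology connectedin_iff_connected)
  have higher: "height (f y) < height (f (mt y))" if "x \<in> c" "height (f x) < height (f (mt x))" "y \<in> c" for x y
  proof (rule ccontr)
    assume n: "\<not> ?thesis"
    have "0 \<in> (\<lambda>p. height (f (mt p)) - height (f p)) ` c"
      by (rule connectedD_interval[OF con, of "height (f (mt y)) - height (f y)" "height (f (mt x)) - height (f x)"])
        (use that n in auto)
    then obtain z where z: "z \<in> c" "height (f (mt z)) - height (f z) = 0" by (elim imageE) metis
    then have "z \<in> mixed" using m(2) by blast
    then show False using height_differs z(2) by force
  qed
  show "c \<subseteq> selected col" if "c \<inter> selected col \<noteq> {}"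
  proof
    obtain x R where x: "x \<in> c" "height (f x) < height (f (mt x))" "R \<in> regions M f" "mt x \<in> R" "col R = 1"
      using \<open>c \<inter> selected col \<noteq> {}\<close> by (auto simp: selected_def)
    fix y assume y: "y \<in> c"
    then show "y \<in> selected col"
      using higher[OF x(1,2) y] reg[OF x(3,1,4)] m x(3,5) unfolding selected_def by blast
  qed
  show "mate M f c \<in> X_circles M f col \<longleftrightarrow> c \<subseteq> selected col"
  proof
    assume X: "mate M f c \<in> X_circles M f col"
    have X1: "\<exists>R\<in>regions M f. mate M f c \<subseteq> R \<and> col R = 1" using X unfolding X_circles_def by (elim CollectE conjE)
    have X2: "\<forall>p\<in>mate M f c. \<forall>q\<in>mate M f (mate M f c). shadow q = shadow p \<longrightarrow> height (f q) < height (f p)"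
      using X unfolding X_circles_def by (elim CollectE conjE)
    obtain R where R: "R \<in> regions M f" "mt ` c \<subseteq> R" "col R = 1" using X1 unfolding m(1) by (elim bexE conjE)
    have hi: "height (f q) < height (f p)" if "p \<in> mt ` c" "q \<in> c" "shadow q = shadow p" for p q
      using X2[unfolded mm(2), unfolded m(1)] that by (metis (no_types, lifting))
    show "c \<subseteq> selected col"
    proof
      fix x assume x: "x \<in> c"
      then have "height (f x) < height (f (mt x))" using hi[of "mt x" x] partner(4)[of x] m(2) by auto
      then show "x \<in> selected col" using x R m(2) unfolding selected_def by blast
    qed
  next
    assume sel: "c \<subseteq> selected col"
    obtain x where x: "x \<in> c" using ne by blast
    then obtain R where R: "R \<in> regions M f" "mt x \<in> R" "col R = 1" using sel by (auto simp: selected_def)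
    have "height (f q) < height (f p)" if pq: "p \<in> mt ` c" "q \<in> c" "shadow q = shadow p" for p q
    proof -
      obtain y where y: "y \<in> c" "p = mt y" using pq(1) by blast
      have ym: "y \<in> mixed" using y m(2) by blast
      have "q = y \<or> q = mt y" using partner(7)[OF ym, of q] pq y partner(4)[OF ym] m(2) mixed_subset by auto
      moreover have "mt y \<notin> c"
        using connected_mixed_component[OF m(3,2) _ y(1), of "mt y"] partner(2)[OF ym] by (auto simp: connected_component_of_refl)
      ultimately have "q = y" using pq(2) by blast
      then show ?thesis using sel y by (auto simp: selected_def)
    qed
    then have "\<forall>p\<in>mate M f c. \<forall>q\<in>mate M f (mate M f c). shadow q = shadow p \<longrightarrow> height (f q) < height (f p)"
      by (subst mm(2), subst m(1)) (intro ballI impI)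
    moreover have "\<exists>R\<in>regions M f. mate M f c \<subseteq> R \<and> col R = 1" using reg[OF R(1) x R(2)] R(1,3) by (intro bexI[of _ R] conjI)
    ultimately show "mate M f c \<in> X_circles M f col"
      unfolding X_circles_def using mm(1) by (intro CollectI conjI)
  qed
qed

lemma selected_flow: "circle_flow M (selected col) flow"
  and selected_orbits: "circle_flow.orbits (selected col) flow = {c \<in> A_circles M f. mate M f c \<in> X_circles M f col}"
proof -
  have sub: "selected col \<subseteq> mixed" by (auto simp: selected_def)
  have orb: "mf.orbit p \<subseteq> selected col" if p: "p \<in> selected col" for p
  proof -
    have pm: "p \<in> mixed" using p sub by blast
    then have "mf.orbit p \<in> A_circles M f" by (auto simp: A_circles_eq mf.orbits_def)
    from selected_circle_cases(2)[OF this, of col] show ?thesis using mf.self_orbit[OF pm] p by blast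
  qed
  show 1: "circle_flow M (selected col) flow" by (rule mf.subflow[OF sub orb])
  interpret s: circle_flow M "selected col" flow by (rule 1)
  have "s.orbits = {c \<in> mf.orbits. c \<subseteq> selected col}"
    unfolding s.orbits_def mf.orbits_def s.orbit_def mf.orbit_def
    using sub orb mf.self_orbit unfolding mf.orbit_def by (auto simp: image_iff) blast
  then show "s.orbits = {c \<in> A_circles M f. mate M f c \<in> X_circles M f col}"
    using selected_circle_cases(1) by (auto simp: A_circles_eq)
qed

end

section \<open>Oriented parametrizations and the crossing class\<close>

lemma path_chain_cong:
  assumes "\<And>t. t \<in> {0..1} \<Longrightarrow> g t = h t" shows "path_chain g 0 1 = path_chain h 0 1"
  unfolding path_chain_def
  by (intro arg_cong[where f=frag_of] restrict_ext) (use assms standard_simplex_1_bounds in auto)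

text \<open>A monotone function has no jumps if its range is an interval.\<close>

lemma monotone_bijection_continuous:
  fixes u :: "real \<Rightarrow> real"
  assumes T: "0 < T" and mono: "\<And>s t. \<lbrakk>0 < s; s < t; t < 1\<rbrakk> \<Longrightarrow> u s < u t"
    and im: "u ` {0<..<1} = {0<..<T}" and u0: "u 0 = 0" and u1: "u 1 = T"
  shows "continuous_on {0..1} u"
proof -
  define v where "v t = (if t \<le> 0 then t else if t < 1 then u t else T + (t - 1))" for t
  have ur: "0 < u t \<and> u t < T" if "0 < t" "t < 1" for t
  proof -
    have "u t \<in> u ` {0<..<1}" using that by auto
    then show ?thesis unfolding im by simp
  qed
  have "range v = UNIV"
  proof -
    have "y \<in> range v" for y
    proof -
      consider "y \<le> 0" | "y \<in> {0<..<T}" | "T \<le> y" by fastforce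
      then show ?thesis
      proof cases
        case 1 then show ?thesis by (intro image_eqI[of _ _ y]) (auto simp: v_def)
      next
        case 2
        then obtain t where "0 < t" "t < 1" "y = u t" unfolding im[symmetric] by auto
        then show ?thesis by (intro image_eqI[of _ _ t]) (auto simp: v_def)
      next
        case 3 then show ?thesis by (intro image_eqI[of _ _ "y - T + 1"]) (use T in \<open>auto simp: v_def\<close>)
      qed
    qed
    then show ?thesis by blast
  qed
  moreover have "v s \<le> v t" if "s \<le> t" for s t
    using that mono[of s t] ur[of s] ur[of t] T by (cases "s = t") (auto simp: v_def)
  ultimately have "continuous_on UNIV v" by (intro continuous_onI_mono) auto
  then have "continuous_on {0..1} v" by (rule continuous_on_subset) simp
  then show ?thesis by (rule continuous_on_eq) (auto simp: v_def u0 u1)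
qed

context diagram begin

lemma det_crossing:
  assumes p: "p \<in> mixed" and n: "oriented_normal \<A> f p n1" "oriented_normal \<A> f (mt p) n2"
  shows "0 < det (vector [n1, n2, c *\<^sub>R dir p] :: real^3^3) \<longleftrightarrow> 0 < c"
proof -
  note d = crossing_direction[OF p n]
  have "det (vector [n1, n2, c *\<^sub>R dir p] :: real^3^3) = (cross3 n1 n2) \<bullet> (c *\<^sub>R dir p)"
    using dot_cross_det[of n1 n2 "c *\<^sub>R dir p"] cross_triple[of n1 n2 "c *\<^sub>R dir p"]
      cross_triple[of n2 "c *\<^sub>R dir p" n1] by (simp add: inner_commute)
  also have "\<dots> = c * norm (cross3 n1 n2)"
    using d(1) by (simp add: d(2) dot_square_norm power2_eq_square)
  finally show ?thesis using d(1) by (simp add: zero_less_mult_iff)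
qed

lemma flow_loop_oriented:
  assumes p: "p \<in> mixed"
  shows "oriented_circle_param M \<A> f (mf.orbit p) (\<lambda>t. flow p (mf.least_period p * t))"
proof -
  let ?T = "mf.least_period p" and ?g = "\<lambda>t. flow p (mf.least_period p * t)"
  note T = mf.least_period[OF p]
  have "continuous_map (top_of_set {0..1}) euclideanreal (\<lambda>t. ?T * t)"
    by (simp add: continuous_on_mult_left)
  from continuous_map_compose[OF this mf.cont[OF p]]
  have c: "continuous_map (top_of_set {0..1}) M ?g" by (simp add: o_def)
  have inj: "inj_on ?g {0..<1}"
  proof (rule inj_onI)
    fix s t assume st: "s \<in> {0..<1::real}" "t \<in> {0..<1}" "?g s = ?g t"
    have "?T * s \<in> {0..<?T}" "?T * t \<in> {0..<?T}" using st T(1) by auto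
    from inj_onD[OF mf.inj_on_period[OF p] st(3) this] show "s = t" using T(1) by simp
  qed
  have im: "?g ` {0..1} = mf.orbit p"
  proof
    show "mf.orbit p \<subseteq> ?g ` {0..1}"
    proof
      fix q assume "q \<in> mf.orbit p"
      then obtain s where s: "s \<in> {0..<?T}" "q = flow p s" unfolding mf.orbit_image_period[OF p] by blast
      then show "q \<in> ?g ` {0..1}" using T(1) by (intro image_eqI[of _ _ "s / ?T"]) auto
    qed
  qed (auto simp: mf.orbit_def)
  have "((\<lambda>t. proj (f (?g t))) has_vector_derivative ?T *\<^sub>R dir (?g t)) (at t within {0..1})" for t
  proof -
    have "((\<lambda>t. ?T * t) has_vector_derivative ?T) (at t)" by (auto intro!: derivative_eq_intros)
    moreover have "((\<lambda>s. shadow (flow p s)) has_vector_derivative dir (flow p (?T * t))) (at (?T * t))"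
      using flow(2)[OF p] by (simp add: integral_at_def)
    ultimately show ?thesis using vector_diff_chain_at[of "\<lambda>t. ?T * t" ?T t "\<lambda>s. shadow (flow p s)"]
      by (auto simp: o_def intro: has_vector_derivative_at_within)
  qed
  moreover have "0 < det (vector [n1, n2, ?T *\<^sub>R dir (?g t)] :: real^3^3)"
    if q: "q \<in> topspace M" "q \<noteq> ?g t" "shadow q = shadow (?g t)" "oriented_normal \<A> f (?g t) n1" "oriented_normal \<A> f q n2" for q n1 n2 t
  proof -
    have m: "?g t \<in> mixed" by (rule mf.inZ[OF p])
    have "q = mt (?g t)" using partner(7)[OF m q(1,3)] q(2) by simp
    then show ?thesis using det_crossing[OF m q(4)] q(5) T(1) by simp
  qed
  ultimately show ?thesis
    unfolding oriented_circle_param_def using c inj im T(2) mf.zero[OF p] by (simp only:) force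
qed

text \<open>The velocity is tangent to the double curve, hence a multiple of the crossing direction, and the
  sign condition on the determinant is the sign of the factor.\<close>

lemma oriented_param_direction:
  assumes c: "c \<subseteq> mixed" and \<gamma>: "oriented_circle_param M \<A> f c \<gamma>" and t: "t \<in> {0..1}"
  shows "\<exists>k>0. ((\<lambda>t. shadow (\<gamma> t)) has_vector_derivative k *\<^sub>R dir (\<gamma> t)) (at t within {0..1})"
proof -
  have \<gamma>c: "\<gamma> s \<in> mixed" if "s \<in> {0..1}" for s using \<gamma> c that by (auto simp: oriented_circle_param_def)
  obtain w where w: "((\<lambda>t. shadow (\<gamma> t)) has_vector_derivative w) (at t within {0..1})"
    and det: "\<And>q n1 n2. \<lbrakk>q \<in> topspace M; q \<noteq> \<gamma> t; shadow q = shadow (\<gamma> t); oriented_normal \<A> f (\<gamma> t) n1;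
        oriented_normal \<A> f q n2\<rbrakk> \<Longrightarrow> 0 < det (vector [n1, n2, w] :: real^3^3)"
    using \<gamma> t unfolding oriented_circle_param_def by metis
  have lim: "limitin M \<gamma> (\<gamma> t) (at t within {0..1})"
  proof -
    have "continuous_map (top_of_set {0..1}) M \<gamma>" using \<gamma> by (simp add: oriented_circle_param_def)
    then have op: "openin (top_of_set {0..1}) {x \<in> topspace (top_of_set {0..1}). \<gamma> x \<in> U}" if "openin M U" for U
      using openin_continuous_map_preimage that by blast
    show ?thesis unfolding limitin_def
    proof (intro conjI allI impI)
      show "\<gamma> t \<in> topspace M" using \<gamma>c[OF t] mixed_subset by blast
      fix U assume U: "openin M U \<and> \<gamma> t \<in> U"
      obtain S where S: "open S" "{x \<in> {0..1}. \<gamma> x \<in> U} = {0..1} \<inter> S"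
        using op[of U] U by (auto simp: openin_open)
      then show "\<forall>\<^sub>F x in at t within {0..1}. \<gamma> x \<in> U"
        unfolding eventually_at_topological using U t by (intro exI[of _ S]) blast
    qed
  qed
  have "\<forall>\<^sub>F s in at t within {0..1}. \<gamma> s \<in> mixed"
    unfolding eventually_at_topological using \<gamma>c by (intro exI[of _ UNIV]) auto
  moreover have "at t within {0..1} \<noteq> bot"
  proof -
    have "\<not> (\<exists>a. {0..1::real} = {a})" by (metis atLeastAtMost_singleton_iff zero_neq_one)
    then show ?thesis unfolding trivial_limit_within using connected_imp_perfect[of "{0..1::real}" t] t by simp
  qed
  ultimately obtain k where k: "w = k *\<^sub>R dir (\<gamma> t)"
    using curve_in_mixed[OF lim \<gamma>c[OF t] _ w _ t] by blast
  note m = partner[OF \<gamma>c[OF t]]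
  obtain n1 where n1: "oriented_normal \<A> f (\<gamma> t) n1" by (rule oriented_normal_exists[OF m(1)])
  obtain n2 where n2: "oriented_normal \<A> f (mt (\<gamma> t)) n2" by (rule oriented_normal_exists[OF m(2)])
  have "0 < k" using det[OF m(2,3,4) n1 n2] unfolding k det_crossing[OF \<gamma>c[OF t] n1 n2] .
  with w show ?thesis unfolding k by (intro exI conjI)
qed

text \<open>Both loops run once around the circle, so they differ by a homeomorphism of the parameter
  interval, which is increasing because the velocities point in the same direction.\<close>

lemma oriented_param_homologous:
  assumes p: "p \<in> mixed" and \<gamma>: "oriented_circle_param M \<A> f (mf.orbit p) \<gamma>" and start: "\<gamma> 0 = p"
  shows "homologous_rel 1 M {} (path_chain \<gamma> 0 1) (mf.loop_chain p)"
proof -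
  let ?T = "mf.least_period p"
  let ?F = "flow p"
  note T = mf.least_period[OF p]
  have cm: "continuous_map (top_of_set {0..1}) M \<gamma>" and \<gamma>1: "\<gamma> 1 = p" and inj: "inj_on \<gamma> {0..<1}" and im: "\<gamma> ` {0..1} = mf.orbit p"
    using \<gamma> start by (auto simp: oriented_circle_param_def)
  have orb: "mf.orbit p = ?F ` {0..<?T}" by (rule mf.orbit_image_period[OF p])
  have injF: "inj_on ?F {0..<?T}" by (rule mf.inj_on_period[OF p])
  have F0: "?F 0 = p" by (rule mf.zero[OF p])
  \<comment> \<open>The change of parameter from \<open>\<gamma>\<close> to the flow. At the end of the circle it takes the full
    period, where the inverse on the half-open interval would return to 0.\<close>
  define u where "u t = (if t = 1 then ?T else inv_into {0..<?T} ?F (\<gamma> t))" for t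
  have \<gamma>F: "\<gamma> t \<in> ?F ` {0..<?T}" if "t \<in> {0..1}" for t using im that orb by auto
  have Fu: "?F (u t) = \<gamma> t" if "t \<in> {0..1}" for t
    using f_inv_into_f[OF \<gamma>F[OF that]] T(2) \<gamma>1 by (auto simp: u_def)
  have u0: "u 0 = 0" using inv_into_f_f[OF injF, of 0] T(1) F0 start by (simp add: u_def)
  have u1: "u 1 = ?T" by (simp add: u_def)
  have ur: "u t \<in> {0<..<?T}" if "t \<in> {0<..<1}" for t
  proof -
    have "u t \<in> {0..<?T}" using inv_into_into[OF \<gamma>F[of t]] that by (auto simp: u_def)
    moreover have "u t \<noteq> 0"
    proof
      assume "u t = 0"
      then have "\<gamma> t = \<gamma> 0" using Fu[of t] that F0 start by simp
      then show False using inj_onD[OF inj, of t 0] that by auto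
    qed
    ultimately show ?thesis by auto
  qed
  have uinj: "inj_on u {0<..<1}"
  proof (rule inj_onI)
    fix s t assume st: "s \<in> {0<..<1::real}" "t \<in> {0<..<1}" "u s = u t"
    have "\<gamma> s = \<gamma> t" using Fu[of s] Fu[of t] st by auto
    then show "s = t" using inj_onD[OF inj, of s t] st by auto
  qed
  have uim: "u ` {0<..<1} = {0<..<?T}"
  proof
    show "{0<..<?T} \<subseteq> u ` {0<..<1}"
    proof
      fix s assume s: "s \<in> {0<..<?T}"
      then have "?F s \<in> mf.orbit p" by (simp add: mf.orbit_def)
      then obtain t where t: "t \<in> {0..1}" "\<gamma> t = ?F s" unfolding im[symmetric] by (metis imageE)
      have "?F s \<noteq> p" using T(3) s by simp
      then have t': "t \<in> {0<..<1}" using t start \<gamma>1 by (cases "t = 0"; cases "t = 1") auto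
      have "u t = s" using inj_onD[OF injF, of "u t" s] Fu[OF t(1)] t(2) ur[OF t'] s by auto
      then show "s \<in> u ` {0<..<1}" using t' by blast
    qed
  qed (use ur in blast)
  have cu: "continuous_on {0<..<1} u"
    unfolding continuous_on_open_vimage[OF open_greaterThanLessThan]
  proof (intro allI impI)
    fix O' :: "real set" assume O': "open O'"
    let ?O = "O' \<inter> {0<..<?T}"
    have "openin (subtopology M mixed) (?F ` ?O)" by (rule mf.openin_flow_image[OF p]) (use O' in auto)
    then obtain W where W: "openin M W" "?F ` ?O = W \<inter> mixed" by (auto simp: openin_subtopology)
    have "continuous_map (top_of_set {0<..<1}) M \<gamma>"
      by (rule continuous_map_from_subtopology_mono[OF cm]) auto
    from openin_continuous_map_preimage[OF this W(1)]
    have "open {t\<in>{0<..<1}. \<gamma> t \<in> W}" by (simp add: openin_open_eq)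
    moreover have "{t\<in>{0<..<1}. \<gamma> t \<in> W} = u -` O' \<inter> {0<..<1}"
    proof
      show "{t\<in>{0<..<1}. \<gamma> t \<in> W} \<subseteq> u -` O' \<inter> {0<..<1}"
      proof
        fix t assume t: "t \<in> {t\<in>{0<..<1}. \<gamma> t \<in> W}"
        have "\<gamma> t \<in> mixed" using im t mf.orbit_subset[OF p] by force
        then have "\<gamma> t \<in> ?F ` ?O" using W t by blast
        then obtain s where s: "s \<in> O'" "s \<in> {0<..<?T}" "\<gamma> t = ?F s" by blast
        have t': "t \<in> {0<..<1}" "t \<in> {0..1}" using t by auto
        have "?F (u t) = ?F s" using Fu[OF t'(2)] s(3) by (rule trans)
        moreover have "u t \<in> {0..<?T}" "s \<in> {0..<?T}" using ur[OF t'(1)] s(2) by auto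
        ultimately have "u t = s" by (rule inj_onD[OF injF])
        then show "t \<in> u -` O' \<inter> {0<..<1}" using s(1) t'(1) by blast
      qed
      show "u -` O' \<inter> {0<..<1} \<subseteq> {t\<in>{0<..<1}. \<gamma> t \<in> W}"
      proof
        fix t assume t: "t \<in> u -` O' \<inter> {0<..<1}"
        then have "u t \<in> ?O" using ur[of t] by auto
        then have "?F (u t) \<in> W" using W(2) by blast
        moreover have "?F (u t) = \<gamma> t" using Fu[of t] t by auto
        ultimately show "t \<in> {t\<in>{0<..<1}. \<gamma> t \<in> W}" using t by auto
      qed
    qed
    ultimately show "open (u -` O' \<inter> {0<..<1})" by simp
  qed
  have "strict_mono_on {0<..<1} u \<or> strict_antimono_on {0<..<1} u"
    using injective_eq_monotone_map[of "{0<..<1}" u] cu uinj is_interval_oo by blast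
  moreover have "\<not> strict_antimono_on {0<..<1} u"
  proof
    assume anti: "strict_antimono_on {0<..<1} u"
    let ?h = "1/2 :: real"
    let ?l = "dir (\<gamma> ?h)"
    have sub: "mf.orbit p \<subseteq> mixed" by (rule mf.orbit_subset[OF p])
    obtain k where k: "k > 0" "((\<lambda>t. shadow (\<gamma> t)) has_vector_derivative k *\<^sub>R ?l) (at ?h within {0..1})"
      using oriented_param_direction[OF sub \<gamma>, of ?h] by auto
    have m: "\<gamma> ?h \<in> mixed" using im sub by force
    have "((\<lambda>t. shadow (\<gamma> t)) has_derivative (\<lambda>x. x *\<^sub>R k *\<^sub>R ?l)) (at ?h)"
      using k(2) by (simp add: has_vector_derivative_def at_within_Icc_at)
    from has_derivative_inner_right[OF this, of ?l]
    have dg: "((\<lambda>t. ?l \<bullet> shadow (\<gamma> t)) has_real_derivative k * (?l \<bullet> ?l)) (at ?h)"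
      unfolding has_field_derivative_def by (rule has_derivative_eq_rhs) (auto simp: mult_ac)
    have Fh: "?F (u ?h) = \<gamma> ?h" using Fu[of ?h] by simp
    have "((\<lambda>s. shadow (?F s)) has_derivative (\<lambda>x. x *\<^sub>R ?l)) (at (u ?h))"
      using flow(2)[OF p, of "u ?h"] Fh by (simp add: integral_at_def has_vector_derivative_def)
    from has_derivative_inner_right[OF this, of ?l]
    have dF: "((\<lambda>s. ?l \<bullet> shadow (?F s)) has_real_derivative (?l \<bullet> ?l)) (at (u ?h))"
      unfolding has_field_derivative_def by (rule has_derivative_eq_rhs) (auto simp: mult_ac)
    have lp: "0 < ?l \<bullet> ?l" using dir_nonzero[OF m] by simp
    obtain d1 where d1: "d1 > 0" "\<And>x. \<lbrakk>0 < x; x < d1\<rbrakk> \<Longrightarrow> ?l \<bullet> shadow (\<gamma> ?h) < ?l \<bullet> shadow (\<gamma> (?h + x))"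
      using DERIV_pos_inc_right[OF dg] k(1) lp by (metis mult_pos_pos)
    obtain d2 where d2: "d2 > 0" "\<And>x. \<lbrakk>0 < x; x < d2\<rbrakk> \<Longrightarrow> ?l \<bullet> shadow (?F (u ?h - x)) < ?l \<bullet> shadow (?F (u ?h))"
      using DERIV_pos_inc_left[OF dF lp] by blast
    have "isCont u ?h" using cu by (simp add: continuous_on_eq_continuous_at)
    then obtain d3 where d3: "d3 > 0" "\<And>y. dist y ?h < d3 \<Longrightarrow> dist (u y) (u ?h) < d2"
      unfolding continuous_at_eps_delta using d2(1) by blast
    define x where "x = min (min d1 d3) ?h / 2"
    have x: "0 < x" "x < d1" "x < d3" "x < ?h" using d1(1) d3(1) by (auto simp: x_def)
    have xin: "?h + x \<in> {0<..<1}" "?h \<in> {0<..<1::real}" using x by auto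
    have lt: "u (?h + x) < u ?h" using anti x xin by (auto simp: monotone_on_def)
    have "dist (u (?h + x)) (u ?h) < d2" using d3(2)[of "?h + x"] x by (simp add: dist_real_def)
    then have "?l \<bullet> shadow (?F (u (?h + x))) < ?l \<bullet> shadow (?F (u ?h))"
      using d2(2)[of "u ?h - u (?h + x)"] lt by (simp add: dist_real_def)
    moreover have "?F (u (?h + x)) = \<gamma> (?h + x)" using Fu[of "?h + x"] xin by auto
    ultimately show False using d1(2)[OF x(1,2)] Fh by simp
  qed
  ultimately have mono: "u s < u t" if "0 < s" "s < t" "t < 1" for s t
    using that by (auto simp: monotone_on_def)
  have "continuous_on {0..1} u" by (rule monotone_bijection_continuous[OF T(1) mono uim u0 u1])
  from path_chain_reparametrize[OF mf.cont[OF p] this u0 u1]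
  have "homologous_rel 1 M {} (path_chain (?F \<circ> u) 0 1) (mf.loop_chain p)" by (simp only: mf.loop_chain_def)
  moreover have "path_chain (?F \<circ> u) 0 1 = path_chain \<gamma> 0 1" by (rule path_chain_cong) (simp add: Fu)
  ultimately show ?thesis by simp
qed

lemma loop_class_oriented:
  assumes c: "c \<in> A_circles M f" and p: "p \<in> c" and \<gamma>: "oriented_circle_param M \<A> f c \<gamma>"
  shows "loop_class M \<gamma> = homologous_rel_set 1 M {} (mf.loop_chain p)"
proof -
  obtain r where r: "r \<in> mixed" "c = mf.orbit r" using c by (auto simp: A_circles_eq mf.orbits_def)
  have "\<gamma> 0 \<in> c" using \<gamma> by (auto simp: oriented_circle_param_def)
  then have q: "\<gamma> 0 \<in> mf.orbit r" using r(2) by simp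
  have m: "\<gamma> 0 \<in> mixed" using mf.orbit_subset[OF r(1)] q by (rule subsetD)
  have cm: "c = mf.orbit (\<gamma> 0)" unfolding mf.orbit_eq[OF r(1) q] by (rule r(2))
  have "homologous_rel 1 M {} (path_chain \<gamma> 0 1) (mf.loop_chain (\<gamma> 0))"
    using oriented_param_homologous[OF m] \<gamma> unfolding cm[symmetric] by blast
  moreover have "homologous_rel 1 M {} (mf.loop_chain (\<gamma> 0)) (mf.loop_chain p)"
    by (rule mf.loop_chain_base[OF m]) (use p cm in simp)
  ultimately show ?thesis
    unfolding loop_class_path_chain homologous_rel_set_eq by (rule homologous_rel_trans[rotated])
qed

lemma oriented_param_exists: "c \<in> A_circles M f \<Longrightarrow> \<exists>\<gamma>. oriented_circle_param M \<A> f c \<gamma>"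
  using flow_loop_oriented by (auto simp: A_circles_eq mf.orbits_def)

lemma circle_class_eq:
  assumes c: "c \<in> A_circles M f" and p: "p \<in> c"
  shows "circle_class M \<A> f c = homologous_rel_set 1 M {} (mf.loop_chain p)"
proof -
  obtain \<gamma> where \<gamma>: "oriented_circle_param M \<A> f c \<gamma>" using oriented_param_exists[OF c] by blast
  show ?thesis
    unfolding circle_class_def
    by (rule the_equality) (use \<gamma> loop_class_oriented[OF c p] in metis)+
qed

text \<open>The class is represented by the flow orbits, started at arbitrary base points. All later
  arguments about moves are carried out with these chains.\<close>

theorem crossing_class_eq:
  assumes b: "\<And>c. c \<in> circle_flow.orbits (selected col) flow \<Longrightarrow> b c \<in> c"
  shows "crossing_class M \<A> f col = homologous_rel_set 1 M {} (\<Sum>c\<in>circle_flow.orbits (selected col) flow. mf.loop_chain (b c))"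
    "crossing_class M \<A> f col \<in> carrier (homology_group 1 M)"
proof -
  interpret s: circle_flow M "selected col" flow by (rule selected_flow)
  have A: "c \<in> A_circles M f" if "c \<in> s.orbits" for c using that selected_orbits by blast
  have "finprod (homology_group 1 M) (circle_class M \<A> f) s.orbits = homologous_rel_set 1 M {} (\<Sum>c\<in>s.orbits. mf.loop_chain (b c))
     \<and> finprod (homology_group 1 M) (circle_class M \<A> f) s.orbits \<in> carrier (homology_group 1 M)"
  proof (rule finprod_homology_classes[OF s.finite_orbits])
    fix c assume c: "c \<in> s.orbits"
    have "b c \<in> mixed" using b[OF c] mate_eq(2)[OF A[OF c]] by blast
    then show "singular_relcycle 1 M {} (mf.loop_chain (b c))" by (rule mf.loop_chain_cycle)
    show "circle_class M \<A> f c = homologous_rel_set 1 M {} (mf.loop_chain (b c))"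
      by (rule circle_class_eq[OF A[OF c] b[OF c]])
  qed
  then show "crossing_class M \<A> f col = homologous_rel_set 1 M {} (\<Sum>c\<in>s.orbits. mf.loop_chain (b c))"
    "crossing_class M \<A> f col \<in> carrier (homology_group 1 M)"
    unfolding crossing_class_def selected_orbits[symmetric] by auto
qed

end

section \<open>Local changes of a diagram\<close>

text \<open>Two diagrams of the same surface that agree outside of a closed set \<open>B\<close>, where \<open>B\<close> is saturated:
  no point of \<open>B\<close> has the same shadow as a point outside.\<close>

locale local_change = D: diagram M \<A> f + D': diagram M \<A> f'
  for M :: "'a topology" and \<A> and f f' :: "'a \<Rightarrow> real^4" +
  fixes B :: "'a set"
  assumes closed_B: "closedin M B"
    and off: "\<And>p. \<lbrakk>p \<in> topspace M; p \<notin> B\<rbrakk> \<Longrightarrow> f' p = f p"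
    and fibres: "\<And>p q. \<lbrakk>p \<in> topspace M; q \<in> topspace M; p \<notin> B; proj (f q) = proj (f p)\<rbrakk> \<Longrightarrow> q \<notin> B"
    and fibres': "\<And>p q. \<lbrakk>p \<in> topspace M; q \<in> topspace M; p \<notin> B; proj (f' q) = proj (f' p)\<rbrakk> \<Longrightarrow> q \<notin> B"
begin

lemma sym: "local_change M \<A> f' f B"
proof (rule local_change.intro[OF D'.diagram_axioms D.diagram_axioms], rule local_change_axioms.intro)
  show "closedin M B" by (rule closed_B)
  show "f p = f' p" if "p \<in> topspace M" "p \<notin> B" for p by (rule off[OF that, symmetric])
  show "q \<notin> B" if "p \<in> topspace M" "q \<in> topspace M" "p \<notin> B" "proj (f' q) = proj (f' p)" for p q
    by (rule fibres'[OF that])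
  show "q \<notin> B" if "p \<in> topspace M" "q \<in> topspace M" "p \<notin> B" "proj (f q) = proj (f p)" for p q
    by (rule fibres[OF that])
qed

lemma mixed_off: assumes p: "p \<in> D.mixed" "p \<notin> B"
  shows "p \<in> D'.mixed" "D'.mt p = D.mt p" "D.mt p \<notin> B"
proof -
  note m = D.partner[OF p(1)]
  show q: "D.mt p \<notin> B" by (rule fibres[OF m(1,2) p(2) m(4)])
  have "proj (f' (D.mt p)) = proj (f' p)" using off[OF m(1) p(2)] off[OF m(2) q] m(4) by simp
  then show "p \<in> D'.mixed" "D'.mt p = D.mt p" using D'.partnerI[OF m(1,2) _ m(5)] by auto
qed

lemma oriented_normal_off:
  assumes p: "p \<in> topspace M" "p \<notin> B" and n: "oriented_normal \<A> f p n"
  shows "oriented_normal \<A> f' p n"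
proof -
  obtain U \<phi> where U: "(U,\<phi>) \<in> \<A>" "p \<in> U" "n = sheet_normal (D.sheet' U \<phi> (\<phi> p))"
    using n by (auto simp: D.oriented_normal_iff)
  have W: "openin M (topspace M - B)" using closed_B by blast
  have op: "open (\<phi> ` (U \<inter> (topspace M - B)))" by (rule D.open_chart_image[OF U(1) W])
  have mem: "\<phi> p \<in> \<phi> ` (U \<inter> (topspace M - B))" using p U by blast
  have pU: "\<phi> p \<in> \<phi> ` U" using U(2) by blast
  have "D.sheet U \<phi> x = D'.sheet U \<phi> x" if "x \<in> \<phi> ` (U \<inter> (topspace M - B))" for x
    using that off D.chart(4)[OF U(1)] by (auto simp: D.sheet_def D'.sheet_def inv_into_f_f)
  then have "frechet_derivative (D.sheet U \<phi>) (at (\<phi> p)) = frechet_derivative (D'.sheet U \<phi>) (at (\<phi> p))"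
    by (intro frechet_derivative_transform_within_open[OF _ op mem] differentiableI[OF D.sheet(1)[OF U(1) pU]])
  then have "n = sheet_normal (D'.sheet' U \<phi> (\<phi> p))" using U(3) by (simp add: D.sheet'_def D'.sheet'_def)
  then show ?thesis using U(1,2) unfolding D'.oriented_normal_iff by blast
qed

lemma direction_off: assumes p: "p \<in> D.mixed" "p \<notin> B" shows "D'.dir p = D.dir p"
proof -
  note m = D.partner[OF p(1)] and m' = mixed_off[OF p]
  obtain n1 where n1: "oriented_normal \<A> f p n1" by (rule D.oriented_normal_exists[OF m(1)])
  obtain n2 where n2: "oriented_normal \<A> f (D.mt p) n2" by (rule D.oriented_normal_exists[OF m(2)])
  have n1': "oriented_normal \<A> f' p n1" by (rule oriented_normal_off[OF m(1) p(2) n1])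
  have n2': "oriented_normal \<A> f' (D'.mt p) n2" unfolding m'(2) by (rule oriented_normal_off[OF m(2) m'(3) n2])
  show ?thesis unfolding D.crossing_direction(2)[OF p(1) n1 n2] D'.crossing_direction(2)[OF m'(1) n1' n2'] ..
qed

lemma integral_off: assumes g: "D.ic g t" and B: "g t \<notin> B" shows "D'.ic g t"
proof -
  have lim: "limitin M g (g t) (at t)" and gm: "g t \<in> D.mixed"
    and der: "((\<lambda>s. proj (f (g s))) has_vector_derivative D.dir (g t)) (at t)"
    using g by (auto simp: integral_at_def)
  have gt: "g t \<in> topspace M" using gm D.mixed_subset by blast
  have "openin M (topspace M - B)" using closed_B by blast
  moreover have "g t \<in> topspace M - B" using B gt by blast
  ultimately have "\<forall>\<^sub>F s in at t. g s \<in> topspace M - B" using lim unfolding limitin_def by blast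
  then have ev: "\<forall>\<^sub>F s in at t. proj (f (g s)) = proj (f' (g s))" by eventually_elim (simp add: off)
  have "((\<lambda>s. proj (f' (g s))) has_vector_derivative D.dir (g t)) (at t)"
    unfolding has_vector_derivative_def
    by (rule has_derivative_transform_eventually[OF der[unfolded has_vector_derivative_def] ev]) (simp_all add: off gt B)
  then show ?thesis unfolding integral_at_def using lim mixed_off(1)[OF gm B] direction_off[OF gm B] by simp
qed

lemma flow_off:
  assumes x: "x \<in> D.mixed" "x \<notin> B" shows "\<exists>e>0. \<forall>t. \<bar>t\<bar> < e \<longrightarrow> D'.flow x t = D.flow x t"
proof -
  have "openin M (topspace M - B)" using closed_B by blast
  from openin_continuous_map_preimage[OF D.mf.cont[OF x(1)] this]
  have "open {t. D.flow x t \<in> topspace M - B}" by simp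
  moreover have "0 \<in> {t. D.flow x t \<in> topspace M - B}" using x D.mixed_subset D.mf.zero[OF x(1)] by auto
  ultimately obtain e where e: "e > 0" "ball 0 e \<subseteq> {t. D.flow x t \<in> topspace M - B}" using open_contains_ball by meson
  have "D'.ic (D.flow x) t" if "\<bar>t\<bar> < e" for t
    by (rule integral_off[OF D.flow(2)[OF x(1)]]) (use e(2) that in \<open>auto simp: subset_iff\<close>)
  then have "D.flow x t = D'.flow x t" if "\<bar>t\<bar> < e" for t
    by (intro D'.flow_unique[OF mixed_off(1)[OF x], of "-e" e]) (use that e D.mf.zero[OF x(1)] in \<open>auto simp: abs_less_iff\<close>)
  then show ?thesis using e(1) by metis
qed

text \<open>The partner of a point outside of \<open>B\<close> is also outside of \<open>B\<close>, so the hypothesis compares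
  the colours of the two regions to which the partner belongs.\<close>

lemma selected_off:
  assumes col: "\<And>R R'. \<lbrakk>R \<in> regions M f; R' \<in> regions M f'; \<exists>p\<in>R \<inter> R'. p \<notin> B\<rbrakk> \<Longrightarrow> col' R' = col R"
    and p: "p \<in> D.selected col" "p \<notin> B"
  shows "p \<in> D'.selected col'"
proof -
  obtain R where R: "p \<in> D.mixed" "height (f p) < height (f (D.mt p))" "R \<in> regions M f" "D.mt p \<in> R" "col R = 1"
    using p(1) by (auto simp: D.selected_def)
  note m = D.partner[OF R(1)] and m' = mixed_off[OF R(1) p(2)]
  have q: "D.mt p \<in> D'.mixed" using D'.partner_partner(1)[OF m'(1)] m'(2) by simp
  have "D'.mf.orbit (D.mt p) \<in> A_circles M f'" using q by (auto simp: D'.A_circles_eq D'.mf.orbits_def)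
  then have "D.mt p \<in> coloured_set M f'" unfolding coloured_set_def using D'.mf.self_orbit[OF q] by blast
  then have "D.mt p \<in> topspace (subtopology M (coloured_set M f'))" using m(2) by simp
  then have "D.mt p \<in> \<Union>(regions M f')" unfolding regions_def Union_connected_components_of .
  then obtain R' where R': "R' \<in> regions M f'" "D.mt p \<in> R'" by (elim UnionE)
  have "col' R' = 1" using col[OF R(3) R'(1)] R(4,5) R'(2) m'(3) by auto
  moreover have "height (f' p) < height (f' (D'.mt p))" using R(2) m'(2) off[OF m(1) p(2)] off[OF m(2) m'(3)] by simp
  ultimately show ?thesis unfolding D'.selected_def using m' R' by auto
qed

text \<open>Outside of \<open>B\<close> the selected circles and their directions do not change, and inside of \<open>B\<close>
  they run in the disc \<open>\<Delta>\<close>, where they may be arbitrary, so \<open>circle_flow_locality\<close>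
  applies. Several circles may be merged or split by the change.\<close>

theorem crossing_class_unchanged:
  assumes col: "\<And>R R'. \<lbrakk>R \<in> regions M f; R' \<in> regions M f'; \<exists>p\<in>R \<inter> R'. p \<notin> B\<rbrakk> \<Longrightarrow> col' R' = col R"
    and \<Delta>: "closedin M \<Delta>" "openin M \<Delta>i" "\<Delta>i \<subseteq> \<Delta>" "contractible_space (subtopology M \<Delta>)" "\<Delta> \<subseteq> B"
    and P: "finite P" "(D.selected col \<union> D'.selected col') \<inter> (\<Delta> - \<Delta>i) \<subseteq> P"
    and inside: "(D.selected col \<union> D'.selected col') \<inter> B \<subseteq> \<Delta>"
  shows "crossing_class M \<A> f' col' = crossing_class M \<A> f col"
proof -
  interpret L': local_change M \<A> f' f B by (rule sym)
  have col': "col R = col' R'" if "R' \<in> regions M f'" "R \<in> regions M f" "\<exists>p\<in>R' \<inter> R. p \<notin> B" for R R'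
    using col[OF that(2,1)] that(3) by (metis Int_commute)
  have out: "D.selected col - \<Delta> = D'.selected col' - \<Delta>"
  proof
    show "D.selected col - \<Delta> \<subseteq> D'.selected col' - \<Delta>"
    proof
      fix p assume p: "p \<in> D.selected col - \<Delta>"
      then have pB: "p \<in> D.selected col" "p \<notin> B" using inside by blast+
      have "p \<in> D'.selected col'" by (rule selected_off[OF _ pB]) (rule col)
      then show "p \<in> D'.selected col' - \<Delta>" using p by blast
    qed
    show "D'.selected col' - \<Delta> \<subseteq> D.selected col - \<Delta>"
    proof
      fix p assume p: "p \<in> D'.selected col' - \<Delta>"
      then have pB: "p \<in> D'.selected col'" "p \<notin> B" using inside by blast+
      have "p \<in> D.selected col" by (rule L'.selected_off[OF _ pB]) (rule col')
      then show "p \<in> D.selected col - \<Delta>" using p by blast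
    qed
  qed
  have loc: "\<exists>e>0. \<forall>t. \<bar>t\<bar> < e \<longrightarrow> D'.flow x t = D.flow x t" if x: "x \<in> D.selected col - \<Delta>" for x
  proof (rule flow_off)
    show "x \<in> D.mixed" using x by (simp add: D.selected_def)
    show "x \<notin> B" using x inside by blast
  qed
  define b where "b c = (SOME x. x \<in> c)" for c :: "'a set"
  have b: "b c \<in> c" if "c \<in> A_circles M h" "diagram M \<A> h" for c h
  proof -
    interpret h: diagram M \<A> h by fact
    have "c \<noteq> {}" using that(1) nonempty_connected_components_of by (auto simp: h.A_circles_eq h.mf.orbits_eq_components)
    then obtain x where "x \<in> c" unfolding ex_in_conv[symmetric] by (elim exE)
    then show ?thesis unfolding b_def by (rule someI)
  qed
  have b1: "b c \<in> c" if "c \<in> circle_flow.orbits (D.selected col) D.flow" for c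
    by (rule b[OF _ D.diagram_axioms]) (use that in \<open>simp add: D.selected_orbits\<close>)
  have b2: "b c \<in> c" if "c \<in> circle_flow.orbits (D'.selected col') D'.flow" for c
    by (rule b[OF _ D'.diagram_axioms]) (use that in \<open>simp add: D'.selected_orbits\<close>)
  have "homologous_rel 1 M {} (\<Sum>c\<in>circle_flow.orbits (D.selected col) D.flow. D.mf.loop_chain (b c))
     (\<Sum>c\<in>circle_flow.orbits (D'.selected col') D'.flow. D'.mf.loop_chain (b c))"
    by (rule circle_flow_locality[OF D.selected_flow D'.selected_flow out loc \<Delta>(1-4) P b1 b2])
  then have "homologous_rel 1 M {} (\<Sum>c\<in>circle_flow.orbits (D'.selected col') D'.flow. D'.mf.loop_chain (b c))
     (\<Sum>c\<in>circle_flow.orbits (D.selected col) D.flow. D.mf.loop_chain (b c))"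
    unfolding homologous_rel_sym[of 1 M "{}" "\<Sum>c\<in>circle_flow.orbits (D.selected col) D.flow. D.mf.loop_chain (b c)"] .
  moreover have "crossing_class M \<A> f col = homologous_rel_set 1 M {} (\<Sum>c\<in>circle_flow.orbits (D.selected col) D.flow. D.mf.loop_chain (b c))"
    by (rule D.crossing_class_eq(1)) (rule b1)
  moreover have "crossing_class M \<A> f' col' = homologous_rel_set 1 M {} (\<Sum>c\<in>circle_flow.orbits (D'.selected col') D'.flow. D'.mf.loop_chain (b c))"
    by (rule D'.crossing_class_eq(1)) (rule b2)
  ultimately show ?thesis by (simp only: homologous_rel_set_eq)
qed

end

context oriented_surface begin

lemma local_param_continuous:
  assumes \<alpha>: "local_param M \<A> D \<alpha>" shows "continuous_map (top_of_set D) M \<alpha>"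
proof (rule continuous_map_openin_preimage_eq[THEN iffD2], intro conjI allI impI)
  have D: "open D" "openin M (\<alpha> ` D)" and
    ch: "\<And>U \<phi>. (U,\<phi>) \<in> \<A> \<Longrightarrow> diffeo {x\<in>D. \<alpha> x \<in> U} (\<phi> ` (\<alpha> ` D \<inter> U)) (\<phi> \<circ> \<alpha>)"
    using \<alpha> by (auto simp: local_param_def)
  have top: "\<alpha> x \<in> topspace M" if "x \<in> D" for x using openin_subset[OF D(2)] that by blast
  then show "\<alpha> \<in> topspace (top_of_set D) \<rightarrow> topspace M" by auto
  fix W assume W: "openin M W"
  have "open (D \<inter> \<alpha> -` W)"
  proof (subst open_subopen, clarify)
    fix x assume x: "x \<in> D" "\<alpha> x \<in> W"
    obtain U \<phi> where U: "(U,\<phi>) \<in> \<A>" "\<alpha> x \<in> U" using chart_at[OF top[OF x(1)]] .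
    let ?S = "{x\<in>D. \<alpha> x \<in> U}"
    have S: "open ?S" "continuous_on ?S (\<phi> \<circ> \<alpha>)"
      using ch[OF U(1)] smooth_on_continuous[of ?S "\<phi> \<circ> \<alpha>"] unfolding diffeo_def by blast+
    have "open ((\<phi> \<circ> \<alpha>) -` (\<phi> ` (U \<inter> W)) \<inter> ?S)"
      using continuous_on_open_vimage[OF S(1), THEN iffD1, OF S(2)] open_chart_image[OF U(1) W] by blast
    moreover have "x \<in> (\<phi> \<circ> \<alpha>) -` (\<phi> ` (U \<inter> W)) \<inter> ?S" using x U(2) by auto
    moreover have "(\<phi> \<circ> \<alpha>) -` (\<phi> ` (U \<inter> W)) \<inter> ?S \<subseteq> D \<inter> \<alpha> -` W"
      using chart(4)[OF U(1)] by (auto dest: inj_onD)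
    ultimately show "\<exists>T. open T \<and> x \<in> T \<and> T \<subseteq> D \<inter> \<alpha> -` W" by blast
  qed
  then show "openin (top_of_set D) (topspace (top_of_set D) \<inter> \<alpha> -` W)" using D(1) by (simp add: openin_open_eq)
qed

lemma local_param_open:
  assumes \<alpha>: "local_param M \<A> D \<alpha>" and O: "open O'" "O' \<subseteq> D" shows "openin M (\<alpha> ` O')"
proof (subst openin_subopen, clarify)
  fix x assume x: "x \<in> O'"
  have D: "open D" "inj_on \<alpha> D" "openin M (\<alpha> ` D)" and
    ch: "\<And>U \<phi>. (U,\<phi>) \<in> \<A> \<Longrightarrow> diffeo {x\<in>D. \<alpha> x \<in> U} (\<phi> ` (\<alpha> ` D \<inter> U)) (\<phi> \<circ> \<alpha>)"
    using \<alpha> by (auto simp: local_param_def)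
  have "\<alpha> x \<in> topspace M" using openin_subset[OF D(3)] x O(2) by blast
  then obtain U \<phi> where U: "(U,\<phi>) \<in> \<A>" "\<alpha> x \<in> U" using chart_at by blast
  let ?S = "{x\<in>D. \<alpha> x \<in> U}" and ?T = "\<phi> ` (\<alpha> ` D \<inter> U)" and ?h = "\<phi> \<circ> \<alpha>"
  have d: "open ?T" "bij_betw ?h ?S ?T" "continuous_on ?T (inv_into ?S ?h)"
    using ch[OF U(1)] smooth_on_continuous[of ?T "inv_into ?S ?h"] unfolding diffeo_def by blast+
  have "open (inv_into ?S ?h -` O' \<inter> ?T)"
    using continuous_on_open_vimage[OF d(1), THEN iffD1, OF d(3)] O(1) by blast
  note N = openin_chart_preimage[OF U(1) this]
  have hx: "inv_into ?S ?h (?h y) = y" if "y \<in> ?S" for y using bij_betw_inv_into_left[OF d(2) that] .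
  have "\<alpha> x \<in> {p\<in>U. \<phi> p \<in> inv_into ?S ?h -` O' \<inter> ?T}"
    using hx[of x] x O(2) U(2) by auto
  moreover have "{p\<in>U. \<phi> p \<in> inv_into ?S ?h -` O' \<inter> ?T} \<subseteq> \<alpha> ` O'"
  proof clarify
    fix p y assume p: "p \<in> U" "inv_into ?S ?h (\<phi> p) \<in> O'" "\<phi> p = \<phi> (\<alpha> y)" "y \<in> D" "\<alpha> y \<in> U"
    have "p = \<alpha> y" using chart(4)[OF U(1)] p by (auto dest: inj_onD)
    moreover have "y \<in> O'" using hx[of y] p by simp
    ultimately show "p \<in> \<alpha> ` O'" by blast
  qed
  ultimately show "\<exists>T. openin M T \<and> \<alpha> x \<in> T \<and> T \<subseteq> \<alpha> ` O'" using N by blast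
qed

text \<open>The star-shaped set \<open>C\<close> is contracted to the origin in the parameter plane.\<close>

lemma local_param_disc:
  assumes \<alpha>: "local_param M \<A> D \<alpha>" and C: "compact C" "C \<subseteq> D" "C \<noteq> {}"
    and star: "\<And>x t. \<lbrakk>x \<in> C; 0 \<le> t; t \<le> 1\<rbrakk> \<Longrightarrow> t *\<^sub>R x \<in> C"
  shows "closedin M (\<alpha> ` C)" "contractible_space (subtopology M (\<alpha> ` C))"
proof -
  have c: "continuous_map (top_of_set C) M \<alpha>"
    by (rule continuous_map_from_subtopology_mono[OF local_param_continuous[OF \<alpha>] C(2)])
  have "compactin M (\<alpha> ` C)"
    by (rule image_compactin[OF _ c]) (simp add: compactin_subtopology C(1))
  then show cl: "closedin M (\<alpha> ` C)" by (rule compactin_imp_closedin[OF Hausdorff])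
  have aC: "\<alpha> ` C \<subseteq> topspace M" using closedin_subset[OF cl] .
  have "inj_on \<alpha> C" using \<alpha> C(2) by (auto simp: local_param_def intro: inj_on_subset)
  then have "homeomorphic_map (top_of_set C) (subtopology M (\<alpha> ` C)) \<alpha>"
    using c C(1) aC by (intro continuous_imp_homeomorphic_map)
      (auto simp: continuous_map_in_subtopology compact_space_subtopology compactin_euclidean_iff Hausdorff_space_subtopology[OF Hausdorff])
  then have "subtopology M (\<alpha> ` C) homeomorphic_space top_of_set C"
    using homeomorphic_map_imp_homeomorphic_space homeomorphic_space_sym by blast
  moreover have "contractible C"
  proof (rule starlike_imp_contractible)
    obtain x where "x \<in> C" using C(3) by blast
    then have "0 \<in> C" using star[of x 0] by simp
    moreover have "closed_segment 0 x \<subseteq> C" if "x \<in> C" for x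
      using star[OF that] by (auto simp: closed_segment_def)
    ultimately show "starlike C" unfolding starlike_def by blast
  qed
  ultimately show "contractible_space (subtopology M (\<alpha> ` C))"
    using homeomorphic_space_contractibility contractible_space_top_of_set by blast
qed

end

section \<open>Roseman moves\<close>

lemma continuous_on_vec3:
  fixes h :: "'a::topological_space \<Rightarrow> real^3"
  assumes "continuous_on S (\<lambda>x. h x $ 1)" "continuous_on S (\<lambda>x. h x $ 2)" "continuous_on S (\<lambda>x. h x $ 3)"
  shows "continuous_on S h"
proof -
  have "continuous_on S (\<lambda>x. h x $ i)" for i using assms exhaust_3[of i] by auto
  then show ?thesis using continuous_on_vec_lambda[of S "\<lambda>i x. h x $ i"] by simp
qed

lemma norm_le_vec3:
  fixes v w :: "real^3"
  assumes "\<bar>v$1\<bar> \<le> \<bar>w$1\<bar>" "\<bar>v$2\<bar> \<le> \<bar>w$2\<bar>" "\<bar>v$3\<bar> \<le> \<bar>w$3\<bar>"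
  shows "norm v \<le> norm w"
proof (rule norm_le_componentwise_cart)
  fix i :: 3
  show "norm (v$i) \<le> norm (w$i)" using exhaust_3[of i] assms by (elim disjE) simp_all
qed

text \<open>The moving sheets of moves III and IV in one family, with \<open>\<sigma> = 1\<close> and \<open>\<sigma> = -1\<close>.\<close>

definition graph_sheet :: "real \<Rightarrow> real \<Rightarrow> real^2 \<Rightarrow> real^3" where
  "graph_sheet \<sigma> s x = vector [x$1, x$2, (x$1)^2 + \<sigma> * (x$2)^2 - s]"

lemma graph_sheet_III: "sheet_III = graph_sheet 1" and graph_sheet_IV: "sheet_IV = graph_sheet (-1)"
  by (auto simp: sheet_III_def sheet_IV_def graph_sheet_def fun_eq_iff)

lemma norm_sheet_flat: "norm (sheet_flat x) = norm x"
  by (simp add: sheet_flat_def norm_eq_sqrt_inner inner_vec_def sum_2 sum_3)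

lemma norm_graph_sheet_ge: "norm x \<le> norm (graph_sheet \<sigma> s x)"
  unfolding norm_sheet_flat[symmetric] by (rule norm_le_vec3) (auto simp: sheet_flat_def graph_sheet_def)

lemma abs_power_scale_le: fixes t a :: real assumes "0 \<le> t" "t \<le> 1" shows "\<bar>t ^ n * a\<bar> \<le> \<bar>a\<bar>"
  using assms by (simp add: abs_mult mult_left_le_one_le power_le_one)

text \<open>The preimages of balls under the singular models are star-shaped, because the coordinates of
  the models are homogeneous; this makes them discs in the surface.\<close>

lemma graph_sheet_star: assumes "0 \<le> t" "t \<le> 1" shows "norm (graph_sheet \<sigma> 0 (t *\<^sub>R x)) \<le> norm (graph_sheet \<sigma> 0 x)"
proof (rule norm_le_vec3)
  have "(graph_sheet \<sigma> 0 (t *\<^sub>R x)) $ 3 = t^2 * ((graph_sheet \<sigma> 0 x) $ 3)"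
    by (simp add: graph_sheet_def power_mult_distrib algebra_simps)
  then show "\<bar>graph_sheet \<sigma> 0 (t *\<^sub>R x) $ 3\<bar> \<le> \<bar>graph_sheet \<sigma> 0 x $ 3\<bar>" using abs_power_scale_le[OF assms] by simp
qed (use abs_power_scale_le[OF assms, of 1] in \<open>auto simp: graph_sheet_def\<close>)

lemma fold_sheet_star:
  assumes t: "0 \<le> t" "t \<le> 1" and g: "g = sheet_I \<or> g = sheet_II"
  shows "norm (g 0 (t *\<^sub>R x)) \<le> norm (g 0 x)"
proof (rule norm_le_vec3)
  have "(g 0 (t *\<^sub>R x)) $ 3 = t^3 * ((g 0 x) $ 3)" "(g 0 (t *\<^sub>R x)) $ 2 = t^2 * ((g 0 x) $ 2)" "(g 0 (t *\<^sub>R x)) $ 1 = t^1 * ((g 0 x) $ 1)"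
    using g by (auto simp: sheet_I_def sheet_II_def power_mult_distrib algebra_simps power2_eq_square power3_eq_cube)
  then show "\<bar>g 0 (t *\<^sub>R x) $ 3\<bar> \<le> \<bar>g 0 x $ 3\<bar>" "\<bar>g 0 (t *\<^sub>R x) $ 2\<bar> \<le> \<bar>g 0 x $ 2\<bar>" "\<bar>g 0 (t *\<^sub>R x) $ 1\<bar> \<le> \<bar>g 0 x $ 1\<bar>"
    by (simp_all only: abs_power_scale_le[OF t])
qed

lemma continuous_graph_sheet: "continuous_on S (graph_sheet \<sigma> s)"
  by (rule continuous_on_vec3) (auto simp: graph_sheet_def intro!: continuous_intros)

text \<open>At the parameter 0 the two model sheets meet in the origin or in two lines, and a line meets a
  circle in two points.\<close>

lemma finite_boundary_crossings:
  assumes \<sigma>: "\<sigma> = 1 \<or> \<sigma> = -1"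
  shows "finite {x :: real^2. norm x = r \<and> (x$1)^2 + \<sigma> * (x$2)^2 = 0}"
proof -
  let ?A = "{0, r / sqrt 2, - (r / sqrt 2)}"
  have "x$1 \<in> ?A \<and> x$2 \<in> ?A" if x: "norm x = r" "(x$1)^2 + \<sigma> * (x$2)^2 = 0" for x :: "real^2"
  proof -
    have n: "(x$1)^2 + (x$2)^2 = r^2"
      using x(1) by (auto simp: norm_eq_sqrt_inner inner_vec_def sum_2 power2_eq_square)
    show ?thesis
    proof (cases "\<sigma> = 1")
      case True
      then have "(x$1)^2 = 0" "(x$2)^2 = 0" using x(2) by (auto simp: sum_power2_eq_zero_iff)
      then show ?thesis by simp
    next
      case False
      then have "(x$1)^2 = (x$2)^2" using x(2) \<sigma> by simp
      then have "(x$1)^2 = (r / sqrt 2)^2" "(x$2)^2 = (r / sqrt 2)^2" using n by (simp_all add: power_divide)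
      then show ?thesis by (auto simp: power2_eq_iff)
    qed
  qed
  then have sub: "(x$1, x$2) \<in> ?A \<times> ?A" if "norm x = r \<and> (x$1)^2 + \<sigma> * (x$2)^2 = 0" for x :: "real^2"
    using that by (simp only: mem_Times_iff fst_conv snd_conv)
  have "(vector [x$1, x$2] :: real^2) = x" for x :: "real^2" by (simp add: vec_eq_iff forall_2)
  then have "x \<in> (\<lambda>(a,b). vector [a,b]) ` (?A \<times> ?A)" if "norm x = r \<and> (x$1)^2 + \<sigma> * (x$2)^2 = 0" for x :: "real^2"
    using imageI[OF sub[OF that], of "\<lambda>(a,b). vector [a,b] :: real^2"] by (simp only: prod.case)
  then have "{x :: real^2. norm x = r \<and> (x$1)^2 + \<sigma> * (x$2)^2 = 0} \<subseteq> (\<lambda>(a,b). vector [a,b]) ` (?A \<times> ?A)"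
    by blast
  then show ?thesis by (rule finite_subset) auto
qed

context diagram begin

text \<open>Each of the two sheets projects injectively, so a double point in the ball lies on both of
  them, and over the same point of the plane because both sheets are graphs. The sign \<open>\<epsilon>\<close> tells
  which sheet is lower, and selected points lie on the lower sheet.\<close>

lemma two_sheet_selected:
  assumes inj: "inj_on \<Psi> W"
    and X: "\<And>x. x \<in> D \<Longrightarrow> sheet_flat x \<in> W \<and> proj (f (\<alpha> x)) = \<Psi> (sheet_flat x)"
    and Y: "\<And>x. x \<in> E \<Longrightarrow> graph_sheet \<sigma> (s * \<rho> x) x \<in> W \<and> proj (f (\<beta> x)) = \<Psi> (graph_sheet \<sigma> (s * \<rho> x) x)"
    and H: "\<And>x y. \<lbrakk>x \<in> D; y \<in> E; proj (f (\<alpha> x)) = proj (f (\<beta> y))\<rbrakk> \<Longrightarrow> \<epsilon> * height (f (\<alpha> x)) < \<epsilon> * height (f (\<beta> y))"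
    and B: "{p \<in> topspace M. proj (f p) \<in> B} = \<alpha> ` C \<union> \<beta> ` C'" and C: "C \<subseteq> D" "C' \<subseteq> E"
    and \<epsilon>: "\<epsilon> \<in> {1,-1}" and p: "p \<in> selected col" "proj (f p) \<in> B"
  shows "\<exists>x. x \<in> C \<and> x \<in> C' \<and> graph_sheet \<sigma> (s * \<rho> x) x = sheet_flat x \<and> (\<epsilon> = 1 \<and> p = \<alpha> x \<or> \<epsilon> = -1 \<and> p = \<beta> x)"
proof -
  have pm: "p \<in> mixed" and low: "height (f p) < height (f (mt p))" using p(1) by (auto simp: selected_def)
  note m = partner[OF pm]
  have "p \<in> \<alpha> ` C \<union> \<beta> ` C'" "mt p \<in> \<alpha> ` C \<union> \<beta> ` C'" unfolding B[symmetric] using m p(2) by auto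
  then have cases: "(\<exists>x\<in>C. \<exists>y\<in>C. p = \<alpha> x \<and> mt p = \<alpha> y) \<or> (\<exists>x\<in>C. \<exists>y\<in>C'. p = \<alpha> x \<and> mt p = \<beta> y)
      \<or> (\<exists>x\<in>C. \<exists>y\<in>C'. p = \<beta> y \<and> mt p = \<alpha> x) \<or> (\<exists>x\<in>C'. \<exists>y\<in>C'. p = \<beta> x \<and> mt p = \<beta> y)"
    by blast
  have \<alpha>: "sheet_flat x \<in> W" "proj (f (\<alpha> x)) = \<Psi> (sheet_flat x)" if "x \<in> C" for x using X[of x] C(1) that by blast+
  have \<beta>: "graph_sheet \<sigma> (s * \<rho> x) x \<in> W" "proj (f (\<beta> x)) = \<Psi> (graph_sheet \<sigma> (s * \<rho> x) x)" if "x \<in> C'" for x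
    using Y[of x] C(2) that by blast+
  have \<alpha>\<alpha>: "x = y" if "x \<in> C" "y \<in> C" "proj (f (\<alpha> x)) = proj (f (\<alpha> y))" for x y
  proof -
    have "sheet_flat x = sheet_flat y"
      by (rule inj_onD[OF inj]) (use \<alpha>[OF that(1)] \<alpha>[OF that(2)] that(3) in simp_all)
    then show ?thesis by (simp add: sheet_flat_def vec_eq_iff forall_2 forall_3)
  qed
  have \<beta>\<beta>: "x = y" if "x \<in> C'" "y \<in> C'" "proj (f (\<beta> x)) = proj (f (\<beta> y))" for x y
  proof -
    have "graph_sheet \<sigma> (s * \<rho> x) x = graph_sheet \<sigma> (s * \<rho> y) y"
      by (rule inj_onD[OF inj]) (use \<beta>[OF that(1)] \<beta>[OF that(2)] that(3) in simp_all)
    then show ?thesis by (simp add: graph_sheet_def vec_eq_iff forall_2 forall_3)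
  qed
  have \<alpha>\<beta>: "x = y \<and> graph_sheet \<sigma> (s * \<rho> x) x = sheet_flat x" if "x \<in> C" "y \<in> C'" "proj (f (\<alpha> x)) = proj (f (\<beta> y))" for x y
  proof -
    have e: "sheet_flat x = graph_sheet \<sigma> (s * \<rho> y) y"
      by (rule inj_onD[OF inj]) (use \<alpha>[OF that(1)] \<beta>[OF that(2)] that(3) in simp_all)
    then have "x = y" by (simp add: sheet_flat_def graph_sheet_def vec_eq_iff forall_2 forall_3)
    then show ?thesis using e by simp
  qed
  have bad1: "\<epsilon> * height (f (\<alpha> x)) < \<epsilon> * height (f (\<beta> y))" if "x \<in> C" "y \<in> C'" "proj (f (\<alpha> x)) = proj (f (\<beta> y))" for x y
    by (rule H[OF _ _ that(3)]) (use that C in blast)+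
  show ?thesis using cases
  proof (elim disjE bexE conjE)
    fix x y assume a: "x \<in> C" "y \<in> C" "p = \<alpha> x" "mt p = \<alpha> y"
    then have "x = y" using \<alpha>\<alpha>[OF a(1,2)] m(4) by simp
    then show ?thesis using m(3) a by simp
  next
    fix x y assume a: "x \<in> C" "y \<in> C'" "p = \<alpha> x" "mt p = \<beta> y"
    have e: "proj (f (\<alpha> x)) = proj (f (\<beta> y))" using m(4) a by simp
    have "\<epsilon> \<noteq> -1" using bad1[OF a(1,2) e] low a by auto
    then have "\<epsilon> = 1" using \<epsilon> by simp
    then show ?thesis using a \<alpha>\<beta>[OF a(1,2) e] by blast
  next
    fix x y assume a: "x \<in> C" "y \<in> C'" "p = \<beta> y" "mt p = \<alpha> x"
    have e: "proj (f (\<alpha> x)) = proj (f (\<beta> y))" using m(4) a by simp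
    have "\<epsilon> \<noteq> 1" using bad1[OF a(1,2) e] low a by auto
    then have "\<epsilon> = -1" using \<epsilon> by simp
    then show ?thesis using a \<alpha>\<beta>[OF a(1,2) e] by blast
  next
    fix x y assume a: "x \<in> C'" "y \<in> C'" "p = \<beta> x" "mt p = \<beta> y"
    then have "x = y" using \<beta>\<beta>[OF a(1,2)] m(4) by simp
    then show ?thesis using m(3) a by simp
  qed
qed

end

text \<open>The disc of the general principle is the piece of the lower sheet. Near its boundary the
  deformation is damped out, so its boundary meets the double curves in finitely many points.\<close>

lemma (in local_change) two_sheet_unchanged:
  fixes \<epsilon> :: real
  assumes col: "\<And>R R'. \<lbrakk>R \<in> regions M f; R' \<in> regions M f'; \<exists>p\<in>R \<inter> R'. p \<notin> B\<rbrakk> \<Longrightarrow> col' R' = col R"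
    and \<sigma>: "\<sigma> = 1 \<or> \<sigma> = -1" and r: "0 < r" and \<alpha>: "local_param M \<A> D \<alpha>" and \<beta>: "local_param M \<A> E \<beta>"
    and C: "{x. sheet_flat x \<in> cball 0 r} \<subseteq> D" "{x. graph_sheet \<sigma> 0 x \<in> cball 0 r} \<subseteq> E"
    and \<rho>: "\<And>x. \<rho> x \<noteq> 0 \<Longrightarrow> norm (graph_sheet \<sigma> 0 x) < r" and \<epsilon>: "\<epsilon> \<in> {1,-1}"
    and B: "B = \<alpha> ` {x. sheet_flat x \<in> cball 0 r} \<union> \<beta> ` {x. graph_sheet \<sigma> 0 x \<in> cball 0 r}"
    and sel: "\<And>p. p \<in> (D.selected col \<union> D'.selected col') \<inter> B \<Longrightarrow>
      \<exists>x s. x \<in> {x. sheet_flat x \<in> cball 0 r} \<and> x \<in> {x. graph_sheet \<sigma> 0 x \<in> cball 0 r} \<and>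
        graph_sheet \<sigma> (s * \<rho> x) x = sheet_flat x \<and> (\<epsilon> = 1 \<and> p = \<alpha> x \<or> \<epsilon> = -1 \<and> p = \<beta> x)"
  shows "crossing_class M \<A> f' col' = crossing_class M \<A> f col"
proof -
  let ?P = "{x :: real^2. norm x = r \<and> (x$1)^2 + \<sigma> * (x$2)^2 = 0}"
  let ?C = "{x. sheet_flat x \<in> cball 0 r}" and ?C' = "{x. graph_sheet \<sigma> 0 x \<in> cball 0 r}"
  have C1: "?C = cball 0 r" by (auto simp: norm_sheet_flat)
  have bd: "norm x = r \<and> (x$1)^2 + \<sigma> * (x$2)^2 = 0"
    if x: "graph_sheet \<sigma> (s * \<rho> x) x = sheet_flat x" "r \<le> norm (graph_sheet \<sigma> 0 x)" "norm x = r \<or> norm (graph_sheet \<sigma> 0 x) = r" for x s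
  proof -
    have "\<rho> x = 0" using \<rho>[of x] x(2) by force
    then have e: "graph_sheet \<sigma> 0 x = sheet_flat x" using x(1) by simp
    then have "(graph_sheet \<sigma> 0 x) $ 3 = (sheet_flat x) $ 3" by simp
    then have "(x$1)^2 + \<sigma> * (x$2)^2 = 0" by (simp add: graph_sheet_def sheet_flat_def)
    moreover have "norm x = r" using x(3) unfolding e norm_sheet_flat by simp
    ultimately show ?thesis by simp
  qed
  have cont: "continuous_on UNIV (\<lambda>x. norm (graph_sheet \<sigma> 0 x))"
    by (intro continuous_on_norm continuous_graph_sheet)
  consider (up) "\<epsilon> = 1" | (down) "\<epsilon> = -1" using \<epsilon> by auto
  then show ?thesis
  proof cases
    case up
    then have "\<not> \<epsilon> = -1" by simp
    then have sel1: "\<exists>x s. x \<in> ?C \<and> x \<in> ?C' \<and> graph_sheet \<sigma> (s * \<rho> x) x = sheet_flat x \<and> p = \<alpha> x"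
      if "p \<in> (D.selected col \<union> D'.selected col') \<inter> B" for p
      using sel[OF that] by blast
    show ?thesis
    proof (rule crossing_class_unchanged[where \<Delta>="\<alpha> ` ?C" and \<Delta>i="\<alpha> ` ball 0 r" and P="\<alpha> ` ?P"])
      show "col' R' = col R" if "R \<in> regions M f" "R' \<in> regions M f'" "\<exists>p\<in>R \<inter> R'. p \<notin> B" for R R'
        by (rule col[OF that])
      have cs: "compact ?C" "?C \<noteq> {}" unfolding C1 using r by auto
      have star: "t *\<^sub>R x \<in> ?C" if "x \<in> ?C" "0 \<le> t" "t \<le> 1" for x :: "real^2" and t
      proof -
        have "t * norm x \<le> norm x" using that(2,3) by (simp add: mult_left_le_one_le)
        then show ?thesis using that unfolding C1 by simp
      qed
      show "closedin M (\<alpha> ` ?C)" "contractible_space (subtopology M (\<alpha> ` ?C))"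
        using D.local_param_disc[OF \<alpha> cs(1) C(1) cs(2) star] by blast+
      show "openin M (\<alpha> ` ball 0 r)"
        by (rule D.local_param_open[OF \<alpha> open_ball]) (use C(1) C1 in auto)
      show "\<alpha> ` ball 0 r \<subseteq> \<alpha> ` ?C" unfolding C1 by (intro image_mono) auto
      show "\<alpha> ` ?C \<subseteq> B" using B by blast
      show "finite (\<alpha> ` ?P)" by (intro finite_imageI finite_boundary_crossings[OF \<sigma>])
      show "(D.selected col \<union> D'.selected col') \<inter> B \<subseteq> \<alpha> ` ?C" using sel1 by blast
      show "(D.selected col \<union> D'.selected col') \<inter> (\<alpha> ` ?C - \<alpha> ` ball 0 r) \<subseteq> \<alpha> ` ?P"
      proof
        fix p assume p: "p \<in> (D.selected col \<union> D'.selected col') \<inter> (\<alpha> ` ?C - \<alpha> ` ball 0 r)"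
        then have "p \<in> (D.selected col \<union> D'.selected col') \<inter> B" using B by blast
        from sel1[OF this] obtain x s where x: "x \<in> ?C" "graph_sheet \<sigma> (s * \<rho> x) x = sheet_flat x" "p = \<alpha> x"
          by blast
        have "x \<notin> ball 0 r" using x(3) p by blast
        then have "norm x = r" using x(1) unfolding C1 by simp
        then have "x \<in> ?P" using bd[OF x(2)] norm_graph_sheet_ge[of x \<sigma> 0] by simp
        then show "p \<in> \<alpha> ` ?P" using x(3) by blast
      qed
    qed
  next
    case down
    then have "\<not> \<epsilon> = 1" by simp
    then have sel1: "\<exists>x s. x \<in> ?C \<and> x \<in> ?C' \<and> graph_sheet \<sigma> (s * \<rho> x) x = sheet_flat x \<and> p = \<beta> x"
      if "p \<in> (D.selected col \<union> D'.selected col') \<inter> B" for p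
      using sel[OF that] by blast
    show ?thesis
    proof (rule crossing_class_unchanged[where \<Delta>="\<beta> ` ?C'" and \<Delta>i="\<beta> ` {x. norm (graph_sheet \<sigma> 0 x) < r}" and P="\<beta> ` ?P"])
      show "col' R' = col R" if "R \<in> regions M f" "R' \<in> regions M f'" "\<exists>p\<in>R \<inter> R'. p \<notin> B" for R R'
        by (rule col[OF that])
      have cl: "closed ?C'" using closed_Collect_le[OF cont continuous_on_const[of _ r]] by simp
      have "?C' \<subseteq> cball 0 r"
      proof
        fix x assume "x \<in> ?C'"
        then show "x \<in> cball 0 r" using norm_graph_sheet_ge[of x \<sigma> 0] by simp
      qed
      then have "bounded ?C'" using bounded_cball bounded_subset by blast
      then have c: "compact ?C'" using cl compact_eq_bounded_closed by blast
      have "graph_sheet \<sigma> 0 0 = 0" by (simp add: graph_sheet_def vec_eq_iff forall_3)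
      then have ne: "?C' \<noteq> {}" using r by (auto intro!: exI[of _ 0])
      have star: "t *\<^sub>R x \<in> ?C'" if "x \<in> ?C'" "0 \<le> t" "t \<le> 1" for x t
        using graph_sheet_star[OF that(2,3), of \<sigma> x] that(1) by simp
      show "closedin M (\<beta> ` ?C')" "contractible_space (subtopology M (\<beta> ` ?C'))"
        using D.local_param_disc[OF \<beta> c C(2) ne star] by blast+
      show "openin M (\<beta> ` {x. norm (graph_sheet \<sigma> 0 x) < r})"
        by (rule D.local_param_open[OF \<beta> open_Collect_less[OF cont continuous_on_const]]) (use C(2) in auto)
      show "\<beta> ` {x. norm (graph_sheet \<sigma> 0 x) < r} \<subseteq> \<beta> ` ?C'" by (intro image_mono) auto
      show "\<beta> ` ?C' \<subseteq> B" using B by blast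
      show "finite (\<beta> ` ?P)" by (intro finite_imageI finite_boundary_crossings[OF \<sigma>])
      show "(D.selected col \<union> D'.selected col') \<inter> B \<subseteq> \<beta> ` ?C'" using sel1 by blast
      show "(D.selected col \<union> D'.selected col') \<inter> (\<beta> ` ?C' - \<beta> ` {x. norm (graph_sheet \<sigma> 0 x) < r}) \<subseteq> \<beta> ` ?P"
      proof
        fix p assume p: "p \<in> (D.selected col \<union> D'.selected col') \<inter> (\<beta> ` ?C' - \<beta> ` {x. norm (graph_sheet \<sigma> 0 x) < r})"
        then have "p \<in> (D.selected col \<union> D'.selected col') \<inter> B" using B by blast
        from sel1[OF this] obtain x s where x: "x \<in> ?C'" "graph_sheet \<sigma> (s * \<rho> x) x = sheet_flat x" "p = \<beta> x"
          by blast
        have "x \<notin> {x. norm (graph_sheet \<sigma> 0 x) < r}" using x(3) p by blast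
        then have "norm (graph_sheet \<sigma> 0 x) = r" using x(1) by simp
        then have "x \<in> ?P" using bd[OF x(2)] by simp
        then show "p \<in> \<beta> ` ?P" using x(3) by blast
      qed
    qed
  qed
qed

lemma (in local_change) no_mixed_unchanged:
  assumes col: "\<And>R R'. \<lbrakk>R \<in> regions M f; R' \<in> regions M f'; \<exists>p\<in>R \<inter> R'. p \<notin> B\<rbrakk> \<Longrightarrow> col' R' = col R"
    and no: "D.mixed \<inter> B = {}" "D'.mixed \<inter> B = {}"
  shows "crossing_class M \<A> f' col' = crossing_class M \<A> f col"
proof (rule crossing_class_unchanged[where \<Delta>="{}" and \<Delta>i="{}" and P="{}"])
  show "col' R' = col R" if "R \<in> regions M f" "R' \<in> regions M f'" "\<exists>p\<in>R \<inter> R'. p \<notin> B" for R R'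
    by (rule col[OF that])
  show "(D.selected col \<union> D'.selected col') \<inter> B \<subseteq> {}" using no by (auto simp: D.selected_def D'.selected_def)
  show "contractible_space (subtopology M {})"
    by (metis contractible_space_empty subtopology_trivial_iff inf_bot_right)
qed auto

text \<open>Both preimages of a double point in the ball lie in the same component.\<close>

lemma (in diagram) no_mixed_in_connected:
  assumes "connectedin M S" "{p \<in> topspace M. proj (f p) \<in> B} \<subseteq> S"
  shows "mixed \<inter> {p \<in> topspace M. proj (f p) \<in> B} = {}"
proof -
  have False if p: "p \<in> mixed" "proj (f p) \<in> B" for p
  proof -
    note m = partner[OF p(1)]
    have "p \<in> S" "mt p \<in> S" using assms(2) m p(2) by auto
    then show False using m(5) assms(1) by (auto simp: connected_component_of_def)
  qed
  then show ?thesis by blast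
qed

text \<open>In moves I and II only one component of the surface is mapped into the ball, so there are no
  mixed points in it. In moves III and IV the selected circles in the ball lie on the lower sheet,
  which is a disc.\<close>

theorem roseman_p_move_invariant:
  assumes surf: "oriented_closed_surface M \<A>" and pd: "p_diagram M \<A> f" "p_diagram M \<A> f'"
    and move: "roseman_p_move M \<A> B f f'"
    and col: "\<And>R R'. \<lbrakk>R \<in> regions M f; R' \<in> regions M f'; \<exists>p\<in>R \<inter> R'. proj (f p) \<notin> B\<rbrakk> \<Longrightarrow> col' R' = col R"
  shows "crossing_class M \<A> f' col' = crossing_class M \<A> f col"
proof -
  interpret D: diagram M \<A> f using surf pd(1) by unfold_locales (auto simp: p_diagram_def)
  interpret D': diagram M \<A> f' using surf pd(2) by unfold_locales (auto simp: p_diagram_def)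
  obtain F a s s' where I: "s \<in> {-a<..<a}" "s' \<in> {-a<..<a}" and ends: "\<And>p. p \<in> topspace M \<Longrightarrow> F s p = f p \<and> F s' p = f' p"
    and outside: "\<And>t p. \<lbrakk>t \<in> {-a<..<a}; p \<in> topspace M; proj (F 0 p) \<notin> B\<rbrakk> \<Longrightarrow> F t p = F 0 p"
    and fam: "one_sheet_family M \<A> sheet_I B {-a<..<a} F \<or> one_sheet_family M \<A> sheet_II B {-a<..<a} F \<or>
      two_sheet_family M \<A> sheet_III B {-a<..<a} F \<or> two_sheet_family M \<A> sheet_IV B {-a<..<a} F"
    using move unfolding roseman_p_move_def by blast
  have I0: "0 \<in> {-a<..<a}" using I by auto
  let ?B = "{p \<in> topspace M. proj (f p) \<in> B}"
  have ps: "?B = {p \<in> topspace M. proj (F s p) \<in> B}"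
    by (rule Collect_cong) (metis ends)
  have ps': "{p \<in> topspace M. proj (f' p) \<in> B} = {p \<in> topspace M. proj (F s' p) \<in> B}"
    by (rule Collect_cong) (metis ends)
  have change: "local_change M \<A> f f' ?B"
    if Bc: "compact B" and pre: "\<And>t. t \<in> {-a<..<a} \<Longrightarrow> {p \<in> topspace M. proj (F t p) \<in> B} = S" for S
  proof (intro local_change.intro D.diagram_axioms D'.diagram_axioms local_change_axioms.intro)
    have fB: "?B = S" unfolding ps by (rule pre[OF I(1)])
    have fB': "{p \<in> topspace M. proj (f' p) \<in> B} = S" unfolding ps' by (rule pre[OF I(2)])
    have f0: "{p \<in> topspace M. proj (F 0 p) \<in> B} = S" using pre[OF I0] .
    show "closedin M ?B"
      using closedin_continuous_map_preimage[OF D.continuous_shadow] compact_imp_closed[OF Bc] by simp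
    show "f' p = f p" if "p \<in> topspace M" "p \<notin> ?B" for p
    proof -
      have "proj (F 0 p) \<notin> B" using that f0 fB by blast
      then show ?thesis using outside[OF I(1) that(1)] outside[OF I(2) that(1)] ends[OF that(1)] by simp
    qed
    show "q \<notin> ?B" if "p \<in> topspace M" "q \<in> topspace M" "p \<notin> ?B" "proj (f q) = proj (f p)" for p q
      using that by simp
    show "q \<notin> ?B" if "p \<in> topspace M" "q \<in> topspace M" "p \<notin> ?B" "proj (f' q) = proj (f' p)" for p q
    proof -
      have "proj (f' p) \<notin> B" using that fB fB' by blast
      then have "proj (f' q) \<notin> B" using that(4) by simp
      then show ?thesis unfolding fB using fB' by blast
    qed
  qed
  have col': "col' R' = col R" if "R \<in> regions M f" "R' \<in> regions M f'" "\<exists>p\<in>R \<inter> R'. p \<notin> ?B" for R R'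
  proof (rule col[OF that(1,2)])
    have "R \<subseteq> topspace M" using that(1) connected_components_of_subset unfolding regions_def by fastforce
    then show "\<exists>p\<in>R \<inter> R'. proj (f p) \<notin> B" using that(3) by blast
  qed
  have comp: "compact (\<Psi> ` cball 0 r)" if "diffeo W (\<Psi> ` W) \<Psi>" "cball 0 r \<subseteq> W" for \<Psi> :: "real^3 \<Rightarrow> real^3" and W r
  proof (rule compact_continuous_image[OF _ compact_cball])
    have "continuous_on W \<Psi>" using that(1) smooth_on_continuous by (auto simp: diffeo_def)
    then show "continuous_on (cball 0 r) \<Psi>" using that(2) continuous_on_subset by blast
  qed
  have one: ?thesis if fam: "one_sheet_family M \<A> g B {-a<..<a} F" and g: "g = sheet_I \<or> g = sheet_II" for g
  proof -
    obtain r W \<Psi> D \<alpha> \<rho> \<epsilon> where d: "0 < r" "diffeo W (\<Psi> ` W) \<Psi>" "cball 0 r \<subseteq> W" "B = \<Psi> ` cball 0 r" "local_param M \<A> D \<alpha>"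
      "{x. g 0 x \<in> cball 0 r} \<subseteq> D"
      and fam': "\<forall>s\<in>{-a<..<a}. (\<forall>x\<in>D. g (s * \<rho> x) x \<in> W \<and> proj (F s (\<alpha> x)) = \<Psi> (g (s * \<rho> x) x) \<and>
          height (F s (\<alpha> x)) = \<epsilon> * x$2) \<and> {p \<in> topspace M. proj (F s p) \<in> B} = \<alpha> ` {x. g 0 x \<in> cball 0 r}"
      using fam unfolding one_sheet_family_def by (elim exE conjE) (rule that)
    have pre: "{p \<in> topspace M. proj (F t p) \<in> B} = \<alpha> ` {x. g 0 x \<in> cball 0 r}" if "t \<in> {-a<..<a}" for t
      using bspec[OF fam' that] by (rule conjunct2)
    interpret L: local_change M \<A> f f' ?B by (rule change[OF _ pre]) (use comp d in auto)
    let ?C = "{x. g 0 x \<in> cball 0 r}"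
    have "connected ?C"
    proof -
      have "x \<in> ?C \<Longrightarrow> closed_segment 0 x \<subseteq> ?C" for x
        using fold_sheet_star[OF _ _ g, of _ x] by (fastforce simp: closed_segment_def)
      then have "connected_component ?C 0 x" if "x \<in> ?C" for x
        using that connected_segment(1) unfolding connected_component_def by (metis ends_in_segment)
      then show ?thesis unfolding connected_iff_connected_component
        by (meson connected_component_sym connected_component_trans)
    qed
    then have con: "connectedin M (\<alpha> ` ?C)"
      by (intro connectedin_continuous_map_image[OF D.local_param_continuous[OF d(5)]])
        (use d(6) in \<open>simp add: connectedin_subtopology connectedin_iff_connected\<close>)
    have B1: "?B \<subseteq> \<alpha> ` ?C" unfolding ps pre[OF I(1)] by (rule subset_refl)
    have B2: "{p \<in> topspace M. proj (f' p) \<in> B} = ?B" unfolding ps ps' pre[OF I(1)] pre[OF I(2)] by (rule refl)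
    show ?thesis
      by (rule L.no_mixed_unchanged[OF col'])
        (use D.no_mixed_in_connected[OF con B1] D'.no_mixed_in_connected[OF con, of B] B1 B2 in auto)
  qed
  have two: ?thesis if fam: "two_sheet_family M \<A> (graph_sheet \<sigma>) B {-a<..<a} F" and \<sigma>: "\<sigma> = 1 \<or> \<sigma> = -1" for \<sigma>
  proof -
    let ?g = "graph_sheet \<sigma>"
    obtain r W \<Psi> D \<alpha> E \<beta> \<rho> \<epsilon> where d: "0 < r" "diffeo W (\<Psi> ` W) \<Psi>" "cball 0 r \<subseteq> W" "B = \<Psi> ` cball 0 r"
      "local_param M \<A> D \<alpha>" "{x. sheet_flat x \<in> cball 0 r} \<subseteq> D" "local_param M \<A> E \<beta>" "{x. ?g 0 x \<in> cball 0 r} \<subseteq> E"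
      "damping ?g r \<rho>" "\<epsilon> \<in> {1,-1}"
      and fam': "\<forall>s\<in>{-a<..<a}. (\<forall>x\<in>D. sheet_flat x \<in> W \<and> proj (F s (\<alpha> x)) = \<Psi> (sheet_flat x)) \<and>
          (\<forall>x\<in>E. ?g (s * \<rho> x) x \<in> W \<and> proj (F s (\<beta> x)) = \<Psi> (?g (s * \<rho> x) x)) \<and>
          (\<forall>x\<in>D. \<forall>y\<in>E. proj (F s (\<alpha> x)) = proj (F s (\<beta> y)) \<longrightarrow> \<epsilon> * height (F s (\<alpha> x)) < \<epsilon> * height (F s (\<beta> y))) \<and>
          {p \<in> topspace M. proj (F s p) \<in> B} = \<alpha> ` {x. sheet_flat x \<in> cball 0 r} \<union> \<beta> ` {x. ?g 0 x \<in> cball 0 r}"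
      using fam unfolding two_sheet_family_def by (elim exE conjE) (rule that)
    note fam1 = conjunct1[OF bspec[OF fam']] and fam2 = conjunct2[OF bspec[OF fam']]
    have X: "sheet_flat x \<in> W \<and> proj (F s (\<alpha> x)) = \<Psi> (sheet_flat x)" if "s \<in> {-a<..<a}" "x \<in> D" for s x
      using fam1[OF that(1)] that(2) by (rule bspec)
    have Y: "?g (s * \<rho> x) x \<in> W \<and> proj (F s (\<beta> x)) = \<Psi> (?g (s * \<rho> x) x)" if "s \<in> {-a<..<a}" "x \<in> E" for s x
      using conjunct1[OF fam2[OF that(1)]] that(2) by (rule bspec)
    have H: "\<epsilon> * height (F s (\<alpha> x)) < \<epsilon> * height (F s (\<beta> y))"
      if "s \<in> {-a<..<a}" "x \<in> D" "y \<in> E" "proj (F s (\<alpha> x)) = proj (F s (\<beta> y))" for s x y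
      by (rule mp[OF bspec[OF bspec[OF conjunct1[OF conjunct2[OF fam2[OF that(1)]]] that(2)] that(3)] that(4)])
    have pre: "{p \<in> topspace M. proj (F s p) \<in> B} = \<alpha> ` {x. sheet_flat x \<in> cball 0 r} \<union> \<beta> ` {x. ?g 0 x \<in> cball 0 r}"
      if "s \<in> {-a<..<a}" for s
      by (rule conjunct2[OF conjunct2[OF fam2[OF that]]])
    interpret L: local_change M \<A> f f' ?B by (rule change[OF _ pre]) (use comp d in auto)
    have inj: "inj_on \<Psi> W" using d(2) by (auto simp: diffeo_def bij_betw_def)
    have \<alpha>t: "\<alpha> x \<in> topspace M" if "x \<in> D" for x using d(5) that openin_subset by (fastforce simp: local_param_def)
    have \<beta>t: "\<beta> x \<in> topspace M" if "x \<in> E" for x using d(7) that openin_subset by (fastforce simp: local_param_def)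
    have \<rho>: "norm (?g 0 x) < r" if "\<rho> x \<noteq> 0" for x using d(9) that unfolding damping_def by force
    have B1: "?B = \<alpha> ` {x. sheet_flat x \<in> cball 0 r} \<union> \<beta> ` {x. ?g 0 x \<in> cball 0 r}"
      unfolding ps by (rule pre[OF I(1)])
    have B2: "{p \<in> topspace M. proj (f' p) \<in> B} = \<alpha> ` {x. sheet_flat x \<in> cball 0 r} \<union> \<beta> ` {x. ?g 0 x \<in> cball 0 r}"
      unfolding ps' by (rule pre[OF I(2)])
    show ?thesis
    proof (rule L.two_sheet_unchanged[OF col' \<sigma> d(1,5,7,6,8) \<rho> d(10) B1])
      fix p assume p: "p \<in> (D.selected col \<union> D'.selected col') \<inter> ?B"
      consider "p \<in> D.selected col" | "p \<in> D'.selected col'" using p by blast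
      then show "\<exists>x s. x \<in> {x. sheet_flat x \<in> cball 0 r} \<and> x \<in> {x. ?g 0 x \<in> cball 0 r} \<and>
        ?g (s * \<rho> x) x = sheet_flat x \<and> (\<epsilon> = 1 \<and> p = \<alpha> x \<or> \<epsilon> = -1 \<and> p = \<beta> x)"
      proof cases
        case 1
        have X1: "sheet_flat x \<in> W \<and> proj (f (\<alpha> x)) = \<Psi> (sheet_flat x)" if "x \<in> D" for x
          using X[OF I(1) that] ends[OF \<alpha>t[OF that]] by simp
        have Y1: "?g (s * \<rho> x) x \<in> W \<and> proj (f (\<beta> x)) = \<Psi> (?g (s * \<rho> x) x)" if "x \<in> E" for x
          using Y[OF I(1) that] ends[OF \<beta>t[OF that]] by simp
        have H1: "\<epsilon> * height (f (\<alpha> x)) < \<epsilon> * height (f (\<beta> y))"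
          if "x \<in> D" "y \<in> E" "proj (f (\<alpha> x)) = proj (f (\<beta> y))" for x y
          using H[OF I(1) that(1,2)] ends[OF \<alpha>t[OF that(1)]] ends[OF \<beta>t[OF that(2)]] that(3) by simp
        have "proj (f p) \<in> B" using p B1 by blast
        from D.two_sheet_selected[OF inj X1 Y1 H1 B1 d(6,8,10) 1 this]
        show ?thesis by blast
      next
        case 2
        have X1: "sheet_flat x \<in> W \<and> proj (f' (\<alpha> x)) = \<Psi> (sheet_flat x)" if "x \<in> D" for x
          using X[OF I(2) that] ends[OF \<alpha>t[OF that]] by simp
        have Y1: "?g (s' * \<rho> x) x \<in> W \<and> proj (f' (\<beta> x)) = \<Psi> (?g (s' * \<rho> x) x)" if "x \<in> E" for x
          using Y[OF I(2) that] ends[OF \<beta>t[OF that]] by simp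
        have H1: "\<epsilon> * height (f' (\<alpha> x)) < \<epsilon> * height (f' (\<beta> y))"
          if "x \<in> D" "y \<in> E" "proj (f' (\<alpha> x)) = proj (f' (\<beta> y))" for x y
          using H[OF I(2) that(1,2)] ends[OF \<alpha>t[OF that(1)]] ends[OF \<beta>t[OF that(2)]] that(3) by simp
        have "proj (f' p) \<in> B" using p B1 B2 by blast
        from D'.two_sheet_selected[OF inj X1 Y1 H1 B2 d(6,8,10) 2 this]
        show ?thesis by blast
      qed
    qed
  qed
  show ?thesis using fam
  proof (elim disjE)
    assume "two_sheet_family M \<A> sheet_III B {-a<..<a} F"
    then show ?thesis by (intro two[of 1]) (simp_all add: graph_sheet_III)
  next
    assume "two_sheet_family M \<A> sheet_IV B {-a<..<a} F"
    then show ?thesis by (intro two[of "-1"]) (simp_all add: graph_sheet_IV)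
  qed (rule one, assumption, simp)+
qed

section \<open>Winding numbers under differentiable maps of the plane\<close>

definition plane_to_complex :: "real^2 \<Rightarrow> complex" where
  "plane_to_complex v = Complex (v$1) (v$2)"

definition planar_index :: "(real \<Rightarrow> real^2) \<Rightarrow> complex" where
  "planar_index \<zeta> = winding_number (plane_to_complex \<circ> \<zeta>) 0"

definition circle_loop :: "real \<Rightarrow> real \<Rightarrow> real^2" where
  "circle_loop r s = vector [r * cos (2 * pi * s), r * sin (2 * pi * s)]"

lemma norm_plane_to_complex: "cmod (plane_to_complex v) = norm v"
  by (simp add: plane_to_complex_def cmod_def norm_eq_sqrt_inner inner_vec_def sum_2 power2_eq_square)

lemma plane_to_complex_eq_0: "plane_to_complex v = 0 \<longleftrightarrow> v = 0"
  using norm_plane_to_complex[of v] by (metis norm_eq_zero)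

lemma plane_to_complex_diff: "plane_to_complex (v - w) = plane_to_complex v - plane_to_complex w"
  by (simp add: plane_to_complex_def complex_eq_iff)

lemma continuous_plane_to_complex: "continuous_on S plane_to_complex"
  unfolding plane_to_complex_def Complex_eq by (intro continuous_intros)

lemma path_plane_to_complex: "path \<zeta> \<Longrightarrow> path (plane_to_complex \<circ> \<zeta>)"
  by (intro path_continuous_image continuous_plane_to_complex)

lemma norm_circle_loop: "norm (circle_loop r s) = \<bar>r\<bar>"
proof -
  have "norm (circle_loop r s) = sqrt ((r * cos (2 * pi * s))^2 + (r * sin (2 * pi * s))^2)"
    by (simp add: circle_loop_def norm_eq_sqrt_inner inner_vec_def sum_2 flip: power2_eq_square)
  also have "(r * cos (2 * pi * s))^2 + (r * sin (2 * pi * s))^2 = r^2 * ((cos (2 * pi * s))^2 + (sin (2 * pi * s))^2)"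
    by (simp only: power_mult_distrib distrib_left)
  finally show ?thesis by simp
qed

lemma continuous_on_circle_loop:
  fixes a b :: "'b::metric_space \<Rightarrow> real"
  assumes "continuous_on S a" "continuous_on S b" shows "continuous_on S (\<lambda>x. circle_loop (a x) (b x))"
proof -
  have "circle_loop r s = (r * cos (2 * pi * s)) *\<^sub>R axis 1 1 + (r * sin (2 * pi * s)) *\<^sub>R axis 2 1" for r s
    by (simp add: circle_loop_def vec_eq_iff forall_2 axis_def)
  moreover have "continuous_on S (\<lambda>x. 2 * pi * b x)" using assms by (intro continuous_intros)
  ultimately show ?thesis
    using assms by (simp only:) (intro continuous_on_add continuous_on_scaleR continuous_on_mult continuous_on_cos continuous_on_sin continuous_on_const)
qed

lemma circle_loop_closed: "circle_loop r 1 = circle_loop r 0"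
  by (simp add: circle_loop_def)

lemma planar_index_circle: assumes "0 < r" shows "planar_index (circle_loop r) = 1"
proof -
  have "plane_to_complex \<circ> circle_loop r = circlepath 0 r"
    by (auto simp: fun_eq_iff plane_to_complex_def circle_loop_def circlepath complex_eq_iff Re_exp Im_exp algebra_simps)
  then show ?thesis unfolding planar_index_def using winding_number_circlepath_centre[OF assms] by simp
qed

lemma planar_index_homotopic:
  assumes "homotopic_loops (- {0}) \<zeta> \<eta>" shows "planar_index \<zeta> = planar_index \<eta>"
  unfolding planar_index_def
proof (rule winding_number_homotopic_loops)
  show "homotopic_loops (- {0}) (plane_to_complex \<circ> \<zeta>) (plane_to_complex \<circ> \<eta>)"
    by (rule homotopic_loops_continuous_image[OF assms continuous_plane_to_complex])
      (auto simp: plane_to_complex_eq_0)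
qed

lemma winding_number_dominated:
  fixes g h :: "real \<Rightarrow> complex"
  assumes "path g" "path h" "pathfinish g = pathstart g" "pathfinish h = pathstart h"
    and less: "\<And>t. t \<in> {0..1} \<Longrightarrow> cmod (g t - h t) < cmod (h t)"
  shows "winding_number g 0 = winding_number h 0"
proof (rule winding_number_homotopic_loops, rule homotopic_loops_linear[OF assms(1-4)])
  fix t :: real assume t: "t \<in> {0..1}"
  show "closed_segment (g t) (h t) \<subseteq> - {0}"
  proof
    fix x assume "x \<in> closed_segment (g t) (h t)"
    then obtain u where u: "0 \<le> u" "u \<le> 1" "x = (1 - u) *\<^sub>R g t + u *\<^sub>R h t" by (auto simp: closed_segment_def)
    have x: "x = h t + (1 - u) *\<^sub>R (g t - h t)" unfolding u(3) by (simp add: algebra_simps)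
    have "norm ((1 - u) *\<^sub>R (g t - h t)) \<le> cmod (g t - h t)" using u by (simp add: mult_left_le_one_le)
    then have "norm ((1 - u) *\<^sub>R (g t - h t)) < cmod (h t)" using less[OF t] by simp
    moreover have "h t = - ((1 - u) *\<^sub>R (g t - h t))" if "x = 0" using x that by (simp only: eq_neg_iff_add_eq_0)
    ultimately have "x \<noteq> 0" by (metis norm_minus_cancel less_irrefl)
    then show "x \<in> - {0}" by auto
  qed
qed

lemma winding_number_scaled:
  assumes g: "path g" "pathfinish g = pathstart g" "0 \<notin> path_image g" and a: "a \<noteq> (0::complex)"
  shows "winding_number (\<lambda>t. a * g t) 0 = winding_number g 0"
proof (rule winding_number_homotopic_loops[symmetric])
  define w where "w = Ln a"
  have w: "exp w = a" unfolding w_def using a by simp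
  show "homotopic_loops (- {0}) g (\<lambda>t. a * g t)"
    unfolding homotopic_loops
  proof (intro exI[of _ "\<lambda>(u,t). exp (of_real u * w) * g t"] conjI ballI)
    have "continuous_on ({0..1::real} \<times> {0..1}) (\<lambda>x. g (snd x))"
      by (rule continuous_on_compose2[OF g(1)[unfolded path_def]]) (auto intro!: continuous_intros)
    then have "continuous_on ({0..1::real} \<times> {0..1}) (\<lambda>x. exp (of_real (fst x) * w) * g (snd x))"
      by (intro continuous_intros)
    then show "continuous_on ({0..1::real} \<times> {0..1}) (\<lambda>(u,t). exp (of_real u * w) * g t)"
      by (simp add: case_prod_unfold)
    show "(\<lambda>(u,t). exp (of_real u * w) * g t) \<in> ({0..1::real} \<times> {0..1}) \<rightarrow> - {0}"
    proof
      fix z :: "real \<times> real" assume z: "z \<in> {0..1} \<times> {0..1}"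
      then have "g (snd z) \<in> path_image g" unfolding path_image_def by (intro imageI) auto
      then have "g (snd z) \<noteq> 0" using g(3) by metis
      then show "(\<lambda>(u,t). exp (of_real u * w) * g t) z \<in> - {0}" by (simp add: case_prod_unfold)
    qed
  qed (use g(2) w in \<open>simp_all add: pathfinish_def pathstart_def\<close>)
qed

text \<open>In complex notation the derivative is \<open>L z = a z + b cnj z\<close>, with determinant
  \<open>|a|^2 - |b|^2\<close>. The term with the larger coefficient dominates the other one and the remainder of
  the Taylor expansion, so the image loop winds like \<open>\<zeta>\<close> or like its conjugate.\<close>

theorem planar_index_differentiable:
  fixes \<tau> L :: "real^2 \<Rightarrow> real^2"
  assumes der: "(\<tau> has_derivative L) (at c)" and det: "det (matrix L) \<noteq> 0"
    and cont: "continuous_on (ball c e) \<tau>" "0 < e"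
  shows "\<exists>d>0. \<forall>\<zeta>. path \<zeta> \<and> pathfinish \<zeta> = pathstart \<zeta> \<and> (\<forall>s\<in>{0..1}. \<zeta> s \<noteq> 0 \<and> norm (\<zeta> s) < d) \<longrightarrow>
      planar_index (\<lambda>s. \<tau> (c + \<zeta> s) - \<tau> c) = (if 0 < det (matrix L) then planar_index \<zeta> else - cnj (planar_index \<zeta>))"
proof -
  let ?C = plane_to_complex
  let ?m = "\<lambda>i j. L (axis j 1) $ i"
  define a where "a = Complex ((?m 1 1 + ?m 2 2) / 2) ((?m 2 1 - ?m 1 2) / 2)"
  define b where "b = Complex ((?m 1 1 - ?m 2 2) / 2) ((?m 2 1 + ?m 1 2) / 2)"
  have lin: "linear L" using der has_derivative_linear by blast
  have L: "?C (L v) = a * ?C v + b * cnj (?C v)" for v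
  proof -
    have v: "v = v$1 *\<^sub>R axis 1 1 + v$2 *\<^sub>R axis 2 1" by (simp add: vec_eq_iff forall_2 axis_def)
    have "L v = v$1 *\<^sub>R L (axis 1 1) + v$2 *\<^sub>R L (axis 2 1)"
      using arg_cong[OF v, of L] by (simp only: linear_add[OF lin] linear_scale[OF lin])
    then show ?thesis by (simp add: plane_to_complex_def complex_eq_iff a_def b_def field_simps)
  qed
  have dt: "det (matrix L) = (cmod a)\<^sup>2 - (cmod b)\<^sup>2"
    unfolding cmod_power2 by (simp add: det_2 matrix_def a_def b_def power2_eq_square field_simps)
  define E where "E = \<bar>cmod a - cmod b\<bar> / 2"
  have E: "0 < E" using det unfolding dt E_def by auto
  obtain d0 where d0: "0 < d0" "\<And>y. norm (y - c) < d0 \<Longrightarrow> norm (\<tau> y - \<tau> c - L (y - c)) \<le> E * norm (y - c)"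
    using der E unfolding has_derivative_at_alt by meson
  show ?thesis
  proof (intro exI[of _ "min d0 e"] conjI allI impI)
    show "0 < min d0 e" using d0 cont by simp
    fix \<zeta> :: "real \<Rightarrow> real^2"
    assume *: "path \<zeta> \<and> pathfinish \<zeta> = pathstart \<zeta> \<and> (\<forall>s\<in>{0..1}. \<zeta> s \<noteq> 0 \<and> norm (\<zeta> s) < min d0 e)"
    then have \<zeta>: "path \<zeta>" "pathfinish \<zeta> = pathstart \<zeta>" and small': "\<forall>s\<in>{0..1}. \<zeta> s \<noteq> 0 \<and> norm (\<zeta> s) < min d0 e"
      by blast+
    have small: "\<zeta> s \<noteq> 0 \<and> norm (\<zeta> s) < min d0 e" if "s \<in> {0..1}" for s using small' that by blast
    let ?g = "?C \<circ> (\<lambda>s. \<tau> (c + \<zeta> s) - \<tau> c)"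
    let ?z = "?C \<circ> \<zeta>"
    have pz: "path ?z" "pathfinish ?z = pathstart ?z" "0 \<notin> path_image ?z"
      using path_plane_to_complex[OF \<zeta>(1)] \<zeta>(2) small by (auto simp: pathfinish_def pathstart_def path_image_def plane_to_complex_eq_0)
    have "continuous_on {0..1} (\<lambda>s. \<tau> (c + \<zeta> s) - \<tau> c)"
      using \<zeta>(1) small unfolding path_def
      by (intro continuous_intros continuous_on_compose2[OF cont(1)]) (auto simp: dist_norm)
    then have pg: "path ?g" "pathfinish ?g = pathstart ?g"
      using path_plane_to_complex \<zeta>(2) by (auto simp: path_def pathfinish_def pathstart_def)
    have near: "cmod (?g s - (a * ?z s + b * cnj (?z s))) \<le> E * cmod (?z s)" if "s \<in> {0..1}" for s
      using d0(2)[of "c + \<zeta> s"] small[OF that]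
      by (simp add: L[symmetric] plane_to_complex_diff[symmetric] norm_plane_to_complex)
    have z0: "0 < cmod (?z s)" if "s \<in> {0..1}" for s using small[OF that] by (simp add: norm_plane_to_complex)
    have cont_z: "continuous_on {0..1} ?z" using pz(1) by (simp add: path_def)
    show "planar_index (\<lambda>s. \<tau> (c + \<zeta> s) - \<tau> c) = (if 0 < det (matrix L) then planar_index \<zeta> else - cnj (planar_index \<zeta>))"
    proof (cases "0 < det (matrix L)")
      case True
      then have "(cmod b)\<^sup>2 < (cmod a)\<^sup>2" unfolding dt by simp
      then have ab: "cmod b < cmod a" by (rule power2_less_imp_less) simp
      then have a0: "a \<noteq> 0" by auto
      have "winding_number ?g 0 = winding_number (\<lambda>s. a * ?z s) 0"
      proof (rule winding_number_dominated[OF pg(1) _ pg(2)])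
        show "path (\<lambda>s. a * ?z s)" unfolding path_def by (rule continuous_on_mult[OF continuous_on_const cont_z])
        show "pathfinish (\<lambda>s. a * ?z s) = pathstart (\<lambda>s. a * ?z s)" using pz(2) by (simp add: pathfinish_def pathstart_def)
        fix s :: real assume s: "s \<in> {0..1}"
        have "cmod (?g s - a * ?z s) \<le> cmod (?g s - (a * ?z s + b * cnj (?z s))) + cmod (b * cnj (?z s))"
          using norm_triangle_ineq[of "?g s - (a * ?z s + b * cnj (?z s))" "b * cnj (?z s)"] by simp
        also have "\<dots> \<le> (E + cmod b) * cmod (?z s)" using near[OF s] by (simp add: norm_mult algebra_simps)
        also have "\<dots> < cmod a * cmod (?z s)" using ab z0[OF s] by (intro mult_strict_right_mono) (auto simp: E_def field_simps)
        finally show "cmod (?g s - a * ?z s) < cmod (a * ?z s)" by (simp add: norm_mult)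
      qed
      then show ?thesis using True winding_number_scaled[OF pz a0] by (simp add: planar_index_def)
    next
      case False
      then have "(cmod a)\<^sup>2 < (cmod b)\<^sup>2" using False det unfolding dt by linarith
      then have ab: "cmod a < cmod b" by (rule power2_less_imp_less) simp
      then have b0: "b \<noteq> 0" by auto
      have pc: "path (cnj \<circ> ?z)" "pathfinish (cnj \<circ> ?z) = pathstart (cnj \<circ> ?z)" "0 \<notin> path_image (cnj \<circ> ?z)"
        using pz path_continuous_image[OF pz(1) continuous_on_cnj[OF continuous_on_id]]
        by (auto simp: path_image_def pathfinish_def pathstart_def id_def)
      have "winding_number ?g 0 = winding_number (\<lambda>s. b * (cnj \<circ> ?z) s) 0"
      proof (rule winding_number_dominated[OF pg(1) _ pg(2)])
        show "path (\<lambda>s. b * (cnj \<circ> ?z) s)" using continuous_on_mult[OF continuous_on_const pc(1)[unfolded path_def]] unfolding path_def .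
        show "pathfinish (\<lambda>s. b * (cnj \<circ> ?z) s) = pathstart (\<lambda>s. b * (cnj \<circ> ?z) s)"
          using pc(2) by (simp add: pathfinish_def pathstart_def)
        fix s :: real assume s: "s \<in> {0..1}"
        have "cmod (?g s - b * cnj (?z s)) \<le> cmod (?g s - (a * ?z s + b * cnj (?z s))) + cmod (a * ?z s)"
          using norm_triangle_ineq[of "?g s - (a * ?z s + b * cnj (?z s))" "a * ?z s"] by (simp add: algebra_simps)
        also have "\<dots> \<le> (E + cmod a) * cmod (?z s)" using near[OF s] by (simp add: norm_mult algebra_simps)
        also have "\<dots> < cmod b * cmod (?z s)" using ab z0[OF s] by (intro mult_strict_right_mono) (auto simp: E_def field_simps)
        finally show "cmod (?g s - b * (cnj \<circ> ?z) s) < cmod (b * (cnj \<circ> ?z) s)" by (simp add: norm_mult)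
      qed
      also have "\<dots> = winding_number (cnj \<circ> ?z) (cnj 0)" using winding_number_scaled[OF pc b0] by simp
      also have "\<dots> = - cnj (winding_number ?z 0)" by (rule winding_number_cnj[OF pz(1,3)])
      finally show ?thesis using False by (simp add: planar_index_def)
    qed
  qed
qed

section \<open>Isotopies of a surface preserve its orientation\<close>

lemma continuous_on_slice:
  assumes "continuous_on (A \<times> B) (\<lambda>(t,x). g t x)" "t \<in> A" shows "continuous_on B (g t)"
proof -
  have "continuous_on B (\<lambda>x. (\<lambda>(t,x). g t x) (t, x))"
    by (rule continuous_on_compose2[OF assms(1) continuous_on_Pair[OF continuous_on_const continuous_on_id]]) (use assms(2) in auto)
  then show ?thesis by simp
qed

context oriented_surface begin

lemma isotopy_in_charts:
  assumes \<theta>: "surface_isotopy M \<theta>" and c: "(U,\<phi>) \<in> \<A>" "p \<in> U" "(V,\<psi>) \<in> \<A>" "\<theta> t0 p \<in> V"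
  obtains e where "0 < e" "ball (\<phi> p) e \<subseteq> \<phi> ` U"
    "\<forall>t\<in>ball t0 e. \<forall>x\<in>ball (\<phi> p) e. \<theta> t (inv_into U \<phi> x) \<in> V"
    "continuous_on (ball t0 e \<times> ball (\<phi> p) e) (\<lambda>(t,x). \<psi> (\<theta> t (inv_into U \<phi> x)))"
proof -
  let ?g = "\<lambda>(t,x). \<theta> t (inv_into U \<phi> x)"
  let ?X = "(UNIV :: real set) \<times> \<phi> ` U"
  have "continuous_map (prod_topology euclideanreal (top_of_set (\<phi> ` U))) (prod_topology euclideanreal M) (\<lambda>(t,x). (t, inv_into U \<phi> x))"
    using chart(6)[OF c(1)] by (simp add: continuous_map_prod_top)
  then have "continuous_map (prod_topology euclideanreal (top_of_set (\<phi> ` U))) M ((\<lambda>(t,p). \<theta> t p) \<circ> (\<lambda>(t,x). (t, inv_into U \<phi> x)))"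
    using \<theta> continuous_map_compose unfolding surface_isotopy_def by blast
  moreover have "(\<lambda>(t,p). \<theta> t p) \<circ> (\<lambda>(t,x). (t, inv_into U \<phi> x)) = ?g" by auto
  moreover have "prod_topology euclideanreal (top_of_set (\<phi> ` U)) = top_of_set ?X"
    using prod_topology_subtopology_eu[of UNIV "\<phi> ` U"] by simp
  ultimately have g: "continuous_map (top_of_set ?X) M ?g" by metis
  let ?N = "{z \<in> ?X. ?g z \<in> V}"
  have "openin (top_of_set ?X) ?N"
    using openin_continuous_map_preimage[OF g chart(1)[OF c(3)]] by simp
  moreover have "open ?X" using chart(3)[OF c(1)] by (intro open_Times) auto
  ultimately have N: "open ?N" using openin_open_eq by blast
  have ip: "inv_into U \<phi> (\<phi> p) = p" using chart(4)[OF c(1)] c(2) by (simp add: inv_into_f_f)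
  then have "(t0, \<phi> p) \<in> ?N" using c by simp
  from open_prod_elim[OF N this] obtain A B where AB: "open A" "open B" "(t0, \<phi> p) \<in> A \<times> B" "A \<times> B \<subseteq> ?N" by blast
  have tA: "t0 \<in> A" and pB: "\<phi> p \<in> B" using AB(3) by simp_all
  obtain e1 where e1: "0 < e1" "ball t0 e1 \<subseteq> A" by (rule openE[OF AB(1) tA])
  obtain e2 where e2: "0 < e2" "ball (\<phi> p) e2 \<subseteq> B" by (rule openE[OF AB(2) pB])
  have "ball t0 (min e1 e2) \<times> ball (\<phi> p) (min e1 e2) \<subseteq> A \<times> B"
    by (rule Sigma_mono) (use e1(2) e2(2) subset_ball[of "min e1 e2" e1 t0] subset_ball[of "min e1 e2" e2 "\<phi> p"] in simp_all)
  then have sub: "ball t0 (min e1 e2) \<times> ball (\<phi> p) (min e1 e2) \<subseteq> ?N" using AB(4) by (rule subset_trans)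
  note e = e1(1) e2(1)
  have "?N \<subseteq> ?X" by (rule Collect_restrict)
  then have "subtopology (top_of_set ?X) ?N = top_of_set ?N" by (simp only: subtopology_subtopology Int_absorb1)
  then have "continuous_map (top_of_set ?N) M ?g"
    using continuous_map_from_subtopology[OF g, of ?N] by (simp only:)
  then have "continuous_map (top_of_set ?N) (subtopology M V) ?g"
    by (simp add: continuous_map_in_subtopology)
  from continuous_map_compose[OF this chart(7)[OF c(3)]]
  have "continuous_on ?N (\<psi> \<circ> ?g)" by simp
  then have cont: "continuous_on ?N (\<lambda>(t,x). \<psi> (\<theta> t (inv_into U \<phi> x)))" by (simp add: o_def case_prod_unfold)
  show ?thesis
  proof (rule that[of "min e1 e2"])
    show "0 < min e1 e2" using e by simp
    have "x \<in> \<phi> ` U" if "x \<in> ball (\<phi> p) (min e1 e2)" for x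
    proof -
      have "(t0, x) \<in> ?N" by (rule subsetD[OF sub]) (use that e in auto)
      then show ?thesis by blast
    qed
    then show "ball (\<phi> p) (min e1 e2) \<subseteq> \<phi> ` U" by blast
    show "\<forall>t\<in>ball t0 (min e1 e2). \<forall>x\<in>ball (\<phi> p) (min e1 e2). \<theta> t (inv_into U \<phi> x) \<in> V"
    proof (intro ballI)
      fix t x assume that: "t \<in> ball t0 (min e1 e2)" "x \<in> ball (\<phi> p) (min e1 e2)"
      have "(t, x) \<in> ?N" by (rule subsetD[OF sub]) (use that in blast)
      then show "\<theta> t (inv_into U \<phi> x) \<in> V" by simp
    qed
    show "continuous_on (ball t0 (min e1 e2) \<times> ball (\<phi> p) (min e1 e2)) (\<lambda>(t,x). \<psi> (\<theta> t (inv_into U \<phi> x)))"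
      by (rule continuous_on_subset[OF cont sub])
  qed
qed

lemma isotopy_injective:
  assumes \<theta>: "surface_isotopy M \<theta>" and c: "(U,\<phi>) \<in> \<A>" "(V,\<psi>) \<in> \<A>"
    and x: "x \<in> \<phi> ` U" "y \<in> \<phi> ` U" "\<theta> t (inv_into U \<phi> x) \<in> V" "\<theta> t (inv_into U \<phi> y) \<in> V" "x \<noteq> y"
  shows "\<psi> (\<theta> t (inv_into U \<phi> x)) \<noteq> \<psi> (\<theta> t (inv_into U \<phi> y))"
proof
  assume "\<psi> (\<theta> t (inv_into U \<phi> x)) = \<psi> (\<theta> t (inv_into U \<phi> y))"
  then have "\<theta> t (inv_into U \<phi> x) = \<theta> t (inv_into U \<phi> y)" using chart(4)[OF c(2)] x by (auto dest: inj_onD)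
  moreover have "inj_on (\<theta> t) (topspace M)" using \<theta> homeomorphic_imp_injective_map unfolding surface_isotopy_def by blast
  moreover have "inv_into U \<phi> x \<in> topspace M" "inv_into U \<phi> y \<in> topspace M"
    using inv_into_into[OF x(1)] inv_into_into[OF x(2)] chart(2)[OF c(1)] by blast+
  ultimately have "inv_into U \<phi> x = inv_into U \<phi> y" by (auto dest: inj_onD)
  then show False using x(1,2,5) by (metis f_inv_into_f)
qed

abbreviation image_loop :: "('a \<Rightarrow> 'a) \<Rightarrow> 'a set \<Rightarrow> ('a \<Rightarrow> real^2) \<Rightarrow> 'a \<Rightarrow> ('a \<Rightarrow> real^2) \<Rightarrow> real \<Rightarrow> real \<Rightarrow> real^2" where
  "image_loop g U \<phi> p \<psi> r \<equiv> \<lambda>s. \<psi> (g (inv_into U \<phi> (\<phi> p + circle_loop r s))) - \<psi> (g p)"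

text \<open>The linear homotopy of time and radius is a homotopy of loops that avoid the origin, since every
  stage of the isotopy is injective.\<close>

lemma isotopy_index_constant:
  assumes \<theta>: "surface_isotopy M \<theta>" and c: "(U,\<phi>) \<in> \<A>" "p \<in> U" "(V,\<psi>) \<in> \<A>"
    and e: "ball (\<phi> p) e \<subseteq> \<phi> ` U" "\<And>t x. \<lbrakk>t \<in> ball t0 e; x \<in> ball (\<phi> p) e\<rbrakk> \<Longrightarrow> \<theta> t (inv_into U \<phi> x) \<in> V"
    and cont: "continuous_on (ball t0 e \<times> ball (\<phi> p) e) (\<lambda>(t,x). \<psi> (\<theta> t (inv_into U \<phi> x)))"
    and t: "t \<in> ball t0 e" "t' \<in> ball t0 e" and r: "0 < r" "r < e" "0 < r'" "r' < e"
  shows "planar_index (image_loop (\<theta> t) U \<phi> p \<psi> r) = planar_index (image_loop (\<theta> t') U \<phi> p \<psi> r')"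
proof (rule planar_index_homotopic)
  define \<Phi> where "\<Phi> = (\<lambda>(t,x). \<psi> (\<theta> t (inv_into U \<phi> x)))"
  define T where "T u = t + u * (t' - t)" for u
  define R where "R u = r + u * (r' - r)" for u
  have ip: "inv_into U \<phi> (\<phi> p) = p" using chart(4)[OF c(1)] c(2) by (simp add: inv_into_f_f)
  have T: "T u \<in> ball t0 e" if "u \<in> {0..1}" for u
  proof -
    have "T u = (1 - u) *\<^sub>R t + u *\<^sub>R t'" by (simp add: T_def algebra_simps)
    then show ?thesis using convexD_alt[OF convex_ball t] that by simp
  qed
  have R: "0 < R u" "R u < e" if "u \<in> {0..1}" for u
  proof -
    have "R u = (1 - u) *\<^sub>R r + u *\<^sub>R r'" by (simp add: R_def algebra_simps)
    moreover have "r \<in> {0<..<e}" "r' \<in> {0<..<e}" using r by auto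
    ultimately have "R u \<in> {0<..<e}" using convexD_alt[OF convex_real_interval(8), of r 0 e r' u] that by simp
    then show "0 < R u" "R u < e" by auto
  qed
  have x: "\<phi> p + circle_loop (R u) s \<in> ball (\<phi> p) e" if "u \<in> {0..1}" for u s
    using R[OF that] by (simp add: dist_norm norm_circle_loop)
  have e0: "\<phi> p \<in> ball (\<phi> p) e" using r by simp
  let ?h = "\<lambda>z. \<Phi> (T (fst z), \<phi> p + circle_loop (R (fst z)) (snd z)) - \<Phi> (T (fst z), \<phi> p)"
  show "homotopic_loops (- {0}) (image_loop (\<theta> t) U \<phi> p \<psi> r) (image_loop (\<theta> t') U \<phi> p \<psi> r')"
    unfolding homotopic_loops
  proof (intro exI[of _ ?h] conjI ballI)
    show "continuous_on ({0..1} \<times> {0..1}) ?h"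
    proof (intro continuous_on_diff continuous_on_compose2[OF cont[folded \<Phi>_def]])
      show "continuous_on ({0..1} \<times> {0..1}) (\<lambda>z. (T (fst z), \<phi> p + circle_loop (R (fst z)) (snd z)))"
        unfolding T_def R_def by (intro continuous_intros continuous_on_circle_loop)
      show "continuous_on ({0..1} \<times> {0..1}) (\<lambda>z. (T (fst z), \<phi> p))" unfolding T_def by (intro continuous_intros)
    qed (use T x e0 in auto)
    show "?h \<in> {0..1} \<times> {0..1} \<rightarrow> - {0}"
    proof
      fix z :: "real \<times> real" assume "z \<in> {0..1} \<times> {0..1}"
      then have u: "fst z \<in> {0..1}" by auto
      have "circle_loop (R (fst z)) (snd z) \<noteq> 0" using R(1)[OF u] norm_circle_loop[of "R (fst z)" "snd z"] by force
      then have "\<Phi> (T (fst z), \<phi> p + circle_loop (R (fst z)) (snd z)) \<noteq> \<Phi> (T (fst z), \<phi> p)"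
        unfolding \<Phi>_def prod.case
        by (intro isotopy_injective[OF \<theta> c(1,3)] subsetD[OF e(1)] e(2) T[OF u] x[OF u] e0) simp
      then show "?h z \<in> - {0}" by simp
    qed
    show "?h (0, s) = image_loop (\<theta> t) U \<phi> p \<psi> r s" for s by (simp add: \<Phi>_def T_def R_def ip)
    show "?h (1, s) = image_loop (\<theta> t') U \<phi> p \<psi> r' s" for s by (simp add: \<Phi>_def T_def R_def ip)
    show "pathfinish (?h \<circ> Pair u) = pathstart (?h \<circ> Pair u)" for u
      by (simp add: pathfinish_def pathstart_def circle_loop_closed)
  qed
qed

text \<open>The maps \<open>\<theta> t\<close> are only continuous, so whether they preserve the orientation is read off from
  the winding number of the image of a small circle.\<close>

definition preserves_orientation_at :: "('a \<Rightarrow> 'a) \<Rightarrow> 'a set \<Rightarrow> ('a \<Rightarrow> real^2) \<Rightarrow> 'a \<Rightarrow> ('a \<Rightarrow> real^2) \<Rightarrow> bool" where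
  "preserves_orientation_at g U \<phi> p \<psi> \<longleftrightarrow> (\<exists>r0>0. \<forall>r. 0 < r \<and> r < r0 \<longrightarrow> planar_index (image_loop g U \<phi> p \<psi> r) = 1)"

lemma preserves_orientation_change_chart:
  assumes \<theta>: "surface_isotopy M \<theta>" and c: "(U,\<phi>) \<in> \<A>" "p \<in> U" "(V,\<psi>) \<in> \<A>" "\<theta> t p \<in> V"
    and c': "(V',\<psi>') \<in> \<A>" "\<theta> t p \<in> V'" and pres: "preserves_orientation_at (\<theta> t) U \<phi> p \<psi>"
  shows "preserves_orientation_at (\<theta> t) U \<phi> p \<psi>'"
proof -
  obtain e where e': "0 < e" "ball (\<phi> p) e \<subseteq> \<phi> ` U" "\<forall>u\<in>ball t e. \<forall>x\<in>ball (\<phi> p) e. \<theta> u (inv_into U \<phi> x) \<in> V"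
    "continuous_on (ball t e \<times> ball (\<phi> p) e) (\<lambda>(t,x). \<psi> (\<theta> t (inv_into U \<phi> x)))"
    by (rule isotopy_in_charts[OF \<theta> c])
  note e = e'(1,2) e'(3)[rule_format] e'(4)
  obtain r0 where r0: "0 < r0" "\<forall>r. 0 < r \<and> r < r0 \<longrightarrow> planar_index (image_loop (\<theta> t) U \<phi> p \<psi> r) = 1"
    using pres unfolding preserves_orientation_at_def by (elim exE conjE) (rule that)
  have ip: "inv_into U \<phi> (\<phi> p) = p" using chart(4)[OF c(1)] c(2) by (simp add: inv_into_f_f)
  let ?\<tau> = "\<psi>' \<circ> inv_into V \<psi>" and ?c = "\<psi> (\<theta> t p)"
  note tr = transition[OF c(3) c'(1) c(4) c'(2)]
  have op: "open (\<psi> ` (V \<inter> V'))" by (rule open_chart_image[OF c(3) chart(1)[OF c'(1)]])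
  have "?c \<in> \<psi> ` (V \<inter> V')" using c(4) c'(2) by blast
  then obtain e2 where e2: "0 < e2" "ball ?c e2 \<subseteq> \<psi> ` (V \<inter> V')" using op open_contains_ball by metis
  have cb: "continuous_on (ball ?c e2) ?\<tau>" by (rule continuous_on_subset[OF smooth_on_continuous[OF tr(4)] e2(2)])
  obtain d where d: "0 < d" "\<forall>\<zeta>. path \<zeta> \<and> pathfinish \<zeta> = pathstart \<zeta> \<and> (\<forall>s\<in>{0..1}. \<zeta> s \<noteq> 0 \<and> norm (\<zeta> s) < d) \<longrightarrow>
      planar_index (\<lambda>s. ?\<tau> (?c + \<zeta> s) - ?\<tau> ?c) =
        (if 0 < det (matrix (frechet_derivative ?\<tau> (at ?c))) then planar_index \<zeta> else - cnj (planar_index \<zeta>))"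
    using planar_index_differentiable[OF tr(1) less_imp_neq[OF tr(2), symmetric] cb e2(1)] by (elim exE conjE) (rule that)
  let ?G = "\<lambda>x. \<psi> (\<theta> t (inv_into U \<phi> x))"
  have cG: "continuous_on (ball (\<phi> p) e) ?G"
    by (rule continuous_on_slice[OF e(4)]) (use e(1) in simp)
  have "isCont ?G (\<phi> p)" using cG e(1) by (simp add: continuous_on_eq_continuous_at)
  then have "\<exists>e3>0. \<forall>x. norm (x - \<phi> p) < e3 \<longrightarrow> norm (?G x - ?G (\<phi> p)) < d"
    unfolding isCont_def LIM_eq using d(1) by (metis diff_self norm_zero)
  then obtain e3 where e3: "0 < e3" "\<And>x. norm (x - \<phi> p) < e3 \<Longrightarrow> norm (?G x - ?G (\<phi> p)) < d" by blast
  show ?thesis unfolding preserves_orientation_at_def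
  proof (intro exI[of _ "min r0 (min e e3)"] conjI allI impI)
    show "0 < min r0 (min e e3)" using r0 e e3 by simp
    fix r assume r: "0 < r \<and> r < min r0 (min e e3)"
    have xb: "\<phi> p + circle_loop r s \<in> ball (\<phi> p) e" for s using r by (simp add: dist_norm norm_circle_loop)
    have yV: "\<theta> t (inv_into U \<phi> (\<phi> p + circle_loop r s)) \<in> V" for s using e(1,3) xb by simp
    let ?\<zeta> = "image_loop (\<theta> t) U \<phi> p \<psi> r"
    have "planar_index (\<lambda>s. ?\<tau> (?c + ?\<zeta> s) - ?\<tau> ?c) =
        (if 0 < det (matrix (frechet_derivative ?\<tau> (at ?c))) then planar_index ?\<zeta> else - cnj (planar_index ?\<zeta>))"
    proof (rule d(2)[rule_format], intro conjI ballI)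
      show "path ?\<zeta>" unfolding path_def
        by (intro continuous_on_diff continuous_on_const continuous_on_compose2[OF cG] continuous_on_add continuous_on_circle_loop)
          (use xb in \<open>auto intro!: continuous_intros\<close>)
      show "pathfinish ?\<zeta> = pathstart ?\<zeta>" by (simp add: pathfinish_def pathstart_def circle_loop_closed)
      fix s :: real
      have "circle_loop r s \<noteq> 0" using r norm_circle_loop[of r s] by force
      then have "?G (\<phi> p + circle_loop r s) \<noteq> ?G (\<phi> p)"
        by (intro isotopy_injective[OF \<theta> c(1,3)] subsetD[OF e(2)] e(3) xb) (use e(1) in auto)
      moreover have "norm (?G (\<phi> p + circle_loop r s) - ?G (\<phi> p)) < d"
        using r by (intro e3(2)) (simp add: norm_circle_loop)
      ultimately show "?\<zeta> s \<noteq> 0" "norm (?\<zeta> s) < d" using ip by simp_all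
    qed
    moreover have "?\<tau> (?c + ?\<zeta> s) - ?\<tau> ?c = image_loop (\<theta> t) U \<phi> p \<psi>' r s" for s
      using yV[of s] c(4) chart(4)[OF c(3)] by (simp add: inv_into_f_f)
    ultimately show "planar_index (image_loop (\<theta> t) U \<phi> p \<psi>' r) = 1" using r0(2) r tr(2) by simp
  qed
qed

text \<open>The winding number of the image of a small circle is locally constant in time and does not depend
  on the chart in the target, because transition maps have positive determinant. It is 1 for the
  identity at time 0, and it would be \<open>-1\<close> for a negative determinant.\<close>

theorem isotopy_preserves_orientation:
  assumes \<theta>: "surface_isotopy M \<theta>" and c: "(U,\<phi>) \<in> \<A>" "p \<in> U" "(V,\<psi>) \<in> \<A>" "\<theta> t1 p \<in> V"
    and der: "((\<psi> \<circ> \<theta> t1 \<circ> inv_into U \<phi>) has_derivative L) (at (\<phi> p))" and nz: "det (matrix L) \<noteq> 0"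
  shows "0 < det (matrix L)"
proof -
  define K where "K t \<longleftrightarrow> (\<forall>(W,\<omega>)\<in>\<A>. \<theta> t p \<in> W \<longrightarrow> preserves_orientation_at (\<theta> t) U \<phi> p \<omega>)" for t
  have ip: "inv_into U \<phi> (\<phi> p) = p" using chart(4)[OF c(1)] c(2) by (simp add: inv_into_f_f)
  have pt: "p \<in> topspace M" using c chart(2) by blast
  have \<theta>t: "\<theta> t p \<in> topspace M" for t
    using \<theta> pt homeomorphic_imp_surjective_map unfolding surface_isotopy_def by blast
  have K_chart: "K t" if "(W,\<omega>) \<in> \<A>" "\<theta> t p \<in> W" "preserves_orientation_at (\<theta> t) U \<phi> p \<omega>" for t W \<omega>
    unfolding K_def using preserves_orientation_change_chart[OF \<theta> c(1,2) that(1,2) _ _ that(3)] by blast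
  have start: "K 0"
  proof (rule K_chart[OF c(1)])
    have \<theta>0: "\<theta> 0 q = q" if "q \<in> topspace M" for q using \<theta> that by (simp add: surface_isotopy_def)
    show "\<theta> 0 p \<in> U" using \<theta>0[OF pt] c(2) by simp
    have "\<phi> p \<in> \<phi> ` U" using c(2) by blast
    then obtain e where e: "0 < e" "ball (\<phi> p) e \<subseteq> \<phi> ` U" using chart(3)[OF c(1)] open_contains_ball by metis
    show "preserves_orientation_at (\<theta> 0) U \<phi> p \<phi>" unfolding preserves_orientation_at_def
    proof (intro exI[of _ e] conjI allI impI e(1))
      fix r assume r: "0 < r \<and> r < e"
      have loop: "image_loop (\<theta> 0) U \<phi> p \<phi> r s = circle_loop r s" for s
      proof -
        have x: "\<phi> p + circle_loop r s \<in> \<phi> ` U"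
          by (rule subsetD[OF e(2)]) (use r in \<open>simp add: dist_norm norm_circle_loop\<close>)
        have q: "inv_into U \<phi> (\<phi> p + circle_loop r s) \<in> topspace M"
          using subsetD[OF chart(2)[OF c(1)] inv_into_into[OF x]] by simp
        show ?thesis using \<theta>0[OF q] \<theta>0[OF pt] f_inv_into_f[OF x] by simp
      qed
      have "image_loop (\<theta> 0) U \<phi> p \<phi> r = circle_loop r" by (rule ext) (rule loop)
      then show "planar_index (image_loop (\<theta> 0) U \<phi> p \<phi> r) = 1" using planar_index_circle[of r] r by simp
    qed
  qed
  have "K t1"
  proof (rule connected_induction_simple[OF connected_UNIV, of 0 t1 K])
    fix t0 :: real
    obtain W \<omega> where W: "(W,\<omega>) \<in> \<A>" "\<theta> t0 p \<in> W" by (rule chart_at[OF \<theta>t])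
    obtain e where e': "0 < e" "ball (\<phi> p) e \<subseteq> \<phi> ` U" "\<forall>u\<in>ball t0 e. \<forall>x\<in>ball (\<phi> p) e. \<theta> u (inv_into U \<phi> x) \<in> W"
      "continuous_on (ball t0 e \<times> ball (\<phi> p) e) (\<lambda>(t,x). \<omega> (\<theta> t (inv_into U \<phi> x)))"
      by (rule isotopy_in_charts[OF \<theta> c(1,2) W])
    note e = e'(1,2) e'(3)[rule_format] e'(4)
    have inW: "\<theta> u p \<in> W" if "u \<in> ball t0 e" for u using e(3)[OF that, of "\<phi> p"] e(1) ip by simp
    show "\<exists>T. openin (top_of_set UNIV) T \<and> t0 \<in> T \<and> (\<forall>x\<in>T. \<forall>y\<in>T. K x \<longrightarrow> K y)"
    proof (intro exI[of _ "ball t0 e"] conjI ballI impI)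
      fix x y assume x: "x \<in> ball t0 e" and y: "y \<in> ball t0 e" and K: "K x"
      have "preserves_orientation_at (\<theta> x) U \<phi> p \<omega>" using K W(1) inW[OF x] unfolding K_def by blast
      then obtain r0 where r0: "0 < r0" "\<And>r. \<lbrakk>0 < r; r < r0\<rbrakk> \<Longrightarrow> planar_index (image_loop (\<theta> x) U \<phi> p \<omega> r) = 1"
        unfolding preserves_orientation_at_def by blast
      define r1 where "r1 = min r0 e / 2"
      have r1: "0 < r1" "r1 < r0" "r1 < e" using r0 e(1) by (auto simp: r1_def)
      have "planar_index (image_loop (\<theta> y) U \<phi> p \<omega> r) = 1" if "0 < r" "r < e" for r
        using isotopy_index_constant[OF \<theta> c(1,2) W(1) e(2,3,4) y x that r1(1,3)] r0(2) r1(1,2) by simp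
      then have "preserves_orientation_at (\<theta> y) U \<phi> p \<omega>" unfolding preserves_orientation_at_def using e(1) by blast
      then show "K y" by (rule K_chart[OF W(1) inW[OF y]])
    qed (use e(1) in auto)
  qed (use start in auto)
  then have pres: "preserves_orientation_at (\<theta> t1) U \<phi> p \<psi>" using c(3,4) unfolding K_def by blast
  obtain r0 where r0: "0 < r0" "\<forall>r. 0 < r \<and> r < r0 \<longrightarrow> planar_index (image_loop (\<theta> t1) U \<phi> p \<psi> r) = 1"
    using pres unfolding preserves_orientation_at_def by (elim exE conjE) (rule that)
  obtain e where e': "0 < e" "ball (\<phi> p) e \<subseteq> \<phi> ` U" "\<forall>u\<in>ball t1 e. \<forall>x\<in>ball (\<phi> p) e. \<theta> u (inv_into U \<phi> x) \<in> V"
    "continuous_on (ball t1 e \<times> ball (\<phi> p) e) (\<lambda>(t,x). \<psi> (\<theta> t (inv_into U \<phi> x)))"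
    by (rule isotopy_in_charts[OF \<theta> c])
  note e = e'(1,2) e'(3)[rule_format] e'(4)
  have cG: "continuous_on (ball (\<phi> p) e) (\<psi> \<circ> \<theta> t1 \<circ> inv_into U \<phi>)"
    unfolding o_def by (rule continuous_on_slice[OF e(4)]) (use e(1) in simp)
  obtain d where d: "0 < d" "\<forall>\<zeta>. path \<zeta> \<and> pathfinish \<zeta> = pathstart \<zeta> \<and> (\<forall>s\<in>{0..1}. \<zeta> s \<noteq> 0 \<and> norm (\<zeta> s) < d) \<longrightarrow>
      planar_index (\<lambda>s. (\<psi> \<circ> \<theta> t1 \<circ> inv_into U \<phi>) (\<phi> p + \<zeta> s) - (\<psi> \<circ> \<theta> t1 \<circ> inv_into U \<phi>) (\<phi> p)) =
      (if 0 < det (matrix L) then planar_index \<zeta> else - cnj (planar_index \<zeta>))"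
    using planar_index_differentiable[OF der nz cG e(1)] by (elim exE conjE) (rule that)
  define r where "r = min r0 d / 2"
  have r: "0 < r" "r < r0" "r < d" using r0 d by (auto simp: r_def)
  have index: "planar_index (\<lambda>s. (\<psi> \<circ> \<theta> t1 \<circ> inv_into U \<phi>) (\<phi> p + circle_loop r s) - (\<psi> \<circ> \<theta> t1 \<circ> inv_into U \<phi>) (\<phi> p)) =
      (if 0 < det (matrix L) then planar_index (circle_loop r) else - cnj (planar_index (circle_loop r)))"
  proof (rule d(2)[rule_format], intro conjI ballI)
    show "path (circle_loop r)" unfolding path_def by (intro continuous_on_circle_loop continuous_intros)
    show "pathfinish (circle_loop r) = pathstart (circle_loop r)" by (simp add: pathfinish_def pathstart_def circle_loop_closed)
    show "circle_loop r s \<noteq> 0" "norm (circle_loop r s) < d" for s using norm_circle_loop[of r s] r by force+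
  qed
  show ?thesis
  proof (rule ccontr)
    assume "\<not> 0 < det (matrix L)"
    then have "planar_index (image_loop (\<theta> t1) U \<phi> p \<psi> r) = - cnj (planar_index (circle_loop r))"
      using index ip by simp
    then show False using r0(2) r planar_index_circle[OF r(1)] by simp
  qed
qed

end

section \<open>Crossing signs and loops under isotopies\<close>

lemma linear_real3_expand:
  fixes A :: "real^3 \<Rightarrow> real^3"
  assumes "linear A" shows "A v = v$1 *\<^sub>R A (axis 1 1) + v$2 *\<^sub>R A (axis 2 1) + v$3 *\<^sub>R A (axis 3 1)"
proof -
  have v: "v = v$1 *\<^sub>R axis 1 1 + v$2 *\<^sub>R axis 2 1 + v$3 *\<^sub>R axis 3 1"
    by (simp add: vec_eq_iff forall_3 axis_def)
  show ?thesis
    using arg_cong[OF v, of A] by (simp only: linear_add[OF assms] linear_scale[OF assms])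
qed

lemma det_linear_images:
  fixes A :: "real^3 \<Rightarrow> real^3"
  assumes A: "linear A" shows "det (vector [A x, A y, A z] :: real^3^3) = det (matrix A) * det (vector [x, y, z] :: real^3^3)"
proof -
  have c: "A v $ i = v$1 * A (axis 1 1) $ i + v$2 * A (axis 2 1) $ i + v$3 * A (axis 3 1) $ i" for v i
    by (subst linear_real3_expand[OF A]) simp
  have "(vector [A x, A y, A z] :: real^3^3) = (vector [x, y, z] :: real^3^3) ** transpose (matrix A)"
    by (simp add: vec_eq_iff forall_3 matrix_matrix_mult_def sum_3 transpose_def matrix_def c[of x] c[of y] c[of z])
  then show ?thesis by (simp add: det_mul det_transpose)
qed

lemma cross3_linear_images:
  fixes A :: "real^3 \<Rightarrow> real^3"
  assumes A: "linear A" shows "cross3 (A a) (A b) \<bullet> A c = det (matrix A) * (cross3 a b \<bullet> c)"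
  using det_linear_images[OF A, of c a b] by (simp add: dot_cross_det[symmetric] inner_commute)

lemma det_gram:
  fixes a b c x y z :: "real^3"
  shows "det (vector [a, b, c] :: real^3^3) * det (vector [x, y, z] :: real^3^3) =
    det (vector [vector [a \<bullet> x, a \<bullet> y, a \<bullet> z], vector [b \<bullet> x, b \<bullet> y, b \<bullet> z], vector [c \<bullet> x, c \<bullet> y, c \<bullet> z]] :: real^3^3)"
proof -
  have "(vector [vector [a \<bullet> x, a \<bullet> y, a \<bullet> z], vector [b \<bullet> x, b \<bullet> y, b \<bullet> z], vector [c \<bullet> x, c \<bullet> y, c \<bullet> z]] :: real^3^3) =
      (vector [a, b, c] :: real^3^3) ** transpose (vector [x, y, z] :: real^3^3)"
    by (simp add: vec_eq_iff forall_3 matrix_matrix_mult_def sum_3 transpose_def inner_vec_def)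
  then show ?thesis by (simp add: det_mul det_transpose)
qed

text \<open>Normals transform by the cofactor matrix of \<open>A\<close> while the tangent vector of the double curve
  transforms by \<open>A\<close> itself. The sign of the resulting determinant is found by multiplying with
  the determinant of \<open>A n1\<close>, \<open>A n2\<close>, \<open>A w\<close>, which is positive: the matrix of inner products splits into
  \<open>det A\<close> times the Gram matrix of the normals and the squared length of \<open>A w\<close>.\<close>

lemma crossing_sign_pushforward:
  fixes A :: "real^3 \<Rightarrow> real^3"
  assumes A: "linear A" "0 < det (matrix A)" and n: "n1 = cross3 a1 b1" "n2 = cross3 a2 b2" "cross3 n1 n2 \<noteq> 0" and k: "0 < k"
  shows "0 < det (vector [cross3 (A a1) (A b1), cross3 (A a2) (A b2), A (k *\<^sub>R cross3 n1 n2)] :: real^3^3)"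
proof -
  let ?N1 = "cross3 (A a1) (A b1)" and ?N2 = "cross3 (A a2) (A b2)" and ?w = "k *\<^sub>R cross3 n1 n2" and ?\<delta> = "det (matrix A)"
  have w0: "A ?w \<noteq> 0"
  proof
    assume "A ?w = 0"
    have "inj A" using A det_nz_iff_inj[OF A(1)] by simp
    then have "?w = 0" using \<open>A ?w = 0\<close> linear_0[OF A(1)] by (metis injD)
    then show False using n(3) k by simp
  qed
  have N: "?N1 \<bullet> A v = ?\<delta> * (n1 \<bullet> v)" "?N2 \<bullet> A v = ?\<delta> * (n2 \<bullet> v)" for v
    unfolding n by (rule cross3_linear_images[OF A(1)])+
  have orth: "n1 \<bullet> ?w = 0" "n2 \<bullet> ?w = 0" by (simp_all add: dot_cross_self)
  have "det (vector [?N1, ?N2, A ?w] :: real^3^3) * det (vector [A n1, A n2, A ?w] :: real^3^3) =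
      ?\<delta> * ?\<delta> * ((n1 \<bullet> n1) * (n2 \<bullet> n2) - (n1 \<bullet> n2) * (n1 \<bullet> n2)) * (A ?w \<bullet> A ?w)"
    unfolding det_gram N orth by (simp add: det_3 inner_commute algebra_simps)
  also have "(n1 \<bullet> n1) * (n2 \<bullet> n2) - (n1 \<bullet> n2) * (n1 \<bullet> n2) = (norm (cross3 n1 n2))\<^sup>2"
    using norm_cross_dot[of n1 n2] unfolding dot_square_norm power2_eq_square[symmetric] power_mult_distrib by linarith
  finally have prod: "0 < det (vector [?N1, ?N2, A ?w] :: real^3^3) * det (vector [A n1, A n2, A ?w] :: real^3^3)"
    using A(2) n(3) w0 by simp
  have "det (vector [A n1, A n2, A ?w] :: real^3^3) = ?\<delta> * det (vector [n1, n2, ?w] :: real^3^3)"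
    by (rule det_linear_images[OF A(1)])
  also have "det (vector [n1, n2, ?w] :: real^3^3) = k * (cross3 n1 n2 \<bullet> cross3 n1 n2)"
    using dot_cross_det[of n1 n2 ?w] cross_triple[of n1 n2 ?w] cross_triple[of n2 ?w n1] by (simp add: inner_commute)
  finally have "0 < det (vector [A n1, A n2, A ?w] :: real^3^3)" using A(2) k n(3) by simp
  with prod show ?thesis by (simp add: zero_less_mult_iff)
qed

lemma ambient_isotopy_derivative:
  assumes "ambient_isotopy H"
  shows "(H t has_derivative (\<lambda>v. frechet_derivative (\<lambda>(t,x). H t x) (at (t,x)) (0,v))) (at x)"
proof -
  have "smooth_on UNIV (\<lambda>(t,x). H t x)" using assms by (simp add: ambient_isotopy_def)
  from smooth_on_has_derivative[OF this, of "(t,x)"]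
  have 1: "((\<lambda>(t,x). H t x) has_derivative frechet_derivative (\<lambda>(t,x). H t x) (at (t,x))) (at (t,x))" by simp
  have 2: "((\<lambda>x. (t,x)) has_derivative (\<lambda>v. (0,v))) (at x)" by (auto intro!: derivative_eq_intros)
  show ?thesis using has_derivative_compose[OF 2 1] by simp
qed

text \<open>The determinant is a continuous function of time without zeros, and it is 1 at time 0.\<close>

lemma ambient_isotopy_orientation:
  fixes x :: "real^3"
  assumes H: "ambient_isotopy H"
  defines "A \<equiv> frechet_derivative (H 1) (at x)"
  shows "(H 1 has_derivative A) (at x)" "linear A" "0 < det (matrix A)"
proof -
  define B where "B t v = frechet_derivative (\<lambda>(t,x). H t x) (at (t,x)) (0,v)" for t v
  have B: "(H t has_derivative B t) (at x)" for t
    unfolding B_def by (rule ambient_isotopy_derivative[OF H])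
  have lin: "linear (B t)" for t using B has_derivative_linear by blast
  have AB: "A = B 1" unfolding A_def using frechet_derivative_at[OF B] by simp
  have s: "smooth_on UNIV (\<lambda>(t,x). H t x)" using H by (simp add: ambient_isotopy_def)
  have cB: "continuous_on UNIV (\<lambda>t. B t v)" for v
    unfolding B_def
    by (rule continuous_on_compose2[OF smooth_on_continuous_derivative[OF s] continuous_on_Pair[OF continuous_on_id continuous_on_const]]) simp
  have "continuous_on UNIV (\<lambda>t. B t v $ i)" for v i using cB by (intro continuous_on_component)
  then have cont: "continuous_on UNIV (\<lambda>t. det (matrix (B t)))"
    unfolding det_3 matrix_def by (simp, intro continuous_on_diff continuous_on_add continuous_on_mult)
  have "inj (B t)" for t
  proof -
    have d: "diffeo UNIV UNIV (H t)" using H by (simp add: ambient_isotopy_def)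
    let ?g = "inv_into UNIV (H t)"
    have "smooth_on UNIV ?g" "inj (H t)" using d by (auto simp: diffeo_def bij_betw_def)
    then have "(?g has_derivative frechet_derivative ?g (at (H t x))) (at (H t x))" using smooth_on_has_derivative by blast
    from has_derivative_compose[OF B[of t] this]
    have "((\<lambda>y. y) has_derivative (\<lambda>v. frechet_derivative ?g (at (H t x)) (B t v))) (at x)" using \<open>inj (H t)\<close> by simp
    then have "(\<lambda>v. frechet_derivative ?g (at (H t x)) (B t v)) = (\<lambda>v. v)"
      using has_derivative_unique has_derivative_ident by blast
    then show ?thesis by (metis injI)
  qed
  then have nz: "det (matrix (B t)) \<noteq> 0" for t using det_nz_iff_inj[OF lin] by blast
  have "H 0 = (\<lambda>y. y)" using H by (auto simp: ambient_isotopy_def)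
  then have "B 0 = (\<lambda>v. v)" using B[of 0] has_derivative_unique has_derivative_ident by metis
  then have B0: "det (matrix (B 0)) = 1" by (simp add: det_3 matrix_def axis_def)
  show "(H 1 has_derivative A) (at x)" "linear A" unfolding AB by (rule B lin)+
  show "0 < det (matrix A)"
  proof (rule ccontr)
    assume "\<not> 0 < det (matrix A)"
    then have "det (matrix (B 1)) \<le> 0" unfolding AB by simp
    then have "\<exists>t. 0 \<le> t \<and> t \<le> 1 \<and> det (matrix (B t)) = 0"
      using B0 by (intro IVT2') (auto intro: continuous_on_subset[OF cont])
    then show False using nz by blast
  qed
qed

lemma loop_class_isotopy:
  assumes \<theta>: "surface_isotopy M \<theta>" and \<gamma>: "continuous_map (top_of_set {0..1}) M \<gamma>" "\<gamma> 0 = \<gamma> 1"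
  shows "loop_class M (\<theta> 1 \<circ> \<gamma>) = loop_class M \<gamma>"
proof -
  have cyc: "singular_relcycle 1 M {} (path_chain \<gamma> 0 1)"
    using singular_chain_path_chain[OF \<gamma>(1)] \<gamma>(2) unfolding singular_cycle chain_boundary_path_chain by simp
  have c: "continuous_map (prod_topology euclideanreal M) M (\<lambda>(t,p). \<theta> t p)" using \<theta> by (simp add: surface_isotopy_def)
  have "continuous_map (prod_topology (top_of_set {0..1}) M) M (\<lambda>(t,p). \<theta> t p)"
    using continuous_map_from_subtopology[OF c, of "{0..1} \<times> topspace M"] by (simp add: subtopology_Times)
  then have "homotopic_with (\<lambda>h. h \<in> {} \<rightarrow> {}) M M (\<theta> 0) (\<theta> 1)"
    unfolding homotopic_with_def by (intro exI[of _ "\<lambda>(t,p). \<theta> t p"]) simp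
  from homotopic_imp_homologous_rel_chain_maps[OF this cyc]
  have "homologous_rel 1 M {} (path_chain (\<theta> 0 \<circ> \<gamma>) 0 1) (path_chain (\<theta> 1 \<circ> \<gamma>) 0 1)"
    by (simp only: chain_map_path_chain)
  moreover have "path_chain (\<theta> 0 \<circ> \<gamma>) 0 1 = path_chain \<gamma> 0 1"
  proof (rule path_chain_cong)
    fix t :: real assume "t \<in> {0..1}"
    then have "\<gamma> t \<in> topspace M" using continuous_map_image_subset_topspace[OF \<gamma>(1)] by auto
    then show "(\<theta> 0 \<circ> \<gamma>) t = \<gamma> t" using \<theta> by (simp add: surface_isotopy_def)
  qed
  ultimately show ?thesis by (simp add: loop_class_path_chain homologous_rel_set_eq homologous_rel_sym)
qed

section \<open>Isotopies of diagrams and p-equivalence\<close>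

text \<open>What the end of an isotopy of diagrams has to say about its two end diagrams: the shadows are
  related by the final diffeomorphism of space, and the order of heights over a double point is kept.\<close>

locale moved_diagram = D: diagram M \<A> f + D': diagram M \<A> f'
  for M :: "'a topology" and \<A> and f f' :: "'a \<Rightarrow> real^4" +
  fixes \<theta> :: "real \<Rightarrow> 'a \<Rightarrow> 'a" and H :: "real \<Rightarrow> real^3 \<Rightarrow> real^3"
  assumes surface_iso: "surface_isotopy M \<theta>" and ambient_iso: "ambient_isotopy H"
    and shadow_moved: "\<And>p. p \<in> topspace M \<Longrightarrow> proj (f' (\<theta> 1 p)) = H 1 (proj (f p))"
    and height_order: "\<And>p q. \<lbrakk>p \<in> topspace M; q \<in> topspace M; proj (f p) = proj (f q)\<rbrakk> \<Longrightarrow>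
      height (f' (\<theta> 1 p)) < height (f' (\<theta> 1 q)) \<longleftrightarrow> height (f p) < height (f q)"
begin

abbreviation h :: "'a \<Rightarrow> 'a" where "h \<equiv> \<theta> 1"

lemma homeo: "homeomorphic_map M M h" using surface_iso by (simp add: surface_isotopy_def)

lemma h_image: "h ` topspace M = topspace M" by (rule homeomorphic_imp_surjective_map[OF homeo])

lemma h_in: "p \<in> topspace M \<Longrightarrow> h p \<in> topspace M" using h_image by blast

lemma h_inj: "inj_on h (topspace M)" by (rule homeomorphic_imp_injective_map[OF homeo])

lemma h_mem: "\<lbrakk>p \<in> topspace M; S \<subseteq> topspace M\<rbrakk> \<Longrightarrow> h p \<in> h ` S \<longleftrightarrow> p \<in> S"
  by (rule inj_on_image_mem_iff[OF h_inj])

lemma shadow_iff: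
  assumes "p \<in> topspace M" "q \<in> topspace M"
  shows "D'.shadow (h p) = D'.shadow (h q) \<longleftrightarrow> D.shadow p = D.shadow q"
proof -
  have "diffeo UNIV UNIV (H 1)" using ambient_iso by (simp add: ambient_isotopy_def)
  then have "inj (H 1)" by (simp add: diffeo_def bij_betw_def)
  then show ?thesis unfolding shadow_moved[OF assms(1)] shadow_moved[OF assms(2)] by (rule inj_eq)
qed

lemma component_iff:
  assumes "p \<in> topspace M" "q \<in> topspace M"
  shows "connected_component_of M (h p) (h q) \<longleftrightarrow> connected_component_of M p q"
proof -
  have "h q \<in> connected_component_of_set M (h p) \<longleftrightarrow> q \<in> connected_component_of_set M p"
    unfolding homeomorphic_map_connected_component_of[OF homeo assms(1)]
    by (rule h_mem[OF assms(2) connected_component_of_subset_topspace])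
  then show ?thesis by simp
qed

lemma partner_moved:
  assumes p: "p \<in> D.mixed" shows "h p \<in> D'.mixed" "D'.mt (h p) = h (D.mt p)"
proof -
  note m = D.partner[OF p]
  have "D'.shadow (h (D.mt p)) = D'.shadow (h p)" using shadow_iff[OF m(2,1)] m(4) by simp
  moreover have "\<not> connected_component_of M (h p) (h (D.mt p))" using component_iff[OF m(1,2)] m(5) by simp
  ultimately show "h p \<in> D'.mixed" "D'.mt (h p) = h (D.mt p)" using D'.partnerI[OF h_in[OF m(1)] h_in[OF m(2)]] by blast+
qed

lemma mixed_moved: "D'.mixed = h ` D.mixed"
proof
  show "h ` D.mixed \<subseteq> D'.mixed" using partner_moved(1) by blast
  show "D'.mixed \<subseteq> h ` D.mixed"
  proof
    fix p' assume p': "p' \<in> D'.mixed"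
    note m = D'.partner[OF p']
    obtain p where p: "p \<in> topspace M" "p' = h p" using m(1) h_image by blast
    obtain q where q: "q \<in> topspace M" "D'.mt p' = h q" using m(2) h_image by blast
    have "D.shadow q = D.shadow p" using m(4) shadow_iff[OF q(1) p(1)] p(2) q(2) by simp
    moreover have "\<not> connected_component_of M p q" using m(5) component_iff[OF p(1) q(1)] p(2) q(2) by simp
    ultimately have "p \<in> D.mixed" using D.partnerI(1)[OF p(1) q(1)] by blast
    then show "p' \<in> h ` D.mixed" using p(2) by blast
  qed
qed

lemma double_decker_moved: "double_decker M f' = h ` double_decker M f"
proof -
  let ?S = "{p \<in> topspace M. \<exists>q \<in> topspace M. q \<noteq> p \<and> D.shadow q = D.shadow p}"
  let ?S' = "{p \<in> topspace M. \<exists>q \<in> topspace M. q \<noteq> p \<and> D'.shadow q = D'.shadow p}"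
  have "?S' = h ` ?S"
  proof
    show "h ` ?S \<subseteq> ?S'"
    proof (rule image_subsetI)
      fix p assume "p \<in> ?S"
      then obtain q where p: "p \<in> topspace M" and q: "q \<in> topspace M" "q \<noteq> p" "D.shadow q = D.shadow p" by blast
      have "h q \<noteq> h p" using q(1,2) p h_inj inj_onD by metis
      moreover have "D'.shadow (h q) = D'.shadow (h p)" using shadow_iff[OF q(1) p] q(3) by simp
      ultimately show "h p \<in> ?S'" using h_in[OF p] h_in[OF q(1)] by blast
    qed
    show "?S' \<subseteq> h ` ?S"
    proof
      fix p' assume "p' \<in> ?S'"
      then obtain q' where p': "p' \<in> topspace M" and q': "q' \<in> topspace M" "q' \<noteq> p'" "D'.shadow q' = D'.shadow p'" by blast
      obtain p where p: "p \<in> topspace M" "p' = h p" using p' h_image by blast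
      obtain q where q: "q \<in> topspace M" "q' = h q" using q'(1) h_image by blast
      have "q \<noteq> p" using q'(2) p(2) q(2) by blast
      moreover have "D.shadow q = D.shadow p" using shadow_iff[OF q(1) p(1)] q'(3) p(2) q(2) by simp
      ultimately have "p \<in> ?S" using p(1) q(1) by blast
      then show "p' \<in> h ` ?S" using p(2) by blast
    qed
  qed
  then show ?thesis unfolding double_decker_def
    using homeomorphic_map_closure_of[OF homeo, of ?S] by simp
qed

lemma components_moved:
  assumes "S \<subseteq> topspace M"
  shows "connected_components_of (subtopology M (h ` S)) = image h ` connected_components_of (subtopology M S)"
proof (rule homeomorphic_map_connected_components_of, rule homeomorphic_map_subtopologies[OF homeo])
  have "h ` S \<subseteq> topspace M" using assms h_image by blast
  then show "h ` (topspace M \<inter> S) = topspace M \<inter> h ` S" using assms by (simp add: Int_absorb1)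
qed

lemma A_circles_moved: "A_circles M f' = image h ` A_circles M f"
  unfolding D.A_circles_eq D'.A_circles_eq D.mf.orbits_eq_components D'.mf.orbits_eq_components
  unfolding mixed_moved by (rule components_moved[OF D.mixed_subset])

lemma A_circles_subset: "\<Union>(A_circles M f) \<subseteq> topspace M"
  using D.mate_eq(2) D.mixed_subset by blast

lemma coloured_set_subset: "coloured_set M f \<subseteq> topspace M"
  unfolding coloured_set_def using A_circles_subset by blast

lemma coloured_set_moved: "coloured_set M f' = h ` coloured_set M f"
proof -
  have dd: "double_decker M f \<subseteq> topspace M" unfolding double_decker_def by (rule closure_of_subset_topspace)
  have "h ` (topspace M - double_decker M f) = topspace M - h ` double_decker M f"
    using inj_on_image_set_diff[OF h_inj _ dd, of "topspace M"] h_image by simp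
  then show ?thesis
    unfolding coloured_set_def A_circles_moved double_decker_moved by (simp only: image_Un image_Union)
qed

lemma regions_moved: "regions M f' = image h ` regions M f"
  unfolding regions_def coloured_set_moved by (rule components_moved[OF coloured_set_subset])

lemma region_subset: "R \<in> regions M f \<Longrightarrow> R \<subseteq> topspace M"
  unfolding regions_def using connected_components_of_subset[of R "subtopology M (coloured_set M f)"] by auto

lemma selected_moved:
  assumes col: "\<And>R. R \<in> regions M f \<Longrightarrow> col' (h ` R) = col R"
  shows "D'.selected col' = h ` D.selected col"
proof -
  have iff: "h p \<in> D'.selected col' \<longleftrightarrow> p \<in> D.selected col" if p: "p \<in> D.mixed" for p
  proof -
    note m = D.partner[OF p]
    have hi: "height (f' (h p)) < height (f' (h (D.mt p))) \<longleftrightarrow> height (f p) < height (f (D.mt p))"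
      by (rule height_order[OF m(1,2) m(4)[symmetric]])
    have "(\<exists>R'\<in>regions M f'. h (D.mt p) \<in> R' \<and> col' R' = 1) \<longleftrightarrow> (\<exists>R\<in>regions M f. h (D.mt p) \<in> h ` R \<and> col' (h ` R) = 1)"
      unfolding regions_moved by blast
    also have "\<dots> \<longleftrightarrow> (\<exists>R\<in>regions M f. D.mt p \<in> R \<and> col R = 1)"
      by (rule bex_cong[OF refl]) (simp only: h_mem[OF m(2) region_subset] col)
    finally show ?thesis
      unfolding D.selected_def D'.selected_def using p partner_moved[OF p] hi by simp
  qed
  show ?thesis
  proof
    show "D'.selected col' \<subseteq> h ` D.selected col"
    proof
      fix p' assume p': "p' \<in> D'.selected col'"
      then have "p' \<in> h ` D.mixed" using mixed_moved by (simp add: D'.selected_def)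
      then obtain p where p: "p \<in> D.mixed" "p' = h p" by blast
      then show "p' \<in> h ` D.selected col" using iff[OF p(1)] p' by blast
    qed
    show "h ` D.selected col \<subseteq> D'.selected col'"
    proof (rule image_subsetI)
      fix p assume p: "p \<in> D.selected col"
      then have "p \<in> D.mixed" by (simp add: D.selected_def)
      from iff[OF this] p show "h p \<in> D'.selected col'" by simp
    qed
  qed
qed

text \<open>At an immersed point the final map \<open>h\<close> of the surface is differentiable, because it is the
  spatial diffeomorphism followed by the local retraction onto the sheet of the new diagram. As the
  end of an isotopy it preserves the orientation.\<close>

lemma sheet_moved:
  assumes p: "p \<in> D.mixed" and c: "(U,\<phi>) \<in> \<A>" "p \<in> U" "(V,\<psi>) \<in> \<A>" "h p \<in> V"
  defines "G' \<equiv> frechet_derivative (H 1) (at (D.shadow p))"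
  shows "\<exists>L. linear L \<and> 0 < det (matrix L) \<and> D'.sheet' V \<psi> (\<psi> (h p)) \<circ> L = G' \<circ> D.sheet' U \<phi> (\<phi> p)"
proof -
  have pt: "p \<in> topspace M" using D.partner(1)[OF p] .
  have ip: "inv_into U \<phi> (\<phi> p) = p" using D.chart(4)[OF c(1)] c(2) by (simp add: inv_into_f_f)
  define g where "g = \<psi> \<circ> h \<circ> inv_into U \<phi>"
  have gp: "g (\<phi> p) = \<psi> (h p)" by (simp add: g_def ip)
  note G = ambient_isotopy_orientation[OF ambient_iso, of "D.shadow p", folded G'_def]
  have a: "\<psi> (h p) \<in> \<psi> ` V" using c(4) by blast
  have injS': "inj (D'.sheet' V \<psi> (\<psi> (h p)))" by (rule D'.immersed_chart[OF partner_moved(1)[OF p] c(3,4)])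
  have injS: "inj (D.sheet' U \<phi> (\<phi> p))" by (rule D.immersed_chart[OF p c(1,2)])
  obtain O1 W r where r: "open O1" "\<psi> (h p) \<in> O1" "O1 \<subseteq> \<psi> ` V" "D'.sheet V \<psi> ` O1 \<subseteq> W"
    "\<And>x. x \<in> O1 \<Longrightarrow> r (D'.sheet V \<psi> x) = x" "\<And>y. y \<in> W \<Longrightarrow> r differentiable (at y)"
    by (rule immersion_local_retraction[OF D.chart(3)[OF c(3)] a D'.sheet(1)[OF c(3)] D'.sheet(2)[OF c(3)] injS']) (assumption | rule that)+
  obtain e where e: "0 < e" "ball (\<phi> p) e \<subseteq> \<phi> ` U" "\<forall>t\<in>ball 1 e. \<forall>x\<in>ball (\<phi> p) e. \<theta> t (inv_into U \<phi> x) \<in> V"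
    "continuous_on (ball 1 e \<times> ball (\<phi> p) e) (\<lambda>(t,x). \<psi> (\<theta> t (inv_into U \<phi> x)))"
    by (rule D.isotopy_in_charts[OF surface_iso c])
  have contg: "continuous_on (ball (\<phi> p) e) g"
    unfolding g_def o_def by (rule continuous_on_slice[OF e(4)]) (use e(1) in simp)
  define N where "N = ball (\<phi> p) e \<inter> g -` O1"
  have N: "open N" "\<phi> p \<in> N"
    using continuous_open_preimage[OF contg open_ball r(1)] e(1) r(2) gp by (simp_all add: N_def)
  have eq: "D'.sheet V \<psi> (g x) = H 1 (D.sheet U \<phi> x)" if x: "x \<in> N" for x
  proof -
    have xb: "x \<in> ball (\<phi> p) e" using x by (simp add: N_def)
    have xU: "x \<in> \<phi> ` U" using e(2) xb by blast
    have hV: "h (inv_into U \<phi> x) \<in> V" using e(3) xb e(1) by simp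
    have q: "inv_into U \<phi> x \<in> topspace M" using subsetD[OF D.chart(2)[OF c(1)] inv_into_into[OF xU]] .
    have "D'.sheet V \<psi> (g x) = D'.shadow (h (inv_into U \<phi> x))"
      using D'.sheet_chart[OF c(3) hV] by (simp add: g_def)
    then show ?thesis using shadow_moved[OF q] by (simp add: D.sheet_def)
  qed
  have xU: "\<phi> p \<in> \<phi> ` U" using c(2) by blast
  have sp: "D.sheet U \<phi> (\<phi> p) = D.shadow p" by (rule D.sheet_chart[OF c(1,2)])
  have GS: "((\<lambda>x. H 1 (D.sheet U \<phi> x)) has_derivative (\<lambda>v. G' (D.sheet' U \<phi> (\<phi> p) v))) (at (\<phi> p))"
    by (rule has_derivative_compose[OF D.sheet(1)[OF c(1) xU]]) (unfold sp, rule G(1))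
  have "H 1 (D.sheet U \<phi> (\<phi> p)) \<in> W" using eq[OF N(2)] gp r(2,4) by force
  then have "(r has_derivative frechet_derivative r (at (H 1 (D.sheet U \<phi> (\<phi> p))))) (at (H 1 (D.sheet U \<phi> (\<phi> p))))"
    using r(6) frechet_derivative_works by blast
  from has_derivative_compose[OF GS this]
  obtain L where rL: "((\<lambda>x. r (H 1 (D.sheet U \<phi> x))) has_derivative L) (at (\<phi> p))" by blast
  have "r (H 1 (D.sheet U \<phi> x)) = g x" if x: "x \<in> N" for x
    unfolding eq[OF x, symmetric] by (rule r(5)) (use x in \<open>simp add: N_def\<close>)
  then have L: "(g has_derivative L) (at (\<phi> p))"
    by (rule has_derivative_transform_within_open[OF rL N])
  then have "((\<lambda>x. D'.sheet V \<psi> (g x)) has_derivative (\<lambda>v. D'.sheet' V \<psi> (\<psi> (h p)) (L v))) (at (\<phi> p))"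
    by (rule has_derivative_compose) (unfold gp, rule D'.sheet(1)[OF c(3) a])
  then have "((\<lambda>x. H 1 (D.sheet U \<phi> x)) has_derivative (\<lambda>v. D'.sheet' V \<psi> (\<psi> (h p)) (L v))) (at (\<phi> p))"
    by (rule has_derivative_transform_within_open[OF _ N eq])
  then have comm: "(\<lambda>v. D'.sheet' V \<psi> (\<psi> (h p)) (L v)) = (\<lambda>v. G' (D.sheet' U \<phi> (\<phi> p) v))"
    using GS by (rule has_derivative_unique)
  have lin: "linear L" using L has_derivative_linear by blast
  have "inj G'" using det_nz_iff_inj[OF G(2)] G(3) by simp
  have "inj L"
  proof (rule injI)
    fix v w assume "L v = L w"
    then have "G' (D.sheet' U \<phi> (\<phi> p) v) = G' (D.sheet' U \<phi> (\<phi> p) w)" using fun_cong[OF comm, of v] fun_cong[OF comm, of w] by simp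
    then show "v = w" using \<open>inj G'\<close> injS by (simp add: inj_eq)
  qed
  then have nz: "det (matrix L) \<noteq> 0" using det_nz_iff_inj[OF lin] by simp
  have "0 < det (matrix L)"
    by (rule D.isotopy_preserves_orientation[OF surface_iso c L[unfolded g_def] nz])
  then show ?thesis using lin comm by (intro exI[of _ L]) (simp add: o_def)
qed

text \<open>Both the normals and the tangent vector are carried along by the derivative of the spatial
  diffeomorphism, the normals up to positive factors.\<close>

lemma oriented_param_moved:
  assumes c: "c \<in> A_circles M f" and \<gamma>: "oriented_circle_param M \<A> f c \<gamma>"
  shows "oriented_circle_param M \<A> f' (h ` c) (h \<circ> \<gamma>)"
proof -
  have \<gamma>1: "continuous_map (top_of_set {0..1}) M \<gamma>" "\<gamma> 0 = \<gamma> 1" "inj_on \<gamma> {0..<1}" "\<gamma> ` {0..1} = c"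
    using \<gamma> by (simp_all add: oriented_circle_param_def)
  have cm: "c \<subseteq> D.mixed" by (rule D.mate_eq(2)[OF c])
  have \<gamma>m: "\<gamma> t \<in> D.mixed" if "t \<in> {0..1}" for t using that \<gamma>1(4) cm by blast
  have \<gamma>t: "\<gamma> t \<in> topspace M" if "t \<in> {0..1}" for t using \<gamma>m[OF that] D.mixed_subset by blast
  have "\<exists>w. ((\<lambda>t. D'.shadow ((h \<circ> \<gamma>) t)) has_vector_derivative w) (at t within {0..1}) \<and>
      (\<forall>q\<in>topspace M. \<forall>n1 n2. q \<noteq> (h \<circ> \<gamma>) t \<and> D'.shadow q = D'.shadow ((h \<circ> \<gamma>) t) \<and>
        oriented_normal \<A> f' ((h \<circ> \<gamma>) t) n1 \<and> oriented_normal \<A> f' q n2 \<longrightarrow> 0 < det (vector [n1, n2, w] :: real^3^3))"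
    if t: "t \<in> {0..1}" for t
  proof -
    let ?p = "\<gamma> t" and ?q = "D.mt (\<gamma> t)"
    note p = \<gamma>m[OF t]
    note q = D.partner_partner(1)[OF p]
    note m = D.partner[OF p]
    define A where "A = frechet_derivative (H 1) (at (D.shadow ?p))"
    note A = ambient_isotopy_orientation[OF ambient_iso, of "D.shadow ?p", folded A_def]
    obtain k where k: "0 < k" "((\<lambda>t. D.shadow (\<gamma> t)) has_vector_derivative k *\<^sub>R D.dir ?p) (at t within {0..1})"
      using D.oriented_param_direction[OF cm \<gamma> t] by blast
    let ?w = "k *\<^sub>R D.dir ?p"
    have "((\<lambda>s. H 1 (D.shadow (\<gamma> s))) has_derivative (\<lambda>x. A (x *\<^sub>R ?w))) (at t within {0..1})"
      by (rule has_derivative_compose[OF k(2)[unfolded has_vector_derivative_def] A(1)])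
    then have "((\<lambda>s. D'.shadow ((h \<circ> \<gamma>) s)) has_derivative (\<lambda>x. A (x *\<^sub>R ?w))) (at t within {0..1})"
      by (rule has_derivative_transform[OF t, rotated]) (simp add: shadow_moved[OF \<gamma>t])
    then have vd: "((\<lambda>s. D'.shadow ((h \<circ> \<gamma>) s)) has_vector_derivative A ?w) (at t within {0..1})"
      unfolding has_vector_derivative_def by (simp only: linear_scale[OF A(2)])
    have "0 < det (vector [n1', n2', A ?w] :: real^3^3)"
      if q': "q' \<in> topspace M" "q' \<noteq> h ?p" "D'.shadow q' = D'.shadow (h ?p)"
        and n': "oriented_normal \<A> f' (h ?p) n1'" "oriented_normal \<A> f' q' n2'" for q' n1' n2'
    proof -
      have "q' = h ?q" using D'.partner(7)[OF partner_moved(1)[OF p] q'(1,3)] q'(2) partner_moved(2)[OF p] by simp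
      then obtain V1 \<psi>1 V2 \<psi>2 where V: "(V1,\<psi>1) \<in> \<A>" "h ?p \<in> V1" "n1' = sheet_normal (D'.sheet' V1 \<psi>1 (\<psi>1 (h ?p)))"
        "(V2,\<psi>2) \<in> \<A>" "h ?q \<in> V2" "n2' = sheet_normal (D'.sheet' V2 \<psi>2 (\<psi>2 (h ?q)))"
        using n' by (auto simp: D'.oriented_normal_iff)
      obtain U1 \<phi>1 where U1: "(U1,\<phi>1) \<in> \<A>" "?p \<in> U1" by (rule D.chart_at[OF m(1)])
      obtain U2 \<phi>2 where U2: "(U2,\<phi>2) \<in> \<A>" "?q \<in> U2" by (rule D.chart_at[OF m(2)])
      let ?S1 = "D.sheet' U1 \<phi>1 (\<phi>1 ?p)" and ?S2 = "D.sheet' U2 \<phi>2 (\<phi>2 ?q)"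
      obtain L1 where L1: "linear L1" "0 < det (matrix L1)" "D'.sheet' V1 \<psi>1 (\<psi>1 (h ?p)) \<circ> L1 = A \<circ> ?S1"
        using sheet_moved[OF p U1 V(1,2)] unfolding A_def by blast
      obtain L2 where L2: "linear L2" "0 < det (matrix L2)" "D'.sheet' V2 \<psi>2 (\<psi>2 (h ?q)) \<circ> L2 = A \<circ> ?S2"
        using sheet_moved[OF q U2 V(4,5)] unfolding A_def m(4) by blast
      have lS: "linear (D'.sheet' V1 \<psi>1 (\<psi>1 (h ?p)))" "linear (D'.sheet' V2 \<psi>2 (\<psi>2 (h ?q)))"
        using D'.sheet(4)[OF V(1)] D'.sheet(4)[OF V(4)] V(2,5) by blast+
      have N1: "cross3 (A (?S1 (axis 1 1))) (A (?S1 (axis 2 1))) = det (matrix L1) *\<^sub>R n1'"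
        using sheet_normal_compose[OF lS(1) L1(1)] unfolding L1(3) V(3) by (simp add: sheet_normal_def)
      have N2: "cross3 (A (?S2 (axis 1 1))) (A (?S2 (axis 2 1))) = det (matrix L2) *\<^sub>R n2'"
        using sheet_normal_compose[OF lS(2) L2(1)] unfolding L2(3) V(6) by (simp add: sheet_normal_def)
      let ?n1 = "sheet_normal ?S1" and ?n2 = "sheet_normal ?S2"
      have on: "oriented_normal \<A> f ?p ?n1" "oriented_normal \<A> f ?q ?n2"
        using U1 U2 by (auto simp: D.oriented_normal_iff)
      note d = D.crossing_direction[OF p on]
      have w: "?w = (k / norm (cross3 ?n1 ?n2)) *\<^sub>R cross3 ?n1 ?n2" unfolding d(2) by (simp add: divide_inverse)
      have "0 < det (vector [cross3 (A (?S1 (axis 1 1))) (A (?S1 (axis 2 1))), cross3 (A (?S2 (axis 1 1))) (A (?S2 (axis 2 1))), A ?w] :: real^3^3)"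
        unfolding w by (rule crossing_sign_pushforward[OF A(2,3) sheet_normal_def sheet_normal_def d(1)]) (use k(1) d(1) in simp)
      also have "det (vector [cross3 (A (?S1 (axis 1 1))) (A (?S1 (axis 2 1))), cross3 (A (?S2 (axis 1 1))) (A (?S2 (axis 2 1))), A ?w] :: real^3^3) =
          (det (matrix L1) * det (matrix L2)) * det (vector [n1', n2', A ?w] :: real^3^3)"
        unfolding N1 N2 by (simp add: det_3 algebra_simps)
      finally show ?thesis by (rule zero_less_mult_pos[OF _ mult_pos_pos[OF L1(2) L2(2)]])
    qed
    then show ?thesis using vd by (intro exI[of _ "A ?w"] conjI) simp_all
  qed
  moreover have "continuous_map (top_of_set {0..1}) M (h \<circ> \<gamma>)"
    by (rule continuous_map_compose[OF \<gamma>1(1) homeomorphic_imp_continuous_map[OF homeo]])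
  moreover have "inj_on (h \<circ> \<gamma>) {0..<1}"
    by (rule comp_inj_on[OF \<gamma>1(3) inj_on_subset[OF h_inj]]) (use \<gamma>t in auto)
  moreover have "(h \<circ> \<gamma>) ` {0..1} = h ` c" using \<gamma>1(4) by (simp only: image_comp[symmetric])
  ultimately show ?thesis unfolding oriented_circle_param_def using \<gamma>1(2) by (intro conjI ballI) simp_all
qed

lemma circle_class_moved:
  assumes c: "c \<in> A_circles M f" shows "circle_class M \<A> f' (h ` c) = circle_class M \<A> f c"
proof -
  obtain \<gamma> where \<gamma>: "oriented_circle_param M \<A> f c \<gamma>" using D.oriented_param_exists[OF c] by blast
  have \<gamma>1: "continuous_map (top_of_set {0..1}) M \<gamma>" "\<gamma> 0 = \<gamma> 1" "\<gamma> ` {0..1} = c"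
    using \<gamma> by (simp_all add: oriented_circle_param_def)
  have p: "\<gamma> 0 \<in> c" using \<gamma>1(3) by force
  have c': "h ` c \<in> A_circles M f'" using c A_circles_moved by blast
  have p': "h (\<gamma> 0) \<in> h ` c" using p by blast
  have "circle_class M \<A> f' (h ` c) = loop_class M (h \<circ> \<gamma>)"
    unfolding D'.circle_class_eq[OF c' p'] by (rule D'.loop_class_oriented[OF c' p' oriented_param_moved[OF c \<gamma>], symmetric])
  also have "\<dots> = loop_class M \<gamma>" by (rule loop_class_isotopy[OF surface_iso \<gamma>1(1,2)])
  also have "\<dots> = circle_class M \<A> f c"
    unfolding D.circle_class_eq[OF c p] by (rule D.loop_class_oriented[OF c p \<gamma>])
  finally show ?thesis .
qed

theorem crossing_class_moved:
  assumes col: "\<And>R. R \<in> regions M f \<Longrightarrow> col' (h ` R) = col R"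
  shows "crossing_class M \<A> f' col' = crossing_class M \<A> f col"
proof -
  let ?I = "{c \<in> A_circles M f. mate M f c \<in> X_circles M f col}"
  have sel: "D'.selected col' = h ` D.selected col" by (rule selected_moved) (rule col)
  have sub: "D.selected col \<subseteq> topspace M" using D.mixed_subset by (auto simp: D.selected_def)
  have cs: "c \<subseteq> topspace M" if "c \<in> A_circles M f" for c using that A_circles_subset by blast
  have "mate M f' (h ` c) \<in> X_circles M f' col' \<longleftrightarrow> mate M f c \<in> X_circles M f col" if c: "c \<in> A_circles M f" for c
  proof -
    have c': "h ` c \<in> A_circles M f'" using c A_circles_moved by blast
    have "h ` c \<subseteq> h ` D.selected col \<longleftrightarrow> c \<subseteq> D.selected col" by (rule inj_on_image_subset_iff[OF h_inj cs[OF c] sub])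
    then show ?thesis unfolding D.selected_circle_cases(1)[OF c] D'.selected_circle_cases(1)[OF c'] sel .
  qed
  then have I: "{c \<in> A_circles M f'. mate M f' c \<in> X_circles M f' col'} = image h ` ?I"
    unfolding A_circles_moved by blast
  have inj: "inj_on (image h) ?I"
    by (rule inj_on_image, rule inj_on_subset[OF h_inj]) (use cs in blast)
  interpret C: comm_group "homology_group 1 M" by (rule abelian_homology_group)
  have carrier: "circle_class M \<A> f c \<in> carrier (homology_group 1 M)" if c: "c \<in> A_circles M f" for c
  proof -
    obtain p where p: "p \<in> c" "p \<in> D.mixed" using c D.mate_eq(2)[OF c] D.A_circles_eq D.mf.orbits_eq_components nonempty_connected_components_of by blast
    show ?thesis unfolding D.circle_class_eq[OF c p(1)]
      using D.mf.loop_chain_cycle[OF p(2)] carrier_relative_homology_group[of 1 M "{}", unfolded of_nat_1] by blast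
  qed
  have "crossing_class M \<A> f' col' = finprod (homology_group 1 M) (\<lambda>c. circle_class M \<A> f' (h ` c)) ?I"
    unfolding crossing_class_def I by (rule C.finprod_reindex[OF _ inj]) (use circle_class_moved carrier in auto)
  also have "\<dots> = finprod (homology_group 1 M) (circle_class M \<A> f) ?I"
    by (rule C.finprod_cong') (use circle_class_moved carrier in auto)
  finally show ?thesis unfolding crossing_class_def .
qed

end

theorem diagram_isotopy_invariant:
  assumes surf: "oriented_closed_surface M \<A>" and pd: "p_diagram M \<A> f" "p_diagram M \<A> f'"
    and iso: "diagram_isotopy M \<A> f f' \<theta>" and col: "\<And>R. R \<in> regions M f \<Longrightarrow> col' (\<theta> 1 ` R) = col R"
  shows "crossing_class M \<A> f' col' = crossing_class M \<A> f col"
proof -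
  interpret D: diagram M \<A> f using surf pd(1) by unfold_locales (auto simp: p_diagram_def)
  interpret D': diagram M \<A> f' using surf pd(2) by unfold_locales (auto simp: p_diagram_def)
  have \<theta>: "surface_isotopy M \<theta>" using iso by (simp add: diagram_isotopy_def)
  then have \<theta>1: "\<theta> 1 p \<in> topspace M" if "p \<in> topspace M" for p
    using that homeomorphic_imp_surjective_map[of M M "\<theta> 1"] by (auto simp: surface_isotopy_def)
  obtain F H where H: "ambient_isotopy H" and ends: "\<forall>p\<in>topspace M. F 0 p = f p \<and> F 1 p = f' p"
    and sh: "\<forall>t. \<forall>p\<in>topspace M. proj (F t (\<theta> t p)) = H t (proj (f p))"
    and hi: "\<forall>t. \<forall>p\<in>topspace M. \<forall>q\<in>topspace M. proj (f p) = proj (f q) \<longrightarrow>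
           (height (F t (\<theta> t p)) < height (F t (\<theta> t q)) \<longleftrightarrow> height (f p) < height (f q))"
    using iso unfolding diagram_isotopy_def by (elim conjE exE) (rule that)
  have F1: "F 1 (\<theta> 1 p) = f' (\<theta> 1 p)" if "p \<in> topspace M" for p using ends \<theta>1[OF that] by blast
  interpret moved_diagram M \<A> f f' \<theta> H
  proof (intro moved_diagram.intro D.diagram_axioms D'.diagram_axioms moved_diagram_axioms.intro \<theta> H)
    show "proj (f' (\<theta> 1 p)) = H 1 (proj (f p))" if "p \<in> topspace M" for p
      using sh[rule_format, OF that, of 1] F1[OF that] by simp
    show "height (f' (\<theta> 1 p)) < height (f' (\<theta> 1 q)) \<longleftrightarrow> height (f p) < height (f q)"
      if "p \<in> topspace M" "q \<in> topspace M" "proj (f p) = proj (f q)" for p q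
      using hi[rule_format, OF that, of 1] F1[OF that(1)] F1[OF that(2)] by simp
  qed
  show ?thesis by (rule crossing_class_moved) (rule col)
qed

theorem theorem2p8:
  fixes M :: "'a topology" and \<A> :: "'a atlas"
    and f f' :: "'a \<Rightarrow> real^4" and col col' :: "'a set \<Rightarrow> nat"
  assumes "oriented_closed_surface M \<A>"
    and "p_diagram M \<A> f"
    and "checkerboard M f col"
    and "p_equivalence_sequence M \<A> (f, col) (f', col')"
  shows "crossing_class M \<A> f col \<in> carrier (homology_group 1 M) \<and>
         crossing_class M \<A> f' col' = crossing_class M \<A> f col"
proof
  interpret D: diagram M \<A> f using assms(1,2) by unfold_locales (auto simp: p_diagram_def)
  interpret s: circle_flow M "D.selected col" D.flow by (rule D.selected_flow)
  have "(SOME x. x \<in> c) \<in> c" if "c \<in> s.orbits" for c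
  proof -
    have "c \<noteq> {}" using that s.orbits_eq_components nonempty_connected_components_of by blast
    then show ?thesis by (simp add: some_in_eq)
  qed
  then show "crossing_class M \<A> f col \<in> carrier (homology_group 1 M)" by (rule D.crossing_class_eq(2))
  have step: "crossing_class M \<A> g' c' = crossing_class M \<A> g c" if "p_transition M \<A> (g, c) (g', c')" for g c g' c'
  proof -
    have pd: "p_diagram M \<A> g" "p_diagram M \<A> g'"
      and cases: "(\<exists>\<theta>. diagram_isotopy M \<A> g g' \<theta> \<and> (\<forall>R \<in> regions M g. c' (\<theta> 1 ` R) = c R)) \<or>
        (\<exists>B. roseman_p_move M \<A> B g g' \<and> (\<forall>R \<in> regions M g. \<forall>R' \<in> regions M g'. (\<exists>p \<in> R \<inter> R'. proj (g p) \<notin> B) \<longrightarrow> c' R' = c R))"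
      using that unfolding p_transition_def by simp_all
    from cases show ?thesis
    proof (elim disjE exE conjE)
      fix \<theta> assume iso: "diagram_isotopy M \<A> g g' \<theta>" and col: "\<forall>R \<in> regions M g. c' (\<theta> 1 ` R) = c R"
      then show ?thesis by (intro diagram_isotopy_invariant[OF assms(1) pd iso]) blast
    next
      fix B assume move: "roseman_p_move M \<A> B g g'"
        and col: "\<forall>R \<in> regions M g. \<forall>R' \<in> regions M g'. (\<exists>p \<in> R \<inter> R'. proj (g p) \<notin> B) \<longrightarrow> c' R' = c R"
      show ?thesis
        by (rule roseman_p_move_invariant[OF assms(1) pd move]) (use col in blast)
    qed
  qed
  have "(p_transition M \<A>)\<^sup>*\<^sup>* (f, col) (f', col')" using assms(4) by (simp add: p_equivalence_sequence_def)
  then show "crossing_class M \<A> f' col' = crossing_class M \<A> f col"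
  proof (induction rule: rtranclp_induct2)
    case refl
    show ?case by (rule refl)
  next
    case (step g c g' c')
    then show ?case using \<open>\<And>g c g' c'. p_transition M \<A> (g, c) (g', c') \<Longrightarrow> crossing_class M \<A> g' c' = crossing_class M \<A> g c\<close> by metis
  qed
qed

end
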